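(* Let $\mathcal{N}_{\mathcal{P}}(n,H)$ denote the maximum, over all $n$-vertex planar graphs $G$, of the number of copies of $H$ in $G$. Then, as $n\to\infty$, \begin{align*} \mathcal{N}_{\mathcal{P}}(n,C_5) &= 2n^2+O(n^{2-1/5}),\\ \mathcal{N}_{\mathcal{P}}(n,C_{2m+1}) &= 2m\Bigl(\frac{n}{m}\Bigr)^m+O(n^{m-1/5}) \quad\text{for } m\in\{3,4\},\\ \mathcal{N}_{\mathcal{P}}(n,C_{2m+1}) &\le 3m\Bigl(\frac{n}{m}\Bigr)^m+O(n^{m-1/5}) \quad\text{for every integer } m\ge 5, \end{align*} where the implicit constants in the $O$-terms depend only on $m$.
   Context: All graphs are finite and simple. $C_k$ denotes the cycle on $k$ vertices. For graphs $G,H$, a copy of $H$ in $G$ is an (unlabeled, not necessarily induced) subgraph of $G$ isomorphic to $H$; $\mathcal{N}(G,H)$ is the number of such copies, and $\mathcal{N}_{\mathcal{P}}(n,H)=\max\{\mathcal{N}(G,H): G \text{ an } n\text{-vertex planar graph}\}$. *)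

theory Defs
  imports "HOL-Analysis.Analysis"
begin

type_synonym 'a graph = "'a set \<times> 'a set set"

definition simple_graph :: "'a graph \<Rightarrow> bool" where
  "simple_graph G \<longleftrightarrow> finite (fst G) \<and> (\<forall>e\<in>snd G. e \<subseteq> fst G \<and> card e = 2)"

definition planar :: "'a graph \<Rightarrow> bool" where
  "planar G \<longleftrightarrow> (\<exists>(p :: 'a \<Rightarrow> complex) (\<gamma> :: 'a set \<Rightarrow> real \<Rightarrow> complex).
      inj_on p (fst G) \<and>
      (\<forall>e\<in>snd G. arc (\<gamma> e) \<and> {pathstart (\<gamma> e), pathfinish (\<gamma> e)} = p ` e \<and>
                  path_image (\<gamma> e) \<inter> p ` fst G = p ` e) \<and>
      (\<forall>e\<in>snd G. \<forall>e'\<in>snd G. e \<noteq> e' \<longrightarrow>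
                  path_image (\<gamma> e) \<inter> path_image (\<gamma> e') \<subseteq> p ` (e \<inter> e')))"

definition graph_iso :: "'a graph \<Rightarrow> 'b graph \<Rightarrow> bool" where
  "graph_iso G H \<longleftrightarrow> (\<exists>f. bij_betw f (fst G) (fst H) \<and>
      (\<forall>u\<in>fst G. \<forall>v\<in>fst G. {u, v} \<in> snd G \<longleftrightarrow> {f u, f v} \<in> snd H))"

definition num_copies :: "'a graph \<Rightarrow> 'b graph \<Rightarrow> nat" where
  "num_copies G H = card {(V', E'). V' \<subseteq> fst G \<and> E' \<subseteq> snd G \<and>
      (\<forall>e\<in>E'. e \<subseteq> V') \<and> graph_iso (V', E') H}"

definition cycle_graph :: "nat \<Rightarrow> nat graph" where
  "cycle_graph k = ({0..<k}, {{i, Suc i mod k} | i. i < k})"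

text \<open>Maximum number of copies of H in an n-vertex planar graph (vertex set {0..<n}
  without loss of generality, since the count is invariant under isomorphism).\<close>

definition NP :: "nat \<Rightarrow> 'b graph \<Rightarrow> nat" where
  "NP n H = Max {num_copies ({0..<n}, E) H | E. simple_graph ({0..<n}, E) \<and> planar ({0..<n}, E)}"

end

theory Submission
  imports Defs
begin

text \<open>Upper bound: a planar graph has no K33 minor, hence it is sparse and its vertices can be ranked
  so that each has boundedly many neighbours of smaller rank. A cycle of length 2m+1 has at most m
  local maxima of the rank, and the other vertices are determined by these up to boundedly many
  choices, so all but O(n^(m-1)) of the cycles have exactly m. In such a cycle the local maxima
  alternate with the other vertices except at one place, and up to O(n^(m-1/5)) cycles the others,
  except possibly for one next to that place, are hubs: vertices of degree at least n^(4/5), or with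
  three neighbours of such a degree. There are O(n^(1/5)) hubs, and all but O(n^(1/5)) of the other
  vertices see them in a simple way, because three disjoint paths from many vertices to the hubs
  would create a K33 minor. This leads to a weight w on the pairs of hubs, of total weight at most n,
  for which the number of cycles is at most the sum of the products of w along the cyclic sequences
  of m hubs plus half the sum along the paths with m + 1 hubs. Under the constraint on the total
  weight, this expression is bounded for m at least 5 by a random growth process, which
  generates cycles and paths with total probability at most 1, and for m = 3, 4 by comparing, for a
  maximiser, the derivative at a heaviest edge with the value of the expression.

  Lower bound: take m hubs in a cyclic order and distribute the other vertices evenly as common
  neighbours of consecutive hubs, forming a path for each of these pairs; for m = 2 both hubs are
  joined to all vertices of one path.\<close>

section \<open>Minors of sparse graphs\<close>

text \<open>The upper bound uses planarity only through the absence of a K33 minor. With a degree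
  threshold D the exceptional cycles number O(n^(m-1) (D + n/D)), which D = n^(4/5) turns into the
  error term.

  The factor 2m in the main term counts, for one cyclic arrangement of m hubs, the m places where
  two adjacent non-hubs can sit between consecutive hubs, and the two ways of attaching them. The
  obstacle to a sharp constant is that these two vertices need not be common neighbours of the two
  hubs: each may see just one of them. A weight made of common neighbourhoods alone would miss such
  vertices, so the weight is \<open>nn + zz\<close>, where \<open>zz\<close> spends the vertices
  with a single hub. Edges of this kind are more numerous per unit of weight, but a cyclic product
  of \<open>nn + zz\<close> contains the terms with one factor \<open>zz\<close> at several places,
  which makes up for it.

  The paths with m + 1 hubs come from cycles in which both vertices at the irregular place are hubs;
  reversal halves their number. The edge between the two end hubs carries no weight, so an
  optimisation over cycles alone would not suffice.\<close>

definition ed :: "'a set set \<Rightarrow> 'a set \<Rightarrow> nat" where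
  "ed E S = card {e\<in>E. e \<subseteq> S}"

definition nb :: "'a set set \<Rightarrow> 'a set \<Rightarrow> 'a \<Rightarrow> 'a set" where
  "nb E S v = {u\<in>S. {u, v} \<in> E}"

definition touch :: "'a set set \<Rightarrow> 'a set \<Rightarrow> 'a set \<Rightarrow> bool" where
  "touch E S T \<longleftrightarrow> (\<exists>u\<in>S. \<exists>v\<in>T. {u, v} \<in> E)"

text \<open>Connectedness through cuts instead of walks: unions and contractions then only require
  an edge across each cut. Paths are extracted from it only in \<open>conn_upath\<close>, where the
  drawing needs them.\<close>

definition conn :: "'a set set \<Rightarrow> 'a set \<Rightarrow> bool" where
  "conn E S \<longleftrightarrow> S \<noteq> {} \<and> (\<forall>X. X \<subseteq> S \<longrightarrow> X \<noteq> {} \<longrightarrow> X \<noteq> S \<longrightarrow> touch E X (S - X))"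

definition clique_minor :: "'a set set \<Rightarrow> 'a set \<Rightarrow> nat \<Rightarrow> bool" where
  "clique_minor E V t \<longleftrightarrow> (\<exists>f::nat \<Rightarrow> 'a set. (\<forall>i<t. conn E (f i) \<and> f i \<subseteq> V) \<and>
     (\<forall>i<t. \<forall>j<t. i \<noteq> j \<longrightarrow> f i \<inter> f j = {} \<and> touch E (f i) (f j)))"

definition k33_minor :: "'a set set \<Rightarrow> 'a set \<Rightarrow> bool" where
  "k33_minor E V \<longleftrightarrow> (\<exists>A B::nat \<Rightarrow> 'a set. (\<forall>i<3. conn E (A i) \<and> A i \<subseteq> V \<and> conn E (B i) \<and> B i \<subseteq> V) \<and>
     (\<forall>i<3. \<forall>j<3. i \<noteq> j \<longrightarrow> A i \<inter> A j = {} \<and> B i \<inter> B j = {}) \<and>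
     (\<forall>i<3. \<forall>j<3. A i \<inter> B j = {} \<and> touch E (A i) (B j)))"

lemma clique_minorE:
  assumes "clique_minor E V t"
  obtains f where "\<And>i::nat. i < t \<Longrightarrow> conn E (f i) \<and> f i \<subseteq> V"
    "\<And>i j. i < t \<Longrightarrow> j < t \<Longrightarrow> i \<noteq> j \<Longrightarrow> f i \<inter> f j = {} \<and> touch E (f i) (f j)"
proof -
  from assms obtain f where "(\<forall>i<t. conn E (f i) \<and> f i \<subseteq> V) \<and>
     (\<forall>i<t. \<forall>j<t. i \<noteq> j \<longrightarrow> f i \<inter> f j = {} \<and> touch E (f i) (f j))"
    unfolding clique_minor_def by (rule exE)
  then show ?thesis by (intro that[of f]) simp_all
qed

lemma clique_minorI:
  assumes "\<And>i::nat. i < t \<Longrightarrow> conn E (f i) \<and> f i \<subseteq> V"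
    "\<And>i j. i < t \<Longrightarrow> j < t \<Longrightarrow> i \<noteq> j \<Longrightarrow> f i \<inter> f j = {} \<and> touch E (f i) (f j)"
  shows "clique_minor E V t"
  unfolding clique_minor_def using assms by (intro exI[of _ f] conjI allI impI) simp_all

lemma k33_minorI:
  assumes "\<And>i::nat. i < 3 \<Longrightarrow> conn E (A i) \<and> A i \<subseteq> V"
    "\<And>i::nat. i < 3 \<Longrightarrow> conn E (B i) \<and> B i \<subseteq> V"
    "\<And>i j. i < 3 \<Longrightarrow> j < 3 \<Longrightarrow> i \<noteq> j \<Longrightarrow> A i \<inter> A j = {} \<and> B i \<inter> B j = {}"
    "\<And>i j. i < 3 \<Longrightarrow> j < 3 \<Longrightarrow> A i \<inter> B j = {} \<and> touch E (A i) (B j)"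
  shows "k33_minor E V"
  unfolding k33_minor_def using assms by (intro exI[of _ A] exI[of _ B] conjI allI impI) simp_all

lemma touch_commute: "touch E S T = touch E T S"
  unfolding touch_def by (metis insert_commute)

lemma touch_mono: "touch E S T \<Longrightarrow> S \<subseteq> S' \<Longrightarrow> T \<subseteq> T' \<Longrightarrow> touch E S' T'"
  by (auto simp: touch_def)

lemma conn_singleton [simp]: "conn E {v}"
  by (auto simp: conn_def)

text \<open>A cut of the union either splits one of the two sets, or separates them and is crossed
  by the touching edge.\<close>

lemma conn_Un:
  assumes "conn E S" "conn E T" "touch E S T"
  shows "conn E (S \<union> T)"
  unfolding conn_def
proof (intro conjI allI impI)
  show "S \<union> T \<noteq> {}" using assms by (auto simp: conn_def)
  fix X assume X: "X \<subseteq> S \<union> T" "X \<noteq> {}" "X \<noteq> S \<union> T"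
  have aux: "touch E X (A \<union> B - X)"
    if "conn E A" "X \<inter> A \<noteq> {}" "\<not> A \<subseteq> X" for A B
  proof -
    have "touch E (X \<inter> A) (A - X \<inter> A)"
      using that unfolding conn_def by (metis Int_lower2 inf.absorb_iff2)
    then show ?thesis by (rule touch_mono) auto
  qed
  show "touch E X (S \<union> T - X)"
  proof (cases "(X \<inter> S \<noteq> {} \<and> \<not> S \<subseteq> X) \<or> (X \<inter> T \<noteq> {} \<and> \<not> T \<subseteq> X)")
    case True
    then show ?thesis using aux[OF assms(1), of T] aux[OF assms(2), of S] by (auto simp: Un_commute)
  next
    case False
    then have "(S \<subseteq> X \<and> X \<inter> T = {}) \<or> (T \<subseteq> X \<and> X \<inter> S = {})"
      using X by auto
    then show ?thesis using assms(3) touch_commute[of E S T]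
      by (elim disjE) (auto intro: touch_mono)
  qed
qed

lemma conn_insert: "conn E S \<Longrightarrow> u \<in> S \<Longrightarrow> {u, v} \<in> E \<Longrightarrow> conn E (insert v S)"
  using conn_Un[of E S "{v}"] by (auto simp: touch_def)

lemma conn_pair: "{u, v} \<in> E \<Longrightarrow> conn E {u, v}"
  using conn_insert[of E "{u}" u v] by (simp add: insert_commute)

text \<open>Undoes a contraction. A cut that splits some blob is crossed inside it; any other cut is
  a union of blobs, that is, a cut of \<open>S\<close> in the contracted graph
  \<open>H\<close>.\<close>

lemma conn_UN_blob:
  assumes S: "conn H S" and bl: "\<And>b. b \<in> S \<Longrightarrow> conn E (blob b)"
    and dj: "\<And>b c. b \<in> S \<Longrightarrow> c \<in> S \<Longrightarrow> b \<noteq> c \<Longrightarrow> blob b \<inter> blob c = {}"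
    and tc: "\<And>b c. b \<in> S \<Longrightarrow> c \<in> S \<Longrightarrow> {b, c} \<in> H \<Longrightarrow> b \<noteq> c \<Longrightarrow> touch E (blob b) (blob c)"
  shows "conn E (\<Union>b\<in>S. blob b)"
  unfolding conn_def
proof (intro conjI allI impI)
  have ne: "blob b \<noteq> {}" if "b \<in> S" for b using bl[OF that] by (simp add: conn_def)
  show "(\<Union>b\<in>S. blob b) \<noteq> {}" using S ne by (auto simp: conn_def)
  fix X assume X: "X \<subseteq> (\<Union>b\<in>S. blob b)" "X \<noteq> {}" "X \<noteq> (\<Union>b\<in>S. blob b)"
  show "touch E X ((\<Union>b\<in>S. blob b) - X)"
  proof (cases "\<exists>b\<in>S. X \<inter> blob b \<noteq> {} \<and> \<not> blob b \<subseteq> X")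
    case True
    then obtain b where b: "b \<in> S" "X \<inter> blob b \<noteq> {}" "\<not> blob b \<subseteq> X" by auto
    then have "touch E (X \<inter> blob b) (blob b - X \<inter> blob b)"
      using bl[OF b(1)] unfolding conn_def by (metis Int_lower2 inf.absorb_iff2)
    then show ?thesis by (rule touch_mono) (use b in auto)
  next
    case False
    define Y where "Y = {b\<in>S. blob b \<subseteq> X}"
    have out: "blob b \<inter> X = {}" if "b \<in> S - Y" for b using False that by (auto simp: Y_def)
    have "Y \<noteq> {}" using X(1,2) False by (fastforce simp: Y_def)
    moreover have "Y \<noteq> S" using X by (auto simp: Y_def)
    ultimately have "touch H Y (S - Y)" using S by (auto simp: conn_def Y_def)
    then obtain b c where bc: "b \<in> Y" "c \<in> S - Y" "{b, c} \<in> H" by (auto simp: touch_def)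
    then have "touch E (blob b) (blob c)" using tc[of b c] by (auto simp: Y_def)
    then show ?thesis by (rule touch_mono) (use bc out[of c] in \<open>auto simp: Y_def\<close>)
  qed
qed

lemma k33_minor_mono: "k33_minor E S \<Longrightarrow> S \<subseteq> V \<Longrightarrow> k33_minor E V"
  unfolding k33_minor_def by (elim ex_forward) auto

text \<open>A minor of a minor is a minor. This transfers density arguments from an auxiliary graph
  \<open>H\<close> to the given graph.\<close>

lemma clique_minor_blob:
  assumes H: "clique_minor H B t" and bl: "\<And>b. b \<in> B \<Longrightarrow> conn E (blob b) \<and> blob b \<subseteq> V"
    and dj: "\<And>b c. b \<in> B \<Longrightarrow> c \<in> B \<Longrightarrow> b \<noteq> c \<Longrightarrow> blob b \<inter> blob c = {}"
    and tc: "\<And>b c. b \<in> B \<Longrightarrow> c \<in> B \<Longrightarrow> {b, c} \<in> H \<Longrightarrow> b \<noteq> c \<Longrightarrow> touch E (blob b) (blob c)"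
  shows "clique_minor E V t"
proof -
  obtain f where f: "\<And>i. i < t \<Longrightarrow> conn H (f i) \<and> f i \<subseteq> B"
    "\<And>i j. i < t \<Longrightarrow> j < t \<Longrightarrow> i \<noteq> j \<Longrightarrow> f i \<inter> f j = {} \<and> touch H (f i) (f j)"
    using clique_minorE[OF H] by metis
  define g where "g i = (\<Union>b\<in>f i. blob b)" for i
  have "conn E (g i) \<and> g i \<subseteq> V" if "i < t" for i
  proof
    have fi: "conn H (f i)" "\<And>b. b \<in> f i \<Longrightarrow> b \<in> B" using f(1)[OF that] by auto
    show "conn E (g i)" unfolding g_def by (rule conn_UN_blob[OF fi(1)]) (use fi(2) bl dj tc in metis)+
    show "g i \<subseteq> V" using fi(2) bl by (fastforce simp: g_def)
  qed
  moreover have "g i \<inter> g j = {} \<and> touch E (g i) (g j)" if ij: "i < t" "j < t" "i \<noteq> j" for i j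
  proof
    show "g i \<inter> g j = {}"
    proof (rule ccontr)
      assume "g i \<inter> g j \<noteq> {}"
      then obtain x b c where "b \<in> f i" "c \<in> f j" "x \<in> blob b" "x \<in> blob c" by (auto simp: g_def)
      moreover have "b \<in> B" "c \<in> B" "b \<noteq> c" using calculation f(1)[OF ij(1)] f(1)[OF ij(2)] f(2)[OF ij] by auto
      ultimately show False using dj[of b c] by auto
    qed
    obtain b c where bc: "b \<in> f i" "c \<in> f j" "{b, c} \<in> H" using f(2)[OF ij] by (auto simp: touch_def)
    then have "b \<in> B" "c \<in> B" "b \<noteq> c" using f(1)[OF ij(1)] f(1)[OF ij(2)] f(2)[OF ij] by auto
    then have "touch E (blob b) (blob c)" using tc bc by auto
    then show "touch E (g i) (g j)" by (rule touch_mono) (use bc in \<open>auto simp: g_def\<close>)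
  qed
  ultimately show ?thesis by (rule clique_minorI)
qed

lemma k33_of_k6:
  assumes "clique_minor E V 6" shows "k33_minor E V"
proof -
  obtain f where f: "\<And>i. i < (6::nat) \<Longrightarrow> conn E (f i) \<and> f i \<subseteq> V"
    "\<And>i j. i < 6 \<Longrightarrow> j < 6 \<Longrightarrow> i \<noteq> j \<Longrightarrow> f i \<inter> f j = {} \<and> touch E (f i) (f j)"
    using clique_minorE[OF assms] by metis
  show ?thesis
    by (rule k33_minorI[of E f _ "\<lambda>i. f (i + 3)"]) (simp_all add: f)
qed

section \<open>Edge counts and complete minors of dense graphs\<close>

locale fin_graph =
  fixes V :: "'a set" and E :: "'a set set"
  assumes finV: "finite V" and edge: "\<And>e. e \<in> E \<Longrightarrow> e \<subseteq> V \<and> card e = 2"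
begin

lemma finE: "finite E"
  using finite_subset[of E "Pow V"] edge finV by auto

lemma adj_neq: "{u, v} \<in> E \<Longrightarrow> u \<noteq> v"
  using edge[of "{u, v}"] by auto

lemma adj_in: "{u, v} \<in> E \<Longrightarrow> u \<in> V \<and> v \<in> V"
  using edge[of "{u, v}"] by auto

lemma finite_nb: "finite (nb E S v)"
proof -
  have "nb E S v \<subseteq> V" using adj_in by (auto simp: nb_def)
  then show ?thesis using finV finite_subset by blast
qed

lemma card_edges_at:
  assumes "v \<in> S"
  shows "card {e\<in>E. e \<subseteq> S \<and> v \<in> e} = card (nb E S v)"
proof -
  have "bij_betw (\<lambda>u. {u, v}) (nb E S v) {e\<in>E. e \<subseteq> S \<and> v \<in> e}"
  proof (rule bij_betwI')
    fix x y assume "x \<in> nb E S v" "y \<in> nb E S v"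
    then show "({x, v} = {y, v}) = (x = y)" by (auto simp: doubleton_eq_iff)
  next
    fix x assume "x \<in> nb E S v"
    then show "{x, v} \<in> {e\<in>E. e \<subseteq> S \<and> v \<in> e}" using assms by (auto simp: nb_def)
  next
    fix e assume e: "e \<in> {e\<in>E. e \<subseteq> S \<and> v \<in> e}"
    then have "card e = 2" using edge by auto
    then obtain a b where "e = {a, b}" by (meson card_2_iff)
    with e have "e = {a, v} \<or> e = {b, v}" by auto
    then show "\<exists>x\<in>nb E S v. e = {x, v}" using e by (auto simp: nb_def)
  qed
  then show ?thesis by (simp add: bij_betw_same_card)
qed

lemma ed_remove:
  assumes "v \<in> S"
  shows "ed E S = ed E (S - {v}) + card (nb E (S - {v}) v)"
proof -
  have "nb E (S - {v}) v = nb E S v" using adj_neq by (auto simp: nb_def)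
  moreover have "{e\<in>E. e \<subseteq> S} = {e\<in>E. e \<subseteq> S - {v}} \<union> {e\<in>E. e \<subseteq> S \<and> v \<in> e}" by auto
  moreover have "{e\<in>E. e \<subseteq> S - {v}} \<inter> {e\<in>E. e \<subseteq> S \<and> v \<in> e} = {}" by auto
  ultimately show ?thesis
    using finE card_edges_at[OF assms] by (simp add: ed_def card_Un_disjoint)
qed

lemma handshake:
  assumes "finite S"
  shows "(\<Sum>v\<in>S. card (nb E S v)) = 2 * ed E S"
proof -
  let ?ES = "{e\<in>E. e \<subseteq> S}"
  have "(\<Sum>v\<in>S. card {e\<in>?ES. v \<in> e}) = 2 * card ?ES"
  proof (rule sum_multicount)
    show "\<forall>e\<in>?ES. card {v\<in>S. v \<in> e} = 2"
    proof
      fix e assume "e \<in> ?ES"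
      moreover then have "{v\<in>S. v \<in> e} = e" by auto
      ultimately show "card {v\<in>S. v \<in> e} = 2" using edge by auto
    qed
  qed (use assms finE in auto)
  moreover have "card {e\<in>?ES. v \<in> e} = card (nb E S v)" if "v \<in> S" for v
    using card_edges_at[OF that] by simp
  ultimately show ?thesis by (simp add: ed_def)
qed

text \<open>Mader's argument: among the connected sets whose contraction keeps the density, a maximal
  one has a neighbourhood of large minimum degree; that set is the last branch set.\<close>

lemma clique_minor_of_dense:
  "S \<subseteq> V \<Longrightarrow> S \<noteq> {} \<Longrightarrow> 2 ^ t * card S \<le> ed E S \<Longrightarrow> clique_minor E S (Suc t)"
proof (induction t arbitrary: S)
  case 0
  then obtain v where "v \<in> S" by auto
  then show ?case unfolding clique_minor_def by (intro exI[of _ "\<lambda>_. {v}"]) auto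
next
  case (Suc t)
  define c :: nat where "c = 2 ^ t"
  define P where "P W \<longleftrightarrow> W \<subseteq> S \<and> W \<noteq> {} \<and> 2 * c * card W \<le> ed E W" for W
  have "P S" using Suc.prems by (auto simp: P_def c_def)
  \<comment> \<open>\<open>W\<close> is a smallest dense set; its minimality is what makes the
    neighbourhood of \<open>U\<close> nonempty below.\<close>
  then obtain W where W: "P W" "\<And>W'. card W' < card W \<Longrightarrow> \<not> P W'"
    using ex_has_least_nat[of P S card] by (metis linorder_not_less)
  have WS: "W \<subseteq> S" "W \<noteq> {}" "2 * c * card W \<le> ed E W" and finW: "finite W"
    using W(1) Suc.prems(1) finV finite_subset[of W V] by (auto simp: P_def)
  define N where "N U = {v\<in>W - U. touch E U {v}}" for U
  \<comment> \<open>Contracting \<open>U\<close> leaves \<open>card W - card U + 1\<close> vertices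
    and, without parallel edges, \<open>ed E (W - U) + card (N U)\<close> edges. \<open>Q U\<close>
    says that the density 2c is kept.\<close>
  define Q where "Q U \<longleftrightarrow> U \<subseteq> W \<and> conn E U \<and> 2 * c * (card W - card U + 1) \<le> ed E (W - U) + card (N U)" for U
  obtain v0 where v0: "v0 \<in> W" using WS by auto
  have "N {v0} = nb E (W - {v0}) v0" by (auto simp: N_def nb_def touch_def insert_commute)
  then have "Q {v0}"
    using ed_remove[OF v0] WS v0 finW card_gt_0_iff[of W] by (auto simp: Q_def)
  moreover have "\<forall>U. Q U \<longrightarrow> card U < Suc (card W)"
    using finW by (auto simp: Q_def card_mono less_Suc_eq_le)
  ultimately obtain U where U: "Q U" "\<And>U'. Q U' \<Longrightarrow> card U' \<le> card U"
    using ex_has_greatest_nat[of Q "{v0}" card "Suc (card W)"] by blast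
  have UW: "U \<subseteq> W" "conn E U" "2 * c * (card W - card U + 1) \<le> ed E (W - U) + card (N U)"
    using U(1) by (auto simp: Q_def)
  have finU: "finite U" and Une: "U \<noteq> {}" using UW finW finite_subset[of U W] by (auto simp: conn_def)
  have NW: "N U \<subseteq> W" and finN: "finite (N U)" using finW by (auto simp: N_def)
  have c1: "c \<ge> 1" by (simp add: c_def)
  \<comment> \<open>Without neighbours of \<open>U\<close> the edges of \<open>W\<close> split
    between \<open>U\<close> and \<open>W - U\<close>, and one of the parts would be a smaller dense
    set; if \<open>U = W\<close>, no edge remains to satisfy \<open>Q\<close>.\<close>
  have Nne: "N U \<noteq> {}"
  proof
    assume N0: "N U = {}"
    have split: "{e\<in>E. e \<subseteq> W} = {e\<in>E. e \<subseteq> W - U} \<union> {e\<in>E. e \<subseteq> U}"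
    proof (intro equalityI subsetI)
      fix e assume e: "e \<in> {e\<in>E. e \<subseteq> W}"
      then obtain a b where ab: "e = {a, b}" using edge by (metis (no_types, lifting) card_2_iff mem_Collect_eq)
      have "\<not> (a \<in> U \<and> b \<notin> U)" "\<not> (b \<in> U \<and> a \<notin> U)"
        using N0 e ab by (auto simp: N_def touch_def insert_commute)
      then show "e \<in> {e\<in>E. e \<subseteq> W - U} \<union> {e\<in>E. e \<subseteq> U}" using e ab by auto
    qed (use UW in auto)
    have emp: "{} \<notin> E" using edge[of "{}"] by auto
    have "{e\<in>E. e \<subseteq> W - U} \<inter> {e\<in>E. e \<subseteq> U} = {}"
    proof (rule equals0I)
      fix e assume "e \<in> {e\<in>E. e \<subseteq> W - U} \<inter> {e\<in>E. e \<subseteq> U}"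
      then have "e = {}" "e \<in> E" by auto
      then show False using emp by auto
    qed
    then have sum: "ed E W = ed E (W - U) + ed E U"
      unfolding ed_def split using finE by (simp add: card_Un_disjoint)
    show False
    proof (cases "U = W")
      case True
      then have "ed E (W - U) = 0" using emp by (auto simp: ed_def)
      then show False using UW(3) N0 c1 by auto
    next
      case False
      then have "card U < card W" using UW finW by (simp add: psubset_card_mono psubsetI)
      moreover have "card (W - U) < card W" 
        using psubset_card_mono[OF finW, of "W - U"] Une UW by blast
      moreover have "card (W - U) = card W - card U" using UW finU by (simp add: card_Diff_subset)
      ultimately have "ed E U < 2 * c * card U" "ed E (W - U) < 2 * c * card (W - U)"
        using W(2)[of U] W(2)[of "W - U"] WS UW Une False by (auto simp: P_def not_le)
      moreover have "2 * c * card W = 2 * c * card U + 2 * c * card (W - U)"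
        using \<open>card (W - U) = card W - card U\<close> \<open>card U < card W\<close>
        by (simp flip: distrib_left)
      ultimately show False using sum WS by linarith
    qed
  qed
  \<comment> \<open>Moving \<open>v\<close> into \<open>U\<close> removes one vertex and 1 + d edges
    of the contracted graph, where d is the number of neighbours of \<open>v\<close> inside
    \<open>N U\<close>. As \<open>U\<close> is largest possible, 1 + d exceeds 2c.\<close>
  have deg: "2 * c \<le> card (nb E (N U) v)" if v: "v \<in> N U" for v
  proof -
    have vW: "v \<in> W - U" "touch E U {v}" using v by (auto simp: N_def)
    then have cU: "conn E (insert v U)" using conn_insert[OF UW(2)] by (auto simp: touch_def)
    have cardI: "card (insert v U) = Suc (card U)" using vW finU by simp
    have "\<not> Q (insert v U)" using U(2) cardI by fastforce
    then have less: "ed E (W - insert v U) + card (N (insert v U)) < 2 * c * (card W - card (insert v U) + 1)"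
      using cU UW vW by (auto simp: Q_def not_le)
    have "card U < card W" using psubset_card_mono[OF finW, of U] UW vW by blast
    then have less': "ed E (W - insert v U) + card (N (insert v U)) < 2 * c * (card W - card U)"
    proof -
      have "card W - card (insert v U) + 1 = card W - card U" using \<open>card U < card W\<close> cardI by linarith
      then show ?thesis using less by simp
    qed
    let ?A = "nb E (W - U - {v}) v"
    have e1: "ed E (W - U) = ed E (W - insert v U) + card ?A"
    proof -
      have "W - U - {v} = W - insert v U" by auto
      then show ?thesis using ed_remove[of v "W - U"] vW by simp
    qed
    have NI: "N (insert v U) = (N U - {v}) \<union> (?A - N U)"
      by (auto simp: N_def nb_def touch_def insert_commute)
    have "card (N (insert v U)) = card (N U - {v}) + card (?A - N U)"
      unfolding NI by (rule card_Un_disjoint) (use finN finite_nb in auto)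
    moreover have "card (N U - {v}) + 1 = card (N U)" using v finN by (metis Suc_eq_plus1 card_Suc_Diff1)
    moreover have "card ?A = card (?A \<inter> N U) + card (?A - N U)"
      using finite_nb by (metis card_Int_Diff)
    moreover have "card (?A \<inter> N U) = card (nb E (N U) v)"
      by (rule arg_cong[of _ _ card]) (use adj_neq in \<open>auto simp: nb_def N_def\<close>)
    moreover define K where "K = 2 * c * (card W - card U)"
    moreover have "K + 2 * c \<le> ed E (W - U) + card (N U)" using UW(3) by (simp add: K_def)
    moreover have "ed E (W - insert v U) + card (N (insert v U)) < K" using less' by (simp only: K_def)
    ultimately show ?thesis using e1 by linarith
  qed
  have "card (N U) * (2 * c) \<le> (\<Sum>v\<in>N U. card (nb E (N U) v))"
    using sum_bounded_below[of "N U" "2 * c" "\<lambda>v. card (nb E (N U) v)"] deg by simp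
  then have "2 ^ t * card (N U) \<le> ed E (N U)"
    unfolding handshake[OF finN] by (simp add: c_def mult.commute)
  moreover have NV: "N U \<subseteq> V" using NW WS Suc.prems by auto
  ultimately have "clique_minor E (N U) (Suc t)" using Suc.IH[of "N U"] Nne by simp
  obtain f where f: "\<And>i. i < Suc t \<Longrightarrow> conn E (f i) \<and> f i \<subseteq> N U"
    "\<And>i j. i < Suc t \<Longrightarrow> j < Suc t \<Longrightarrow> i \<noteq> j \<Longrightarrow> f i \<inter> f j = {} \<and> touch E (f i) (f j)"
    using clique_minorE[OF \<open>clique_minor E (N U) (Suc t)\<close>] by metis
  have fU: "f i \<inter> U = {} \<and> touch E U (f i) \<and> touch E (f i) U" if i: "i < Suc t" for i
  proof -
    obtain x where "x \<in> f i" "x \<in> N U" using f(1)[OF i] by (auto simp: conn_def)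
    then have "touch E U {x}" "x \<in> f i" by (auto simp: N_def)
    then have "touch E U (f i)" by (auto intro: touch_mono)
    then show ?thesis using f(1)[OF i] touch_commute[of E U] by (auto simp: N_def)
  qed
  define g where "g i = (if i < Suc t then f i else U)" for i
  have "conn E (g i) \<and> g i \<subseteq> S" if "i < Suc (Suc t)" for i
    using f(1)[of i] UW(1,2) WS(1) NW by (cases "i < Suc t") (auto simp: g_def)
  moreover have "g i \<inter> g j = {} \<and> touch E (g i) (g j)"
    if "i < Suc (Suc t)" "j < Suc (Suc t)" "i \<noteq> j" for i j
    using that f(2)[of i j] fU[of i] fU[of j] by (auto simp: g_def)
  ultimately show ?case by (rule clique_minorI)
qed

end

section \<open>Sparseness and the degeneracy rank\<close>

locale k33_free = fin_graph +
  assumes k33: "\<not> k33_minor E V"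

text \<open>The bound 32 = 2^5 is the density that forces a K6 minor. Density is assumed here rather
  than the absence of a minor, so that the results also serve for auxiliary graphs whose minors are
  pulled back to the given graph.\<close>

locale sparse = fin_graph +
  assumes sparse: "\<And>S. S \<subseteq> V \<Longrightarrow> S \<noteq> {} \<Longrightarrow> ed E S < 32 * card S"
begin

lemma low_degree: 
  assumes "S \<subseteq> V" "S \<noteq> {}"
  shows "\<exists>v\<in>S. card (nb E S v) \<le> 64"
proof (rule ccontr)
  assume "\<not> ?thesis"
  then have "card S * 64 \<le> (\<Sum>v\<in>S. card (nb E S v))"
    using sum_bounded_below[of S 64 "\<lambda>v. card (nb E S v)"] by force
  then show False using handshake[of S] sparse[OF assms] finV assms finite_subset by fastforce
qed

text \<open>Degeneracy order: a vertex of degree at most 64 is taken off and receives the largest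
  rank, so its lower neighbours are all its neighbours in what remains.\<close>

lemma rank_exists: "\<exists>r::'a \<Rightarrow> nat. inj_on r V \<and> (\<forall>v\<in>V. card {u\<in>nb E V v. r u < r v} \<le> 64)"
proof -
  have "\<exists>r::'a \<Rightarrow> nat. inj_on r S \<and> (\<forall>v\<in>S. r v < card S \<and> card {u\<in>nb E S v. r u < r v} \<le> 64)"
    if "S \<subseteq> V" for S
    using that
  proof (induction "card S" arbitrary: S)
    case 0
    then show ?case using finV finite_subset by fastforce
  next
    case (Suc k)
    then have "S \<noteq> {}" "finite S" using finV finite_subset by auto
    then obtain v where v: "v \<in> S" "card (nb E S v) \<le> 64" using low_degree Suc.prems by blast
    have k: "k = card (S - {v})" using Suc.hyps(2) v \<open>finite S\<close> by simp
    then obtain r where r: "inj_on r (S - {v})" "\<And>u. u \<in> S - {v} \<Longrightarrow> r u < k"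
      "\<And>u. u \<in> S - {v} \<Longrightarrow> card {w\<in>nb E (S - {v}) u. r w < r u} \<le> 64"
    proof -
      have "S - {v} \<subseteq> V" using Suc.prems by auto
      from Suc.hyps(1)[OF k this] k show ?thesis using that by auto
    qed
    define r' where "r' = r(v := k)"
    have "inj_on r' S" 
    proof (rule inj_onI)
      fix x y assume "x \<in> S" "y \<in> S" "r' x = r' y"
      then show "x = y" using r(2)[of x] r(2)[of y] inj_onD[OF r(1), of x y]
        by (auto simp: r'_def split: if_splits)
    qed
    moreover have "r' u < card S" if "u \<in> S" for u
      using r(2)[of u] that Suc.hyps(2) by (auto simp: r'_def)
    moreover have "card {w\<in>nb E S u. r' w < r' u} \<le> 64" if "u \<in> S" for u
    proof (cases "u = v")
      case True
      have "card {w\<in>nb E S u. r' w < r' u} \<le> card (nb E S v)"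
        using True finite_nb by (auto intro: card_mono)
      then show ?thesis using v by simp
    next
      case False
      then have "{w\<in>nb E S u. r' w < r' u} = {w\<in>nb E (S - {v}) u. r w < r u}"
        using r(2)[of u] that by (auto simp: r'_def nb_def)
      then show ?thesis using r(3)[of u] that False by simp
    qed
    ultimately show ?case by blast
  qed
  then show ?thesis by blast
qed

end

sublocale k33_free \<subseteq> sparse
proof
  fix S assume S: "S \<subseteq> V" "S \<noteq> {}"
  show "ed E S < 32 * card S"
  proof (rule ccontr)
    assume "\<not> ?thesis"
    then have dense: "2 ^ 5 * card S \<le> ed E S" by simp
    have six: "6 = Suc 5" by simp
    have "clique_minor E S 6" unfolding six by (rule clique_minor_of_dense[OF S dense])
    from k33_minor_mono[OF k33_of_k6[OF this] S(1)] k33 show False by simp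
  qed
qed

section \<open>Disjoint connected sets with three neighbours in a small set\<close>

lemma maximal_disjoint_family:
  assumes "finite \<C>" "{} \<notin> \<C>"
  obtains \<F> where "\<F> \<subseteq> \<C>" "\<And>F G. F \<in> \<F> \<Longrightarrow> G \<in> \<F> \<Longrightarrow> F \<noteq> G \<Longrightarrow> F \<inter> G = {}"
    "\<And>C. C \<in> \<C> \<Longrightarrow> C \<inter> \<Union>\<F> \<noteq> {}"
proof -
  define P where "P \<F> \<longleftrightarrow> \<F> \<subseteq> \<C> \<and> (\<forall>F\<in>\<F>. \<forall>G\<in>\<F>. F \<noteq> G \<longrightarrow> F \<inter> G = {})" for \<F>
  have "P {}" by (simp add: P_def)
  moreover have "\<forall>\<F>. P \<F> \<longrightarrow> card \<F> < Suc (card \<C>)"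
    using assms(1) by (auto simp: P_def less_Suc_eq_le intro: card_mono)
  ultimately obtain \<F> where F: "P \<F>" "\<And>\<G>. P \<G> \<Longrightarrow> card \<G> \<le> card \<F>"
    using ex_has_greatest_nat[of P "{}" card "Suc (card \<C>)"] by blast
  have "C \<inter> \<Union>\<F> \<noteq> {}" if C: "C \<in> \<C>" for C
  proof
    assume C0: "C \<inter> \<Union>\<F> = {}"
    then have "P (insert C \<F>)" using F(1) C by (auto simp: P_def)
    then have "card (insert C \<F>) \<le> card \<F>" by (rule F(2))
    moreover have "C \<notin> \<F>" using C0 C assms(2) by (metis Int_absorb2 Union_upper)
    moreover have "finite \<F>" using F(1) assms(1) finite_subset by (auto simp: P_def)
    ultimately show False by simp
  qed
  then show ?thesis using F(1) that[of \<F>] by (auto simp: P_def)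
qed

context fin_graph
begin

lemma finite_sub: "S \<subseteq> V \<Longrightarrow> finite S"
  using finV finite_subset by auto

text \<open>A triangle is determined by its vertex of largest rank and two of the at most 64 lower
  neighbours of this vertex; 4096 = 64 * 64.\<close>

lemma sparse_triangles:
  assumes "\<And>S. S \<subseteq> V \<Longrightarrow> S \<noteq> {} \<Longrightarrow> ed E S < 32 * card S"
  shows "card {t. t \<subseteq> V \<and> card t = 3 \<and> (\<forall>x\<in>t. \<forall>y\<in>t. x \<noteq> y \<longrightarrow> {x, y} \<in> E)} \<le> 4096 * card V"
proof -
  interpret sparse V E by unfold_locales (fact assms)
  obtain r :: "'a \<Rightarrow> nat" where r: "inj_on r V" "\<And>v. v \<in> V \<Longrightarrow> card {u\<in>nb E V v. r u < r v} \<le> 64"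
    using rank_exists by blast
  define out where "out v = {u\<in>nb E V v. r u < r v}" for v
  have fo: "finite (out v)" for v using finite_nb by (simp add: out_def)
  let ?T = "{t. t \<subseteq> V \<and> card t = 3 \<and> (\<forall>x\<in>t. \<forall>y\<in>t. x \<noteq> y \<longrightarrow> {x, y} \<in> E)}"
  have "?T \<subseteq> (\<Union>v\<in>V. (\<lambda>(p, q). {v, p, q}) ` (out v \<times> out v))"
  proof
    fix t assume t: "t \<in> ?T"
    then have ft: "finite t" "t \<noteq> {}" by (auto intro: card_ge_0_finite)
    obtain v where v: "v \<in> t" "\<And>u. u \<in> t \<Longrightarrow> r u \<le> r v"
    proof -
      have "Max (r ` t) \<in> r ` t" using ft by (intro Max_in) auto
      then obtain v where "v \<in> t" "r v = Max (r ` t)" by auto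
      then show ?thesis using that[of v] Max_ge[of "r ` t"] ft by auto
    qed
    have "card (t - {v}) = 2" using t v ft by simp
    then obtain p q where pq: "t - {v} = {p, q}" by (meson card_2_iff)
    have "u \<in> out v" if "u \<in> t - {v}" for u
    proof -
      have "r u \<noteq> r v" using inj_onD[OF r(1), of u v] that v(1) t by auto
      then show ?thesis using v(2)[of u] that t v(1) by (auto simp: out_def nb_def)
    qed
    then have "p \<in> out v" "q \<in> out v" using pq by auto
    moreover have "t = {v, p, q}" using pq v(1) by auto
    moreover have "v \<in> V" using v(1) t by auto
    ultimately show "t \<in> (\<Union>v\<in>V. (\<lambda>(p, q). {v, p, q}) ` (out v \<times> out v))"
      by (intro UN_I[of v] image_eqI[of _ _ "(p, q)"]) simp_all
  qed
  then have "card ?T \<le> card (\<Union>v\<in>V. (\<lambda>(p, q). {v, p, q}) ` (out v \<times> out v))"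
    using finV fo by (intro card_mono) auto
  also have "\<dots> \<le> (\<Sum>v\<in>V. card ((\<lambda>(p, q). {v, p, q}) ` (out v \<times> out v)))"
    using finV by (rule card_UN_le)
  also have "\<dots> \<le> (\<Sum>v\<in>V. 4096)"
  proof (rule sum_mono)
    fix v assume "v \<in> V"
    have "card ((\<lambda>(p, q). {v, p, q}) ` (out v \<times> out v)) \<le> card (out v \<times> out v)"
      using fo by (intro card_image_le) auto
    also have "\<dots> \<le> 64 * 64" unfolding card_cartesian_product
      by (intro mult_mono) (use r(2)[OF \<open>v \<in> V\<close>] in \<open>auto simp: out_def\<close>)
    finally show "card ((\<lambda>(p, q). {v, p, q}) ` (out v \<times> out v)) \<le> 4096" by simp
  qed
  finally show ?thesis by simp
qed

definition ends :: "'a set \<Rightarrow> 'a set \<Rightarrow> 'a set" where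
  "ends B F = {b\<in>B. touch E F {b}}"

end

context k33_free
begin

text \<open>Three such sets, contracted, against the three vertices of \<open>t\<close> would be a
  K33 minor.\<close>

lemma card_le_2_of_common_ends:
  assumes dj: "\<And>F G. F \<in> \<F> \<Longrightarrow> G \<in> \<F> \<Longrightarrow> F \<noteq> G \<Longrightarrow> F \<inter> G = {}"
    and cn: "\<And>F. F \<in> \<F> \<Longrightarrow> conn E F \<and> F \<subseteq> V \<and> F \<inter> t = {} \<and> (\<forall>b\<in>t. touch E F {b})"
    and t: "t \<subseteq> V" "card t = 3" and fin: "finite \<F>"
  shows "card \<F> \<le> 2"
proof (rule ccontr)
  assume "\<not> card \<F> \<le> 2"
  then have "3 \<le> card \<F>" by simp
  then obtain \<G> where G: "\<G> \<subseteq> \<F>" "card \<G> = 3" by (meson obtain_subset_with_card_n)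
  obtain A where A: "bij_betw A {0..<(3::nat)} \<G>" using ex_bij_betw_nat_finite[of \<G>] G by (metis card_ge_0_finite zero_less_numeral)
  obtain b where b: "bij_betw b {0..<(3::nat)} t" using ex_bij_betw_nat_finite[of t] t by (metis card_ge_0_finite zero_less_numeral)
  have Ain: "A i \<in> \<F>" if "i < 3" for i using A that G(1) by (auto simp: bij_betw_def)
  have bin: "b i \<in> t" if "i < 3" for i using b that by (auto simp: bij_betw_def)
  have "k33_minor E V"
  proof (rule k33_minorI[of E A V "\<lambda>i. {b i}"])
    fix i j :: nat assume ij: "i < 3" "j < 3"
    show "A i \<inter> {b j} = {} \<and> touch E (A i) {b j}" using cn[OF Ain[OF ij(1)]] bin[OF ij(2)] by auto
    assume "i \<noteq> j"
    then have "A i \<noteq> A j" "b i \<noteq> b j" using A b ij by (auto simp: bij_betw_def inj_on_def)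
    then show "A i \<inter> A j = {} \<and> {b i} \<inter> {b j} = {}" using dj[OF Ain[OF ij(1)] Ain[OF ij(2)]] by auto
  qed (use cn Ain bin t in auto)
  then show False using k33 by simp
qed

text \<open>As many sets as possible each get a private pair of their ends and are absorbed by one
  of the two, which turns the pair into an edge of a minor \<open>H\<close> on \<open>B\<close>;
  sparseness allows 32 per vertex. For a set left over, maximality makes all pairs of its ends edges
  of \<open>H\<close>, so its ends contain a triangle of \<open>H\<close>; there are at most 4096
  triangles per vertex, and each serves at most two sets. 8224 = 32 + 2 * 4096.\<close>

lemma spider_count:
  assumes B: "B \<subseteq> V" and fin: "finite \<F>"
    and dj: "\<And>F G. F \<in> \<F> \<Longrightarrow> G \<in> \<F> \<Longrightarrow> F \<noteq> G \<Longrightarrow> F \<inter> G = {}"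
    and cn: "\<And>F. F \<in> \<F> \<Longrightarrow> conn E F \<and> F \<subseteq> V - B \<and> 3 \<le> card (ends B F)"
  shows "card \<F> \<le> 8224 * card B"
proof -
  have finB: "finite B" using B by (rule finite_sub)
  define P where "P M \<longleftrightarrow> M \<subseteq> \<F> \<times> (B \<times> B) \<and>
      (\<forall>(F, b, c)\<in>M. b \<noteq> c \<and> touch E F {b} \<and> touch E F {c}) \<and>
      (\<forall>p\<in>M. \<forall>q\<in>M. p \<noteq> q \<longrightarrow> fst p \<noteq> fst q \<and> {fst (snd p), snd (snd p)} \<noteq> {fst (snd q), snd (snd q)})" for M
  have finFB: "finite (\<F> \<times> (B \<times> B))" using fin finB by simp
  have "P {}" by (simp add: P_def)
  moreover have "\<forall>M. P M \<longrightarrow> card M < Suc (card (\<F> \<times> (B \<times> B)))"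
    using finFB by (auto simp: P_def less_Suc_eq_le intro: card_mono)
  ultimately obtain M where M: "P M" "\<And>M'. P M' \<Longrightarrow> card M' \<le> card M"
    using ex_has_greatest_nat[of P "{}" card "Suc (card (\<F> \<times> (B \<times> B)))"] by blast
  have M1: "\<And>F b c. (F, b, c) \<in> M \<Longrightarrow> F \<in> \<F> \<and> b \<in> B \<and> c \<in> B \<and> b \<noteq> c \<and> touch E F {b} \<and> touch E F {c}"
    and M2: "\<And>p q. p \<in> M \<Longrightarrow> q \<in> M \<Longrightarrow> p \<noteq> q \<Longrightarrow> fst p \<noteq> fst q \<and> {fst (snd p), snd (snd p)} \<noteq> {fst (snd q), snd (snd q)}"
    using M(1) by (auto simp: P_def)
  have finM: "finite M" using M(1) finFB by (auto simp: P_def intro: finite_subset)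
  define h where "h p = {fst (snd p), snd (snd p)}" for p :: "'a set \<times> 'a \<times> 'a"
  define H where "H = h ` M"
  have injh: "inj_on h M" by (rule inj_onI) (use M2 in \<open>unfold h_def, metis\<close>)
  have injf: "inj_on fst M" by (rule inj_onI) (use M2 in metis)
  interpret H: fin_graph B H
  proof
    fix e assume "e \<in> H"
    then obtain F b c where "(F, b, c) \<in> M" "e = {b, c}" by (auto simp: H_def h_def)
    then show "e \<subseteq> B \<and> card e = 2" using M1[of F b c] by auto
  qed (fact finB)
  \<comment> \<open>\<open>F\<close> joins the blob of the first entry of its pair only, which keeps
    the blobs disjoint; the second entry is then touched by that blob.\<close>
  define blob where "blob b = {b} \<union> \<Union>{F. \<exists>c. (F, b, c) \<in> M}" for b
  have Bdj: "F \<inter> B = {}" "F \<subseteq> V" "conn E F" if "F \<in> \<F>" for F using cn[OF that] by auto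
  have blob: "conn E (blob b) \<and> blob b \<subseteq> V" if b: "b \<in> B" for b
  proof
    have *: "finite G \<Longrightarrow> G \<subseteq> {F. \<exists>c. (F, b, c) \<in> M} \<Longrightarrow> conn E ({b} \<union> \<Union>G)" for G
    proof (induction G rule: finite_induct)
      case (insert F G)
      obtain c where "(F, b, c) \<in> M" using insert.prems by auto
      then have F: "conn E F" "touch E F {b}" using M1 Bdj by auto
      have "conn E (({b} \<union> \<Union>G) \<union> F)"
      proof (rule conn_Un)
        show "touch E ({b} \<union> \<Union>G) F" using F(2) touch_commute[of E F] by (auto intro: touch_mono)
      qed (use insert F in auto)
      then show ?case by (simp add: Un_ac)
    qed simp
    have "{F. \<exists>c. (F, b, c) \<in> M} \<subseteq> fst ` M" by force
    then have "finite {F. \<exists>c. (F, b, c) \<in> M}" using finM by (rule finite_subset[OF _ finite_imageI])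
    then show "conn E (blob b)" unfolding blob_def by (rule *) simp
    have "F \<subseteq> V" if "(F, b, c) \<in> M" for F c using M1[OF that] Bdj(2) by blast
    then show "blob b \<subseteq> V" using b B unfolding blob_def by blast
  qed
  have blob_dj: "blob b \<inter> blob c = {}" if bc: "b \<in> B" "c \<in> B" "b \<noteq> c" for b c
  proof -
    have 1: "F \<inter> G = {}" if FG: "(F, b, x) \<in> M" "(G, c, y) \<in> M" for F G x y
    proof -
      have "(F, b, x) \<noteq> (G, c, y)" using bc by simp
      from M2[OF FG this] have "F \<noteq> G" by simp
      then show ?thesis using dj M1[OF FG(1)] M1[OF FG(2)] by blast
    qed
    have 2: "z \<notin> F" if "(F, x, y) \<in> M" "z \<in> B" for F x y z using M1[OF that(1)] Bdj(1)[of F] that(2) by blast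
    show ?thesis
    proof (rule equals0I)
      fix z assume "z \<in> blob b \<inter> blob c"
      then have "z = b \<or> (\<exists>F x. (F, b, x) \<in> M \<and> z \<in> F)" "z = c \<or> (\<exists>F x. (F, c, x) \<in> M \<and> z \<in> F)"
        by (auto simp: blob_def)
      then show False using bc 1 2 by blast
    qed
  qed
  have blob_touch: "touch E (blob b) (blob c)" if bc: "{b, c} \<in> H" for b c
  proof -
    obtain F x y where F: "(F, x, y) \<in> M" "{b, c} = {x, y}" using bc by (auto simp: H_def h_def)
    have "touch E F {y}" using M1[OF F(1)] by auto
    moreover have "F \<subseteq> blob x" "{y} \<subseteq> blob y" using F(1) by (auto simp: blob_def)
    ultimately have "touch E (blob x) (blob y)" by (rule touch_mono)
    then show ?thesis using F(2) touch_commute[of E "blob x"] by (auto simp: doubleton_eq_iff)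
  qed
  \<comment> \<open>A dense part of \<open>H\<close> has a K6 minor in \<open>H\<close>, which the
    blobs carry over to the given graph.\<close>
  have sp: "ed H S < 32 * card S" if S: "S \<subseteq> B" "S \<noteq> {}" for S
  proof (rule ccontr)
    assume "\<not> ?thesis"
    then have dense: "2 ^ 5 * card S \<le> ed H S" by simp
    have six: "6 = Suc 5" by simp
    have "clique_minor H S 6" unfolding six by (rule H.clique_minor_of_dense[OF S dense])
    then have "clique_minor E V 6"
      by (rule clique_minor_blob[of _ _ _ _ blob]) (use S blob blob_dj blob_touch in blast)+
    then show False using k33_of_k6 k33 by auto
  qed
  interpret H: sparse B H by unfold_locales (fact sp)
  have cardM: "card M \<le> 32 * card B"
  proof (cases "B = {}")
    case True
    then have "M = {}" using M1 by fastforce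
    then show ?thesis by simp
  next
    case False
    have "card M = card H" unfolding H_def using injh by (simp add: card_image)
    also have "H = {e\<in>H. e \<subseteq> B}" using H.edge by auto
    then have "card H = ed H B" by (simp add: ed_def)
    finally show ?thesis using sp[OF subset_refl False] by simp
  qed
  define \<R> where "\<R> = \<F> - fst ` M"
  define TT where "TT = {t. t \<subseteq> B \<and> card t = 3 \<and> (\<forall>x\<in>t. \<forall>y\<in>t. x \<noteq> y \<longrightarrow> {x, y} \<in> H)}"
  have finTT: "finite TT" using finB by (auto simp: TT_def)
  \<comment> \<open>Otherwise \<open>(F, b, c)\<close> could be added to the maximal family
    \<open>M\<close>.\<close>
  have ends_H: "{b, c} \<in> H" if F: "F \<in> \<R>" and bc: "b \<in> ends B F" "c \<in> ends B F" "b \<noteq> c" for F b c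
  proof (rule ccontr)
    assume nH: "{b, c} \<notin> H"
    have new: "{x, y} \<noteq> {b, c}" "G \<noteq> F" if "(G, x, y) \<in> M" for G x y
    proof -
      have "h (G, x, y) \<in> H" using that by (simp add: H_def)
      then show "{x, y} \<noteq> {b, c}" using nH by (auto simp: h_def)
      have "G \<in> fst ` M" using that by (rule image_eqI[rotated]) simp
      then show "G \<noteq> F" using F by (auto simp: \<R>_def)
    qed
    have "P (insert (F, b, c) M)"
      unfolding P_def
    proof (intro conjI ballI impI)
      show "insert (F, b, c) M \<subseteq> \<F> \<times> B \<times> B" using M(1) F bc by (auto simp: P_def \<R>_def ends_def)
    next
      fix p assume "p \<in> insert (F, b, c) M"
      then show "case p of (F, b, c) \<Rightarrow> b \<noteq> c \<and> touch E F {b} \<and> touch E F {c}"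
        using M1 bc by (auto simp: ends_def)
    next
      fix p q assume "p \<in> insert (F, b, c) M" "q \<in> insert (F, b, c) M" "p \<noteq> q"
      then consider "p \<in> M" "q \<in> M" | "p = (F, b, c)" "q \<in> M" | "q = (F, b, c)" "p \<in> M" by auto
      then have "fst p \<noteq> fst q \<and> {fst (snd p), snd (snd p)} \<noteq> {fst (snd q), snd (snd q)}"
      proof cases
        case 1
        then show ?thesis using M2 \<open>p \<noteq> q\<close> by blast
      next
        case 2
        obtain G x y where "q = (G, x, y)" by (cases q)
        then show ?thesis using 2 new[of G x y] by auto
      next
        case 3
        obtain G x y where "p = (G, x, y)" by (cases p)
        then show ?thesis using 3 new[of G x y] by auto
      qed
      then show "fst p \<noteq> fst q" "{fst (snd p), snd (snd p)} \<noteq> {fst (snd q), snd (snd q)}" by auto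
    qed
    then have "card (insert (F, b, c) M) \<le> card M" by (rule M(2))
    moreover have "(F, b, c) \<notin> M" using new(2) by blast
    ultimately show False using finM by simp
  qed
  have "\<exists>t. t \<in> TT \<and> t \<subseteq> ends B F" if F: "F \<in> \<R>" for F
  proof -
    have "3 \<le> card (ends B F)" using cn F by (auto simp: \<R>_def)
    then obtain t where "t \<subseteq> ends B F" "card t = 3" by (meson obtain_subset_with_card_n)
    then have "t \<in> TT" using ends_H[OF F] by (auto simp: TT_def ends_def)
    then show ?thesis using \<open>t \<subseteq> ends B F\<close> by blast
  qed
  then obtain tt where tt: "\<And>F. F \<in> \<R> \<Longrightarrow> tt F \<in> TT \<and> tt F \<subseteq> ends B F" by metis
  have "card \<R> \<le> (\<Sum>t\<in>TT. card {F\<in>\<R>. tt F = t})"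
  proof -
    have "\<R> = (\<Union>t\<in>TT. {F\<in>\<R>. tt F = t})" using tt by auto
    then show ?thesis using card_UN_le[OF finTT, of "\<lambda>t. {F\<in>\<R>. tt F = t}"] by simp
  qed
  also have "\<dots> \<le> (\<Sum>t\<in>TT. 2)"
  proof (rule sum_mono)
    fix t assume t: "t \<in> TT"
    show "card {F\<in>\<R>. tt F = t} \<le> 2"
    proof (rule card_le_2_of_common_ends)
      fix F assume "F \<in> {F\<in>\<R>. tt F = t}"
      then have "F \<in> \<F>" "t \<subseteq> ends B F" using tt by (auto simp: \<R>_def)
      then show "conn E F \<and> F \<subseteq> V \<and> F \<inter> t = {} \<and> (\<forall>b\<in>t. touch E F {b})"
        using Bdj by (fastforce simp: ends_def)
    qed (use dj t B fin in \<open>auto simp: \<R>_def TT_def\<close>)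
  qed
  also have "\<dots> \<le> 2 * (4096 * card B)"
    using H.sparse_triangles[OF sp] by (simp add: TT_def)
  finally have "card \<R> \<le> 8192 * card B" by simp
  moreover have "card \<F> \<le> card \<R> + card (fst ` M)"
  proof -
    have "\<F> \<subseteq> \<R> \<union> fst ` M" by (auto simp: \<R>_def)
    then have "card \<F> \<le> card (\<R> \<union> fst ` M)" using fin finM by (intro card_mono) (auto simp: \<R>_def)
    then show ?thesis using card_Un_le[of \<R> "fst ` M"] by linarith
  qed
  moreover have "card (fst ` M) \<le> 32 * card B" unfolding card_image[OF injf] by (rule cardM)
  ultimately show ?thesis by linarith
qed

end

text \<open>A vertex is bad for X if it is the centre of a fan of three paths of length at most two, the
  first of length one, ending in three different vertices of X.\<close>

context fin_graph
begin

definition bad0 :: "'a set \<Rightarrow> 'a set" where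
  "bad0 X = {v\<in>V - X. 3 \<le> card (nb E X v)}"

definition bad1 :: "'a set \<Rightarrow> 'a set" where
  "bad1 X = {v\<in>V - X. \<exists>a b c y. a \<in> nb E X v \<and> b \<in> nb E X v \<and> y \<in> nb E (V - X) v \<and> c \<in> nb E X y \<and>
     a \<noteq> b \<and> a \<noteq> c \<and> b \<noteq> c}"

definition bad2 :: "'a set \<Rightarrow> 'a set" where
  "bad2 X = {v\<in>V - X. \<exists>a b c y z. a \<in> nb E X v \<and> y \<in> nb E (V - X) v \<and> b \<in> nb E X y \<and>
     z \<in> nb E (V - X) v \<and> c \<in> nb E X z \<and> y \<noteq> z \<and> a \<noteq> b \<and> a \<noteq> c \<and> b \<noteq> c}"

definition bad :: "'a set \<Rightarrow> 'a set" where
  "bad X = bad0 X \<union> bad1 X \<union> bad2 X"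

lemma bad_subset: "bad X \<subseteq> V - X"
  by (auto simp: bad_def bad0_def bad1_def bad2_def)

lemma card_ge_3I:
  assumes "finite S" "a \<in> S" "b \<in> S" "c \<in> S" "a \<noteq> b" "a \<noteq> c" "b \<noteq> c"
  shows "3 \<le> card S"
proof -
  have "card {a, b, c} \<le> card S" using assms by (intro card_mono) auto
  then show ?thesis using assms by simp
qed

end

context k33_free
begin

lemma card_bad0: "X \<subseteq> V \<Longrightarrow> card (bad0 X) \<le> 8224 * card X"
proof -
  assume X: "X \<subseteq> V"
  have "finite (bad0 X)" using finV by (auto simp: bad0_def)
  then have "card ((\<lambda>v. {v}) ` bad0 X) \<le> 8224 * card X"
  proof (intro spider_count[OF X])
    fix F assume "F \<in> (\<lambda>v. {v}) ` bad0 X"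
    then obtain v where "v \<in> bad0 X" "F = {v}" by auto
    moreover then have "ends X F = nb E X v" by (auto simp: ends_def nb_def touch_def insert_commute)
    ultimately show "conn E F \<and> F \<subseteq> V - X \<and> 3 \<le> card (ends X F)" by (auto simp: bad0_def)
  qed auto
  then show ?thesis by (simp add: card_image)
qed

text \<open>A maximal disjoint subfamily has few members by \<open>spider_count\<close>. Every
  member of the family meets its union, and the union is small because the members have at most
  \<open>k\<close> vertices.\<close>

lemma card_cover:
  assumes X: "X \<subseteq> V" and C: "\<And>C. C \<in> \<C> \<Longrightarrow> conn E C \<and> C \<subseteq> V - X \<and> card C \<le> k \<and> 3 \<le> card (ends X C)"
  obtains Z where "Z \<subseteq> V - X" "card Z \<le> 8224 * k * card X" "\<And>C. C \<in> \<C> \<Longrightarrow> C \<inter> Z \<noteq> {}"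
proof -
  have "\<C> \<subseteq> Pow V" using C by auto
  then have finC: "finite \<C>" using finV finite_subset by (metis finite_Pow_iff)
  have "{} \<notin> \<C>" using C by (auto simp: conn_def)
  then obtain \<F> where F: "\<F> \<subseteq> \<C>" "\<And>F G. F \<in> \<F> \<Longrightarrow> G \<in> \<F> \<Longrightarrow> F \<noteq> G \<Longrightarrow> F \<inter> G = {}"
    "\<And>C. C \<in> \<C> \<Longrightarrow> C \<inter> \<Union>\<F> \<noteq> {}"
    using maximal_disjoint_family[OF finC] by metis
  have finF: "finite \<F>" using F(1) finC finite_subset by auto
  have cF: "card \<F> \<le> 8224 * card X"
    using F(1) C finF by (intro spider_count[OF X]) (auto dest: F(2))
  have "card (\<Union>\<F>) \<le> (\<Sum>C\<in>\<F>. card C)"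
    by (rule card_Union_le_sum_card)
  also have "\<dots> \<le> card \<F> * k" using sum_bounded_above[of \<F> card k] F(1) C by auto
  also have "\<dots> \<le> 8224 * card X * k" using cF by simp
  finally show ?thesis using F(1,3) C by (intro that[of "\<Union>\<F>"]) (auto simp: mult_ac)
qed

lemma card_Un_bound: "X \<subseteq> V \<Longrightarrow> Z \<subseteq> V \<Longrightarrow> card Z \<le> k * card X \<Longrightarrow> card (X \<union> Z) \<le> (k + 1) * card X"
  using card_Un_le[of X Z] by simp

text \<open>The pairs {v, y} are hit by a small set \<open>Z\<close>. If v escapes \<open>Z\<close>,
  then y lies in it and is a third neighbour of v in \<open>X \<union> Z\<close>, which reduces the
  count to \<open>bad0\<close> of a larger set.\<close>

lemma card_bad1: 
  assumes X: "X \<subseteq> V"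
  shows "card (bad1 X) \<le> 150000000 * card X"
proof -
  define \<C> where "\<C> = {{v, y} | v y. v \<in> V - X \<and> y \<in> nb E (V - X) v \<and>
     (\<exists>a b c. a \<in> nb E X v \<and> b \<in> nb E X v \<and> c \<in> nb E X y \<and> a \<noteq> b \<and> a \<noteq> c \<and> b \<noteq> c)}"
  have CC: "conn E C \<and> C \<subseteq> V - X \<and> card C \<le> 2 \<and> 3 \<le> card (ends X C)" if mem: "C \<in> \<C>" for C
  proof -
    obtain v y a b c where *: "C = {v, y}" "v \<in> V - X" "y \<in> nb E (V - X) v" "a \<in> nb E X v" "b \<in> nb E X v"
      "c \<in> nb E X y" "a \<noteq> b" "a \<noteq> c" "b \<noteq> c" using mem unfolding \<C>_def by blast
    have "3 \<le> card (ends X C)"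
      by (rule card_ge_3I[of _ a b c]) (use * finite_sub[OF X] in \<open>auto simp: ends_def touch_def nb_def insert_commute\<close>)
    then show ?thesis using * conn_pair[of v y E] by (auto simp: nb_def insert_commute card_insert_if)
  qed
  obtain Z where Z: "Z \<subseteq> V - X" "card Z \<le> 8224 * 2 * card X" "\<And>C. C \<in> \<C> \<Longrightarrow> C \<inter> Z \<noteq> {}"
    using card_cover[OF X CC] by metis
  have "bad1 X \<subseteq> Z \<union> bad0 (X \<union> Z)"
  proof
    fix v assume v: "v \<in> bad1 X"
    then obtain a b c y where *: "v \<in> V - X" "a \<in> nb E X v" "b \<in> nb E X v" "y \<in> nb E (V - X) v"
      "c \<in> nb E X y" "a \<noteq> b" "a \<noteq> c" "b \<noteq> c" by (auto simp: bad1_def)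
    then have "{v, y} \<in> \<C>" unfolding \<C>_def by blast
    then have "{v, y} \<inter> Z \<noteq> {}" by (rule Z(3))
    then have "v \<in> Z \<or> (v \<notin> Z \<and> y \<in> Z)" by auto
    then show "v \<in> Z \<union> bad0 (X \<union> Z)"
    proof
      assume vy: "v \<notin> Z \<and> y \<in> Z"
      have "3 \<le> card (nb E (X \<union> Z) v)"
        by (rule card_ge_3I[OF finite_nb, of a _ _ b y]) (use * vy Z(1) in \<open>auto simp: nb_def\<close>)
      then show ?thesis using * vy by (auto simp: bad0_def)
    qed auto
  qed
  moreover have fin: "finite Z" "finite (bad0 (X \<union> Z))" using Z finite_sub finV by (auto simp: bad0_def)
  ultimately have "card (bad1 X) \<le> card (Z \<union> bad0 (X \<union> Z))" by (intro card_mono) auto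
  also have "\<dots> \<le> card Z + card (bad0 (X \<union> Z))" by (rule card_Un_le)
  also have "card (bad0 (X \<union> Z)) \<le> 8224 * card (X \<union> Z)" using X Z by (intro card_bad0) auto
  also have "card (X \<union> Z) \<le> (8224 * 2 + 1) * card X" using X Z by (intro card_Un_bound) auto
  finally show ?thesis using Z(2) by simp
qed

text \<open>The same enlargement of \<open>X\<close>: when \<open>Z\<close> contains y or z but not
  v, the fan at v has more legs of length one with respect to \<open>X \<union> Z\<close>, hence v
  is of kind \<open>bad0\<close> or \<open>bad1\<close> there. Applying the earlier bounds to the
  larger set multiplies the constants.\<close>

lemma card_bad2:
  assumes X: "X \<subseteq> V"
  shows "card (bad2 X) \<le> 4000000000000 * card X"
proof -
  define \<C> where "\<C> = {{v, y, z} | v y z. v \<in> V - X \<and> y \<in> nb E (V - X) v \<and> z \<in> nb E (V - X) v \<and> y \<noteq> z \<and>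
     (\<exists>a b c. a \<in> nb E X v \<and> b \<in> nb E X y \<and> c \<in> nb E X z \<and> a \<noteq> b \<and> a \<noteq> c \<and> b \<noteq> c)}"
  have CC: "conn E C \<and> C \<subseteq> V - X \<and> card C \<le> 3 \<and> 3 \<le> card (ends X C)" if mem: "C \<in> \<C>" for C
  proof -
    obtain v y z a b c where *: "C = {v, y, z}" "v \<in> V - X" "y \<in> nb E (V - X) v" "z \<in> nb E (V - X) v"
      "a \<in> nb E X v" "b \<in> nb E X y" "c \<in> nb E X z" "a \<noteq> b" "a \<noteq> c" "b \<noteq> c" using mem unfolding \<C>_def by blast
    have "3 \<le> card (ends X C)"
      by (rule card_ge_3I[of _ a b c]) (use * finite_sub[OF X] in \<open>auto simp: ends_def touch_def nb_def insert_commute\<close>)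
    moreover have "conn E (insert z {v, y})"
      by (rule conn_insert[of _ _ v]) (use * in \<open>auto intro!: conn_pair simp: nb_def insert_commute\<close>)
    ultimately show ?thesis using * by (auto simp: nb_def insert_commute card_insert_if)
  qed
  obtain Z where Z: "Z \<subseteq> V - X" "card Z \<le> 8224 * 3 * card X" "\<And>C. C \<in> \<C> \<Longrightarrow> C \<inter> Z \<noteq> {}"
    using card_cover[OF X CC] by metis
  have "bad2 X \<subseteq> Z \<union> (bad0 (X \<union> Z) \<union> bad1 (X \<union> Z))"
  proof
    fix v assume v: "v \<in> bad2 X"
    then obtain a b c y z where *: "v \<in> V - X" "a \<in> nb E X v" "y \<in> nb E (V - X) v" "b \<in> nb E X y"
      "z \<in> nb E (V - X) v" "c \<in> nb E X z" "y \<noteq> z" "a \<noteq> b" "a \<noteq> c" "b \<noteq> c" by (auto simp: bad2_def)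
    then have "{v, y, z} \<in> \<C>" unfolding \<C>_def by blast
    then have "{v, y, z} \<inter> Z \<noteq> {}" by (rule Z(3))
    then consider "v \<in> Z" | "v \<notin> Z" "y \<in> Z" "z \<in> Z" | "v \<notin> Z" "y \<in> Z" "z \<notin> Z" | "v \<notin> Z" "y \<notin> Z" "z \<in> Z" by auto
    then show "v \<in> Z \<union> (bad0 (X \<union> Z) \<union> bad1 (X \<union> Z))"
    proof cases
      case 2
      have "3 \<le> card (nb E (X \<union> Z) v)"
        by (rule card_ge_3I[OF finite_nb, of a _ _ y z]) (use * 2 Z(1) in \<open>auto simp: nb_def\<close>)
      then show ?thesis using * 2 by (auto simp: bad0_def)
    next
      case 3
      have "v \<in> bad1 (X \<union> Z)" unfolding bad1_def
        using * 3 Z(1) by (intro CollectI conjI exI[of _ a] exI[of _ y] exI[of _ c] exI[of _ z]) (auto simp: nb_def)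
      then show ?thesis by simp
    next
      case 4
      have "v \<in> bad1 (X \<union> Z)" unfolding bad1_def
        using * 4 Z(1) by (intro CollectI conjI exI[of _ a] exI[of _ z] exI[of _ b] exI[of _ y]) (auto simp: nb_def)
      then show ?thesis by simp
    qed auto
  qed
  moreover have fin: "finite Z" "finite (bad0 (X \<union> Z))" "finite (bad1 (X \<union> Z))"
    using Z finite_sub finV by (auto simp: bad0_def bad1_def)
  ultimately have "card (bad2 X) \<le> card (Z \<union> (bad0 (X \<union> Z) \<union> bad1 (X \<union> Z)))" by (intro card_mono) auto
  also have "\<dots> \<le> card Z + (card (bad0 (X \<union> Z)) + card (bad1 (X \<union> Z)))"
    by (meson add_left_mono card_Un_le order_trans)
  also have "card (bad0 (X \<union> Z)) \<le> 8224 * card (X \<union> Z)" using X Z by (intro card_bad0) auto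
  also have "card (bad1 (X \<union> Z)) \<le> 150000000 * card (X \<union> Z)" using X Z by (intro card_bad1) auto
  also have "card (X \<union> Z) \<le> (8224 * 3 + 1) * card X" using X Z by (intro card_Un_bound) auto
  finally show ?thesis using Z(2) by simp
qed

lemma card_bad: "X \<subseteq> V \<Longrightarrow> card (bad X) \<le> 5000000000000 * card X"
  using card_bad0[of X] card_bad1[of X] card_bad2[of X] card_Un_le[of "bad0 X \<union> bad1 X" "bad2 X"]
    card_Un_le[of "bad0 X" "bad1 X"] by (simp add: bad_def)

end

section \<open>Planar graphs have no K33 minor\<close>

lemma connected_inside_or_outside:
  fixes J :: "complex set"
  assumes "closed J" "connected S" "S \<inter> J = {}"
  shows "S \<subseteq> inside J \<or> S \<subseteq> outside J"
proof -
  have "S \<subseteq> inside J \<union> outside J" using assms(3) by auto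
  moreover have "open (inside J)" "open (outside J)" using assms(1) by (auto simp: open_inside open_outside)
  moreover have "inside J \<inter> outside J \<inter> S = {}" by simp
  ultimately have "inside J \<inter> S = {} \<or> outside J \<inter> S = {}"
    using connectedD[OF assms(2), of "inside J" "outside J"] by blast
  then show ?thesis using \<open>S \<subseteq> inside J \<union> outside J\<close> by blast
qed

lemma arc_ends_in_closure:
  fixes e :: "real \<Rightarrow> complex"
  assumes "arc e"
  shows "path_image e \<subseteq> closure (path_image e - {pathstart e, pathfinish e})"
proof -
  have "e ` closure {0<..<1} \<subseteq> closure (e ` {0<..<1})"
    by (rule image_closure_subset)
      (use assms in \<open>auto simp: arc_def path_def intro: closure_subset[THEN subsetD]\<close>)
  moreover have "e ` {0<..<1} = path_image e - {pathstart e, pathfinish e}"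
    using assms by (simp add: simple_path_endless arc_imp_simple_path)
  ultimately show ?thesis by (simp add: path_image_def)
qed

definition chord :: "(real \<Rightarrow> complex) \<Rightarrow> complex set \<Rightarrow> bool" where
  "chord c J \<longleftrightarrow> arc c \<and> path_image c \<inter> J = {pathstart c, pathfinish c}"

lemma chord_side:
  assumes "closed J" "chord c J"
  shows "path_image c - J \<subseteq> inside J \<or> path_image c - J \<subseteq> outside J"
proof -
  have eq: "path_image c - J = path_image c - {pathstart c, pathfinish c}" using assms by (auto simp: chord_def)
  have "connected (path_image c - J)" unfolding eq
    by (rule connected_simple_path_endless) (use assms in \<open>simp add: chord_def arc_imp_simple_path\<close>)
  then show ?thesis using connected_inside_or_outside[OF assms(1)] by auto
qed

lemma chord_nonempty:
  assumes "chord c J"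
  shows "path_image c - J \<noteq> {}"
proof -
  have eq: "path_image c - J = path_image c - {pathstart c, pathfinish c}" using assms by (auto simp: chord_def)
  show ?thesis unfolding eq 
    by (rule nonempty_simple_path_endless) (use assms in \<open>simp add: chord_def arc_imp_simple_path\<close>)
qed

text \<open>The chord \<open>c\<close> splits the inside of the curve into two regions, and
  \<open>e\<close> without its ends lies in one of them. The closure of that region misses the part
  of the curve that carries the other end of \<open>e\<close>.\<close>

lemma crossing_chords_inside:
  assumes arcs: "arc c1" "arc c2"
    and c1: "pathstart c1 = a" "pathfinish c1 = b" and c2: "pathstart c2 = a" "pathfinish c2 = b"
    and c12: "path_image c1 \<inter> path_image c2 = {a, b}"
    and J: "J = path_image c1 \<union> path_image c2"
    and c: "chord c J" "pathstart c = a" "pathfinish c = b"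
    and e: "chord e J" "pathstart e \<in> path_image c1 - {a, b}" "pathfinish e \<in> path_image c2 - {a, b}"
    and ce: "path_image c \<inter> path_image e = {}"
    and ins: "path_image c - J \<subseteq> inside J" "path_image e - J \<subseteq> inside J"
  shows False
proof -
  have ab: "a \<noteq> b" using arcs(1) c1 arc_distinct_ends by blast
  have sub: "{a, b} \<subseteq> path_image c1" "{a, b} \<subseteq> path_image c2" using c12 by auto
  have arcc: "arc c" "arc e" and cJ: "path_image c \<inter> J = {a, b}"
    and eJ: "path_image e \<inter> J = {pathstart e, pathfinish e}" using c e by (auto simp: chord_def)
  define I1 where "I1 = inside (path_image c1 \<union> path_image c)"
  define I2 where "I2 = inside (path_image c2 \<union> path_image c)"
  have "path_image c \<inter> inside (path_image c1 \<union> path_image c2) \<noteq> {}"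
    using chord_nonempty[OF c(1)] ins(1) J by auto
  note ne = this
  have c1c: "path_image c1 \<inter> path_image c = {a, b}" and c2c: "path_image c2 \<inter> path_image c = {a, b}"
    using cJ sub unfolding J by blast+
  have I12: "I1 \<inter> I2 = {}" and IU: "I1 \<union> I2 \<union> (path_image c - {a, b}) = inside J"
    using split_inside_simple_closed_curve[OF arc_imp_simple_path[OF arcs(1)] c1 arc_imp_simple_path[OF arcs(2)] c2
        arc_imp_simple_path[OF arcc(1)] c(2,3) ab c12 c1c c2c ne] unfolding J I1_def I2_def by metis+
  have cl: "closed (path_image c1 \<union> path_image c)" "closed (path_image c2 \<union> path_image c)"
    using arcs arcc by (auto intro!: closed_Un closed_path_image arc_imp_path)
  define S where "S = path_image e - {pathstart e, pathfinish e}"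
  have SJ: "S = path_image e - J" using eJ by (auto simp: S_def)
  have conS: "connected S" unfolding S_def by (rule connected_simple_path_endless) (use arcc in \<open>simp add: arc_imp_simple_path\<close>)
  have "S \<subseteq> I1 \<union> I2" using ins(2) IU ce SJ by blast
  moreover have "open I1" "open I2" unfolding I1_def I2_def using cl open_inside by auto
  ultimately have "S \<subseteq> I1 \<or> S \<subseteq> I2"
    using connectedD[OF conS, of I1 I2] I12 by blast
  moreover have ends: "pathstart e \<in> closure S" "pathfinish e \<in> closure S"
    using arc_ends_in_closure[OF arcc(2)] by (auto simp: S_def)
  moreover have "closure I1 \<subseteq> (path_image c1 \<union> path_image c) \<union> I1" "closure I2 \<subseteq> (path_image c2 \<union> path_image c) \<union> I2"
    unfolding I1_def I2_def using cl closure_inside_subset by blast+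
  ultimately have "pathfinish e \<in> path_image c1 \<union> path_image c \<union> I1 \<or> pathstart e \<in> path_image c2 \<union> path_image c \<union> I2"
    using closure_mono by blast
  moreover have "pathfinish e \<notin> path_image c" "pathstart e \<notin> path_image c" using ce pathfinish_in_path_image pathstart_in_path_image by blast+
  moreover have "pathfinish e \<notin> path_image c1" "pathstart e \<notin> path_image c2" using e c12 by blast+
  moreover have "pathfinish e \<notin> inside J" "pathstart e \<notin> inside J" using e J inside_no_overlap[of J] by blast+
  ultimately show False using IU by blast
qed

text \<open>Suppose the image of the outside lay outside the image curve. The image of the inside
  punctured at \<open>z0\<close> is unbounded, so it lies outside too, and the inside of the image
  curve could contain nothing but 0, the image of infinity; but it is open and nonempty.\<close>

lemma inversion_outside_to_inside:
  fixes c :: "real \<Rightarrow> complex"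
  assumes c: "simple_path c" "pathfinish c = pathstart c" and z0: "z0 \<in> inside (path_image c)"
    and x: "x \<in> outside (path_image c)"
  shows "inverse (x - z0) \<in> inside ((\<lambda>z. inverse (z - z0)) ` path_image c)"
proof -
  define J where "J = path_image c"
  define \<phi> where "\<phi> = (\<lambda>z. inverse (z - z0))"
  note JC = Jordan_inside_outside[OF c, folded J_def]
  have z0J: "z0 \<notin> J" and z0O: "z0 \<notin> outside J" 
    using z0 inside_no_overlap[of J] inside_Int_outside[of J] unfolding J_def by blast+
  have cont: "continuous_on S \<phi>" if "z0 \<notin> S" for S unfolding \<phi>_def using that by (intro continuous_intros) auto
  have inj: "inj_on \<phi> S" for S by (auto simp: inj_on_def \<phi>_def)
  have sp: "simple_path (\<phi> \<circ> c)" "pathfinish (\<phi> \<circ> c) = pathstart (\<phi> \<circ> c)"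
    using simple_path_continuous_image[OF c(1) cont inj] z0J c(2)
    by (auto simp: J_def pathfinish_def pathstart_def)
  have pim: "path_image (\<phi> \<circ> c) = \<phi> ` J" by (simp add: path_image_compose J_def)
  note JC' = Jordan_inside_outside[OF sp, unfolded pim]
  have clJ': "closed (\<phi> ` J)" using closed_path_image[OF simple_path_imp_path[OF sp(1)]] pim by simp
  have conO: "connected (\<phi> ` outside J)" using JC z0O by (intro connected_continuous_image cont) auto
  have inj2: "\<phi> u \<noteq> \<phi> v" if "u \<noteq> v" for u v using that by (auto simp: \<phi>_def)
  have Int: "\<phi> ` X \<inter> \<phi> ` Y = \<phi> ` (X \<inter> Y)" for X Y using image_Int[OF inj[of UNIV]] by metis
  have dO: "\<phi> ` outside J \<inter> \<phi> ` J = {}" unfolding Int by (simp add: outside_no_overlap)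
  have "\<not> \<phi> ` outside J \<subseteq> outside (\<phi> ` J)"
  proof
    assume sub: "\<phi> ` outside J \<subseteq> outside (\<phi> ` J)"
    define I where "I = inside J - {z0}"
    have conI: "connected (\<phi> ` I)" unfolding I_def
      using JC by (intro connected_continuous_image cont connected_open_delete) auto
    have "I \<inter> J = {}" using inside_no_overlap[of J] unfolding I_def by blast
    then have dI: "\<phi> ` I \<inter> \<phi> ` J = {}" unfolding Int by simp
    have unb: "\<not> bounded (\<phi> ` I)"
    proof
      assume "bounded (\<phi> ` I)"
      then obtain M where M: "M > 0" "\<And>y. y \<in> I \<Longrightarrow> cmod (\<phi> y) \<le> M" by (auto simp: bounded_pos)
      obtain r where r: "r > 0" "ball z0 r \<subseteq> inside J" using JC z0 open_contains_ball by (metis J_def)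
      define d where "d = min (r / 2) (1 / (2 * M))"
      have d: "d > 0" "d < r" "d < 1 / M" using r M by (auto simp: d_def min_def field_simps)
      have "z0 + of_real d \<in> I" using d r by (auto simp: I_def dist_norm subset_iff)
      then have "cmod (\<phi> (z0 + of_real d)) \<le> M" by (rule M(2))
      then have "1 / d \<le> M" using d by (simp add: \<phi>_def norm_inverse divide_inverse)
      then show False using d M by (simp add: field_simps)
    qed
    have "\<phi> ` I \<subseteq> outside (\<phi> ` J)"

    proof -
      have "bounded (inside (\<phi> ` J))" using JC' by simp
      then have "\<not> \<phi> ` I \<subseteq> inside (\<phi> ` J)" using unb bounded_subset by auto
      then show ?thesis using connected_inside_or_outside[OF clJ' conI dI] by simp
    qed
    moreover have "inside (\<phi> ` J) \<subseteq> insert 0 (\<phi> ` I \<union> \<phi> ` outside J)"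
    proof
      fix y assume y: "y \<in> inside (\<phi> ` J)"
      show "y \<in> insert 0 (\<phi> ` I \<union> \<phi> ` outside J)"
      proof (cases "y = 0")
        case False
        define u where "u = z0 + inverse y"
        have u: "\<phi> u = y" "u \<noteq> z0" using False by (auto simp: u_def \<phi>_def)
        have "y \<notin> \<phi> ` J" using y inside_no_overlap[of "\<phi> ` J"] by blast
        then have "u \<notin> J" using u by blast
        then have "u \<in> inside J \<union> outside J" unfolding inside_Un_outside by simp
        then show ?thesis using u unfolding I_def by blast
      qed simp
    qed
    ultimately have "inside (\<phi> ` J) \<subseteq> {0}" using sub inside_Int_outside[of "\<phi> ` J"] by blast
    moreover have "open (inside (\<phi> ` J))" "inside (\<phi> ` J) \<noteq> {}" using JC' by auto
    ultimately show False 
      using finite_imp_not_open[of "inside (\<phi> ` J)"] finite_subset[of "inside (\<phi> ` J)" "{0}"] by blast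
  qed
  then have "\<phi> ` outside J \<subseteq> inside (\<phi> ` J)"
    using connected_inside_or_outside[OF clJ' conO dO] by auto
  then show ?thesis using x by (auto simp: J_def \<phi>_def)
qed

text \<open>An inversion about a point inside the curve reduces two chords on the outside to two
  chords on the inside.\<close>

lemma crossing_chords:
  assumes arcs: "arc c1" "arc c2"
    and c1: "pathstart c1 = a" "pathfinish c1 = b" and c2: "pathstart c2 = a" "pathfinish c2 = b"
    and c12: "path_image c1 \<inter> path_image c2 = {a, b}"
    and J: "J = path_image c1 \<union> path_image c2"
    and c: "chord c J" "pathstart c = a" "pathfinish c = b"
    and e: "chord e J" "pathstart e \<in> path_image c1 - {a, b}" "pathfinish e \<in> path_image c2 - {a, b}"
    and ce: "path_image c \<inter> path_image e = {}"
  shows "\<not> (path_image c - J \<subseteq> inside J \<and> path_image e - J \<subseteq> inside J)"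
    and "\<not> (path_image c - J \<subseteq> outside J \<and> path_image e - J \<subseteq> outside J)"
proof -
  show "\<not> (path_image c - J \<subseteq> inside J \<and> path_image e - J \<subseteq> inside J)"
    using crossing_chords_inside[OF assms] by blast
  show "\<not> (path_image c - J \<subseteq> outside J \<and> path_image e - J \<subseteq> outside J)"
  proof
    assume out: "path_image c - J \<subseteq> outside J \<and> path_image e - J \<subseteq> outside J"
    define h where "h = c1 +++ reversepath c2"
    have hp: "simple_path h" "pathfinish h = pathstart h" unfolding h_def
      using arcs c1 c2 c12 by (auto intro!: simple_path_join_loop simp: arc_reversepath)
    have hJ: "path_image h = J" unfolding h_def J using c1 c2 by (simp add: path_image_join)
    note JC = Jordan_inside_outside[OF hp, unfolded hJ]
    obtain z0 where z0: "z0 \<in> inside J" using JC by auto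
    define \<phi> where "\<phi> = (\<lambda>z::complex. inverse (z - z0))"
    have z0J: "z0 \<notin> J" using z0 inside_no_overlap[of J] by blast
    have z0c: "z0 \<notin> path_image c" "z0 \<notin> path_image e" using z0 z0J out inside_Int_outside[of J] by blast+
    have z01: "z0 \<notin> path_image c1" "z0 \<notin> path_image c2" using z0J J by auto
    have inj2: "\<phi> u = \<phi> v \<longleftrightarrow> u = v" for u v by (auto simp: \<phi>_def)
    have arcphi: "arc (\<phi> \<circ> g)" if "arc g" "z0 \<notin> path_image g" for g
    proof -
      have "continuous_on (path_image g) \<phi>" unfolding \<phi>_def using that by (intro continuous_intros) auto
      then show ?thesis using that
        by (auto simp: arc_def path_def path_image_def inj_on_def inj2 intro: continuous_on_compose2)
    qed
    have Int: "\<phi> ` X \<inter> \<phi> ` Y = \<phi> ` (X \<inter> Y)" for X Y using inj2 by auto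
    have ins: "\<phi> ` (outside J) \<subseteq> inside (\<phi> ` J)"
      using inversion_outside_to_inside[OF hp, unfolded hJ, OF z0] by (auto simp: \<phi>_def)
    have diff: "\<phi> ` X - \<phi> ` Y = \<phi> ` (X - Y)" for X Y using inj2 by auto
    show False
    proof (rule crossing_chords_inside[of "\<phi> \<circ> c1" "\<phi> \<circ> c2" "\<phi> a" "\<phi> b" "\<phi> ` J" "\<phi> \<circ> c" "\<phi> \<circ> e"])
      show "path_image (\<phi> \<circ> c) - \<phi> ` J \<subseteq> inside (\<phi> ` J)" "path_image (\<phi> \<circ> e) - \<phi> ` J \<subseteq> inside (\<phi> ` J)"
        using out ins by (auto simp: path_image_compose diff)
      show "chord (\<phi> \<circ> c) (\<phi> ` J)" "chord (\<phi> \<circ> e) (\<phi> ` J)"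
        using c(1) e(1) arcphi z0c by (auto simp: chord_def path_image_compose Int pathstart_compose pathfinish_compose)
      show "path_image (\<phi> \<circ> c) \<inter> path_image (\<phi> \<circ> e) = {}" using ce by (simp add: path_image_compose Int)
      show "path_image (\<phi> \<circ> c1) \<inter> path_image (\<phi> \<circ> c2) = {\<phi> a, \<phi> b}" using c12 by (simp add: path_image_compose Int)
      show "\<phi> ` J = path_image (\<phi> \<circ> c1) \<union> path_image (\<phi> \<circ> c2)" by (simp add: J path_image_compose image_Un)
    qed (use arcs arcphi z01 c1 c2 c e inj2 in \<open>auto simp: pathstart_compose pathfinish_compose path_image_compose\<close>)
  qed
qed

section \<open>K33 cannot be drawn by arcs\<close>

definition k33_arcs :: "(nat \<Rightarrow> complex) \<Rightarrow> (nat \<Rightarrow> complex) \<Rightarrow> (nat \<Rightarrow> nat \<Rightarrow> real \<Rightarrow> complex) \<Rightarrow> bool" where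
  "k33_arcs A B g \<longleftrightarrow> inj_on A {..<3} \<and> inj_on B {..<3} \<and>
     (\<forall>i<3. \<forall>j<3. arc (g i j) \<and> pathstart (g i j) = A i \<and> pathfinish (g i j) = B j) \<and>
     (\<forall>i<3. \<forall>j<3. \<forall>k<3. \<forall>l<3. (i, j) \<noteq> (k, l) \<longrightarrow>
        path_image (g i j) \<inter> path_image (g k l) \<subseteq> {A i, B j} \<inter> {A k, B l})"

text \<open>The cycle A0 B0 A1 B1 A2 B2. The three remaining edges \<open>g 0 1\<close>,
  \<open>g 1 2\<close>, \<open>g 2 0\<close> join opposite vertices, so the ends of any two of them
  alternate around it.\<close>

definition hexagon :: "(nat \<Rightarrow> nat \<Rightarrow> real \<Rightarrow> complex) \<Rightarrow> complex set" where
  "hexagon g = path_image (g 0 0) \<union> path_image (g 1 0) \<union> path_image (g 1 1) \<union>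
     path_image (g 2 1) \<union> path_image (g 2 2) \<union> path_image (g 0 2)"

lemma k33_arcs_sides:
  assumes K: "k33_arcs A B g"
  shows "(path_image (g 0 1) - hexagon g \<subseteq> inside (hexagon g)) \<noteq>
         (path_image (g 1 2) - hexagon g \<subseteq> inside (hexagon g))"
proof -
  have ar: "arc (g i j)" "pathstart (g i j) = A i" "pathfinish (g i j) = B j" if "i < 3" "j < 3" for i j
    using K that by (auto simp: k33_arcs_def)
  have injA: "A i = A j \<longleftrightarrow> i = j" and injB: "B i = B j \<longleftrightarrow> i = j" if "i < 3" "j < 3" for i j
    using K that by (auto simp: k33_arcs_def inj_on_def)
  have in1: "A i \<in> path_image (g i j)" "B j \<in> path_image (g i j)" if "i < 3" "j < 3" for i j
    using pathstart_in_path_image[of "g i j"] pathfinish_in_path_image[of "g i j"] ar[OF that] by auto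
  have AB: "A i \<noteq> B j" "B j \<noteq> A i" if "i < 3" "j < 3" for i j
    using arc_distinct_ends[OF ar(1)[OF that]] ar[OF that] by auto
  have int: "path_image (g i j) \<inter> path_image (g k l) = {A i, B j} \<inter> {A k, B l}"
    if "i < 3" "j < 3" "k < 3" "l < 3" "(i, j) \<noteq> (k, l)" for i j k l
  proof
    show "path_image (g i j) \<inter> path_image (g k l) \<subseteq> {A i, B j} \<inter> {A k, B l}"
      using K that by (simp add: k33_arcs_def)
    show "{A i, B j} \<inter> {A k, B l} \<subseteq> path_image (g i j) \<inter> path_image (g k l)"
      using in1[of i j] in1[of k l] that by auto
  qed
  have int': "path_image (g i j) \<inter> path_image (g k l) = (if i = k then {A i} else {}) \<union> (if j = l then {B j} else {})"
    if "i < 3" "j < 3" "k < 3" "l < 3" "(i, j) \<noteq> (k, l)" for i j k l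
    using int[OF that] injA[OF that(1,3)] injB[OF that(2,4)] AB that by auto
  \<comment> \<open>The halves of the hexagon between the ends of the chord \<open>g 0 1\<close>;
    the chord \<open>g 1 2\<close> runs from the first half to the second.\<close>
  define c1 where "c1 = (g 0 0 +++ reversepath (g 1 0)) +++ g 1 1"
  define c2 where "c2 = (g 0 2 +++ reversepath (g 2 2)) +++ g 2 1"
  have p1: "path_image c1 = path_image (g 0 0) \<union> path_image (g 1 0) \<union> path_image (g 1 1)"
    and p2: "path_image c2 = path_image (g 0 2) \<union> path_image (g 2 2) \<union> path_image (g 2 1)"
    by (auto simp: c1_def c2_def path_image_join ar)
  have a1: "arc c1" "arc c2"
    by (auto simp: c1_def c2_def arc_join_eq arc_reversepath ar path_image_join Int_Un_distrib2 int')
  have H: "hexagon g = path_image c1 \<union> path_image c2" by (auto simp: hexagon_def p1 p2)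
  have s1: "pathstart c1 = A 0" "pathfinish c1 = B 1" "pathstart c2 = A 0" "pathfinish c2 = B 1"
    by (simp_all add: c1_def c2_def ar)
  have c12: "path_image c1 \<inter> path_image c2 = {A 0, B 1}"
    by (auto simp: p1 p2 Int_Un_distrib2 Int_Un_distrib int')
  have ch: "chord (g 0 1) (hexagon g)" "chord (g 1 2) (hexagon g)"
    by (auto simp: chord_def hexagon_def ar Int_Un_distrib int')
  have e: "pathstart (g 1 2) \<in> path_image c1 - {A 0, B 1}" "pathfinish (g 1 2) \<in> path_image c2 - {A 0, B 1}"
    using in1[of 1 0] in1[of 2 2] by (auto simp: ar p1 p2 injA injB AB)
  have ce: "path_image (g 0 1) \<inter> path_image (g 1 2) = {}" by (simp add: int')
  have cl: "closed (hexagon g)" by (auto simp: hexagon_def intro!: closed_Un closed_path_image arc_imp_path ar)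
  have s: "pathstart (g 0 1) = A 0" "pathfinish (g 0 1) = B 1" by (simp_all add: ar)
  note cr = crossing_chords[OF a1 s1 c12 H ch(1) s ch(2) e ce]
  have "path_image (g 0 1) - hexagon g \<subseteq> inside (hexagon g) \<or> path_image (g 0 1) - hexagon g \<subseteq> outside (hexagon g)"
    "path_image (g 1 2) - hexagon g \<subseteq> inside (hexagon g) \<or> path_image (g 1 2) - hexagon g \<subseteq> outside (hexagon g)"
    using chord_side[OF cl] ch by auto
  then show ?thesis using cr by blast
qed

lemma k33_arcs_shift:
  assumes "k33_arcs A B g"
  shows "k33_arcs (\<lambda>i. A ((i + 1) mod 3)) (\<lambda>i. B ((i + 1) mod 3)) (\<lambda>i j. g ((i + 1) mod 3) ((j + 1) mod 3))"
proof -
  have inj: "i = j" if "i < 3" "j < 3" "(i + 1) mod 3 = (j + 1) mod 3" for i j :: nat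
    using that by presburger
  have lt: "(i + 1) mod 3 < 3" for i :: nat by simp
  have *: "path_image (g i j) \<inter> path_image (g k l) \<subseteq> {A i, B j} \<inter> {A k, B l}"
    if "i < 3" "j < 3" "k < 3" "l < 3" "(i, j) \<noteq> (k, l)" for i j k l
    using assms that by (simp add: k33_arcs_def)
  have injs: "inj_on (\<lambda>i::nat. (i + 1) mod 3) {..<3}" by (rule inj_onI, rule inj) auto
  have im: "(\<lambda>i::nat. (i + 1) mod 3) ` {..<3} \<subseteq> {..<3}" by auto
  have ar: "arc (g i j) \<and> pathstart (g i j) = A i \<and> pathfinish (g i j) = B j" if "i < 3" "j < 3" for i j
    using assms that by (simp add: k33_arcs_def)
  show ?thesis
    unfolding k33_arcs_def
  proof (intro conjI allI impI)
    show "inj_on (\<lambda>i. A ((i + 1) mod 3)) {..<3}" "inj_on (\<lambda>i. B ((i + 1) mod 3)) {..<3}"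
    proof -
      have "inj_on A {..<3}" "inj_on B {..<3}" using assms by (simp_all add: k33_arcs_def)
      then show "inj_on (\<lambda>i. A ((i + 1) mod 3)) {..<3}" "inj_on (\<lambda>i. B ((i + 1) mod 3)) {..<3}"
        using comp_inj_on[OF injs inj_on_subset[OF _ im]] unfolding comp_def by blast+
    qed
  next
    fix i j k l :: nat assume ij: "i < 3" "j < 3" "k < 3" "l < 3" "(i, j) \<noteq> (k, l)"
    then have "((i + 1) mod 3, (j + 1) mod 3) \<noteq> ((k + 1) mod 3, (l + 1) mod 3)" using inj by blast
    then show "path_image (g ((i + 1) mod 3) ((j + 1) mod 3)) \<inter> path_image (g ((k + 1) mod 3) ((l + 1) mod 3))
       \<subseteq> {A ((i + 1) mod 3), B ((j + 1) mod 3)} \<inter> {A ((k + 1) mod 3), B ((l + 1) mod 3)}"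
      by (intro *[OF lt lt lt lt])
  qed (use ar[OF lt lt] in simp_all)
qed

text \<open>The shift of indices preserves the hexagon and permutes its three chords cyclically.
  Hence the chords lie pairwise on different sides, of which there are only two.\<close>

lemma no_k33_arcs: "\<not> k33_arcs A B g"
proof
  assume K: "k33_arcs A B g"
  let ?s = "\<lambda>i::nat. (i + 1) mod 3"
  note K1 = k33_arcs_shift[OF K]
  note K2 = k33_arcs_shift[OF K1]
  have s: "(0 + 1) mod 3 = (1::nat)" "(1 + 1) mod 3 = (2::nat)" "(2 + 1) mod 3 = (0::nat)" by simp_all
  have h1: "hexagon (\<lambda>i j. g (?s i) (?s j)) = hexagon g" unfolding hexagon_def s by blast
  have h2: "hexagon (\<lambda>i j. g (?s (?s i)) (?s (?s j))) = hexagon g" unfolding hexagon_def s by blast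
  show False
    using k33_arcs_sides[OF K] k33_arcs_sides[OF K1, unfolded h1 s] k33_arcs_sides[OF K2, unfolded h2 s]
    by blast
qed

section \<open>Tripods in branch sets and the passage from a minor to a drawing\<close>

definition upath :: "'a set set \<Rightarrow> 'a list \<Rightarrow> bool" where
  "upath E xs \<longleftrightarrow> xs \<noteq> [] \<and> distinct xs \<and> successively (\<lambda>u v. {u, v} \<in> E) xs"

lemma upath_rev: "upath E xs \<Longrightarrow> upath E (rev xs)"
  by (simp add: upath_def insert_commute)

lemma upath_append:
  "upath E xs \<Longrightarrow> upath E ys \<Longrightarrow> set xs \<inter> set ys = {} \<Longrightarrow> {last xs, hd ys} \<in> E \<Longrightarrow> upath E (xs @ ys)"
  by (auto simp: upath_def successively_append_iff)

lemma upath_appendD: "upath E (xs @ ys) \<Longrightarrow> (xs \<noteq> [] \<longrightarrow> upath E xs) \<and> (ys \<noteq> [] \<longrightarrow> upath E ys)"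
  by (auto simp: upath_def successively_append_iff)

lemma upath_ends: "upath E xs \<Longrightarrow> hd xs \<in> set xs \<and> last xs \<in> set xs"
  by (simp add: upath_def)

lemma upath_prefix: "upath E (xs @ y # ys) \<Longrightarrow> upath E (xs @ [y])"
  using upath_appendD[of E "xs @ [y]" ys] by simp

lemma conn_upath:
  assumes S: "conn E S" and u: "u \<in> S" and v: "v \<in> S"
  obtains xs where "upath E xs" "hd xs = u" "last xs = v" "set xs \<subseteq> S"
proof -
  define X where "X = {w\<in>S. \<exists>xs. upath E xs \<and> hd xs = u \<and> last xs = w \<and> set xs \<subseteq> S}"
  have uX: "u \<in> X" using u by (auto simp: X_def upath_def intro!: exI[of _ "[u]"])
  have "X = S"
  proof (rule ccontr)
    assume "X \<noteq> S"
    moreover have "X \<subseteq> S" "X \<noteq> {}" using uX by (auto simp: X_def)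
    ultimately have "touch E X (S - X)" using S unfolding conn_def by blast
    then obtain x y where xy: "x \<in> X" "y \<in> S" "y \<notin> X" "{x, y} \<in> E" by (auto simp: touch_def)
    obtain xs where xs: "upath E xs" "hd xs = u" "last xs = x" "set xs \<subseteq> S" using xy(1) by (auto simp: X_def)
    have "\<exists>zs. upath E zs \<and> hd zs = u \<and> last zs = y \<and> set zs \<subseteq> S"
    proof (cases "y \<in> set xs")
      case True
      then obtain as bs where "xs = as @ y # bs" by (meson split_list)
      then show ?thesis using xs upath_prefix[of E as y bs]
        by (intro exI[of _ "as @ [y]"]) (auto simp: hd_append)
    next
      case False
      then show ?thesis using xs xy upath_append[of E xs "[y]"]
        by (intro exI[of _ "xs @ [y]"]) (auto simp: upath_def hd_append)
    qed
    then show False using xy by (auto simp: X_def)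
  qed
  then show ?thesis using v that by (auto simp: X_def)
qed

text \<open>Join two of the targets by a path and follow a path from the third until it meets this
  path; the meeting point is the centre. Three legs are enough because K33 is cubic, so that a K33
  minor yields a subdivision.\<close>

lemma conn_tripod:
  assumes S: "conn E S" and t: "\<And>i::nat. i < 3 \<Longrightarrow> t i \<in> S"
  obtains v P where "\<And>i::nat. i < 3 \<Longrightarrow> upath E (P i) \<and> hd (P i) = v \<and> last (P i) = t i \<and> set (P i) \<subseteq> S"
    "\<And>i j. i < 3 \<Longrightarrow> j < 3 \<Longrightarrow> i \<noteq> j \<Longrightarrow> set (P i) \<inter> set (P j) = {v}"
proof -
  obtain ps where ps: "upath E ps" "hd ps = t 0" "last ps = t 1" "set ps \<subseteq> S"
    using conn_upath[OF S t[of 0] t[of 1]] by auto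
  obtain qs where qs: "upath E qs" "hd qs = t 2" "last qs = t 0" "set qs \<subseteq> S"
    using conn_upath[OF S t[of 2] t[of 0]] by auto
  have "t 0 \<in> set ps \<inter> set qs" using upath_ends[OF ps(1)] upath_ends[OF qs(1)] ps qs by auto
  then have "\<exists>x\<in>set qs. x \<in> set ps" by auto
  then obtain as v bs where q: "qs = as @ v # bs" "v \<in> set ps" "\<forall>x\<in>set as. x \<notin> set ps"
    using split_list_first_prop[of qs "\<lambda>x. x \<in> set ps"] by blast
  obtain cs ds where p: "ps = cs @ v # ds" using q(2) by (meson split_list)
  define P where "P i = (if i = 0 then rev (cs @ [v]) else if i = 1 then v # ds else rev (as @ [v]))" for i :: nat
  have u: "upath E (rev (cs @ [v]))" "upath E (v # ds)" "upath E (rev (as @ [v]))"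
    using upath_rev upath_prefix[of E cs v ds] upath_prefix[of E as v bs] upath_appendD[of E cs "v # ds"] ps(1) qs(1) p q(1)
    by (blast, simp, blast)
  have "upath E (P i) \<and> hd (P i) = v \<and> last (P i) = t i \<and> set (P i) \<subseteq> S" if "i < 3" for i
  proof -
    have "i = 0 \<or> i = 1 \<or> i = 2" using that by linarith
    then show ?thesis using u ps qs p q
      by (elim disjE) (auto simp: P_def hd_append last_rev split: if_splits)
  qed
  moreover have "set (P i) \<inter> set (P j) = {v}" if "i < 3" "j < 3" "i \<noteq> j" for i j
  proof -
    have 01: "set (P 0) \<inter> set (P 1) = {v}" using ps(1) p by (auto simp: P_def upath_def)
    have 02: "set (P 0) \<inter> set (P 2) = {v}" using p q by (auto simp: P_def)
    have 12: "set (P 1) \<inter> set (P 2) = {v}" using p q by (auto simp: P_def)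
    have "i = 0 \<or> i = 1 \<or> i = 2" "j = 0 \<or> j = 1 \<or> j = 2" using that by linarith+
    then show ?thesis using 01 02 12 that(3) by (elim disjE) (simp_all add: Int_commute)
  qed
  ultimately show ?thesis using that by blast
qed

fun pe :: "'a list \<Rightarrow> 'a set set" where
  "pe (x # y # xs) = insert {x, y} (pe (y # xs))"
| "pe _ = {}"

lemma pe_sub: "e \<in> pe xs \<Longrightarrow> e \<subseteq> set xs"
  by (induction xs rule: pe.induct) auto

lemma pe_successively: "successively (\<lambda>u v. {u, v} \<in> E) xs \<Longrightarrow> pe xs \<subseteq> E"
  by (induction xs rule: pe.induct) auto

locale planar_drawing = fin_graph V E for V :: "'a set" and E +
  fixes p :: "'a \<Rightarrow> complex" and \<gamma> :: "'a set \<Rightarrow> real \<Rightarrow> complex"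
  assumes p_inj: "inj_on p V"
    and arc: "\<And>e. e \<in> E \<Longrightarrow> arc (\<gamma> e) \<and> {pathstart (\<gamma> e), pathfinish (\<gamma> e)} = p ` e"
    and disj: "\<And>e e'. e \<in> E \<Longrightarrow> e' \<in> E \<Longrightarrow> e \<noteq> e' \<Longrightarrow> path_image (\<gamma> e) \<inter> path_image (\<gamma> e') \<subseteq> p ` (e \<inter> e')"
begin

lemma pe_image_Int:
  assumes "pe xs \<subseteq> E" "pe ys \<subseteq> E" "card (set xs \<inter> set ys) \<le> 1"
  shows "(\<Union>e\<in>pe xs. path_image (\<gamma> e)) \<inter> (\<Union>e\<in>pe ys. path_image (\<gamma> e)) \<subseteq> p ` (set xs \<inter> set ys)"
proof
  fix z assume "z \<in> (\<Union>e\<in>pe xs. path_image (\<gamma> e)) \<inter> (\<Union>e\<in>pe ys. path_image (\<gamma> e))"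
  then obtain e e' where e: "e \<in> pe xs" "e' \<in> pe ys" "z \<in> path_image (\<gamma> e)" "z \<in> path_image (\<gamma> e')" by auto
  \<comment> \<open>A common edge would give the two lists two common vertices.\<close>
  have "e \<noteq> e'"
  proof
    assume "e = e'"
    then have "card e \<le> card (set xs \<inter> set ys)" using e pe_sub by (intro card_mono) auto
    then show False using assms e(1) edge by fastforce
  qed
  then have "z \<in> p ` (e \<inter> e')" using disj[of e e'] e assms by blast
  then show "z \<in> p ` (set xs \<inter> set ys)" using pe_sub[OF e(1)] pe_sub[OF e(2)] by blast
qed

lemma upath_arc:
  assumes "upath E xs" "hd xs \<noteq> last xs"
  shows "\<exists>g. arc g \<and> pathstart g = p (hd xs) \<and> pathfinish g = p (last xs) \<and>
           path_image g = (\<Union>e\<in>pe xs. path_image (\<gamma> e))"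
  using assms
proof (induction xs rule: induct_list012)
  case 1
  then show ?case by (simp add: upath_def)
next
  case (2 x)
  then show ?case by simp
next
  case (3 u v xs)
  have uv: "{u, v} \<in> E" and up: "upath E (v # xs)" and nin: "u \<notin> set (v # xs)"
    using 3(3) by (auto simp: upath_def)
  have A: "arc (\<gamma> {u, v})" "{pathstart (\<gamma> {u, v}), pathfinish (\<gamma> {u, v})} = {p u, p v}"
    using arc[OF uv] by auto
  define g0 where "g0 = (if pathstart (\<gamma> {u, v}) = p u then \<gamma> {u, v} else reversepath (\<gamma> {u, v}))"
  have g0: "arc g0" "pathstart g0 = p u" "pathfinish g0 = p v" "path_image g0 = path_image (\<gamma> {u, v})"
    using A arc_distinct_ends[OF A(1)] by (auto simp: g0_def arc_reversepath doubleton_eq_iff)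
  show ?case
  proof (cases xs)
    case Nil
    then show ?thesis using g0 by (intro exI[of _ g0]) auto
  next
    case (Cons w ys)
    have "hd (v # xs) \<noteq> last (v # xs)" using up Cons by (auto simp: upath_def)
    then obtain g where g: "arc g" "pathstart g = p v" "pathfinish g = p (last (v # xs))"
      "path_image g = (\<Union>e\<in>pe (v # xs). path_image (\<gamma> e))" using 3(2) up by auto
    have st: "pe [u, v] = {{u, v}}" by auto
    have s: "set [u, v] \<inter> set (v # xs) = {v}" using nin by auto
    have "pe (v # xs) \<subseteq> E" using up pe_successively by (auto simp: upath_def)
    then have "path_image g0 \<inter> path_image g \<subseteq> {p v}"
      using pe_image_Int[of "[u, v]" "v # xs"] uv unfolding st s g(4) g0(4) by simp
    then have "arc (g0 +++ g)" using g0 g by (intro arc_join) auto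
    then show ?thesis using g0 g
      by (intro exI[of _ "g0 +++ g"]) (auto simp: path_image_join)
  qed
qed

text \<open>In every branch set a tripod joins a centre to the ends of three edges that lead to the
  other side. Leg, edge and opposite leg make nine paths between the six centres; their arcs meet
  only at common centres and would draw K33.\<close>

lemma not_k33_minor: "\<not> k33_minor E V"
proof
  assume "k33_minor E V"
  then obtain A B :: "nat \<Rightarrow> 'a set" where AB:
    "\<forall>i<3. conn E (A i) \<and> A i \<subseteq> V \<and> conn E (B i) \<and> B i \<subseteq> V"
    "\<forall>i<3. \<forall>j<3. i \<noteq> j \<longrightarrow> A i \<inter> A j = {} \<and> B i \<inter> B j = {}"
    "\<forall>i<3. \<forall>j<3. A i \<inter> B j = {} \<and> touch E (A i) (B j)"
    unfolding k33_minor_def by (elim exE conjE)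
  have "\<forall>i j. \<exists>x y. i < 3 \<longrightarrow> j < 3 \<longrightarrow> x \<in> A i \<and> y \<in> B j \<and> {x, y} \<in> E"
    using AB(3) unfolding touch_def by metis
  then obtain s t where st: "\<And>i j. i < 3 \<Longrightarrow> j < 3 \<Longrightarrow> s i j \<in> A i \<and> t i j \<in> B j \<and> {s i j, t i j} \<in> E"
    by metis
  have "\<forall>i. \<exists>v P. i < 3 \<longrightarrow> (\<forall>j<3. upath E (P j) \<and> hd (P j) = v \<and> last (P j) = s i j \<and> set (P j) \<subseteq> A i) \<and>
     (\<forall>j<3. \<forall>k<3. j \<noteq> k \<longrightarrow> set (P j) \<inter> set (P k) = {v})"
  proof
    fix i
    show "\<exists>v P. i < 3 \<longrightarrow> (\<forall>j<3. upath E (P j) \<and> hd (P j) = v \<and> last (P j) = s i j \<and> set (P j) \<subseteq> A i) \<and>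
     (\<forall>j<3. \<forall>k<3. j \<noteq> k \<longrightarrow> set (P j) \<inter> set (P k) = {v})"
    proof (cases "i < 3")
      case True
      have c: "conn E (A i)" and m: "\<And>j. j < 3 \<Longrightarrow> s i j \<in> A i" using AB(1) True st by simp_all
      show ?thesis by (rule conn_tripod[OF c m]) (assumption, metis)
    qed auto
  qed
  then obtain a P where P: "\<And>i j. i < 3 \<Longrightarrow> j < 3 \<Longrightarrow> upath E (P i j) \<and> hd (P i j) = a i \<and> last (P i j) = s i j \<and> set (P i j) \<subseteq> A i"
    "\<And>i j k. i < 3 \<Longrightarrow> j < 3 \<Longrightarrow> k < 3 \<Longrightarrow> j \<noteq> k \<Longrightarrow> set (P i j) \<inter> set (P i k) = {a i}"
    by metis
  have "\<forall>j. \<exists>v Q. j < 3 \<longrightarrow> (\<forall>i<3. upath E (Q i) \<and> hd (Q i) = v \<and> last (Q i) = t i j \<and> set (Q i) \<subseteq> B j) \<and>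
     (\<forall>i<3. \<forall>k<3. i \<noteq> k \<longrightarrow> set (Q i) \<inter> set (Q k) = {v})"
  proof
    fix j
    show "\<exists>v Q. j < 3 \<longrightarrow> (\<forall>i<3. upath E (Q i) \<and> hd (Q i) = v \<and> last (Q i) = t i j \<and> set (Q i) \<subseteq> B j) \<and>
     (\<forall>i<3. \<forall>k<3. i \<noteq> k \<longrightarrow> set (Q i) \<inter> set (Q k) = {v})"
    proof (cases "j < 3")
      case True
      have c: "conn E (B j)" and m: "\<And>i. i < 3 \<Longrightarrow> t i j \<in> B j" using AB(1) True st by simp_all
      show ?thesis by (rule conn_tripod[OF c m]) (assumption, metis)
    qed auto
  qed
  then obtain b Q where Q: "\<And>i j. i < 3 \<Longrightarrow> j < 3 \<Longrightarrow> upath E (Q j i) \<and> hd (Q j i) = b j \<and> last (Q j i) = t i j \<and> set (Q j i) \<subseteq> B j"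
    "\<And>i j k. j < 3 \<Longrightarrow> i < 3 \<Longrightarrow> k < 3 \<Longrightarrow> i \<noteq> k \<Longrightarrow> set (Q j i) \<inter> set (Q j k) = {b j}"
    by metis
  define R where "R i j = P i j @ rev (Q j i)" for i j
  have aA: "a i \<in> A i" and bB: "b i \<in> B i" if "i < 3" for i
  proof -
    have "hd (P i 0) \<in> set (P i 0)" "hd (Q i 0) \<in> set (Q i 0)" using P(1)[of i 0] Q(1)[of 0 i] that upath_ends[of E "P i 0"] upath_ends[of E "Q i 0"] by simp_all
    then show "a i \<in> A i" "b i \<in> B i" using P(1)[of i 0] Q(1)[of 0 i] that by auto
  qed
  have dAA: "A i \<inter> A k = {}" and dBB: "B i \<inter> B k = {}" if "i < 3" "k < 3" "i \<noteq> k" for i k using AB(2) that by simp_all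
  have dAB: "A i \<inter> B k = {}" if "i < 3" "k < 3" for i k using AB(3) that by simp
  have R: "upath E (R i j)" "hd (R i j) = a i" "last (R i j) = b j" "hd (R i j) \<noteq> last (R i j)"
    if ij: "i < 3" "j < 3" for i j
  proof -
    have ne: "P i j \<noteq> []" "Q j i \<noteq> []" using P(1)[OF ij] Q(1)[OF ij] by (auto simp: upath_def)
    show "upath E (R i j)" unfolding R_def
    proof (rule upath_append)
      show "set (P i j) \<inter> set (rev (Q j i)) = {}" using P(1)[OF ij] Q(1)[OF ij] dAB[OF ij] by auto
      show "{last (P i j), hd (rev (Q j i))} \<in> E" using P(1)[OF ij] Q(1)[OF ij] st[OF ij] by (simp add: hd_rev)
    qed (use P(1)[OF ij] Q(1)[OF ij] upath_rev in auto)
    show 1: "hd (R i j) = a i" "last (R i j) = b j" using P(1)[OF ij] Q(1)[OF ij] ne by (simp_all add: R_def last_rev)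
    show "hd (R i j) \<noteq> last (R i j)" using 1 aA[OF ij(1)] bB[OF ij(2)] dAB[OF ij] by auto
  qed
  have RI: "set (R i j) \<inter> set (R k l) \<subseteq> (if i = k then {a i} else if j = l then {b j} else {})"
    if ij: "i < 3" "j < 3" "k < 3" "l < 3" "(i, j) \<noteq> (k, l)" for i j k l
  proof -
    have PP: "set (P i j) \<inter> set (P k l) \<subseteq> (if i = k then {a i} else {})"
      using P(1)[OF ij(1,2)] P(1)[OF ij(3,4)] P(2)[of i j l] dAA[OF ij(1,3)] ij by auto
    have QQ: "set (Q j i) \<inter> set (Q l k) \<subseteq> (if j = l then {b j} else {})"
      using Q(1)[OF ij(1,2)] Q(1)[OF ij(3,4)] Q(2)[of j i k] dBB[OF ij(2,4)] ij by auto
    have PQ: "set (P i j) \<inter> set (Q l k) = {}" "set (Q j i) \<inter> set (P k l) = {}"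
      using P(1)[OF ij(1,2)] Q(1)[OF ij(3,4)] P(1)[OF ij(3,4)] Q(1)[OF ij(1,2)] dAB[OF ij(1,4)] dAB[OF ij(3,2)] by blast+
    have "set (R i j) = set (P i j) \<union> set (Q j i)" "set (R k l) = set (P k l) \<union> set (Q l k)" by (simp_all add: R_def)
    then have "set (R i j) \<inter> set (R k l) \<subseteq> (if i = k then {a i} else {}) \<union> (if j = l then {b j} else {})"
      using PP QQ PQ by blast
    then show ?thesis using ij(5) by (auto split: if_splits)
  qed
  have stE: "pe (R i j) \<subseteq> E" if "i < 3" "j < 3" for i j using R(1)[OF that] pe_successively by (auto simp: upath_def)
  have "\<forall>i j. \<exists>g. i < 3 \<longrightarrow> j < 3 \<longrightarrow> arc g \<and> pathstart g = p (a i) \<and> pathfinish g = p (b j) \<and>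
           path_image g = (\<Union>e\<in>pe (R i j). path_image (\<gamma> e))"
    using upath_arc[OF R(1) R(4)] R(2,3) by metis
  then obtain g where g: "\<And>i j. i < 3 \<Longrightarrow> j < 3 \<Longrightarrow> arc (g i j) \<and> pathstart (g i j) = p (a i) \<and> pathfinish (g i j) = p (b j) \<and>
           path_image (g i j) = (\<Union>e\<in>pe (R i j). path_image (\<gamma> e))" by metis
  have "k33_arcs (\<lambda>i. p (a i)) (\<lambda>i. p (b i)) g"
    unfolding k33_arcs_def
  proof (intro conjI allI impI)
    have "inj_on a {..<3}" by (rule inj_onI) (use aA dAA in \<open>metis disjoint_iff lessThan_iff\<close>)
    moreover have "a ` {..<3} \<subseteq> V" using aA AB(1) by auto
    ultimately show "inj_on (\<lambda>i. p (a i)) {..<3}" using comp_inj_on[of a "{..<3}" p] inj_on_subset[OF p_inj] by (simp add: comp_def)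
    have "inj_on b {..<3}" by (rule inj_onI) (use bB dBB in \<open>metis disjoint_iff lessThan_iff\<close>)
    moreover have "b ` {..<3} \<subseteq> V" using bB AB(1) by auto
    ultimately show "inj_on (\<lambda>i. p (b i)) {..<3}" using comp_inj_on[of b "{..<3}" p] inj_on_subset[OF p_inj] by (simp add: comp_def)
  next
    fix i j k l :: nat assume ij: "i < 3" "j < 3" "k < 3" "l < 3" "(i, j) \<noteq> (k, l)"
    have "set (R i j) \<inter> set (R k l) \<subseteq> {a i} \<or> set (R i j) \<inter> set (R k l) \<subseteq> {b j}"
      using RI[OF ij] by (auto split: if_splits)
    then have "card (set (R i j) \<inter> set (R k l)) \<le> 1"
      by (elim disjE) (metis One_nat_def card.empty card_mono card_insert_if empty_iff finite.emptyI finite_insert)+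
    then have "path_image (g i j) \<inter> path_image (g k l) \<subseteq> p ` (set (R i j) \<inter> set (R k l))"
      using pe_image_Int[OF stE[OF ij(1,2)] stE[OF ij(3,4)]] g[OF ij(1,2)] g[OF ij(3,4)] by simp
    also have "\<dots> \<subseteq> p ` (if i = k then {a i} else if j = l then {b j} else {})" using RI[OF ij] by (rule image_mono)
    also have "\<dots> \<subseteq> {p (a i), p (b j)} \<inter> {p (a k), p (b l)}" by auto
    finally show "path_image (g i j) \<inter> path_image (g k l) \<subseteq> {p (a i), p (b j)} \<inter> {p (a k), p (b l)}" .
  qed (use g in auto)
  then show False using no_k33_arcs by simp
qed

end

lemma planar_k33_free:
  assumes "simple_graph (V, E)" "planar (V, E)"
  shows "k33_free V E"
proof -
  interpret fin_graph V E using assms(1) by unfold_locales (auto simp: simple_graph_def)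
  obtain p :: "'a \<Rightarrow> complex" and \<gamma> where pg: "inj_on p V"
    "\<forall>e\<in>E. arc (\<gamma> e) \<and> {pathstart (\<gamma> e), pathfinish (\<gamma> e)} = p ` e \<and> path_image (\<gamma> e) \<inter> p ` V = p ` e"
    "\<forall>e\<in>E. \<forall>e'\<in>E. e \<noteq> e' \<longrightarrow> path_image (\<gamma> e) \<inter> path_image (\<gamma> e') \<subseteq> p ` (e \<inter> e')"
    using assms(2) unfolding planar_def fst_conv snd_conv by (elim exE conjE)
  interpret planar_drawing V E p \<gamma>
    by unfold_locales (use pg in simp_all)
  show ?thesis by unfold_locales (rule not_k33_minor)
qed

section \<open>Pairs of hubs and their common neighbourhoods\<close>

lemma three_distinct:
  assumes "\<not> card (S :: 'b set) \<le> 2" "finite S"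
  obtains q :: "nat \<Rightarrow> 'b" where "\<And>i. i < 3 \<Longrightarrow> q i \<in> S" "inj_on q {..<3}"
proof -
  have "3 \<le> card S" using assms by simp
  then obtain T where T: "T \<subseteq> S" "card T = 3" by (meson obtain_subset_with_card_n)
  have "finite T" using T assms finite_subset by auto
  then obtain q where "bij_betw q {0..<(3::nat)} T" using ex_bij_betw_nat_finite[of T] T by auto
  then show ?thesis using T by (intro that[of q]) (auto simp: bij_betw_def atLeast0LessThan)
qed

lemma card_pairs_le:
  assumes "finite P" "finite Q" "G \<subseteq> P \<times> Q" "\<And>p. p \<in> P \<Longrightarrow> card {q. (p, q) \<in> G} \<le> k"
  shows "card G \<le> k * card P"
proof -
  have fin: "finite {q. (p, q) \<in> G}" for p
    by (rule finite_subset[OF _ assms(2)]) (use assms(3) in auto)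
  have "G = (SIGMA p:P. {q. (p, q) \<in> G})" using assms(3) by auto
  then have "card G = (\<Sum>p\<in>P. card {q. (p, q) \<in> G})" using card_SigmaI[OF assms(1), of "\<lambda>p. {q. (p, q) \<in> G}"] fin by simp
  also have "\<dots> \<le> (\<Sum>p\<in>P. k)" using assms(4) by (rule sum_mono)
  finally show ?thesis by (simp add: mult.commute)
qed

text \<open>\<open>B\<close> is meant for the vertices of large degree, and \<open>X\<close> for
  \<open>B\<close> together with the vertices having three neighbours in \<open>B\<close>; the last
  assumption holds by that choice. \<open>r\<close> is the degeneracy rank.\<close>

locale hubs = k33_free V E for V :: "'a set" and E +
  fixes X B :: "'a set" and r :: "'a \<Rightarrow> nat"
  assumes X: "X \<subseteq> V" and BX: "B \<subseteq> X" and B2: "\<And>v. v \<in> V - X \<Longrightarrow> card (nb E B v) \<le> 2"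
begin

lemma finX: "finite X" using X by (rule finite_sub)
lemma finB: "finite B" using BX finX finite_subset by blast

text \<open>An edge of a cycle whose ends are not hubs joins a neighbour x of a hub a to a neighbour t of a
  hub b. The weight z1 charges such pairs to the vertices x that have no other hub than a as a
  neighbour; the pairs for which this fails are controlled by nn.\<close>

definition cl :: "'a set \<Rightarrow> 'a set" where "cl S = {v\<in>V - X. nb E X v = S}"

definition adherent :: "'a \<Rightarrow> 'a \<Rightarrow> 'a set" where
  "adherent a b = {x\<in>cl {a}. \<exists>t\<in>cl {b} \<union> cl {a, b}. {x, t} \<in> E}"

definition remote :: "'a \<Rightarrow> 'a \<Rightarrow> 'a set" where
  "remote a b = {x\<in>cl {a} - bad X. \<exists>t\<in>V - X. {x, t} \<in> E \<and> 2 \<le> card (nb E X t - {a}) \<and> b \<in> nb E X t \<and> b \<in> B \<and> a \<noteq> b}"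

definition nn :: "'a \<Rightarrow> 'a \<Rightarrow> real" where "nn a b = (if a = b then 0 else real (card (cl {a, b})))"

text \<open>A vertex outside \<open>X\<close> can have many neighbours in \<open>X\<close> but at
  most two in \<open>B\<close>. Hence the restriction to \<open>B\<close> and the factor 1/2, with
  which a remote vertex is charged at most 1 in total.\<close>

definition z1 :: "'a \<Rightarrow> 'a \<Rightarrow> real" where
  "z1 a b = (if a \<in> B \<and> b \<in> B \<and> a \<noteq> b then real (card (adherent a b - bad X)) + real (card (remote a b)) / 2 else 0)"

definition zz :: "'a \<Rightarrow> 'a \<Rightarrow> real" where "zz a b = z1 a b + z1 b a"

text \<open>The pairs that can fill the irregular place of a cycle between the hubs \<open>a\<close>
  and \<open>b\<close>: x is the last peak and t the non-hub after it. The rank condition lets an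
  edge be used in one direction only.\<close>

definition links :: "'a \<Rightarrow> 'a \<Rightarrow> ('a \<times> 'a) set" where
  "links a b = {(x, t). x \<in> V - X - bad X \<and> t \<in> V - X \<and> {x, t} \<in> E \<and> r t < r x \<and> a \<in> nb E X x \<and> b \<in> nb E X t}"

lemma fin_cl: "finite (cl S)" using finV by (simp add: cl_def)
lemma fin_adh: "finite (adherent a b)" using fin_cl by (simp add: adherent_def)
lemma fin_rem: "finite (remote a b)" using fin_cl by (simp add: remote_def)
lemma fin_bad: "finite (bad X)" using bad_subset[of X] finV finite_subset by blast

lemma cl_adj: "v \<in> cl S \<Longrightarrow> s \<in> S \<Longrightarrow> {s, v} \<in> E \<and> s \<in> X"
  by (auto simp: cl_def nb_def)

text \<open>Three common neighbours of a, b and v would be a K33.\<close>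

lemma deg_in_class:
  assumes v: "v \<in> V - X" and ab: "a \<noteq> b"
  shows "card {q\<in>cl {a, b}. {v, q} \<in> E} \<le> 2"
proof (rule ccontr)
  let ?S = "{q\<in>cl {a, b}. {v, q} \<in> E}"
  assume "\<not> ?thesis"
  moreover have "finite ?S" using fin_cl by simp
  ultimately obtain q where q: "\<And>i::nat. i < 3 \<Longrightarrow> q i \<in> ?S" "inj_on q {..<3}"
    by (rule three_distinct) blast
  have c: "q i \<in> cl {a, b}" "{v, q i} \<in> E" "q i \<noteq> v" if "i < 3" for i
    using q(1)[OF that] adj_neq[of v "q i"] by auto
  have aX: "a \<in> X" "b \<in> X" using cl_adj[OF c(1)[of 0]] by auto
  define A where "A i = (if i = 0 then {a} else if i = 1 then {b} else {v})" for i :: nat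
  have "k33_minor E V"
  proof (rule k33_minorI[of E A V "\<lambda>i. {q i}"])
    fix i j :: nat assume ij: "i < 3" "j < 3"
    have "q j \<notin> X" using c(1)[OF ij(2)] by (auto simp: cl_def)
    then show "A i \<inter> {q j} = {} \<and> touch E (A i) {q j}"
      using c[OF ij(2)] cl_adj[OF c(1)[OF ij(2)]] aX by (auto simp: A_def touch_def)
    assume "i \<noteq> j"
    then show "A i \<inter> A j = {} \<and> {q i} \<inter> {q j} = {}"
      using q(2) ij ab aX v by (auto simp: A_def inj_on_def split: if_splits)
  qed (use aX X v c in \<open>auto simp: A_def cl_def\<close>)
  then show False using k33 by simp
qed

text \<open>Three such q would all be joined to \<open>p\<close>, to \<open>b\<close> and, through
  their further neighbours x, to the star around \<open>a\<close>. Contracting this star gives a K33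
  minor.\<close>

lemma deg_thick:
  assumes p: "p \<in> cl {a}" and ab: "a \<noteq> b"
  shows "card {q\<in>cl {b}. {p, q} \<in> E \<and> (\<exists>x\<in>cl {a}. x \<noteq> p \<and> {x, q} \<in> E)} \<le> 2"
proof (rule ccontr)
  let ?S = "{q\<in>cl {b}. {p, q} \<in> E \<and> (\<exists>x\<in>cl {a}. x \<noteq> p \<and> {x, q} \<in> E)}"
  assume "\<not> ?thesis"
  moreover have "finite ?S" using fin_cl by simp
  ultimately obtain q where q: "\<And>i::nat. i < 3 \<Longrightarrow> q i \<in> ?S" "inj_on q {..<3}"
    by (rule three_distinct) blast
  have "\<exists>x. i < 3 \<longrightarrow> x \<in> cl {a} \<and> x \<noteq> p \<and> {x, q i} \<in> E" for i using q(1)[of i] by auto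
  then obtain x where x: "\<And>i. i < 3 \<Longrightarrow> x i \<in> cl {a} \<and> x i \<noteq> p \<and> {x i, q i} \<in> E" by metis
  have aX: "a \<in> X" "b \<in> X" using cl_adj[OF p] q(1)[of 0] cl_adj by auto
  have pX: "p \<in> V - X" using p by (simp add: cl_def)
  define A where "A i = (if i = 0 then {p} else if i = 1 then {b} else {a, x 0, x 1, x 2})" for i :: nat
  have xX: "x i \<in> V - X" if "i < 3" for i using x[OF that] by (auto simp: cl_def)
  have cA: "conn E {a, x 0, x 1, x 2}"
  proof -
    have e: "{a, x i} \<in> E" if "i < 3" for i using cl_adj[of "x i" "{a}" a] x[OF that] by auto
    have "conn E (insert (x 0) {a})" by (rule conn_insert[of E "{a}" a]) (use e[of 0] in auto)
    then have "conn E (insert (x 1) (insert (x 0) {a}))"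
      by (rule conn_insert[of E "insert (x 0) {a}" a]) (use e[of 1] in auto)
    then have "conn E (insert (x 2) (insert (x 1) (insert (x 0) {a})))"
      by (rule conn_insert[of E "insert (x 1) (insert (x 0) {a})" a]) (use e[of 2] in auto)
    then show ?thesis by (simp add: insert_commute)
  qed
  have "k33_minor E V"
  proof (rule k33_minorI[of E A V "\<lambda>i. {q i}"])
    fix i j :: nat assume ij: "i < 3" "j < 3"
    have qj: "q j \<in> V - X" "{b, q j} \<in> E" "{p, q j} \<in> E" "q j \<noteq> p" "nb E X (q j) = {b}"
      using q(1)[OF ij(2)] cl_adj[of "q j" "{b}" b] adj_neq[of p "q j"] by (auto simp: cl_def)
    have "q j \<noteq> x l" if "l < 3" for l using x[OF that] qj(5) ab by (auto simp: cl_def)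
    moreover have "x j = x 0 \<or> x j = x 1 \<or> x j = x 2"
    proof -
      have "j = 0 \<or> j = 1 \<or> j = 2" using ij(2) by linarith
      then show ?thesis by auto
    qed
    then have "touch E {a, x 0, x 1, x 2} {q j}" using x[OF ij(2)] by (auto simp: touch_def)
    ultimately show "A i \<inter> {q j} = {} \<and> touch E (A i) {q j}"
      using qj aX by (auto simp: A_def touch_def)
    assume "i \<noteq> j"
    have d: "x l \<noteq> p" "x l \<noteq> b" if "l < 3" for l using x[OF that] xX[OF that] aX by auto
    have "{a, x 0, x 1, x 2} \<inter> {p} = {}" "{a, x 0, x 1, x 2} \<inter> {b} = {}" "{p} \<inter> {b} = {}"
      using d[of 0] d[of 1] d[of 2] ab aX pX by auto
    then show "A i \<inter> A j = {} \<and> {q i} \<inter> {q j} = {}"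
      using q(2) ij \<open>i \<noteq> j\<close> by (auto simp: A_def inj_on_def split: if_splits)
  next
    fix i :: nat assume "i < 3"
    show "conn E (A i) \<and> A i \<subseteq> V" using cA pX aX X xX[of 0] xX[of 1] xX[of 2] by (auto simp: A_def)
  qed (use q(1) in \<open>auto simp: cl_def\<close>)
  then show False using k33 by simp
qed

lemma card_class_pairs:
  assumes ab: "a \<noteq> b"
  shows "card {(p, q). p \<in> cl {a, b} \<and> q \<in> cl {a, b} \<and> {p, q} \<in> E} \<le> 2 * card (cl {a, b})"
proof (rule card_pairs_le[of _ "cl {a, b}"])
  fix p assume "p \<in> cl {a, b}"
  then have "card {q\<in>cl {a, b}. {p, q} \<in> E} \<le> 2" by (intro deg_in_class ab) (auto simp: cl_def)
  then show "card {q. (p, q) \<in> {(p, q). p \<in> cl {a, b} \<and> q \<in> cl {a, b} \<and> {p, q} \<in> E}} \<le> 2"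
    using \<open>p \<in> cl {a, b}\<close> by simp
qed (use fin_cl in auto)

lemma card_adherent_pairs:
  assumes ab: "a \<noteq> b"
  shows "card {(p, q). p \<in> cl {a} \<and> q \<in> cl {a, b} \<and> {p, q} \<in> E} \<le> 2 * card (adherent a b)"
proof (rule card_pairs_le[of _ "cl {a, b}"])
  show "{(p, q). p \<in> cl {a} \<and> q \<in> cl {a, b} \<and> {p, q} \<in> E} \<subseteq> adherent a b \<times> cl {a, b}"
    by (auto simp: adherent_def)
  fix p assume "p \<in> adherent a b"
  then have "p \<in> V - X" "p \<in> cl {a}" by (auto simp: adherent_def cl_def)
  then show "card {q. (p, q) \<in> {(p, q). p \<in> cl {a} \<and> q \<in> cl {a, b} \<and> {p, q} \<in> E}} \<le> 2"
    using deg_in_class[OF _ ab, of p] by simp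
qed (use fin_cl fin_adh in auto)

text \<open>Charge an edge to its end in the class of b if that end has no other neighbour in the class
  of a, and to its other end otherwise.\<close>

lemma card_cross_pairs:
  assumes ab: "a \<noteq> b"
  shows "card {(p, q). p \<in> cl {a} \<and> q \<in> cl {b} \<and> {p, q} \<in> E} \<le> 2 * card (adherent a b) + card (adherent b a)"
proof -
  define thick where "thick = {(p, q). p \<in> cl {a} \<and> q \<in> cl {b} \<and> {p, q} \<in> E \<and> (\<exists>x\<in>cl {a}. x \<noteq> p \<and> {x, q} \<in> E)}"
  define thin where "thin = {(p, q). p \<in> cl {a} \<and> q \<in> cl {b} \<and> {p, q} \<in> E \<and> \<not> (\<exists>x\<in>cl {a}. x \<noteq> p \<and> {x, q} \<in> E)}"
  have fin: "finite thick" "finite thin"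
    by (rule finite_subset[of _ "cl {a} \<times> cl {b}"]; use fin_cl in \<open>auto simp: thick_def thin_def\<close>)+
  have "card thick \<le> 2 * card (adherent a b)"
  proof (rule card_pairs_le[of _ "cl {b}"])
    show "thick \<subseteq> adherent a b \<times> cl {b}" by (auto simp: thick_def adherent_def)
    fix p assume "p \<in> adherent a b"
    then show "card {q. (p, q) \<in> thick} \<le> 2" using deg_thick[OF _ ab, of p] by (simp add: thick_def adherent_def)
  qed (use fin_cl fin_adh in auto)
  moreover have "card thin \<le> card (adherent b a)"
  proof (rule card_inj_on_le)
    show "inj_on snd thin" by (auto simp: inj_on_def thin_def)
    show "snd ` thin \<subseteq> adherent b a"
    proof
      fix y assume "y \<in> snd ` thin"
      then obtain p where "p \<in> cl {a}" "y \<in> cl {b}" "{y, p} \<in> E" by (auto simp: thin_def insert_commute)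
      then show "y \<in> adherent b a" by (auto simp: adherent_def)
    qed
  qed (rule fin_adh)
  moreover have "{(p, q). p \<in> cl {a} \<and> q \<in> cl {b} \<and> {p, q} \<in> E} \<subseteq> thick \<union> thin" by (auto simp: thick_def thin_def)
  then have "card {(p, q). p \<in> cl {a} \<and> q \<in> cl {b} \<and> {p, q} \<in> E} \<le> card (thick \<union> thin)" using fin by (intro card_mono) auto
  ultimately show ?thesis using card_Un_le[of thick thin] by linarith
qed

lemma not_bad_class:
  assumes "x \<in> V - X" "x \<notin> bad X" "a \<in> nb E X x"
  shows "nb E X x = {a} \<or> (\<exists>c. c \<noteq> a \<and> nb E X x = {a, c})"
proof -
  have "card (nb E X x) \<le> 2" using assms by (auto simp: bad_def bad0_def)
  moreover have "card (nb E X x) = Suc (card (nb E X x - {a}))" using assms finite_nb by (metis card_Suc_Diff1)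
  ultimately have "card (nb E X x - {a}) \<le> 1" by simp
  then consider "nb E X x - {a} = {}" | c where "nb E X x - {a} = {c}"
    using finite_nb[of X x] by (metis card_0_eq card_1_singletonE finite_Diff le_Suc_eq le_zero_eq One_nat_def)
  then show ?thesis
  proof cases
    case 1
    then show ?thesis using assms(3) by auto
  next
    case 2
    then have "nb E X x = {a, c}" "c \<noteq> a" using assms(3) by auto
    then show ?thesis by auto
  qed
qed

text \<open>A further hub at \<open>t\<close> would be the third end of a fan at \<open>x\<close> of
  the kind excluded by \<open>bad1\<close>.\<close>

lemma not_bad_two:
  assumes "x \<in> V - X" "x \<notin> bad X" "nb E X x = {a, c}" "a \<noteq> c" "t \<in> V - X" "{x, t} \<in> E"
  shows "nb E X t \<subseteq> {a, c}"
proof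
  fix e assume e: "e \<in> nb E X t"
  show "e \<in> {a, c}"
  proof (rule ccontr)
    assume "e \<notin> {a, c}"
    then have "e \<noteq> a" "e \<noteq> c" by auto
    moreover have "t \<in> nb E (V - X) x" using assms(5,6) by (simp add: nb_def insert_commute)
    moreover have "a \<in> nb E X x" "c \<in> nb E X x" using assms(3) by simp_all
    ultimately have "x \<in> bad1 X" unfolding bad1_def using assms(1,4) e by blast
    then show False using assms(2) by (simp add: bad_def)
  qed
qed

text \<open>Otherwise \<open>x\<close> would be the centre of a fan with the ends \<open>a\<close>,
  \<open>b\<close>, \<open>c\<close> and two legs of length two, as excluded by
  \<open>bad2\<close>.\<close>

lemma not_bad_one:
  assumes "x \<in> V - X" "x \<notin> bad X" "a \<in> nb E X x" "t \<in> V - X" "{x, t} \<in> E" "s \<in> V - X" "{x, s} \<in> E" "s \<noteq> t"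
    "b \<in> nb E X t" "c \<in> nb E X s" "b \<noteq> a" "c \<noteq> a"
  shows "b = c"
proof (rule ccontr)
  assume "b \<noteq> c"
  moreover have "t \<in> nb E (V - X) x" "s \<in> nb E (V - X) x" using assms(4-7) by (simp_all add: nb_def insert_commute)
  ultimately have "x \<in> bad2 X" unfolding bad2_def using assms(1,3,8-12) by blast
  then show False using assms(2) by (simp add: bad_def)
qed

text \<open>\<open>t\<close> sees two hubs other than \<open>a\<close>, so one of them also differs
  from \<open>c\<close>; if \<open>s\<close> and \<open>t\<close> were different,
  \<open>not_bad_one\<close> would identify it with \<open>c\<close>.\<close>

lemma remote_unique:
  assumes "x \<in> cl {a} - bad X" "t \<in> V - X" "{x, t} \<in> E" "2 \<le> card (nb E X t - {a})"
    "s \<in> V - X" "{x, s} \<in> E" "c \<in> nb E X s" "c \<noteq> a"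
  shows "s = t"
proof (rule ccontr)
  assume st: "s \<noteq> t"
  have "finite (nb E X t - {a})" using finite_nb by simp
  have "\<exists>b\<in>nb E X t - {a}. b \<noteq> c"
  proof (rule ccontr)
    assume "\<not> ?thesis"
    then have "nb E X t - {a} \<subseteq> {c}" by auto
    then have "card (nb E X t - {a}) \<le> card {c}" by (intro card_mono) auto
    then show False using assms(4) by simp
  qed
  then obtain b where "b \<in> nb E X t" "b \<noteq> a" "b \<noteq> c" by auto
  then show False using not_bad_one[of x a t s b c] assms st by (auto simp: cl_def)
qed

text \<open>As x is not bad, either both ends of a link see no hubs but \<open>a\<close> and
  \<open>b\<close>, or x is remote. The edges inside the class of \<open>{a, b}\<close> give the
  term with \<open>nn\<close>, two ordered pairs for each vertex. The coefficient of
  \<open>zz\<close> may be twice that of \<open>nn\<close>, since \<open>Ssum_add_ge\<close>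
  collects \<open>zz\<close> twice.\<close>

lemma card_links:
  assumes ab: "a \<in> B" "b \<in> B" "a \<noteq> b"
  shows "real (card (links a b)) + real (card (links b a)) \<le> 2 * nn a b + 4 * zz a b + 8 * real (card (bad X))"
proof -
  define CC where "CC = {(p, q). p \<in> cl {a, b} \<and> q \<in> cl {a, b} \<and> {p, q} \<in> E}"
  define AC where "AC = {(p, q). p \<in> cl {a} \<and> q \<in> cl {a, b} \<and> {p, q} \<in> E}"
  define BC where "BC = {(p, q). p \<in> cl {b} \<and> q \<in> cl {b, a} \<and> {p, q} \<in> E}"
  define AB where "AB = {(p, q). p \<in> cl {a} \<and> q \<in> cl {b} \<and> {p, q} \<in> E}"
  define U where "U a b = {(p, q). p \<in> remote a b \<and> q \<in> V - X \<and> {p, q} \<in> E \<and> 2 \<le> card (nb E X q - {a}) \<and> b \<in> nb E X q}" for a b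
  have fin: "finite CC" "finite AC" "finite BC" "finite AB" "finite (U p q)" for p q
    by (rule finite_subset[of _ "V \<times> V"]; use finV in \<open>auto simp: CC_def AC_def BC_def AB_def U_def cl_def remote_def\<close>)+
  have finL: "finite (links p q)" for p q
    by (rule finite_subset[of _ "V \<times> V"]) (use finV in \<open>auto simp: links_def\<close>)
  have Ucard: "card (U p q) \<le> card (remote p q)" if "p \<noteq> q" for p q
  proof (rule card_inj_on_le)
    show "inj_on fst (U p q)"
    proof (rule inj_onI)
      fix g h assume gh: "g \<in> U p q" "h \<in> U p q" "fst g = fst h"
      then have "snd h = snd g"
        using remote_unique[of "fst g" p "snd g" "snd h" q] that by (auto simp: U_def remote_def)
      then show "g = h" using gh by (simp add: prod_eq_iff)
    qed
  qed (use fin_rem in \<open>auto simp: U_def\<close>)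
  have main: "(p, q) \<in> CC \<union> AC \<union> AB \<union> prod.swap ` BC \<union> U a b"
    if pq: "(p, q) \<in> links a b" and ab: "a \<in> B" "b \<in> B" "a \<noteq> b"
      and defs: "CC = {(p, q). p \<in> cl {a, b} \<and> q \<in> cl {a, b} \<and> {p, q} \<in> E}"
       "AC = {(p, q). p \<in> cl {a} \<and> q \<in> cl {a, b} \<and> {p, q} \<in> E}"
       "BC = {(p, q). p \<in> cl {b} \<and> q \<in> cl {b, a} \<and> {p, q} \<in> E}"
       "AB = {(p, q). p \<in> cl {a} \<and> q \<in> cl {b} \<and> {p, q} \<in> E}" for p q a b CC AC BC AB
  proof -
    have p: "p \<in> V - X" "p \<notin> bad X" "q \<in> V - X" "{p, q} \<in> E" "a \<in> nb E X p" "b \<in> nb E X q"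
      using pq by (auto simp: links_def)
    from not_bad_class[OF p(1,2,5)] show ?thesis
    proof (elim disjE exE conjE)
      assume pa: "nb E X p = {a}"
      show ?thesis
      proof (cases "2 \<le> card (nb E X q - {a})")
        case True
        then have "p \<in> remote a b" using p pa ab by (auto simp: remote_def cl_def)
        then show ?thesis using True p by (auto simp: U_def)
      next
        case False
        then have "card (nb E X q - {a}) \<le> 1" by simp
        moreover have "b \<in> nb E X q - {a}" using p ab by auto
        ultimately have "nb E X q - {a} = {b}"
          using card_seteq[of "nb E X q - {a}" "{b}"] finite_nb[of X q] by simp
        then have "nb E X q = {b} \<or> nb E X q = {a, b}" by auto
        then show ?thesis using p pa by (auto simp: defs cl_def)
      qed
    next
      fix c assume c: "c \<noteq> a" "nb E X p = {a, c}"
      have sub: "nb E X q \<subseteq> {a, c}" using not_bad_two[OF p(1,2) c(2) _ p(3,4)] c by auto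
      then have "b = c" using p(6) ab by auto
      then have "nb E X q = {b} \<or> nb E X q = {a, b}" using sub p(6) by auto
      then show ?thesis using p c \<open>b = c\<close>
        by (auto simp: defs cl_def insert_commute image_iff)
    qed
  qed
  have sub1: "links a b \<subseteq> CC \<union> AC \<union> AB \<union> prod.swap ` BC \<union> U a b"
  proof
    fix g assume g: "g \<in> links a b"
    obtain p q where pq: "g = (p, q)" by (cases g)
    show "g \<in> CC \<union> AC \<union> AB \<union> prod.swap ` BC \<union> U a b"
      unfolding pq by (rule main[OF g[unfolded pq] ab CC_def AC_def BC_def AB_def])
  qed
  have sub2: "links b a \<subseteq> CC \<union> BC \<union> prod.swap ` AB \<union> prod.swap ` AC \<union> U b a"
  proof
    fix g assume g: "g \<in> links b a"
    obtain p q where pq: "g = (p, q)" by (cases g)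
    have CC': "CC = {(p, q). p \<in> cl {b, a} \<and> q \<in> cl {b, a} \<and> {p, q} \<in> E}" by (simp add: CC_def insert_commute)
    have AB': "prod.swap ` AB = {(p, q). p \<in> cl {b} \<and> q \<in> cl {a} \<and> {p, q} \<in> E}"
      by (auto simp: AB_def insert_commute image_iff)
    show "g \<in> CC \<union> BC \<union> prod.swap ` AB \<union> prod.swap ` AC \<union> U b a"
      using main[of p q b a CC BC AC "prod.swap ` AB"] g pq ab CC' AB' by (simp add: BC_def AC_def)
  qed
  \<comment> \<open>Ranks orient each edge, so no edge is counted from both sides; without this the
    set \<open>CC\<close> would have to be counted twice.\<close>
  have dj: "links a b \<inter> prod.swap ` links b a = {}" by (auto simp: links_def)
  have "prod.swap ` links b a \<subseteq> prod.swap ` CC \<union> prod.swap ` BC \<union> AB \<union> AC \<union> prod.swap ` U b a"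
    using sub2 by (fastforce simp: image_Un image_image)
  moreover have "prod.swap ` CC = CC" by (force simp: CC_def insert_commute)
  ultimately have "links a b \<union> prod.swap ` links b a \<subseteq> CC \<union> AC \<union> AB \<union> prod.swap ` BC \<union> U a b \<union> prod.swap ` U b a"
    using sub1 by blast
  then have "card (links a b \<union> prod.swap ` links b a) \<le> card (CC \<union> AC \<union> AB \<union> prod.swap ` BC \<union> U a b \<union> prod.swap ` U b a)"
    using fin by (intro card_mono) auto
  also have "\<dots> \<le> card CC + card AC + card AB + card (prod.swap ` BC) + card (U a b) + card (prod.swap ` U b a)"
    by (meson add_mono card_Un_le order_refl order_trans)
  also have "card (prod.swap ` BC) = card BC" by (simp add: card_image)
  also have "card (prod.swap ` U b a) = card (U b a)" by (simp add: card_image)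
  also have "card (links a b \<union> prod.swap ` links b a) = card (links a b) + card (links b a)"
    using dj finL by (simp add: card_Un_disjoint card_image)
  finally have "card (links a b) + card (links b a) \<le> card CC + card AC + card AB + card BC + card (U a b) + card (U b a)" .
  moreover have "card CC \<le> 2 * card (cl {a, b})" unfolding CC_def by (rule card_class_pairs[OF ab(3)])
  moreover have "card AC \<le> 2 * card (adherent a b)" unfolding AC_def by (rule card_adherent_pairs[OF ab(3)])
  moreover have "card BC \<le> 2 * card (adherent b a)" unfolding BC_def using ab(3) by (intro card_adherent_pairs) simp
  moreover have "card AB \<le> 2 * card (adherent a b) + card (adherent b a)" unfolding AB_def by (rule card_cross_pairs[OF ab(3)])
  moreover have "card (U a b) \<le> card (remote a b)" "card (U b a) \<le> card (remote b a)" using Ucard ab(3) by auto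
  ultimately have 1: "card (links a b) + card (links b a) \<le> 2 * card (cl {a, b}) + 4 * card (adherent a b) + 4 * card (adherent b a) + card (remote a b) + card (remote b a)"
    by linarith
  \<comment> \<open>\<open>z1\<close> leaves the bad vertices out, whereas the edge counts run over
    all of \<open>adherent\<close>; the difference is absorbed by the term
    \<open>8 * real (card (bad X))\<close>.\<close>
  have adh: "card (adherent p q) \<le> card (adherent p q - bad X) + card (bad X)" for p q
  proof -
    have "card (adherent p q) \<le> card ((adherent p q - bad X) \<union> bad X)" using fin_adh fin_bad by (intro card_mono) auto
    then show ?thesis using card_Un_le[of "adherent p q - bad X" "bad X"] by linarith
  qed
  have 2: "real (card (links a b)) + real (card (links b a)) \<le> 2 * real (card (cl {a, b})) + 4 * real (card (adherent a b))
     + 4 * real (card (adherent b a)) + real (card (remote a b)) + real (card (remote b a))"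
    using of_nat_mono[OF 1, where 'a = real] by simp
  have "real (card (adherent p q)) \<le> real (card (adherent p q - bad X)) + real (card (bad X))" for p q
    using of_nat_mono[OF adh, where 'a = real] by simp
  from 2 this[of a b] this[of b a]
  have "real (card (links a b)) + real (card (links b a)) \<le> 2 * real (card (cl {a, b})) + 4 * real (card (adherent a b - bad X))
     + 4 * real (card (adherent b a - bad X)) + 8 * real (card (bad X)) + real (card (remote a b)) + real (card (remote b a))"
    by linarith
  then show ?thesis using ab by (simp add: nn_def zz_def z1_def insert_commute)
qed

text \<open>Every vertex of the class of \<open>a\<close> that is not bad is charged at most 1. If
  it is remote, \<open>remote_unique\<close> leaves one vertex t through which other hubs are
  reached, which rules out adherence and allows at most two charges of 1/2; otherwise it adheres to
  at most one b by \<open>not_bad_one\<close>.\<close>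

lemma sum_z1:
  assumes a: "a \<in> X"
  shows "(\<Sum>b\<in>X. z1 a b) \<le> real (card (cl {a}))"
proof (cases "a \<in> B")
  case False
  then show ?thesis by (simp add: z1_def)
next
  case True
  define f where "f x b = (if x \<in> adherent a b then 1 else 0) + (if x \<in> remote a b then 1 / 2 else (0::real))" for x b
  let ?C = "cl {a} - bad X"
  have finC: "finite ?C" using fin_cl by simp
  have z1: "z1 a b = (\<Sum>x\<in>?C. f x b)" if b: "b \<in> B - {a}" for b
  proof -
    have "(\<Sum>x\<in>?C. if x \<in> adherent a b then 1 else 0::real) = real (card (?C \<inter> adherent a b))"
      "(\<Sum>x\<in>?C. if x \<in> remote a b then 1 / 2 else 0::real) = real (card (?C \<inter> remote a b)) / 2"
      using finC by (simp_all add: sum.If_cases)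
    moreover have "?C \<inter> adherent a b = adherent a b - bad X" "?C \<inter> remote a b = remote a b"
      by (auto simp: adherent_def remote_def)
    moreover have "a \<noteq> b" using b by auto
    ultimately show ?thesis using b True by (simp add: z1_def f_def sum.distrib)
  qed
  have f1: "(\<Sum>b\<in>B - {a}. f x b) \<le> 1" if x: "x \<in> ?C" for x
  proof (cases "\<exists>b\<in>B - {a}. x \<in> remote a b")
    case True
    then obtain t where t: "t \<in> V - X" "{x, t} \<in> E" "2 \<le> card (nb E X t - {a})" by (auto simp: remote_def)
    have noadh: "x \<notin> adherent a b" if "b \<in> B - {a}" for b
    proof
      assume "x \<in> adherent a b"
      then obtain s where s: "s \<in> cl {b} \<union> cl {a, b}" "{x, s} \<in> E" by (auto simp: adherent_def)
      then have "s \<in> V - X" "b \<in> nb E X s" "nb E X s - {a} \<subseteq> {b}" by (auto simp: cl_def)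
      moreover then have "s = t" using remote_unique[OF x t, of s b] s that by auto
      ultimately have "card (nb E X t - {a}) \<le> card {b}" by (intro card_mono) auto
      then show False using t(3) by simp
    qed
    have rem: "{b\<in>B - {a}. x \<in> remote a b} \<subseteq> nb E B t"
    proof
      fix b assume b: "b \<in> {b\<in>B - {a}. x \<in> remote a b}"
      then obtain s where s: "s \<in> V - X" "{x, s} \<in> E" "b \<in> nb E X s" by (auto simp: remote_def)
      then have "s = t" using remote_unique[OF x t, of s b] b by auto
      then show "b \<in> nb E B t" using s b by (auto simp: nb_def)
    qed
    have "card {b\<in>B - {a}. x \<in> remote a b} \<le> card (nb E B t)" by (rule card_mono[OF finite_nb rem])
    then have c2: "card {b\<in>B - {a}. x \<in> remote a b} \<le> 2" using B2[OF t(1)] by linarith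
    have "(\<Sum>b\<in>B - {a}. f x b) = (\<Sum>b\<in>B - {a}. if x \<in> remote a b then 1 / 2 else 0)"
      using noadh by (intro sum.cong refl) (simp add: f_def)
    also have "\<dots> = real (card {b\<in>B - {a}. x \<in> remote a b}) / 2"
      using finB by (simp add: sum.If_cases Int_def)
    finally show ?thesis using c2 by simp
  next
    case False
    have uniq: "b = c" if bc: "b \<in> B - {a}" "c \<in> B - {a}" "x \<in> adherent a b" "x \<in> adherent a c" for b c
    proof -
      obtain s where s: "s \<in> cl {b} \<union> cl {a, b}" "{x, s} \<in> E" using bc by (auto simp: adherent_def)
      obtain t where t: "t \<in> cl {c} \<union> cl {a, c}" "{x, t} \<in> E" using bc by (auto simp: adherent_def)
      show ?thesis
      proof (cases "s = t")
        case True
        then have "nb E X s - {a} = {b}" "nb E X s - {a} = {c}" using s t bc by (auto simp: cl_def)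
        then show ?thesis by auto
      next
        case False
        show ?thesis
          by (rule not_bad_one[of x a s t b c]) (use x s t bc False in \<open>auto simp: cl_def\<close>)
      qed
    qed
    have "(\<Sum>b\<in>B - {a}. f x b) = (\<Sum>b\<in>B - {a}. if x \<in> adherent a b then 1 else 0)"
      using False by (intro sum.cong refl) (auto simp: f_def)
    also have "\<dots> = real (card {b\<in>B - {a}. x \<in> adherent a b})"
      using finB by (simp add: sum.If_cases Int_def)
    also have "card {b\<in>B - {a}. x \<in> adherent a b} \<le> 1"
      using uniq finB by (intro card_le_Suc0_iff_eq[THEN iffD2, simplified One_nat_def[symmetric]]) auto
    finally show ?thesis by simp
  qed
  have "(\<Sum>b\<in>X. z1 a b) = (\<Sum>b\<in>B - {a}. z1 a b)"
    using BX finX by (intro sum.mono_neutral_right) (auto simp: z1_def)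
  also have "\<dots> = (\<Sum>b\<in>B - {a}. \<Sum>x\<in>?C. f x b)" by (intro sum.cong refl) (rule z1)
  also have "\<dots> = (\<Sum>x\<in>?C. \<Sum>b\<in>B - {a}. f x b)" by (rule sum.swap)
  also have "\<dots> \<le> (\<Sum>x\<in>?C. 1)" by (rule sum_mono[OF f1])
  also have "\<dots> \<le> real (card (cl {a}))" using fin_cl by (simp add: card_mono)
  finally show ?thesis .
qed

lemma sum_nn: "(\<Sum>a\<in>X. \<Sum>b\<in>X. nn a b) \<le> 2 * real (card {v\<in>V - X. card (nb E X v) = 2})"
proof -
  let ?W = "{v\<in>V - X. card (nb E X v) = 2}"
  have finW: "finite ?W" using finV by simp
  define f :: "'a \<Rightarrow> 'a \<times> 'a \<Rightarrow> real"
    where "f v g = (if fst g \<noteq> snd g \<and> nb E X v = {fst g, snd g} then 1 else 0)" for v g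
  have nnf: "nn (fst g) (snd g) = (\<Sum>v\<in>?W. f v g)" for g
  proof -
    have "{v\<in>?W. fst g \<noteq> snd g \<and> nb E X v = {fst g, snd g}} = (if fst g \<noteq> snd g then cl {fst g, snd g} else {})"
      by (auto simp: cl_def)
    then show ?thesis using finW by (simp add: nn_def f_def sum.If_cases Int_def)
  qed
  have f2: "(\<Sum>g\<in>X \<times> X. f v g) \<le> 2" if v: "v \<in> ?W" for v
  proof -
    have "card (nb E X v) = 2" using v by simp
    then obtain p q where pq: "nb E X v = {p, q}" "p \<noteq> q" unfolding card_2_iff by blast
    have "{g\<in>X \<times> X. fst g \<noteq> snd g \<and> nb E X v = {fst g, snd g}} \<subseteq> {(p, q), (q, p)}"
    proof
      fix g assume "g \<in> {g\<in>X \<times> X. fst g \<noteq> snd g \<and> nb E X v = {fst g, snd g}}"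
      then have "{p, q} = {fst g, snd g}" using pq(1) by simp
      then show "g \<in> {(p, q), (q, p)}" by (cases g) (auto simp: doubleton_eq_iff)
    qed
    then have "card {g\<in>X \<times> X. fst g \<noteq> snd g \<and> nb E X v = {fst g, snd g}} \<le> card {(p, q), (q, p)}"
      by (rule card_mono[rotated]) simp
    also have "\<dots> = 2" using pq by simp
    finally show ?thesis using finX by (simp add: f_def sum.If_cases Int_def)
  qed
  have "(\<Sum>a\<in>X. \<Sum>b\<in>X. nn a b) = (\<Sum>g\<in>X \<times> X. nn (fst g) (snd g))"
    by (simp add: sum.cartesian_product case_prod_unfold)
  also have "\<dots> = (\<Sum>v\<in>?W. \<Sum>g\<in>X \<times> X. f v g)" unfolding nnf by (rule sum.swap)
  also have "\<dots> \<le> (\<Sum>v\<in>?W. 2)" by (rule sum_mono[OF f2])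
  finally show ?thesis by simp
qed

lemma sum_cl: "(\<Sum>a\<in>X. real (card (cl {a}))) \<le> real (card {v\<in>V - X. card (nb E X v) = 1})"
proof -
  have "(\<Sum>a\<in>X. card (cl {a})) = card (\<Union>a\<in>X. cl {a})"
    using finX fin_cl by (intro card_UN_disjoint[symmetric]) (auto simp: cl_def)
  also have "\<dots> \<le> card {v\<in>V - X. card (nb E X v) = 1}"
    using finV by (intro card_mono) (auto simp: cl_def)
  finally show ?thesis by (simp flip: of_nat_sum)
qed

text \<open>A non-hub that sees two hubs is spent in \<open>nn\<close>, one that sees a single hub
  in \<open>z1\<close>, and never in both; the factor 2 comes from ordered pairs.\<close>

lemma total_weight: "(\<Sum>a\<in>X. \<Sum>b\<in>X. nn a b + zz a b) \<le> 2 * real (card V)"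
proof -
  have "(\<Sum>a\<in>X. \<Sum>b\<in>X. z1 b a) = (\<Sum>a\<in>X. \<Sum>b\<in>X. z1 a b)" by (rule sum.swap)
  then have "(\<Sum>a\<in>X. \<Sum>b\<in>X. nn a b + zz a b) = (\<Sum>a\<in>X. \<Sum>b\<in>X. nn a b) + 2 * (\<Sum>a\<in>X. \<Sum>b\<in>X. z1 a b)"
    by (simp add: zz_def sum.distrib)
  also have "(\<Sum>a\<in>X. \<Sum>b\<in>X. z1 a b) \<le> (\<Sum>a\<in>X. real (card (cl {a})))" by (intro sum_mono sum_z1)
  also note sum_cl
  also note sum_nn
  finally have 1: "(\<Sum>a\<in>X. \<Sum>b\<in>X. nn a b + zz a b) \<le> 2 * (real (card {v\<in>V - X. card (nb E X v) = 2}) + real (card {v\<in>V - X. card (nb E X v) = 1}))"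
    by simp
  have "card {v\<in>V - X. card (nb E X v) = 2} + card {v\<in>V - X. card (nb E X v) = 1}
      = card ({v\<in>V - X. card (nb E X v) = 2} \<union> {v\<in>V - X. card (nb E X v) = 1})"
    using finV by (intro card_Un_disjoint[symmetric]) auto
  also have "\<dots> \<le> card V" using finV by (intro card_mono) auto
  finally show ?thesis using 1 by simp
qed

end

section \<open>Vertex sets with few free choices\<close>

lemma card_inserts:
  assumes fin: "finite \<S>" and A: "\<And>S. S \<in> \<S> \<Longrightarrow> finite (A S) \<and> card (A S) \<le> q"
  shows "card {insert v S | v S. S \<in> \<S> \<and> v \<in> A S} \<le> q * card \<S>"
proof -
  have "{insert v S | v S. S \<in> \<S> \<and> v \<in> A S} = (\<lambda>(S, v). insert v S) ` (SIGMA S:\<S>. A S)" by auto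
  moreover have "card ((\<lambda>(S, v). insert v S) ` (SIGMA S:\<S>. A S)) \<le> card (SIGMA S:\<S>. A S)"
    using fin A by (intro card_image_le finite_SigmaI) auto
  moreover have "card (SIGMA S:\<S>. A S) = (\<Sum>S\<in>\<S>. card (A S))" using fin A by (simp add: card_SigmaI)
  moreover have "(\<Sum>S\<in>\<S>. card (A S)) \<le> (\<Sum>S\<in>\<S>. q)" using A by (intro sum_mono) auto
  ultimately show ?thesis by (simp add: mult.commute)
qed

lemma card_UN_le_mult: "finite S \<Longrightarrow> card S \<le> k \<Longrightarrow> (\<And>u. u \<in> S \<Longrightarrow> card (f u) \<le> q) \<Longrightarrow> card (\<Union>u\<in>S. f u) \<le> k * q"
proof -
  assume a: "finite S" "card S \<le> k" "\<And>u. u \<in> S \<Longrightarrow> card (f u) \<le> q"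
  have "card (\<Union>u\<in>S. f u) \<le> (\<Sum>u\<in>S. card (f u))" by (rule card_UN_le[OF a(1)])
  also have "\<dots> \<le> (\<Sum>u\<in>S. q)" by (rule sum_mono[OF a(3)])
  also have "\<dots> \<le> k * q" using a(2) by simp
  finally show ?thesis .
qed

text \<open>\<open>Z\<close> and the degree bound \<open>D\<close> outside \<open>B\<close> provide
  the limited choices of a special step. Later \<open>Z\<close> consists of the hubs and the bad
  vertices.\<close>

locale ranked = fin_graph V E for V :: "'a set" and E +
  fixes r :: "'a \<Rightarrow> nat" and B Z :: "'a set" and D :: nat
  assumes low: "\<And>v. v \<in> V \<Longrightarrow> card {u\<in>nb E V v. r u < r v} \<le> 64"
    and light: "\<And>v. v \<in> V - B \<Longrightarrow> card (nb E V v) \<le> D"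
    and Z: "Z \<subseteq> V"
begin

text \<open>Only the steps free and special have an unbounded number of choices, so a and b control the
  number of sets that can be built.\<close>

inductive gen :: "nat \<Rightarrow> nat \<Rightarrow> nat \<Rightarrow> 'a set \<Rightarrow> bool" where
  empty: "gen 0 a b {}"
| stay: "gen k a b S \<Longrightarrow> gen (Suc k) a b S"
| free: "gen k a b S \<Longrightarrow> v \<in> V \<Longrightarrow> gen (Suc k) (Suc a) b (insert v S)"
| down: "gen k a b S \<Longrightarrow> u \<in> S \<Longrightarrow> {u, v} \<in> E \<Longrightarrow> r v < r u \<Longrightarrow> gen (Suc k) a b (insert v S)"
| special: "gen k a b S \<Longrightarrow> v \<in> Z \<or> (\<exists>u\<in>S - B. {u, v} \<in> E) \<Longrightarrow> gen (Suc k) a (Suc b) (insert v S)"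

lemma gen_sub: "gen k a b S \<Longrightarrow> finite S \<and> S \<subseteq> V \<and> card S \<le> k"
proof (induction rule: gen.induct)
  case (free k a b S v)
  then show ?case using card_insert_le_m1[of "Suc k" S v] by simp
next
  case (down k a b S u v)
  then show ?case using card_insert_le_m1[of "Suc k" S v] adj_in by simp
next
  case (special k a b S v)
  then have "v \<in> V" using Z adj_in by auto
  then show ?case using special card_insert_le_m1[of "Suc k" S v] by simp
qed auto

lemma gen_le: "gen k a b S \<Longrightarrow> a \<le> a' \<Longrightarrow> b \<le> b' \<Longrightarrow> gen k a' b' S"
proof (induction arbitrary: a' b' rule: gen.induct)
  case (free k a b S v)
  obtain c where c: "a' = Suc c" "a \<le> c" using free.prems(1) by (cases a') auto
  show ?case unfolding c(1) by (rule gen.free[OF free.IH[OF c(2) free.prems(2)] free.hyps(2)])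
next
  case (special k a b S v)
  obtain c where c: "b' = Suc c" "b \<le> c" using special.prems(2) by (cases b') auto
  show ?case unfolding c(1) by (rule gen.special[OF special.IH[OF special.prems(1) c(2)] special.hyps(2)])
qed (auto intro: gen.empty gen.stay gen.down)

lemma gen_add: "gen k a b S \<Longrightarrow> gen (k + j) a b S"
  by (induction j) (auto intro: gen.stay)

lemma gen_mono: "gen k a b S \<Longrightarrow> k \<le> k' \<Longrightarrow> a \<le> a' \<Longrightarrow> b \<le> b' \<Longrightarrow> gen k' a' b' S"
  using gen_le[OF gen_add[of k a b S "k' - k"]] by simp

lemma gen_free: "finite T \<Longrightarrow> T \<subseteq> V \<Longrightarrow> gen (card T) (card T) b T"
  by (induction rule: finite_induct) (auto intro: gen.empty gen.free)

lemma gen_down: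
  assumes "gen k a b S" "finite T" "\<And>t. t \<in> T \<Longrightarrow> \<exists>u\<in>S. {u, t} \<in> E \<and> r t < r u"
  shows "gen (k + card T) a b (T \<union> S)"
  using assms(2,3)
proof (induction rule: finite_induct)
  case empty
  then show ?case using assms(1) by simp
next
  case (insert t T)
  have "gen (k + card T) a b (T \<union> S)" using insert by simp
  moreover obtain u where "u \<in> T \<union> S" "{u, t} \<in> E" "r t < r u" using insert.prems[of t] by auto
  ultimately have "gen (Suc (k + card T)) a b (insert t (T \<union> S))" by (rule gen.down)
  then show ?case using insert by simp
qed

text \<open>The set is built in order of decreasing rank: taking off the vertex of smallest rank
  deprives no other vertex of its higher neighbour. Only the members of \<open>P\<close>, later the
  peaks, cost a free step.\<close>

lemma gen_few:
  assumes "finite T" "T \<subseteq> V" "\<And>v. v \<in> T \<Longrightarrow> v \<in> P \<or> (\<exists>u\<in>T. {u, v} \<in> E \<and> r v < r u)"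
  shows "gen (card T) (card (T \<inter> P)) b T"
  using assms
proof (induction "card T" arbitrary: T)
  case 0
  then show ?case using gen.empty by simp
next
  case (Suc n)
  then have ne: "T \<noteq> {}" by auto
  obtain w where w: "w \<in> T" "\<And>v. v \<in> T \<Longrightarrow> r w \<le> r v"
    using ex_min_if_finite[of "r ` T"] Suc.prems(1) ne by (metis (no_types, lifting) arg_min_if_finite(1) arg_min_least)
  let ?T = "T - {w}"
  have c: "n = card ?T" using Suc.hyps(2) Suc.prems(1) w(1) by simp
  have IH: "gen n (card (?T \<inter> P)) b ?T"
    unfolding c
  proof (rule Suc.hyps(1)[OF c])
    fix v assume v: "v \<in> ?T"
    then consider "v \<in> P" | u where "u \<in> T" "{u, v} \<in> E" "r v < r u" using Suc.prems(3)[of v] by auto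
    then show "v \<in> P \<or> (\<exists>u\<in>?T. {u, v} \<in> E \<and> r v < r u)"
    proof cases
      case 2
      then have "u \<noteq> w" using w(2)[of v] v by auto
      then show ?thesis using 2 by blast
    qed simp
  qed (use Suc.prems in auto)
  have T: "insert w ?T = T" using w(1) by auto
  show ?case
  proof (cases "w \<in> P")
    case True
    have "gen (Suc n) (Suc (card (?T \<inter> P))) b (insert w ?T)"
      using IH Suc.prems(2) w(1) by (intro gen.free) auto
    moreover have "T \<inter> P = insert w (?T \<inter> P)" using True w(1) by auto
    then have "card (T \<inter> P) = Suc (card (?T \<inter> P))" using Suc.prems(1) by simp
    ultimately show ?thesis using Suc.hyps(2) T by simp
  next
    case False
    then obtain u where u: "u \<in> T" "{u, w} \<in> E" "r w < r u" using Suc.prems(3)[OF w(1)] by auto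
    then have "u \<in> ?T" by auto
    then have "gen (Suc n) (card (?T \<inter> P)) b (insert w ?T)" using IH u by (intro gen.down)
    moreover have "T \<inter> P = ?T \<inter> P" using False by auto
    ultimately show ?thesis using Suc.hyps(2) T by simp
  qed
qed

text \<open>\<open>S\<close> is meant for the peaks and \<open>T\<close> for the rest. From the
  peaks other than \<open>s\<close>, at most two down steps lead to a light vertex next to
  \<open>s\<close> (none if \<open>s \<in> Z\<close>); a special step takes \<open>s\<close>, and
  down steps supply the remaining vertices. One free choice is thereby exchanged for a special
  one.\<close>

lemma gen_error:
  assumes fin: "finite S" "S \<subseteq> V" "finite T" and s: "s \<in> S"
    and down: "\<And>t. t \<in> T \<Longrightarrow> \<exists>u\<in>S. {u, t} \<in> E \<and> r t < r u"
    and error: "s \<in> Z \<or> (\<exists>t\<in>T - B. {t, s} \<in> E \<and> ((\<exists>u\<in>S - {s}. {u, t} \<in> E \<and> r t < r u) \<or>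
       (\<exists>t'\<in>T. (\<exists>u\<in>S - {s}. {u, t'} \<in> E \<and> r t' < r u) \<and> {t', t} \<in> E \<and> r t < r t')))"
  shows "gen (card S + 2 + card T) (card S - 1) 1 (S \<union> T)"
proof -
  let ?n = "card S - 1"
  have c: "card (S - {s}) = ?n" using s fin by simp
  have "gen ?n ?n 0 (S - {s})" using gen_free[of "S - {s}" 0] fin c by auto
  then have start: "gen (?n + j) ?n 0 (S - {s})" for j by (rule gen_add)
  have "\<exists>S'. gen (?n + 2) ?n 0 S' \<and> S - {s} \<subseteq> S' \<and> S' \<subseteq> S \<union> T \<and> (s \<in> Z \<or> (\<exists>u\<in>S' - B. {u, s} \<in> E))"
    using error
  proof (elim disjE bexE conjE)
    assume "s \<in> Z"
    then show ?thesis using start[of 2] by (intro exI[of _ "S - {s}"]) auto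
  next
    fix t u assume t: "t \<in> T - B" "{t, s} \<in> E" and u: "u \<in> S - {s}" "{u, t} \<in> E" "r t < r u"
    have "gen (Suc (?n + 1)) ?n 0 (insert t (S - {s}))" by (rule gen.down[OF start u])
    then show ?thesis using t by (intro exI[of _ "insert t (S - {s})"]) auto
  next
    fix t t' u assume t: "t \<in> T - B" "{t, s} \<in> E" and u: "u \<in> S - {s}" "{u, t'} \<in> E" "r t' < r u"
      and t': "t' \<in> T" "{t', t} \<in> E" "r t < r t'"
    have "gen (Suc ?n) ?n 0 (insert t' (S - {s}))" using gen.down[OF start[of 0] u] by simp
    then have "gen (Suc (Suc ?n)) ?n 0 (insert t (insert t' (S - {s})))" by (rule gen.down[OF _ insertI1 t'(2,3)])
    then show ?thesis using t t' by (intro exI[of _ "insert t (insert t' (S - {s}))"]) auto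
  qed
  then obtain S' where S': "gen (?n + 2) ?n 0 S'" "S - {s} \<subseteq> S'" "S' \<subseteq> S \<union> T"
    "s \<in> Z \<or> (\<exists>u\<in>S' - B. {u, s} \<in> E)" by blast
  have "gen (Suc (?n + 2)) ?n (Suc 0) (insert s S')" by (rule gen.special[OF S'(1,4)])
  moreover have sub: "S \<subseteq> insert s S'" using S'(2) by auto
  then have "\<exists>u\<in>insert s S'. {u, t} \<in> E \<and> r t < r u" if "t \<in> T" for t using down[OF that] by blast
  ultimately have "gen (Suc (?n + 2) + card T) ?n (Suc 0) (T \<union> insert s S')" using fin(3) by (intro gen_down) auto
  moreover have "T \<union> insert s S' = S \<union> T" using S'(3) sub s by auto
  moreover have "Suc (?n + 2) = card S + 2" using s fin(1) by (cases "card S") auto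
  ultimately show ?thesis by simp
qed

lemma gen_finite: "finite {S. gen k a b S}"
  by (rule finite_subset[of _ "Pow V"]) (use gen_sub finV in \<open>auto dest: gen_sub\<close>)

text \<open>One step offers 1 (stay), card V (free), 64k (down) or (1 + k) M (special) choices at
  most; the coefficients add up to 65k + 3.\<close>

lemma gen_bound:
  assumes M: "D \<le> M" "card Z \<le> M" and pos: "1 \<le> card V" "1 \<le> M"
  shows "k \<le> K \<Longrightarrow> card {S. gen k a b S} \<le> (65 * K + 3) ^ k * card V ^ a * M ^ b"
proof (induction k arbitrary: a b)
  case 0
  have "{S. gen 0 a b S} = {{}}" by (auto intro: gen.empty elim: gen.cases)
  then show ?case using pos by (simp add: Suc_le_eq)
next
  case (Suc k)
  let ?G = "\<lambda>a b. {S. gen k a b S}"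
  let ?c = "(65 * K + 3) ^ k * card V ^ a * M ^ b"
  have kK: "k \<le> K" using Suc by simp
  note IH = Suc.IH[OF kK]
  define P1 where "P1 = {insert v S | v S. S \<in> {S. \<exists>a'. a = Suc a' \<and> gen k a' b S} \<and> v \<in> V}"
  define P2 where "P2 = {insert v S | v S. S \<in> ?G a b \<and> v \<in> (\<Union>u\<in>S. {w\<in>nb E V u. r w < r u})}"
  define P3 where "P3 = {insert v S | v S. S \<in> {S. \<exists>b'. b = Suc b' \<and> gen k a b' S} \<and> v \<in> Z \<union> (\<Union>u\<in>S - B. nb E V u)}"
  have "{S. gen (Suc k) a b S} \<subseteq> ?G a b \<union> P1 \<union> P2 \<union> P3"
  proof
    fix S assume "S \<in> {S. gen (Suc k) a b S}"
    then have "gen (Suc k) a b S" by simp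
    then show "S \<in> ?G a b \<union> P1 \<union> P2 \<union> P3"
    proof (cases rule: gen.cases)
      case (free a' S' v)
      then have "S \<in> P1" by (auto simp: P1_def)
      then show ?thesis by simp
    next
      case (down S' u v)
      then have "v \<in> (\<Union>u\<in>S'. {w\<in>nb E V u. r w < r u})"
        using adj_in by (auto simp: nb_def insert_commute intro!: bexI[of _ u])
      then have "S \<in> P2" using down by (auto simp: P2_def)
      then show ?thesis by simp
    next
      case (special b' S' v)
      then have "v \<in> Z \<union> (\<Union>u\<in>S' - B. nb E V u)"
        using adj_in by (fastforce simp: nb_def insert_commute)
      then have "S \<in> P3" unfolding P3_def using special by blast
      then show ?thesis by simp
    qed simp
  qed
  moreover have "S \<in> P1 \<or> S \<in> P2 \<or> S \<in> P3 \<Longrightarrow> S \<subseteq> V" for S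
    using gen_sub Z adj_in by (fastforce simp: P1_def P2_def P3_def nb_def)
  then have "finite (?G a b)" "finite P1" "finite P2" "finite P3"
    using gen_finite finV by (auto intro!: finite_subset[of _ "Pow V"])
  ultimately have "card {S. gen (Suc k) a b S} \<le> card (?G a b \<union> P1 \<union> P2 \<union> P3)" by (intro card_mono) auto
  also have "\<dots> \<le> card (?G a b) + card P1 + card P2 + card P3"
    using card_Un_le[of "?G a b \<union> P1 \<union> P2" P3] card_Un_le[of "?G a b \<union> P1" P2] card_Un_le[of "?G a b" P1] by linarith
  also have "\<dots> \<le> ?c + ?c + (k * 64) * ?c + (1 + k) * ?c"
  proof (intro add_mono)
    show "card (?G a b) \<le> ?c" by (rule IH)
    show "card P1 \<le> ?c"
    proof (cases a)
      case 0
      then show ?thesis by (simp add: P1_def)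
    next
      case (Suc a')
      have "card P1 \<le> card V * card {S. \<exists>a'. a = Suc a' \<and> gen k a' b S}"
        unfolding P1_def by (rule card_inserts) (use Suc gen_finite finV in auto)
      also have "{S. \<exists>a'. a = Suc a' \<and> gen k a' b S} = ?G a' b" using Suc by auto
      also have "card V * card (?G a' b) \<le> card V * ((65 * K + 3) ^ k * card V ^ a' * M ^ b)"
        by (rule mult_left_mono[OF IH]) simp
      finally show ?thesis using Suc by (simp add: mult_ac)
    qed
    have "card P2 \<le> (k * 64) * card (?G a b)"
      unfolding P2_def
    proof (rule card_inserts[OF gen_finite])
      fix S assume "S \<in> ?G a b"
      then have S: "finite S" "S \<subseteq> V" "card S \<le> k" using gen_sub by auto
      then show "finite (\<Union>u\<in>S. {w\<in>nb E V u. r w < r u}) \<and> card (\<Union>u\<in>S. {w\<in>nb E V u. r w < r u}) \<le> k * 64"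
        using card_UN_le_mult[OF S(1,3), of "\<lambda>u. {w\<in>nb E V u. r w < r u}" 64] low finite_nb by auto
    qed
    also have "\<dots> \<le> (k * 64) * ?c" by (rule mult_left_mono[OF IH]) simp
    finally show "card P2 \<le> (k * 64) * ?c" .
    show "card P3 \<le> (1 + k) * ?c"
    proof (cases b)
      case 0
      then show ?thesis by (simp add: P3_def)
    next
      case (Suc b')
      have e: "{S. \<exists>b'. b = Suc b' \<and> gen k a b' S} = ?G a b'" using Suc by auto
      have "card P3 \<le> ((1 + k) * M) * card (?G a b')"
        unfolding P3_def e
      proof (rule card_inserts[OF gen_finite])
        fix S assume "S \<in> ?G a b'"
        then have S: "finite S" "S \<subseteq> V" "card S \<le> k" using gen_sub by auto
        have S': "finite (S - B)" "card (S - B) \<le> k" using S card_mono[of S "S - B"] by auto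
        have "card (\<Union>u\<in>S - B. nb E V u) \<le> k * D"
          by (rule card_UN_le_mult[OF S']) (use light S in auto)
        also have "\<dots> \<le> k * M" using M by simp
        finally have "card (Z \<union> (\<Union>u\<in>S - B. nb E V u)) \<le> M + k * M"
          using card_Un_le[of Z "\<Union>u\<in>S - B. nb E V u"] M by linarith
        moreover have "finite Z" using Z finV finite_subset by blast
        ultimately show "finite (Z \<union> (\<Union>u\<in>S - B. nb E V u)) \<and> card (Z \<union> (\<Union>u\<in>S - B. nb E V u)) \<le> (1 + k) * M"
          using S' finite_nb by (simp add: algebra_simps)
      qed
      also have "\<dots> \<le> ((1 + k) * M) * ((65 * K + 3) ^ k * card V ^ a * M ^ b')" by (rule mult_left_mono[OF IH]) simp
      finally show ?thesis using Suc by (simp add: algebra_simps)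
    qed
  qed
  also have "\<dots> = (65 * k + 3) * ?c" by (simp add: algebra_simps)
  also have "\<dots> \<le> (65 * K + 3) * ?c" using kK by (intro mult_right_mono) auto
  also have "\<dots> = (65 * K + 3) ^ Suc k * card V ^ a * M ^ b" by (simp add: mult_ac)
  finally show ?case .
qed

end

section \<open>Weighted cycles and paths\<close>

definition DL :: "nat \<Rightarrow> 'a set \<Rightarrow> 'a list set" where
  "DL k X = {xs. length xs = k \<and> distinct xs \<and> set xs \<subseteq> X}"

fun pw :: "('a \<Rightarrow> 'a \<Rightarrow> real) \<Rightarrow> 'a list \<Rightarrow> real" where
  "pw w (x # y # xs) = w x y * pw w (y # xs)"
| "pw w _ = 1"

definition cw :: "('a \<Rightarrow> 'a \<Rightarrow> real) \<Rightarrow> 'a list \<Rightarrow> real" where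
  "cw w xs = pw w xs * w (last xs) (hd xs)"

text \<open>Lists instead of cycles: for m at least 3 each cycle of m hubs occurs 2m times, by
  starting point and direction. A single cycle with all weights n/m thus has the value 2m (n/m)^m,
  the main term. A path occurs twice in \<open>Qsum\<close>.\<close>

definition Ssum :: "('a \<Rightarrow> 'a \<Rightarrow> real) \<Rightarrow> 'a set \<Rightarrow> nat \<Rightarrow> real" where
  "Ssum w X m = (\<Sum>xs\<in>DL m X. cw w xs)"

definition Qsum :: "('a \<Rightarrow> 'a \<Rightarrow> real) \<Rightarrow> 'a set \<Rightarrow> nat \<Rightarrow> real" where
  "Qsum w X m = (\<Sum>xs\<in>DL (Suc m) X. pw w xs)"

lemma finite_DL: "finite X \<Longrightarrow> finite (DL k X)"
  by (rule finite_subset[OF _ finite_lists_length_eq[of X k]]) (auto simp: DL_def)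

lemma sum_DL_Suc:
  assumes "finite X"
  shows "(\<Sum>xs\<in>DL (Suc k) X. F xs) = (\<Sum>zs\<in>DL k X. \<Sum>y\<in>X - set zs. F (y # zs))"
proof -
  have "(\<Sum>zs\<in>DL k X. \<Sum>y\<in>X - set zs. F (y # zs)) = (\<Sum>(zs, y)\<in>(SIGMA zs:DL k X. X - set zs). F (y # zs))"
    using assms finite_DL by (intro sum.Sigma) auto
  also have "\<dots> = (\<Sum>xs\<in>DL (Suc k) X. F xs)"
    by (rule sum.reindex_bij_witness[of _ "\<lambda>xs. (tl xs, hd xs)" "\<lambda>(zs, y). y # zs"])
      (auto simp: DL_def length_Suc_conv)
  finally show ?thesis by simp
qed

lemma sum_DL_rotate1:
  assumes "finite X"
  shows "(\<Sum>xs\<in>DL k X. F (rotate1 xs)) = (\<Sum>xs\<in>DL k X. F xs)"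
proof (rule sum.reindex_bij_betw)
  have "rotate1 ` DL k X \<subseteq> DL k X" by (auto simp: DL_def)
  then show "bij_betw rotate1 (DL k X) (DL k X)"
    using endo_inj_surj[OF finite_DL[OF assms], of rotate1 k] inj_on_subset[OF inj_rotate1 subset_UNIV]
    by (auto simp: bij_betw_def)
qed

lemma sum_DL_rotate:
  assumes "finite X"
  shows "(\<Sum>xs\<in>DL k X. F (rotate r xs)) = (\<Sum>xs\<in>DL k X. F xs)"
proof (induction r arbitrary: F)
  case (Suc r)
  have "(\<Sum>xs\<in>DL k X. F (rotate (Suc r) xs)) = (\<Sum>xs\<in>DL k X. (\<lambda>ys. F (rotate1 ys)) (rotate r xs))"
    by (simp add: rotate_def)
  also have "\<dots> = (\<Sum>xs\<in>DL k X. F (rotate1 xs))" by (rule Suc.IH)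
  also have "\<dots> = (\<Sum>xs\<in>DL k X. F xs)" by (rule sum_DL_rotate1[OF assms])
  finally show ?case .
qed (simp add: rotate_def)

lemma sum_DL_rev:
  assumes "finite X"
  shows "(\<Sum>xs\<in>DL k X. F (rev xs)) = (\<Sum>xs\<in>DL k X. F xs)"
  by (rule sum.reindex_bij_witness[of _ rev rev]) (auto simp: DL_def)

lemma pw_snoc: "xs \<noteq> [] \<Longrightarrow> pw w (xs @ [y]) = pw w xs * w (last xs) y"
  by (induction w xs rule: pw.induct) auto

lemma cw_rotate1: "xs \<noteq> [] \<Longrightarrow> cw w (rotate1 xs) = cw w xs"
proof (cases xs)
  case (Cons x ys)
  then show ?thesis
  proof (cases ys)
    case (Cons y zs)
    then show ?thesis using \<open>xs = x # ys\<close> by (simp add: cw_def pw_snoc flip: append_Cons)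
  qed (simp add: cw_def)
qed simp

lemma cw_rotate: "xs \<noteq> [] \<Longrightarrow> cw w (rotate r xs) = cw w xs"
  by (induction r) (auto simp: rotate_def cw_rotate1 simp flip: rotate_def)

section \<open>The growth process and the bound for large m\<close>

locale weights =
  fixes X :: "'a set" and w :: "'a \<Rightarrow> 'a \<Rightarrow> real"
  assumes finX: "finite X" and nonneg: "\<And>x y. w x y \<ge> 0" and sym: "\<And>x y. w x y = w y x"
    and diag: "\<And>x. w x x = 0"
begin

definition d :: "'a set \<Rightarrow> 'a \<Rightarrow> real" where "d U x = (\<Sum>y\<in>U. w x y)"
definition tot :: "'a set \<Rightarrow> real" where "tot U = (\<Sum>x\<in>U. d U x)"

lemma d_nonneg: "d U x \<ge> 0"
  by (simp add: d_def nonneg sum_nonneg)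

lemma tot_nonneg: "tot U \<ge> 0"
  by (simp add: tot_def d_nonneg sum_nonneg)

lemma pw_nonneg: "pw w xs \<ge> 0"
  by (induction xs rule: induct_list012) (auto simp: nonneg)

lemma cw_nonneg: "cw w xs \<ge> 0"
  by (simp add: cw_def pw_nonneg nonneg)

lemma w_le_d: "finite U \<Longrightarrow> y \<in> U \<Longrightarrow> w x y \<le> d U x"
  unfolding d_def using member_le_sum[of y U "w x"] nonneg by simp

lemma d_union: "finite X' \<Longrightarrow> U \<subseteq> X' \<Longrightarrow> d X' x = d U x + d (X' - U) x"
  unfolding d_def by (simp add: sum.subset_diff add.commute)

text \<open>On the left is the weight of the edges that meet \<open>U\<close>: the degree sum counts
  the edges inside \<open>U\<close> twice, and half of \<open>tot U\<close> corrects this.\<close>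

lemma touching_le:
  assumes "finite X'" "U \<subseteq> X'"
  shows "(\<Sum>x\<in>U. d X' x) - tot U / 2 \<le> tot X' / 2"
proof -
  let ?V = "X' - U"
  have "tot X' = (\<Sum>x\<in>U. d X' x) + (\<Sum>x\<in>?V. d X' x)"
    unfolding tot_def using assms by (simp add: sum.subset_diff add.commute)
  moreover have "(\<Sum>x\<in>U. d X' x) = tot U + (\<Sum>x\<in>U. d ?V x)"
    unfolding tot_def by (simp add: d_union[OF assms] sum.distrib)
  moreover have "(\<Sum>x\<in>?V. d X' x) = (\<Sum>x\<in>?V. d U x) + (\<Sum>x\<in>?V. d ?V x)"
    by (simp add: d_union[OF assms] sum.distrib)
  moreover have "(\<Sum>x\<in>?V. d U x) = (\<Sum>x\<in>U. d ?V x)"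
    unfolding d_def by (subst sum.swap) (simp add: sym)
  moreover have "(\<Sum>x\<in>?V. d ?V x) \<ge> 0" by (simp add: d_nonneg sum_nonneg)
  ultimately show ?thesis by linarith
qed

text \<open>A path is grown at the head of the list. The random growth process starts at a random edge
  and follows edges with probability proportional to their weight; in its last step it may also
  close a cycle. Summing the probabilities of all outcomes bounds cycles and paths simultaneously.\<close>

definition D :: "'a list \<Rightarrow> real" where "D xs = d (X - set xs) (hd xs)"

text \<open>The newest vertex is the head. \<open>gD\<close> multiplies the normalising factors of
  the steps that led from the initial edge to the present list; \<open>sD\<close> adds up the same
  factors.\<close>

fun gD :: "'a list \<Rightarrow> real" where
  "gD (y # z # u # xs) = gD (z # u # xs) * D (z # u # xs)"
| "gD _ = 1"

fun sD :: "'a list \<Rightarrow> real" where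
  "sD (y # z # u # xs) = sD (z # u # xs) + D (z # u # xs)"
| "sD _ = 0"

text \<open>The normalising factor of the last step, in which closing the cycle competes with adding
  a further vertex.\<close>

definition D' :: "'a list \<Rightarrow> real" where "D' xs = D xs + w (hd xs) (last xs)"
definition pr :: "'a list \<Rightarrow> real" where "pr xs = pw w xs / (2 * gD xs)"

lemma D_nonneg: "D xs \<ge> 0" by (simp add: D_def d_nonneg)
lemma D'_nonneg: "D' xs \<ge> 0" by (simp add: D'_def D_nonneg nonneg)
lemma gD_nonneg: "gD xs \<ge> 0" by (induction xs rule: gD.induct) (auto simp: D_nonneg)
lemma pr_nonneg: "pr xs \<ge> 0" by (simp add: pr_def pw_nonneg gD_nonneg)

lemma gD_Cons: "length zs \<ge> 2 \<Longrightarrow> gD (y # zs) = gD zs * D zs"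
  by (cases zs; cases "tl zs") auto

lemma sD_Cons: "length zs \<ge> 2 \<Longrightarrow> sD (y # zs) = sD zs + D zs"
  by (cases zs; cases "tl zs") auto

lemma pw_Cons: "zs \<noteq> [] \<Longrightarrow> pw w (y # zs) = w y (hd zs) * pw w zs"
  by (cases zs) auto

lemma sum_w_hd: "(\<Sum>y\<in>X - set zs. w y (hd zs)) = D zs"
  by (simp add: D_def d_def sym)

lemma pr_total:
  assumes "tot X = 2" "2 \<le> k"
  shows "(\<Sum>xs\<in>DL k X. pr xs) \<le> 1"
  using assms(2)
proof (induction k rule: dec_induct)
  case base
  have "(\<Sum>xs\<in>DL 2 X. pr xs) = (\<Sum>xs\<in>DL (Suc (Suc 0)) X. pr xs)" by (simp add: numeral_2_eq_2)
  also have "\<dots> = (\<Sum>y\<in>X. \<Sum>x\<in>X - {y}. w x y / 2)"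
  proof -
    have "DL 0 X = {[]}" by (auto simp: DL_def)
    then show ?thesis unfolding sum_DL_Suc[OF finX] by (simp add: pr_def)
  qed
  also have "\<dots> = (\<Sum>y\<in>X. d X y / 2)"
  proof (rule sum.cong[OF refl])
    fix y assume "y \<in> X"
    then have "(\<Sum>x\<in>X. w y x) = w y y + (\<Sum>x\<in>X - {y}. w y x)" using finX by (intro sum.remove) auto
    then show "(\<Sum>x\<in>X - {y}. w x y / 2) = d X y / 2"
      by (simp add: d_def diag sym flip: sum_divide_distrib)
  qed
  also have "\<dots> = 1" using assms(1) by (simp add: tot_def flip: sum_divide_distrib)
  finally show ?case by simp
next
  case (step k)
  have "(\<Sum>xs\<in>DL (Suc k) X. pr xs) = (\<Sum>zs\<in>DL k X. pr zs * (D zs / D zs))"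
    unfolding sum_DL_Suc[OF finX]
  proof (rule sum.cong[OF refl])
    fix zs assume "zs \<in> DL k X"
    then have l: "length zs \<ge> 2" "zs \<noteq> []" using step.hyps by (auto simp: DL_def)
    have "pr (y # zs) = w y (hd zs) * (pr zs / D zs)" for y
      using l by (simp add: pr_def pw_Cons gD_Cons mult_ac)
    then have "(\<Sum>y\<in>X - set zs. pr (y # zs)) = (\<Sum>y\<in>X - set zs. w y (hd zs)) * (pr zs / D zs)"
      by (simp only: sum_distrib_right)
    then show "(\<Sum>y\<in>X - set zs. pr (y # zs)) = pr zs * (D zs / D zs)"
      unfolding sum_w_hd by simp
  qed
  \<comment> \<open>The quotient is 1, or 0 where the process is stuck; the probability lost there
    makes this an inequality.\<close>
  also have "\<dots> \<le> (\<Sum>zs\<in>DL k X. pr zs)"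
    by (intro sum_mono mult_left_le) (auto simp: pr_nonneg)
  finally show ?case using step.IH by simp
qed

lemma process_total:
  assumes "tot X = 2" "2 \<le> m"
  shows "(\<Sum>zs\<in>DL m X. cw w zs / (2 * gD zs * D' zs)) +
         (\<Sum>zs\<in>DL m X. \<Sum>y\<in>X - set zs. pw w (y # zs) / (2 * gD zs * D' zs)) \<le> 1"
proof -
  have "cw w zs / (2 * gD zs * D' zs) + (\<Sum>y\<in>X - set zs. pw w (y # zs) / (2 * gD zs * D' zs)) \<le> pr zs"
    if "zs \<in> DL m X" for zs
  proof -
    have ne: "zs \<noteq> []" using that assms(2) by (auto simp: DL_def)
    have "cw w zs / (2 * gD zs * D' zs) + (\<Sum>y\<in>X - set zs. pw w (y # zs) / (2 * gD zs * D' zs))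
        = pr zs * (w (hd zs) (last zs) + (\<Sum>y\<in>X - set zs. w y (hd zs))) / D' zs"
      by (simp add: pr_def cw_def pw_Cons[OF ne] sym[of "last zs"] sum_distrib_left
          sum_divide_distrib distrib_left add_divide_distrib mult_ac)
    also have "\<dots> = pr zs * (D' zs / D' zs)" unfolding sum_w_hd by (simp add: D'_def add.commute)
    also have "\<dots> \<le> pr zs" by (intro mult_left_le) (auto simp: pr_nonneg)
    finally show ?thesis .
  qed
  then have "(\<Sum>zs\<in>DL m X. cw w zs / (2 * gD zs * D' zs) + (\<Sum>y\<in>X - set zs. pw w (y # zs) / (2 * gD zs * D' zs)))
     \<le> (\<Sum>zs\<in>DL m X. pr zs)" by (rule sum_mono)
  then show ?thesis using pr_total[OF assms] by (simp add: sum.distrib)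
qed

text \<open>By t \<le> exp (t - 1), each factor satisfies 1 / D \<ge> c exp (1 - c D), with equality
  at D = 1 / c. The product of the factors thus becomes a sum in the exponent.\<close>

lemma inverse_gD_ge:
  assumes "c > 0" "gD zs > 0" "2 \<le> length zs"
  shows "1 / gD zs \<ge> c ^ (length zs - 2) * exp (real (length zs - 2) - c * sD zs)"
  using assms(2,3)
proof (induction zs)
  case (Cons y zs)
  show ?case
  proof (cases "length zs \<ge> 2")
    case False
    then have "length zs = 1" using Cons.prems by simp
    then have "gD (y # zs) = 1" "sD (y # zs) = 0" by (cases zs; simp)+
    then show ?thesis using \<open>length zs = 1\<close> by simp
  next
    case True
    have pos: "gD zs > 0" "D zs > 0"
      using Cons.prems(1) gD_nonneg[of zs] D_nonneg[of zs] by (auto simp: gD_Cons[OF True] zero_less_mult_iff)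
    define k where "k = length zs - 2"
    have k: "length (y # zs) - 2 = Suc k" using True by (simp add: k_def)
    have "c * D zs \<le> exp (c * D zs - 1)" using exp_ge_add_one_self[of "c * D zs - 1"] by simp
    then have "exp (1 - c * D zs) \<le> 1 / (c * D zs)"
      using pos assms(1) by (simp add: exp_diff field_simps)
    then have 1: "c * exp (1 - c * D zs) \<le> 1 / D zs" using assms(1) pos by (simp add: field_simps)
    have 2: "c ^ k * exp (real k - c * sD zs) \<le> 1 / gD zs" using Cons.IH pos True by (simp add: k_def)
    have "c ^ Suc k * exp (real (Suc k) - c * sD (y # zs))
        = (c ^ k * exp (real k - c * sD zs)) * (c * exp (1 - c * D zs))"
      by (simp add: sD_Cons[OF True] algebra_simps flip: exp_add)
    also have "\<dots> \<le> (1 / gD zs) * (1 / D zs)"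
      using 1 2 pos assms(1) by (intro mult_mono) auto
    finally show ?thesis unfolding k by (simp add: gD_Cons[OF True])
  qed
qed simp

text \<open>The exponential is replaced by its tangent, because the averaging over rotations needs
  an expression linear in \<open>sD zs + D' zs\<close>.\<close>

lemma inverse_ge:
  assumes c: "c > 0" and g: "gD zs > 0" "D' zs > 0" and l: "length zs = m" "2 \<le> m"
  shows "1 / (gD zs * D' zs) \<ge> c ^ (m - 1) * (real m - c * (sD zs + D' zs))"
proof -
  have "c * D' zs \<le> exp (c * D' zs - 1)" using exp_ge_add_one_self[of "c * D' zs - 1"] by simp
  then have "exp (1 - c * D' zs) \<le> 1 / (c * D' zs)" using g c by (simp add: exp_diff field_simps)
  then have 1: "c * exp (1 - c * D' zs) \<le> 1 / D' zs" using c g by (simp add: field_simps)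
  have 2: "c ^ (m - 2) * exp (real (m - 2) - c * sD zs) \<le> 1 / gD zs" using inverse_gD_ge[OF c g(1)] l by simp
  have m: "m - 1 = Suc (m - 2)" using l by simp
  have "real m - c * (sD zs + D' zs) \<le> exp (real (m - 1) - c * (sD zs + D' zs))"
    using exp_ge_add_one_self[of "real (m - 1) - c * (sD zs + D' zs)"] l by simp
  then have "c ^ (m - 1) * (real m - c * (sD zs + D' zs)) \<le> c ^ (m - 1) * exp (real (m - 1) - c * (sD zs + D' zs))"
    using c by (intro mult_left_mono) auto
  also have "\<dots> = (c ^ (m - 2) * exp (real (m - 2) - c * sD zs)) * (c * exp (1 - c * D' zs))"
    unfolding m by (simp add: algebra_simps flip: exp_add)
  also have "\<dots> \<le> (1 / gD zs) * (1 / D' zs)"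
    using 1 2 c g by (intro mult_mono) auto
  finally show ?thesis by simp
qed

lemma pw_pos_gD:
  assumes "zs \<in> DL k X" "pw w zs > 0"
  shows "gD zs > 0"
  using assms
proof (induction zs arbitrary: k)
  case (Cons y zs)
  show ?case
  proof (cases "length zs \<ge> 2")
    case False
    then show ?thesis by (cases zs; cases "tl zs") auto
  next
    case True
    then have ne: "zs \<noteq> []" by auto
    have pos: "pw w zs > 0" "w y (hd zs) > 0"
      using Cons.prems(2) pw_nonneg[of zs] nonneg[of y "hd zs"] by (auto simp: pw_Cons[OF ne] zero_less_mult_iff)
    have "gD zs > 0" using Cons.IH[of "length zs"] Cons.prems pos by (auto simp: DL_def)
    moreover have "w (hd zs) y \<le> D zs" unfolding D_def
      using Cons.prems(1) finX by (intro w_le_d) (auto simp: DL_def)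
    ultimately show ?thesis using pos sym[of y] by (simp add: gD_Cons[OF True])
  qed
qed simp

text \<open>The weight of the edges that meet \<open>zs\<close>, in the form of
  \<open>touching_le\<close>.\<close>

definition T :: "'a list \<Rightarrow> real" where "T zs = (\<Sum>x\<in>set zs. d X x) - tot (set zs) / 2"

lemma T_le: "tot X = 2 \<Longrightarrow> zs \<in> DL k X \<Longrightarrow> T zs \<le> 1"
  using touching_le[OF finX, of "set zs"] by (simp add: T_def DL_def)

lemma d_Diff: "U \<subseteq> X \<Longrightarrow> d (X - U) x = d X x - d U x"
  using d_union[OF finX, of U x] by simp

lemma tot_insert:
  assumes "finite U" "y \<notin> U"
  shows "tot (insert y U) = tot U + 2 * d U y"
proof -
  have "d (insert y U) x = w x y + d U x" for x using assms by (simp add: d_def)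
  then have "tot (insert y U) = d U y + (\<Sum>x\<in>U. w x y + d U x)" using assms by (simp add: tot_def diag)
  also have "(\<Sum>x\<in>U. w x y + d U x) = d U y + tot U" by (simp add: sum.distrib tot_def d_def sym)
  finally show ?thesis by simp
qed

text \<open>Each edge that meets \<open>zs\<close> is counted at the end that joined earlier. The
  share of the initial vertex, the last of the list, is missing because the sum begins with lists of
  length two.\<close>

lemma sD_eq:
  assumes "zs \<in> DL k X" "2 \<le> length zs"
  shows "sD zs + D zs = T zs - d X (last zs)"
  using assms
proof (induction zs arbitrary: k)
  case (Cons y zs)
  have y: "y \<in> X" "y \<notin> set zs" "set zs \<subseteq> X" using Cons.prems(1) by (auto simp: DL_def)
  have DC: "D (y # zs) = d X y - d (set zs) y"
  proof -
    have "insert y (set zs) \<subseteq> X" using y by auto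
    then have "D (y # zs) = d X y - d (insert y (set zs)) y" by (simp add: D_def d_Diff)
    also have "d (insert y (set zs)) y = d (set zs) y" using y by (simp add: d_def diag)
    finally show ?thesis .
  qed
  have TC: "T (y # zs) = T zs + d X y - d (set zs) y"
    using y tot_insert[of "set zs" y] by (simp add: T_def add_divide_distrib)
  show ?case
  proof (cases "length zs \<ge> 2")
    case True
    then have ne: "zs \<noteq> []" by auto
    have "zs \<in> DL (length zs) X" using Cons.prems(1) by (auto simp: DL_def)
    then have "sD zs + D zs = T zs - d X (last zs)" using Cons.IH True by blast
    then show ?thesis using sD_Cons[OF True, of y] DC TC ne by simp
  next
    case False
    then obtain x where x: "zs = [x]" using Cons.prems(2) by (cases zs; cases "tl zs") auto
    have "T zs = d X x" by (simp add: T_def x tot_def d_def diag)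
    then show ?thesis using DC TC x by simp
  qed
qed simp

lemma s_eq:
  assumes "zs \<in> DL k X" "2 \<le> length zs"
  shows "sD zs + D' zs = T zs - d X (last zs) + w (hd zs) (last zs)"
  using sD_eq[OF assms] by (simp add: D'_def)

text \<open>On at least three vertices the ordered pairs along the cycle are distinct from their
  reversals, so together they fit into \<open>tot (set zs)\<close>.\<close>

lemma cyclic_weight_le:
  assumes "distinct zs" "length zs = m" "3 \<le> m"
  shows "(\<Sum>i<m. w (zs ! i) (zs ! (Suc i mod m))) \<le> tot (set zs) / 2"
proof -
  define A where "A = (\<lambda>i. (zs ! i, zs ! (Suc i mod m))) ` {..<m}"
  define B where "B = prod.swap ` A"
  have lt': "Suc i mod m < m" for i using assms(3) by simp
  have mem: "zs ! (Suc i mod m) \<in> set zs" for i using lt' assms(2) by (intro nth_mem) simp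
  have inj: "inj_on (\<lambda>i. (zs ! i, zs ! (Suc i mod m))) {..<m}"
    using assms by (auto simp: inj_on_def nth_eq_iff_index_eq)
  have sA: "(\<Sum>(x, y)\<in>A. w x y) = (\<Sum>i<m. w (zs ! i) (zs ! (Suc i mod m)))"
    unfolding A_def using sum.reindex[OF inj, of "\<lambda>(x, y). w x y"] by (simp add: comp_def)
  have sB: "(\<Sum>(x, y)\<in>B. w x y) = (\<Sum>(x, y)\<in>A. w x y)"
    unfolding B_def using sum.reindex[of prod.swap A "\<lambda>(x, y). w x y"] by (simp add: case_prod_unfold sym)
  have dis: "A \<inter> B = {}"
  proof (rule ccontr)
    assume "A \<inter> B \<noteq> {}"
    then obtain i j where ij: "i < m" "j < m" "zs ! i = zs ! (Suc j mod m)" "zs ! (Suc i mod m) = zs ! j"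
      by (auto simp: A_def B_def)
    have lt: "Suc i mod m < m" "Suc j mod m < m" using assms(3) by auto
    have "i = Suc j mod m" "Suc i mod m = j" using ij lt assms by (auto simp: nth_eq_iff_index_eq)
    then show False using assms(3) ij(1,2) by (auto simp: mod_Suc split: if_splits)
  qed
  have sub: "A \<union> B \<subseteq> set zs \<times> set zs"
    using assms(2) mem by (auto simp: A_def B_def)
  have "(\<Sum>(x, y)\<in>A. w x y) + (\<Sum>(x, y)\<in>B. w x y) = (\<Sum>(x, y)\<in>A \<union> B. w x y)"
    using dis by (intro sum.union_disjoint[symmetric]) (auto simp: A_def B_def)
  also have "\<dots> \<le> (\<Sum>(x, y)\<in>set zs \<times> set zs. w x y)"
    using sub by (intro sum_mono2) (auto simp: nonneg)
  also have "\<dots> = tot (set zs)" by (simp add: tot_def d_def sum.cartesian_product)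
  finally show ?thesis using sA sB by simp
qed

text \<open>\<open>cw\<close> is invariant under rotation, so the correction \<open>h\<close> by
  which \<open>sD zs + D' zs\<close> falls short of \<open>T\<close> may be averaged. Its sum over
  the m rotations is the degree sum minus the weight of the cycle, hence at least \<open>T\<close>;
  with \<open>T\<close> at most 1 the average of 1 minus the sum is at least 1/m.\<close>

lemma cycle_average:
  assumes t: "tot X = 2" and m: "3 \<le> m"
  shows "(\<Sum>zs\<in>DL m X. cw w zs * (1 - (sD zs + D' zs))) \<ge> Ssum w X m / real m"
proof -
  define h where "h zs = d X (last zs) - w (hd zs) (last zs)" for zs
  have ne: "zs \<noteq> []" "length zs = m" "distinct zs" if "zs \<in> DL m X" for zs using that m by (auto simp: DL_def)
  have "real m * (\<Sum>zs\<in>DL m X. cw w zs * h zs) = (\<Sum>r<m. \<Sum>zs\<in>DL m X. cw w (rotate r zs) * h (rotate r zs))"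
    using sum_DL_rotate[OF finX, where F = "\<lambda>zs. cw w zs * h zs" and k = m] by simp
  also have "\<dots> = (\<Sum>r<m. \<Sum>zs\<in>DL m X. cw w zs * h (rotate r zs))"
    by (intro sum.cong refl) (simp add: cw_rotate ne)
  also have "\<dots> = (\<Sum>zs\<in>DL m X. cw w zs * (\<Sum>r<m. h (rotate r zs)))"
    by (subst sum.swap) (simp add: sum_distrib_left)
  finally have avg: "real m * (\<Sum>zs\<in>DL m X. cw w zs * h zs) = (\<Sum>zs\<in>DL m X. cw w zs * (\<Sum>r<m. h (rotate r zs)))" .
  have hT: "(\<Sum>r<m. h (rotate r zs)) \<ge> T zs" if zs: "zs \<in> DL m X" for zs
  proof -
    have hr: "h (rotate (Suc i mod m) zs) = d X (zs ! i) - w (zs ! i) (zs ! (Suc i mod m))" if i: "i < m" for i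
    proof -
      have "hd (rotate (Suc i mod m) zs) = zs ! (Suc i mod m)"
        using ne[OF zs] by (simp add: hd_rotate_conv_nth)
      moreover have "last (rotate (Suc i mod m) zs) = zs ! i"
      proof -
        have "last (rotate (Suc i mod m) zs) = rotate (Suc i mod m) zs ! (m - 1)"
          using ne[OF zs] by (simp add: last_conv_nth)
        also have "\<dots> = zs ! ((Suc i mod m + (m - 1)) mod m)"
          using ne[OF zs] m by (simp add: nth_rotate add.commute)
        also have "(Suc i mod m + (m - 1)) mod m = (Suc i + (m - 1)) mod m" by (rule mod_add_left_eq)
        also have "Suc i + (m - 1) = i + m" using i by simp
        also have "(i + m) mod m = i" using i by simp
        finally show ?thesis .
      qed
      ultimately show ?thesis by (simp add: h_def sym)
    qed
    have bij: "bij_betw (\<lambda>i. Suc i mod m) {..<m} {..<m}"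
    proof -
      have "inj_on (\<lambda>i. Suc i mod m) {..<m}" by (auto simp: inj_on_def mod_Suc split: if_splits)
      moreover have "(\<lambda>i. Suc i mod m) ` {..<m} \<subseteq> {..<m}" using m by auto
      ultimately show ?thesis using endo_inj_surj[of "{..<m}"] by (auto simp: bij_betw_def)
    qed
    have "(\<Sum>r<m. h (rotate r zs)) = (\<Sum>i<m. h (rotate (Suc i mod m) zs))"
      by (rule sum.reindex_bij_betw[OF bij, symmetric])
    also have "\<dots> = (\<Sum>i<m. d X (zs ! i)) - (\<Sum>i<m. w (zs ! i) (zs ! (Suc i mod m)))"
      by (simp add: hr sum_subtractf)
    also have "(\<Sum>i<m. d X (zs ! i)) = (\<Sum>x\<in>set zs. d X x)"
      using ne[OF zs] by (intro sum.reindex_bij_betw) (auto simp: bij_betw_nth)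
    finally show ?thesis using cyclic_weight_le[of zs m] ne[OF zs] m by (simp add: T_def)
  qed
  have "(\<Sum>zs\<in>DL m X. cw w zs * (1 - (sD zs + D' zs))) = (\<Sum>zs\<in>DL m X. cw w zs * (1 - T zs) + cw w zs * h zs)"
  proof (rule sum.cong[OF refl])
    fix zs assume zs: "zs \<in> DL m X"
    have "2 \<le> length zs" using ne[OF zs] m by simp
    show "cw w zs * (1 - (sD zs + D' zs)) = cw w zs * (1 - T zs) + cw w zs * h zs"
      unfolding s_eq[OF zs \<open>2 \<le> length zs\<close>] h_def by (simp add: algebra_simps)
  qed
  also have "\<dots> = (\<Sum>zs\<in>DL m X. cw w zs * (1 - T zs)) + (\<Sum>zs\<in>DL m X. cw w zs * h zs)" by (rule sum.distrib)
  finally have "real m * (\<Sum>zs\<in>DL m X. cw w zs * (1 - (sD zs + D' zs)))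
      = (\<Sum>zs\<in>DL m X. cw w zs * (real m * (1 - T zs) + (\<Sum>r<m. h (rotate r zs))))"
    using avg by (simp add: distrib_left sum_distrib_left sum.distrib mult_ac)
  also have "\<dots> \<ge> (\<Sum>zs\<in>DL m X. cw w zs * 1)"
  proof (rule sum_mono)
    fix zs assume zs: "zs \<in> DL m X"
    have "(real m - 1) * (1 - T zs) \<ge> 0" using T_le[OF t zs] m by (intro mult_nonneg_nonneg) auto
    then have "1 \<le> real m * (1 - T zs) + (\<Sum>r<m. h (rotate r zs))" using hT[OF zs] by (simp add: algebra_simps)
    then show "cw w zs * 1 \<le> cw w zs * (real m * (1 - T zs) + (\<Sum>r<m. h (rotate r zs)))"
      by (intro mult_left_mono) (auto simp: cw_nonneg)
  qed
  finally show ?thesis using m by (simp add: Ssum_def field_simps)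
qed

text \<open>Let s be \<open>sD zs + D' zs\<close>. \<open>inverse_ge\<close> is used with c = m for
  cycles, where 1 - s averages to at least 1/m, and with c = m - 1 for paths, where s \<le> 1 holds
  for every list. Both kinds of outcome share the total probability 1.\<close>

theorem cycle_path_inequality:
  assumes t: "tot X = 2" and m: "3 \<le> m"
  shows "real m ^ (m - 1) * Ssum w X m + real (m - 1) ^ (m - 1) * Qsum w X m \<le> 2"
proof -
  have gpos: "gD zs > 0" if "zs \<in> DL m X" "pw w zs > 0" for zs using pw_pos_gD that by blast
  have len: "length zs = m" "2 \<le> length zs" if "zs \<in> DL m X" for zs using that m by (auto simp: DL_def)
  have C: "cw w zs / (2 * gD zs * D' zs) \<ge> real m ^ m / 2 * (cw w zs * (1 - (sD zs + D' zs)))"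
    if zs: "zs \<in> DL m X" for zs
  proof (cases "cw w zs = 0")
    case False
    then have "pw w zs > 0" "w (hd zs) (last zs) > 0"
      using pw_nonneg[of zs] nonneg[of "hd zs" "last zs"] by (auto simp: cw_def sym[of "last zs"] less_le)
    then have p: "gD zs > 0" "D' zs > 0" using gpos[OF zs] D_nonneg[of zs] by (auto simp: D'_def)
    have "real m ^ m / 2 * (cw w zs * (1 - (sD zs + D' zs)))
        = cw w zs / 2 * (real m ^ (m - 1) * (real m - real m * (sD zs + D' zs)))"
      using m by (simp add: power_eq_if[of _ m] algebra_simps)
    also have "\<dots> \<le> cw w zs / 2 * (1 / (gD zs * D' zs))"
      using inverse_ge[OF _ p len(1)[OF zs], of "real m"] m cw_nonneg[of zs] by (intro mult_left_mono) auto
    finally show ?thesis by (simp add: mult_ac)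
  qed simp
  have P: "pw w (y # zs) / (2 * gD zs * D' zs) \<ge> real (m - 1) ^ (m - 1) / 2 * pw w (y # zs)"
    if zs: "zs \<in> DL m X" and y: "y \<in> X - set zs" for zs y
  proof (cases "pw w (y # zs) = 0")
    case False
    have ne: "zs \<noteq> []" using len[OF zs] by auto
    have "pw w zs > 0" "w y (hd zs) > 0"
      using False pw_nonneg[of zs] nonneg[of y "hd zs"] by (auto simp: pw_Cons[OF ne] less_le)
    moreover have "w (hd zs) y \<le> D zs" unfolding D_def using y finX by (intro w_le_d) auto
    ultimately have p: "gD zs > 0" "D' zs > 0"
      using gpos[OF zs] nonneg[of "hd zs" "last zs"] sym[of y] by (auto simp: D'_def)
    have "hd zs \<in> X" using zs ne by (auto simp: DL_def)
    then have "w (hd zs) (last zs) \<le> d X (last zs)" using w_le_d[OF finX] sym by metis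
    then have "sD zs + D' zs \<le> 1" using s_eq[OF zs len(2)[OF zs]] T_le[OF t zs] by simp
    then have "real (m - 1) * (sD zs + D' zs) \<le> real (m - 1) * 1" by (intro mult_left_mono) auto
    moreover have "real m = real (m - 1) + 1" using m by (simp add: of_nat_diff)
    ultimately have one: "1 \<le> real m - real (m - 1) * (sD zs + D' zs)" by linarith
    have "real (m - 1) ^ (m - 1) * 1 \<le> real (m - 1) ^ (m - 1) * (real m - real (m - 1) * (sD zs + D' zs))"
      by (rule mult_left_mono[OF one]) simp
    also have "\<dots> \<le> 1 / (gD zs * D' zs)" using inverse_ge[OF _ p len(1)[OF zs], of "real (m - 1)"] m by simp
    finally have "pw w (y # zs) / 2 * real (m - 1) ^ (m - 1) \<le> pw w (y # zs) / 2 * (1 / (gD zs * D' zs))"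
      using pw_nonneg[of "y # zs"] by (intro mult_left_mono) auto
    then show ?thesis by (simp add: mult_ac)
  qed simp
  have "real m ^ (m - 1) / 2 * Ssum w X m = real m ^ m / 2 * (Ssum w X m / real m)"
    using m by (simp add: power_eq_if[of _ m])
  also have "\<dots> \<le> real m ^ m / 2 * (\<Sum>zs\<in>DL m X. cw w zs * (1 - (sD zs + D' zs)))"
    using cycle_average[OF t m] by (intro mult_left_mono) auto
  also have "\<dots> \<le> (\<Sum>zs\<in>DL m X. cw w zs / (2 * gD zs * D' zs))"
    unfolding sum_distrib_left by (intro sum_mono C)
  finally have 1: "real m ^ (m - 1) / 2 * Ssum w X m \<le> (\<Sum>zs\<in>DL m X. cw w zs / (2 * gD zs * D' zs))" .
  have 2: "real (m - 1) ^ (m - 1) / 2 * Qsum w X m \<le> (\<Sum>zs\<in>DL m X. \<Sum>y\<in>X - set zs. pw w (y # zs) / (2 * gD zs * D' zs))"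
    unfolding Qsum_def sum_DL_Suc[OF finX] sum_distrib_left by (intro sum_mono P)
  show ?thesis using 1 2 process_total[OF t, of m] m by simp
qed

text \<open>The constant 3 is an upper bound for e: m^(m-1) is at most 3 (m-1)^(m-1), and A + B
  \<le> 2 with nonnegative A and B implies A + 3/2 B \<le> 3.\<close>

corollary large_m_bound:
  assumes t: "tot X = 2" and m: "3 \<le> m"
  shows "Ssum w X m + Qsum w X m / 2 \<le> 3 * real m / real m ^ m"
proof -
  have S0: "Ssum w X m \<ge> 0" and Q0: "Qsum w X m \<ge> 0"
    by (auto simp: Ssum_def Qsum_def intro!: sum_nonneg cw_nonneg pw_nonneg)
  have "real m ^ (m - 1) = real (m - 1) ^ (m - 1) * (1 + 1 / real (m - 1)) ^ (m - 1)"
    using m by (simp add: field_simps of_nat_diff flip: power_mult_distrib)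
  moreover have "(1 + 1 / real (m - 1)) ^ (m - 1) \<le> exp (1 / real (m - 1)) ^ (m - 1)"
    using m by (intro power_mono) (auto intro: exp_ge_add_one_self)
  moreover have "exp (1 / real (m - 1)) ^ (m - 1) = exp 1"
    using m by (simp flip: exp_of_nat_mult)
  moreover have "exp (1::real) \<le> 3" by (rule exp_le)
  ultimately have eq: "real m ^ (m - 1) = real (m - 1) ^ (m - 1) * (1 + 1 / real (m - 1)) ^ (m - 1)"
    and le: "(1 + 1 / real (m - 1)) ^ (m - 1) \<le> 3" by linarith+
  have "real m ^ (m - 1) \<le> real (m - 1) ^ (m - 1) * 3"
    unfolding eq by (rule mult_left_mono[OF le]) simp
  then have "real m ^ (m - 1) * (Qsum w X m / 2) \<le> real (m - 1) ^ (m - 1) * 3 * (Qsum w X m / 2)"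
    using Q0 by (intro mult_right_mono) auto
  moreover have "real m ^ (m - 1) * Ssum w X m \<ge> 0" using S0 by simp
  ultimately have "real m ^ (m - 1) * (Ssum w X m + Qsum w X m / 2) \<le> 3"
    using cycle_path_inequality[OF t m] by (simp add: distrib_left)
  moreover have "real m ^ m = real m * real m ^ (m - 1)" using m by (simp add: power_eq_if)
  ultimately show ?thesis using m by (simp add: field_simps)
qed

end

section \<open>Optimality conditions for squarefree homogeneous polynomials on a simplex\<close>

lemma kkt_point:
  fixes c :: "'i \<Rightarrow> real" and M :: "'i \<Rightarrow> 'e set"
  assumes E: "finite E" "E \<noteq> {}" and I: "finite I"
    and M: "\<And>i. i \<in> I \<Longrightarrow> M i \<subseteq> E \<and> card (M i) = m"
    and P_def: "P = (\<lambda>W. \<Sum>i\<in>I. c i * (\<Prod>e\<in>M i. W e))"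
  shows "\<exists>W. (\<forall>e. W e \<ge> 0) \<and> (\<Sum>e\<in>E. W e) = 1 \<and>
    (\<forall>W'. (\<forall>e. W' e \<ge> 0) \<longrightarrow> (\<Sum>e\<in>E. W' e) = 1 \<longrightarrow> P W' \<le> P W) \<and>
    (\<forall>e\<in>E. (\<Sum>i\<in>{i\<in>I. e \<in> M i}. c i * (\<Prod>e\<in>M i. W e)) = real m * W e * P W)"
proof -
  \<comment> \<open>Coordinates outside \<open>E\<close> are fixed at 0, so that the box is a
    product of compact sets over the whole index type.\<close>
  define box where "box = {W :: 'e \<Rightarrow> real. \<forall>e. W e \<in> (if e \<in> E then {0..1} else {0})}"
  define K where "K = box \<inter> {W. (\<Sum>e\<in>E. W e) = 1}"
  have "box = PiE UNIV (\<lambda>e. if e \<in> E then {0..1} else {0})" 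
    unfolding box_def PiE_UNIV_domain Pi_def by simp
  moreover have "compactin (product_topology (\<lambda>_. euclidean) UNIV) (PiE UNIV (\<lambda>e. if e \<in> E then {0..1} else {0::real}))"
    unfolding compactin_PiE by auto
  ultimately have "compact box" by (simp add: euclidean_product_topology)
  moreover have cont: "continuous_on UNIV (\<lambda>W::'e \<Rightarrow> real. \<Sum>e\<in>E. W e)"
    by (intro continuous_intros continuous_on_product_coordinates)
  then have "closed {W::'e \<Rightarrow> real. (\<Sum>e\<in>E. W e) = 1}"
    by (intro closed_Collect_eq continuous_on_const)
  ultimately have "compact K" unfolding K_def by (rule compact_Int_closed)
  moreover have "K \<noteq> {}"
  proof -
    obtain a where a: "a \<in> E" using E by auto
    have "(\<lambda>e. if e = a then 1 else 0) \<in> K" using a E by (auto simp: K_def box_def)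
    then show ?thesis by blast
  qed
  moreover have "continuous_on K P"
    unfolding P_def
    by (intro continuous_intros continuous_on_subset[OF continuous_on_product_coordinates]) auto
  ultimately obtain W where W: "W \<in> K" "\<And>V. V \<in> K \<Longrightarrow> P V \<le> P W"
    using continuous_attains_sup[of K P] by blast
  have W0: "W e \<ge> 0" for e using W(1) by (auto simp: K_def box_def split: if_splits dest!: spec[of _ e])
  have W1: "(\<Sum>e\<in>E. W e) = 1" using W(1) by (simp add: K_def)
  have max: "P W' \<le> P W" if "\<And>e. W' e \<ge> 0" "(\<Sum>e\<in>E. W' e) = 1" for W'
  proof -
    define V where "V e = (if e \<in> E then W' e else 0)" for e
    have "P V = P W'" unfolding P_def
      by (intro sum.cong refl arg_cong2[of _ _ _ _ "(*)"] prod.cong) (use M in \<open>auto simp: V_def\<close>)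
    moreover have "V \<in> K"
    proof -
      have "W' e \<le> 1" if "e \<in> E" for e
        using member_le_sum[of e E W'] that E \<open>(\<Sum>e\<in>E. W' e) = 1\<close> \<open>\<And>e. W' e \<ge> 0\<close> by simp
      then show ?thesis using that by (auto simp: K_def box_def V_def)
    qed
    ultimately show ?thesis using W(2)[of V] by simp
  qed
  have kkt: "(\<Sum>i\<in>{i\<in>I. e \<in> M i}. c i * (\<Prod>e\<in>M i. W e)) = real m * W e * P W" if e: "e \<in> E" for e
  proof -
    \<comment> \<open>Multiply the coordinate \<open>e\<close> by 1 + t and divide all coordinates
      by their new sum s = 1 + t W e. The value becomes (P W + t f) / s^m by homogeneity and
      linearity in W e. Maximality makes \<open>\<phi>\<close> minimal at 0, and its derivative
      there vanishes.\<close>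
    define f where "f = (\<Sum>i\<in>{i\<in>I. e \<in> M i}. c i * (\<Prod>e\<in>M i. W e))"
    define \<phi> where "\<phi> t = P W * (1 + t * W e) ^ m - P W - t * f" for t
    have finM: "finite (M i)" if "i \<in> I" for i using M[OF that] E finite_subset by blast
    have "\<phi> 0 \<le> \<phi> t" if t: "\<bar>0 - t\<bar> < 1" for t
    proof -
      have "W e \<le> 1" using member_le_sum[of e E W] e E W1 W0 by simp
      then have "\<bar>t * W e\<bar> < 1" using t W0[of e] mult_mono[of "\<bar>t\<bar>" "\<bar>t\<bar>" "W e" 1] by (simp add: abs_mult)
      then have pos: "1 + t * W e > 0" by linarith
      define s where "s = 1 + t * W e"
      define V where "V x = (if x = e then W x * (1 + t) else W x)" for x
      have "(\<Sum>x\<in>E. V x) = V e + (\<Sum>x\<in>E - {e}. V x)" using E e by (intro sum.remove) auto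
      also have "\<dots> = W e * (1 + t) + (\<Sum>x\<in>E - {e}. W x)" by (simp add: V_def)
      also have "\<dots> = s" using sum.remove[OF E(1) e, of W] W1 by (simp add: s_def algebra_simps)
      finally have "(\<Sum>x\<in>E. V x / s) = 1" using pos by (simp add: s_def flip: sum_divide_distrib)
      moreover have "V x / s \<ge> 0" for x using W0[of x] t pos by (auto simp: V_def s_def)
      ultimately have le: "P (\<lambda>x. V x / s) \<le> P W" by (intro max)
      have prodV: "(\<Prod>x\<in>M i. V x) = (if e \<in> M i then 1 + t else 1) * (\<Prod>x\<in>M i. W x)" if "i \<in> I" for i
      proof (cases "e \<in> M i")
        case True
        have "(\<Prod>x\<in>M i. V x) = V e * (\<Prod>x\<in>M i - {e}. V x)" using finM[OF that] True by (intro prod.remove)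
        also have "(\<Prod>x\<in>M i - {e}. V x) = (\<Prod>x\<in>M i - {e}. W x)" by (simp add: V_def)
        finally show ?thesis using True prod.remove[OF finM[OF that] True, of W] by (simp add: V_def)
      next
        case False
        then have "(\<Prod>x\<in>M i. V x) = (\<Prod>x\<in>M i. W x)" by (intro prod.cong refl) (auto simp: V_def)
        then show ?thesis using False by simp
      qed
      have "P (\<lambda>x. V x / s) = (\<Sum>i\<in>I. c i * (\<Prod>x\<in>M i. V x)) / s ^ m"
        unfolding P_def sum_divide_distrib by (intro sum.cong refl) (use M in \<open>simp add: prod_dividef\<close>)
      also have "(\<Sum>i\<in>I. c i * (\<Prod>x\<in>M i. V x)) = (\<Sum>i\<in>I. c i * (\<Prod>x\<in>M i. W x) + (if e \<in> M i then t * (c i * (\<Prod>x\<in>M i. W x)) else 0))"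
        by (intro sum.cong refl) (auto simp: prodV algebra_simps)
      also have "\<dots> = P W + (\<Sum>i\<in>I. if e \<in> M i then t * (c i * (\<Prod>x\<in>M i. W x)) else 0)"
        unfolding sum.distrib P_def by simp
      also have "(\<Sum>i\<in>I. if e \<in> M i then t * (c i * (\<Prod>x\<in>M i. W x)) else 0) = t * f"
        unfolding f_def sum_distrib_left by (rule sum.inter_filter[OF I, symmetric])
      finally have "P (\<lambda>x. V x / s) * s ^ m = P W + t * f" using pos by (simp add: s_def)
      then have "P W + t * f \<le> P W * s ^ m" using mult_right_mono[OF le, of "s ^ m"] pos by (simp add: s_def)
      then show ?thesis by (simp add: \<phi>_def s_def)
    qed
    moreover have "(\<phi> has_real_derivative (P W * (real m * W e) - f)) (at 0)"
      unfolding \<phi>_def by (auto intro!: derivative_eq_intros)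
    ultimately have "P W * (real m * W e) - f = 0" by (intro DERIV_local_min[of \<phi> _ 0 1]) auto
    then show ?thesis by (simp add: f_def mult_ac)
  qed
  show ?thesis by (intro exI[of _ W] conjI allI impI ballI) (use W0 W1 max kkt in auto)
qed

text \<open>At a maximiser the optimality condition for a heaviest edge bounds the maximum itself:
  the terms through \<open>e\<close> equal m W e P W, and \<open>step\<close> compares them with m W
  e B. Homogeneity extends the bound from the simplex to all weights.\<close>

lemma kkt_bound:
  fixes c :: "'i \<Rightarrow> real" and M :: "'i \<Rightarrow> 'e set"
  assumes E: "finite E" and I: "finite I" and m: "m \<ge> 1" and B: "B \<ge> 0" and c: "\<And>i. i \<in> I \<Longrightarrow> c i \<ge> 0"
    and M: "\<And>i. i \<in> I \<Longrightarrow> M i \<subseteq> E \<and> card (M i) = m"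
    and step: "\<And>W e. (\<And>e. W e \<ge> 0) \<Longrightarrow> (\<Sum>e\<in>E. W e) = 1 \<Longrightarrow> e \<in> E \<Longrightarrow> (\<And>e'. e' \<in> E \<Longrightarrow> W e' \<le> W e) \<Longrightarrow>
       real m * W e \<le> 1 \<Longrightarrow> (\<Sum>i\<in>{i\<in>I. e \<in> M i}. c i * (\<Prod>e\<in>M i. W e)) \<le> real m * W e * B"
    and V: "\<And>e. V e \<ge> 0"
  shows "(\<Sum>i\<in>I. c i * (\<Prod>e\<in>M i. V e)) \<le> B * (\<Sum>e\<in>E. V e) ^ m"
proof (cases "E = {}")
  case True
  then have "I = {}" using M m by fastforce
  then show ?thesis using B V by (simp add: sum_nonneg)
next
  case False
  define P where "P = (\<lambda>W. \<Sum>i\<in>I. c i * (\<Prod>e\<in>M i. W e))"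
  have "\<exists>W. (\<forall>e. W e \<ge> 0) \<and> (\<Sum>e\<in>E. W e) = 1 \<and>
      (\<forall>W'. (\<forall>e. W' e \<ge> 0) \<longrightarrow> (\<Sum>e\<in>E. W' e) = 1 \<longrightarrow> P W' \<le> P W) \<and>
      (\<forall>e\<in>E. (\<Sum>i\<in>{i\<in>I. e \<in> M i}. c i * (\<Prod>e\<in>M i. W e)) = real m * W e * P W)"
    by (rule kkt_point[OF E False I _ P_def]) (rule M)
  then obtain W where W: "\<forall>e. W e \<ge> 0" "(\<Sum>e\<in>E. W e) = 1"
    "\<forall>W'. (\<forall>e. W' e \<ge> 0) \<longrightarrow> (\<Sum>e\<in>E. W' e) = 1 \<longrightarrow> P W' \<le> P W"
    "\<forall>e\<in>E. (\<Sum>i\<in>{i\<in>I. e \<in> M i}. c i * (\<Prod>e\<in>M i. W e)) = real m * W e * P W"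
    by (elim exE conjE)
  have PW: "P W \<le> B"
  proof (cases "P W > 0")
    case True
    have "Max (W ` E) \<in> W ` E" using E False by (intro Max_in) auto
    then obtain e where e: "e \<in> E" "W e = Max (W ` E)" by auto
    then have mx: "W e' \<le> W e" if "e' \<in> E" for e' using E that by simp
    have pos: "W e > 0"
    proof (rule ccontr)
      assume "\<not> W e > 0"
      then have "(\<Sum>e\<in>E. W e) \<le> 0" using mx by (intro sum_nonpos) (meson linorder_not_less order_trans)
      then show False using W(2) by simp
    qed
    \<comment> \<open>The terms through \<open>e\<close> are only a part of \<open>P W\<close>; this
      is where the side condition \<open>real m * W e \<le> 1\<close> of \<open>step\<close> comes
      from.\<close>
    have f: "(\<Sum>i\<in>{i\<in>I. e \<in> M i}. c i * (\<Prod>e\<in>M i. W e)) \<le> P W"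
      unfolding P_def using I W(1) c by (intro sum_mono2) (auto intro!: mult_nonneg_nonneg prod_nonneg)
    then have "real m * W e * P W \<le> 1 * P W" using bspec[OF W(4) e(1)] by simp
    then have "real m * W e \<le> 1" using True by (simp only: mult_le_cancel_right_pos)
    then have "real m * W e * P W \<le> real m * W e * B" using step[OF spec[OF W(1)] W(2) e(1) mx] bspec[OF W(4) e(1)] by simp
    then show ?thesis using pos m by simp
  qed (use B in simp)
  define s where "s = (\<Sum>e\<in>E. V e)"
  have finM: "finite (M i)" "M i \<noteq> {}" if "i \<in> I" for i using M[OF that] E m finite_subset by (blast, fastforce)
  show ?thesis
  proof (cases "s = 0")
    case True
    then have "V e = 0" if "e \<in> E" for e using that E V by (simp add: s_def sum_nonneg_eq_0_iff)
    then have "(\<Prod>e\<in>M i. V e) = 0" if "i \<in> I" for i using finM[OF that] M[OF that] by (auto simp: prod_zero_iff)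
    then have "(\<Sum>i\<in>I. c i * (\<Prod>e\<in>M i. V e)) = 0" by (simp add: sum.neutral)
    then show ?thesis using B V by (simp add: sum_nonneg)
  next
    case False
    have s: "s > 0" using False V sum_nonneg[of E V] by (simp add: s_def less_le)
    have "P (\<lambda>e. V e / s) \<le> P W"
      using s V by (intro W(3)[rule_format]) (auto simp: s_def simp flip: sum_divide_distrib)
    moreover have "P (\<lambda>e. V e / s) = (\<Sum>i\<in>I. c i * (\<Prod>e\<in>M i. V e)) / s ^ m"
      unfolding P_def sum_divide_distrib by (intro sum.cong refl) (use M in \<open>simp add: prod_dividef\<close>)
    ultimately have "(\<Sum>i\<in>I. c i * (\<Prod>e\<in>M i. V e)) / s ^ m \<le> B" using PW by linarith
    then show ?thesis using s by (simp add: s_def pos_divide_le_eq)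
  qed
qed

definition ce :: "'a list \<Rightarrow> 'a set set" where
  "ce xs = insert {last xs, hd xs} (pe xs)"

lemma pe_edges: "distinct xs \<Longrightarrow> e \<in> pe xs \<Longrightarrow> card e = 2"
  by (induction xs rule: pe.induct) auto

lemma finite_pe [simp]: "finite (pe xs)"
  by (induction xs rule: pe.induct) auto

lemma pe_pw:
  assumes "distinct xs"
  shows "card (pe xs) = length xs - 1 \<and> (\<Prod>e\<in>pe xs. W e) = pw (\<lambda>x y. W {x, y}) xs"
  using assms
proof (induction xs rule: pe.induct)
  case (1 x y xs)
  then have "{x, y} \<notin> pe (y # xs)" using pe_sub[of "{x, y}" "y # xs"] by auto
  then show ?case using 1 by simp
qed auto

lemma ce_cw:
  assumes "distinct xs" "3 \<le> length xs"
  shows "card (ce xs) = length xs \<and> (\<Prod>e\<in>ce xs. W e) = cw (\<lambda>x y. W {x, y}) xs"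
proof -
  obtain x y z zs where xs: "xs = x # y # z # zs" using assms(2)
    by (metis (no_types, opaque_lifting) Suc_le_length_iff numeral_3_eq_3)
  have l: "last xs \<in> set (z # zs)" using last_in_set[of "z # zs"] by (simp add: xs)
  have "{last xs, hd xs} \<notin> pe xs"
  proof
    assume "{last xs, hd xs} \<in> pe xs"
    moreover have "{last xs, hd xs} \<notin> pe (y # z # zs)"
      using pe_sub[of "{last xs, hd xs}" "y # z # zs"] assms(1) xs by auto
    ultimately have "{last xs, hd xs} = {x, y}" by (simp add: xs)
    then have "last xs = x \<or> last xs = y" by (auto simp: doubleton_eq_iff)
    then show False using l assms(1) xs by auto
  qed
  then show ?thesis using pe_pw[OF assms(1)] assms(2) by (simp add: ce_def cw_def)
qed

lemma ce_edges: "distinct xs \<Longrightarrow> 3 \<le> length xs \<Longrightarrow> e \<in> ce xs \<Longrightarrow> e \<subseteq> set xs \<and> card e = 2"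
proof -
  assume a: "distinct xs" "3 \<le> length xs" "e \<in> ce xs"
  then have "last xs \<in> set xs" "hd xs \<in> set xs" by (auto intro!: last_in_set hd_in_set)
  moreover have "last xs \<noteq> hd xs" using a by (cases xs) auto
  ultimately show ?thesis using a pe_sub[of e xs] pe_edges[of xs e] by (auto simp: ce_def)
qed

lemma sum_le_images:
  fixes F :: "'b \<Rightarrow> real"
  assumes "finite A" "L \<subseteq> (\<Union>\<phi>\<in>set \<phi>s. \<phi> ` A)" "\<And>x. F x \<ge> 0"
  shows "(\<Sum>x\<in>L. F x) \<le> (\<Sum>\<phi>\<leftarrow>\<phi>s. \<Sum>a\<in>A. F (\<phi> a))"
proof -
  have "(\<Sum>x\<in>(\<Union>\<phi>\<in>set \<phi>s. \<phi> ` A). F x) \<le> (\<Sum>\<phi>\<leftarrow>\<phi>s. \<Sum>a\<in>A. F (\<phi> a))"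
  proof (induction \<phi>s)
    case (Cons \<phi> \<phi>s)
    have "(\<Sum>x\<in>\<phi> ` A \<union> (\<Union>\<phi>\<in>set \<phi>s. \<phi> ` A). F x) \<le> (\<Sum>x\<in>\<phi> ` A. F x) + (\<Sum>x\<in>(\<Union>\<phi>\<in>set \<phi>s. \<phi> ` A). F x)"
      using assms(1,3) by (simp add: sum_Un sum_nonneg)
    also have "(\<Sum>x\<in>\<phi> ` A. F x) \<le> (\<Sum>a\<in>A. F (\<phi> a))"
      using sum_image_le[OF assms(1), of F \<phi>] assms(3) by (simp add: comp_def)
    finally show ?case using Cons.IH by simp
  qed simp
  moreover have "(\<Sum>x\<in>L. F x) \<le> (\<Sum>x\<in>(\<Union>\<phi>\<in>set \<phi>s. \<phi> ` A). F x)"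
    using assms by (intro sum_mono2) auto
  ultimately show ?thesis by linarith
qed

text \<open>The reduction of the optimisation problem to its optimality condition at a heaviest edge.\<close>

lemma (in weights) heaviest_edge_bound:
  assumes m: "3 \<le> m" and B: "B \<ge> 0"
    and step: "\<And>w' u v. weights X w' \<Longrightarrow> weights.tot w' X = 2 \<Longrightarrow> u \<in> X \<Longrightarrow> v \<in> X \<Longrightarrow> u \<noteq> v \<Longrightarrow>
      (\<And>x y. x \<in> X \<Longrightarrow> y \<in> X \<Longrightarrow> w' x y \<le> w' u v) \<Longrightarrow> real m * w' u v \<le> 1 \<Longrightarrow>
      (\<Sum>xs\<in>{xs\<in>DL m X. {u, v} \<in> ce xs}. cw w' xs) + (\<Sum>xs\<in>{xs\<in>DL (Suc m) X. {u, v} \<in> pe xs}. pw w' xs) / 2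
        \<le> real m * w' u v * B"
  shows "Ssum w X m + Qsum w X m / 2 \<le> B * (tot X / 2) ^ m"
proof -
  define E where "E = {e. e \<subseteq> X \<and> card e = 2}"
  define I where "I = DL m X \<union> DL (Suc m) X"
  define c where "c xs = (if length xs = m then 1 else 1 / 2 :: real)" for xs :: "'a list"
  define M where "M xs = (if length xs = m then ce xs else pe xs)" for xs :: "'a list"
  have finE: "finite E" using finX by (simp add: E_def)
  have finI: "finite I" using finX by (simp add: I_def finite_DL)
  have M: "M xs \<subseteq> E \<and> card (M xs) = m" if "xs \<in> I" for xs
  proof -
    have x: "distinct xs" "set xs \<subseteq> X" "length xs = m \<or> length xs = Suc m" using that by (auto simp: I_def DL_def)
    show ?thesis
    proof (cases "length xs = m")
      case True
      then show ?thesis using x m ce_cw[OF x(1)] ce_edges[OF x(1)] by (fastforce simp: M_def E_def)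
    next
      case False
      then show ?thesis using x pe_pw[OF x(1)] pe_edges[OF x(1)] pe_sub by (fastforce simp: M_def E_def)
    qed
  qed
  have split: "(\<Sum>xs\<in>{xs\<in>I. Z xs}. c xs * (\<Prod>e\<in>M xs. W e)) =
      (\<Sum>xs\<in>{xs\<in>DL m X. Z xs}. cw (\<lambda>x y. W {x, y}) xs) + (\<Sum>xs\<in>{xs\<in>DL (Suc m) X. Z xs}. pw (\<lambda>x y. W {x, y}) xs) / 2" for W Z
  proof -
    have "{xs\<in>I. Z xs} = {xs\<in>DL m X. Z xs} \<union> {xs\<in>DL (Suc m) X. Z xs}" by (auto simp: I_def)
    moreover have "{xs\<in>DL m X. Z xs} \<inter> {xs\<in>DL (Suc m) X. Z xs} = {}" by (auto simp: DL_def)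
    ultimately have "(\<Sum>xs\<in>{xs\<in>I. Z xs}. c xs * (\<Prod>e\<in>M xs. W e)) =
      (\<Sum>xs\<in>{xs\<in>DL m X. Z xs}. c xs * (\<Prod>e\<in>M xs. W e)) + (\<Sum>xs\<in>{xs\<in>DL (Suc m) X. Z xs}. c xs * (\<Prod>e\<in>M xs. W e))"
      using finX by (simp add: finite_DL sum.union_disjoint)
    also have "(\<Sum>xs\<in>{xs\<in>DL m X. Z xs}. c xs * (\<Prod>e\<in>M xs. W e)) = (\<Sum>xs\<in>{xs\<in>DL m X. Z xs}. cw (\<lambda>x y. W {x, y}) xs)"
      using m by (intro sum.cong refl) (auto simp: c_def M_def DL_def ce_cw)
    also have "(\<Sum>xs\<in>{xs\<in>DL (Suc m) X. Z xs}. c xs * (\<Prod>e\<in>M xs. W e)) = (\<Sum>xs\<in>{xs\<in>DL (Suc m) X. Z xs}. pw (\<lambda>x y. W {x, y}) xs) / 2"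
      unfolding sum_divide_distrib by (intro sum.cong refl) (auto simp: c_def M_def DL_def pe_pw)
    finally show ?thesis .
  qed
  define wW where "wW W x y = (if {x, y} \<in> E then W {x, y} else 0)" for W :: "'a set \<Rightarrow> real" and x y
  have wts: "weights X (wW W)" if "\<And>e. W e \<ge> 0" for W
    by unfold_locales (use finX that in \<open>auto simp: wW_def E_def insert_commute\<close>)
  have totW: "weights.tot (wW W) X = 2 * (\<Sum>e\<in>E. W e)" if "\<And>e. W e \<ge> 0" for W
  proof -
    interpret W: weights X "wW W" by (rule wts[OF that])
    have "W.tot X = (\<Sum>(x, y)\<in>X \<times> X. wW W x y)" by (simp add: W.tot_def W.d_def sum.cartesian_product)
    also have "\<dots> = (\<Sum>(x, y)\<in>{(x, y)\<in>X \<times> X. x \<noteq> y}. wW W x y)"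
      using finX by (intro sum.mono_neutral_right) (auto simp: W.diag)
    also have "\<dots> = (\<Sum>e\<in>E. \<Sum>(x, y)\<in>{p\<in>{(x, y)\<in>X \<times> X. x \<noteq> y}. {fst p, snd p} = e}. wW W x y)"
      using finX finE by (intro sum.group[symmetric]) (auto simp: E_def intro: finite_subset[of _ "X \<times> X"])
    also have "\<dots> = (\<Sum>e\<in>E. 2 * W e)"
    proof (rule sum.cong[OF refl])
      fix e assume e: "e \<in> E"
      then obtain a b where ab: "e = {a, b}" "a \<noteq> b" by (auto simp: E_def card_2_iff)
      have "{p\<in>{(x, y)\<in>X \<times> X. x \<noteq> y}. {fst p, snd p} = e} = {(a, b), (b, a)}"
        using ab e by (auto simp: E_def doubleton_eq_iff)
      then show "(\<Sum>(x, y)\<in>{p\<in>{(x, y)\<in>X \<times> X. x \<noteq> y}. {fst p, snd p} = e}. wW W x y) = 2 * W e"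
        using ab e by (simp add: wW_def insert_commute)
    qed
    finally show ?thesis by (simp add: sum_distrib_left)
  qed
  have cong: "cw (\<lambda>x y. W {x, y}) xs = cw (wW W) xs" if "xs \<in> DL m X" for W xs
  proof -
    have x: "distinct xs" "set xs \<subseteq> X" "3 \<le> length xs" using that m by (auto simp: DL_def)
    have "(\<Prod>e\<in>ce xs. W e) = (\<Prod>e\<in>ce xs. if e \<in> E then W e else 0)"
      by (intro prod.cong refl) (use ce_edges[OF x(1,3)] x(2) in \<open>auto simp: E_def\<close>)
    then show ?thesis using ce_cw[OF x(1,3), of W] ce_cw[OF x(1,3), of "\<lambda>e. if e \<in> E then W e else 0"]
      by (simp add: wW_def[abs_def])
  qed
  have cong': "pw (\<lambda>x y. W {x, y}) xs = pw (wW W) xs" if "xs \<in> DL k X" for W xs k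
  proof -
    have x: "distinct xs" "set xs \<subseteq> X" using that by (auto simp: DL_def)
    have "(\<Prod>e\<in>pe xs. W e) = (\<Prod>e\<in>pe xs. if e \<in> E then W e else 0)"
      by (intro prod.cong refl) (use pe_edges[OF x(1)] pe_sub[of _ xs] x(2) in \<open>auto simp: E_def\<close>)
    then show ?thesis using pe_pw[OF x(1), of W] pe_pw[OF x(1), of "\<lambda>e. if e \<in> E then W e else 0"]
      by (simp add: wW_def[abs_def])
  qed
  have bound: "(\<Sum>xs\<in>I. c xs * (\<Prod>e\<in>M xs. V e)) \<le> B * (\<Sum>e\<in>E. V e) ^ m" if V: "\<And>e. V e \<ge> 0" for V
  proof (rule kkt_bound[OF finE finI _ B _ M])
    fix W :: "'a set \<Rightarrow> real" and e
    assume W: "\<And>e. W e \<ge> 0" "(\<Sum>e\<in>E. W e) = 1" and e: "e \<in> E" and mx: "\<And>e'. e' \<in> E \<Longrightarrow> W e' \<le> W e"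
      and le: "real m * W e \<le> 1"
    obtain u v where uv: "e = {u, v}" "u \<noteq> v" "u \<in> X" "v \<in> X" using e by (auto simp: E_def card_2_iff)
    have we: "wW W u v = W e" using e uv by (simp add: wW_def)
    have "(\<Sum>xs\<in>{xs\<in>DL m X. {u, v} \<in> ce xs}. cw (wW W) xs) + (\<Sum>xs\<in>{xs\<in>DL (Suc m) X. {u, v} \<in> pe xs}. pw (wW W) xs) / 2
        \<le> real m * wW W u v * B"
      using wts[OF W(1)] totW[OF W(1)] W uv mx le by (intro step) (auto simp: we, auto simp: wW_def)
    moreover have "{xs\<in>I. e \<in> M xs} = {xs\<in>I. if length xs = m then {u, v} \<in> ce xs else {u, v} \<in> pe xs}"
      by (auto simp: M_def uv)
    moreover have "{xs\<in>DL m X. if length xs = m then {u, v} \<in> ce xs else {u, v} \<in> pe xs} = {xs\<in>DL m X. {u, v} \<in> ce xs}"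
      "{xs\<in>DL (Suc m) X. if length xs = m then {u, v} \<in> ce xs else {u, v} \<in> pe xs} = {xs\<in>DL (Suc m) X. {u, v} \<in> pe xs}"
      by (auto simp: DL_def)
    ultimately show "(\<Sum>xs\<in>{xs\<in>I. e \<in> M xs}. c xs * (\<Prod>e\<in>M xs. W e)) \<le> real m * W e * B"
      by (simp add: split we cong cong'[where k = "Suc m"])
  qed (use m V in \<open>auto simp: c_def\<close>)
  \<comment> \<open>The weight of an unordered pair is read off from \<open>w\<close> by choosing an
    order of its elements; symmetry makes the choice immaterial.\<close>
  define V where "V e = (if e \<in> E then w (SOME x. x \<in> e) (SOME y. y \<in> e \<and> y \<noteq> (SOME x. x \<in> e)) else 0)" for e
  have V: "V {x, y} = w x y" if "x \<in> X" "y \<in> X" "x \<noteq> y" for x y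
  proof -
    have "(SOME z. z \<in> {x, y}) = x \<or> (SOME z. z \<in> {x, y}) = y" using someI[of "\<lambda>z. z \<in> {x, y}" x] by auto
    moreover have "(SOME z. z \<in> {x, y} \<and> z \<noteq> x) = y" "(SOME z. z \<in> {x, y} \<and> z \<noteq> y) = x" using that by (auto intro!: some_equality)
    moreover have "{x, y} \<in> E" using that by (auto simp: E_def)
    ultimately show ?thesis using sym unfolding V_def by metis
  qed
  have V0: "V e \<ge> 0" for e by (simp add: V_def nonneg)
  have wV: "wW V x y = w x y" if "x \<in> X" "y \<in> X" for x y
    by (cases "x = y") (use V[OF that] diag that in \<open>auto simp: wW_def E_def card_insert_if\<close>)
  have "tot X = weights.tot (wW V) X"
    unfolding weights.tot_def[OF wts[OF V0]] weights.d_def[OF wts[OF V0]] tot_def d_def by (intro sum.cong refl) (simp add: wV)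
  then have tV: "(\<Sum>e\<in>E. V e) = tot X / 2" using totW[OF V0] by simp
  have pwV: "pw (wW V) xs = pw w xs" if "set xs \<subseteq> X" for xs
    using that by (induction xs rule: induct_list012) (auto simp: wV)
  have "cw (wW V) xs = cw w xs" if "xs \<in> DL m X" for xs
  proof -
    have "xs \<noteq> []" "set xs \<subseteq> X" using that m by (auto simp: DL_def)
    then have "last xs \<in> X" "hd xs \<in> X" using last_in_set hd_in_set by blast+
    then show ?thesis using pwV \<open>set xs \<subseteq> X\<close> by (simp add: cw_def wV)
  qed
  then have "Ssum w X m + Qsum w X m / 2 = (\<Sum>xs\<in>I. c xs * (\<Prod>e\<in>M xs. V e))"
    using split[of V "\<lambda>_. True"] cong[of _ V] cong'[where k = "Suc m" and W = V] pwV
    by (simp add: Ssum_def Qsum_def DL_def)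
  then show ?thesis using bound[of V, OF V0] tV by simp
qed

section \<open>The optimisation for m = 3, 4 and 2\<close>

lemma quadratic_estimate:
  fixes w \<sigma> \<rho> c p :: real
  assumes "w \<ge> 0" "\<sigma> \<ge> 0" "\<rho> \<ge> 0" "w + \<sigma> + \<rho> = 1" "3 * w \<le> 1" "c \<le> w * \<sigma> / 2" "p \<le> \<sigma>\<^sup>2 / 4"
  shows "5 * c + p + \<sigma> * \<rho> \<le> 2 / 3"
proof -
  \<comment> \<open>\<open>k\<close> and \<open>\<rho>\<close> vanish at the extremal triangle,
    whose weights are 1/3; the slack is therefore expressed through them.\<close>
  define k where "k = 1 - 3 * w"
  have k: "k \<ge> 0" "\<sigma> = 2 * w + k - \<rho>" using assms by (auto simp: k_def)
  have "5 * c + p + \<sigma> * \<rho> \<le> 5 * (w * \<sigma> / 2) + \<sigma>\<^sup>2 / 4 + \<sigma> * \<rho>" using assms by linarith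
  also have "\<dots> = 2 / 3 * (3 * w + k)\<^sup>2 - (w * k / 2 + 3 / 2 * (w * \<rho>) + (k - \<rho>)\<^sup>2 / 4 + k\<^sup>2 / 6 + \<rho>\<^sup>2 / 2)"
    unfolding k(2) by (simp add: power2_eq_square field_simps)
  also have "\<dots> \<le> 2 / 3 * (3 * w + k)\<^sup>2"
  proof -
    have "0 \<le> w * k / 2 + 3 / 2 * (w * \<rho>) + (k - \<rho>)\<^sup>2 / 4 + k\<^sup>2 / 6 + \<rho>\<^sup>2 / 2"
      using assms k(1) by (intro add_nonneg_nonneg) auto
    then show ?thesis by linarith
  qed
  also have "\<dots> = 2 / 3" by (simp add: k_def)
  finally show ?thesis .
qed

text \<open>Here a is half the weight between a heaviest edge and the rest, \<rho> the weight inside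
  the rest and r its heaviest edge, with r at most half of \<rho>. The slack against the cube of the
  total is a form in a, r and s = \<rho> - 2r with a single negative coefficient, treated in
  \<open>key\<close>.\<close>

lemma cubic_estimate_small:
  fixes a \<rho> r :: real
  assumes "a \<ge> 0" "r \<ge> 0" "2 * r \<le> \<rho>" "2 * a + r + \<rho> \<le> 1"
  shows "7 * (r * a\<^sup>2) + a\<^sup>2 * \<rho> + 2 * a * (\<rho>\<^sup>2 / 4) \<le> 1 / 8"
proof -
  define s where "s = \<rho> - 2 * r"
  have s: "s \<ge> 0" "\<rho> = 2 * r + s" using assms by (auto simp: s_def)
  have key: "8 * a ^ 3 - 36 * (a\<^sup>2 * r) + 38 * (a * r\<^sup>2) + 27 * r ^ 3 \<ge> 0"
  proof (cases "a \<le> 10 * r")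
    case True
    have "8 * a ^ 3 - 36 * (a\<^sup>2 * r) + 38 * (a * r\<^sup>2) + 27 * r ^ 3
        = 8 * a * (a - 9 / 4 * r)\<^sup>2 + r\<^sup>2 * (27 * r - 5 / 2 * a)"
      by (simp add: power2_eq_square power3_eq_cube algebra_simps)
    also have "\<dots> \<ge> 0" using assms True by (intro add_nonneg_nonneg mult_nonneg_nonneg) auto
    finally show ?thesis .
  next
    case False
    have "8 * a ^ 3 - 36 * (a\<^sup>2 * r) + 38 * (a * r\<^sup>2) + 27 * r ^ 3
        = 4 * a\<^sup>2 * (2 * a - 9 * r) + 38 * (a * r\<^sup>2) + 27 * r ^ 3"
      by (simp add: power2_eq_square power3_eq_cube algebra_simps)
    also have "\<dots> \<ge> 0" using assms False by (intro add_nonneg_nonneg mult_nonneg_nonneg) auto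
    finally show ?thesis .
  qed
  have "8 * (7 * (r * a\<^sup>2) + a\<^sup>2 * \<rho> + 2 * a * (\<rho>\<^sup>2 / 4)) = (2 * a + r + \<rho>) ^ 3
     - ((8 * a ^ 3 - 36 * (a\<^sup>2 * r) + 38 * (a * r\<^sup>2) + 27 * r ^ 3)
       + (4 * (a\<^sup>2 * s) + 20 * (a * r * s) + 2 * (a * s\<^sup>2) + 27 * (r\<^sup>2 * s) + 9 * (r * s\<^sup>2) + s ^ 3))"
    unfolding s(2) by (simp add: power2_eq_square power3_eq_cube algebra_simps)
  also have "\<dots> \<le> (2 * a + r + \<rho>) ^ 3"
  proof -
    have "0 \<le> 4 * (a\<^sup>2 * s) + 20 * (a * r * s) + 2 * (a * s\<^sup>2) + 27 * (r\<^sup>2 * s) + 9 * (r * s\<^sup>2) + s ^ 3"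
      using assms s(1) by (intro add_nonneg_nonneg mult_nonneg_nonneg zero_le_power) auto
    then show ?thesis using key by linarith
  qed
  also have "\<dots> \<le> 1 ^ 3" using assms by (intro power_mono) auto
  finally show ?thesis by simp
qed

text \<open>The case where one edge carries at least half the weight of the rest; equality holds for
  the 4-cycle with weights 1/4. The nonnegative coordinates q, p and k vanish there, and the slack
  is a form in q, j, p, k whose few negative terms are balanced in \<open>R\<close>,
  \<open>S\<close> and \<open>T\<close>.\<close>

lemma cubic_estimate_large:
  fixes a \<rho> r w P :: real
  assumes "r \<le> w" "\<rho> \<le> 2 * r" "r \<le> \<rho>" "4 * w \<le> 1" "w + 2 * a + \<rho> = 1" "P \<le> w * a"
  shows "7 * ((2 * r - \<rho>) * P + (\<rho> - r) * a\<^sup>2) + a\<^sup>2 * \<rho> + 2 * a * (r * (\<rho> - r)) \<le> 1 / 8"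
proof -
  define q j p k where "q = \<rho> - r" and "j = 2 * r - \<rho>" and "p = w - r" and "k = 1 - 4 * w"
  have nn: "q \<ge> 0" "j \<ge> 0" "p \<ge> 0" "k \<ge> 0" using assms by (auto simp: q_def j_def p_def k_def)
  have e: "\<rho> = 2 * q + j" "r = q + j" "w = p + q + j" "a = j + (3 * p + q + k) / 2"
    using assms by (simp_all add: q_def j_def p_def k_def field_simps)
  have one: "4 * j + 4 * p + 4 * q + k = 1" unfolding q_def j_def p_def k_def by simp
  have R: "12 * (j\<^sup>2 * k) + 66 * (j * q\<^sup>2) + (10 * (j * k\<^sup>2) - 16 * (j * q * k)) \<ge> 0"
  proof -
    have "66 * (j * q\<^sup>2) + (10 * (j * k\<^sup>2) - 16 * (j * q * k)) = j * (8 * (q - k)\<^sup>2 + 58 * q\<^sup>2 + 2 * k\<^sup>2)"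
      by (simp add: power2_eq_square algebra_simps)
    also have "\<dots> \<ge> 0" using nn by (intro mult_nonneg_nonneg) auto
    finally show ?thesis using nn by (simp add: add.assoc)
  qed
  have S: "60 * (p * q\<^sup>2) + 12 * (p * k\<^sup>2) - 12 * (p * q * k) \<ge> 0"
  proof -
    have "60 * (p * q\<^sup>2) + 12 * (p * k\<^sup>2) - 12 * (p * q * k) = p * (6 * (q - k)\<^sup>2 + 54 * q\<^sup>2 + 6 * k\<^sup>2)"
      by (simp add: power2_eq_square algebra_simps)
    also have "\<dots> \<ge> 0" using nn by (intro mult_nonneg_nonneg) auto
    finally show ?thesis .
  qed
  have T: "38 * q ^ 3 + 4 * (q\<^sup>2 * k) - 6 * (q * k\<^sup>2) + k ^ 3 \<ge> 0"
  proof (cases "k \<le> 7 * q")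
    case True
    have "38 * q ^ 3 + 4 * (q\<^sup>2 * k) - 6 * (q * k\<^sup>2) + k ^ 3 = k * (k - 3 * q)\<^sup>2 + q\<^sup>2 * (38 * q - 5 * k)"
      by (simp add: power2_eq_square power3_eq_cube algebra_simps)
    also have "\<dots> \<ge> 0" using nn True by (intro add_nonneg_nonneg mult_nonneg_nonneg) auto
    finally show ?thesis .
  next
    case False
    have "38 * q ^ 3 + 4 * (q\<^sup>2 * k) - 6 * (q * k\<^sup>2) + k ^ 3 = k\<^sup>2 * (k - 6 * q) + 38 * q ^ 3 + 4 * (q\<^sup>2 * k)"
      by (simp add: power2_eq_square power3_eq_cube algebra_simps)
    also have "\<dots> \<ge> 0" using nn False by (intro add_nonneg_nonneg mult_nonneg_nonneg) auto
    finally show ?thesis .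
  qed
  have "(2 * r - \<rho>) * P \<le> (2 * r - \<rho>) * (w * a)" using assms by (intro mult_left_mono) auto
  then have "7 * ((2 * r - \<rho>) * P + (\<rho> - r) * a\<^sup>2) + a\<^sup>2 * \<rho> + 2 * a * (r * (\<rho> - r))
      \<le> 7 * ((2 * r - \<rho>) * (w * a) + (\<rho> - r) * a\<^sup>2) + a\<^sup>2 * \<rho> + 2 * a * (r * (\<rho> - r))" by simp
  also have "8 * \<dots> = (4 * j + 4 * p + 4 * q + k) ^ 3 -
     (28 * (j\<^sup>2 * p) + 12 * (j\<^sup>2 * q) + 90 * (j * p\<^sup>2) + 20 * (j * p * q) + 56 * (j * p * k)
       + 64 * p ^ 3 + 30 * (p\<^sup>2 * q) + 48 * (p\<^sup>2 * k)
       + (12 * (j\<^sup>2 * k) + 66 * (j * q\<^sup>2) + (10 * (j * k\<^sup>2) - 16 * (j * q * k)))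
       + (60 * (p * q\<^sup>2) + 12 * (p * k\<^sup>2) - 12 * (p * q * k))
       + (38 * q ^ 3 + 4 * (q\<^sup>2 * k) - 6 * (q * k\<^sup>2) + k ^ 3))"
    unfolding e by (simp add: power2_eq_square power3_eq_cube field_simps)
  also have "\<dots> \<le> (4 * j + 4 * p + 4 * q + k) ^ 3"
  proof -
    have "0 \<le> 28 * (j\<^sup>2 * p) + 12 * (j\<^sup>2 * q) + 90 * (j * p\<^sup>2) + 20 * (j * p * q) + 56 * (j * p * k)
       + 64 * p ^ 3 + 30 * (p\<^sup>2 * q) + 48 * (p\<^sup>2 * k)"
      using nn by (intro add_nonneg_nonneg mult_nonneg_nonneg zero_le_power) auto
    then show ?thesis using R S T by linarith
  qed
  also have "\<dots> = 1" using one by simp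
  finally show ?thesis by simp
qed

context weights
begin

definition R2 :: "'a set \<Rightarrow> ('a \<times> 'a) set" where "R2 R = (SIGMA x:R. R - {x})"
definition R3 :: "'a set \<Rightarrow> ('a \<times> 'a \<times> 'a) set" where "R3 R = (SIGMA x:R. SIGMA y:R - {x}. R - {x, y})"

lemma finite_R: "finite R \<Longrightarrow> finite (R2 R)" "finite R \<Longrightarrow> finite (R3 R)"
  by (auto simp: R2_def R3_def)

lemma sum_R2: "finite R \<Longrightarrow> (\<Sum>(x, y)\<in>R2 R. G x y) = (\<Sum>x\<in>R. \<Sum>y\<in>R - {x}. G x y)"
  unfolding R2_def by (rule sum.Sigma[symmetric]) auto

lemma sum_R3: "finite R \<Longrightarrow> (\<Sum>(x, y, z)\<in>R3 R. G x y z) = (\<Sum>x\<in>R. \<Sum>y\<in>R - {x}. \<Sum>z\<in>R - {x, y}. G x y z)"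
proof -
  assume R: "finite R"
  have "(\<Sum>x\<in>R. \<Sum>y\<in>R - {x}. \<Sum>z\<in>R - {x, y}. G x y z) = (\<Sum>x\<in>R. \<Sum>(y, z)\<in>(SIGMA y:R - {x}. R - {x, y}). G x y z)"
    using R by (intro sum.cong refl sum.Sigma) auto
  also have "\<dots> = (\<Sum>(x, yz)\<in>R3 R. case yz of (y, z) \<Rightarrow> G x y z)"
    unfolding R3_def using R by (intro sum.Sigma) auto
  finally show ?thesis by (simp add: case_prod_unfold)
qed

lemma R2_swap: "finite R \<Longrightarrow> (\<Sum>(x, y)\<in>R2 R. G x y) = (\<Sum>(x, y)\<in>R2 R. G y x)"
  by (rule sum.reindex_bij_witness[of _ prod.swap prod.swap]) (auto simp: R2_def)

lemma d_remove: "finite R \<Longrightarrow> x \<in> R \<Longrightarrow> d (R - {x}) x = d R x"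
  unfolding d_def using sum.remove[of R x "w x"] by (simp add: diag)

lemma d_remove2: "finite R \<Longrightarrow> x \<in> R \<Longrightarrow> y \<in> R \<Longrightarrow> x \<noteq> y \<Longrightarrow> d (R - {x, y}) y = d R y - w x y"
proof -
  assume *: "finite R" "x \<in> R" "y \<in> R" "x \<noteq> y"
  have "R - {x} - {y} = R - {x, y}" by auto
  then show ?thesis using sum.remove[of R x "w y"] sum.remove[of "R - {x}" y "w y"] * sym[of x y]
    by (simp add: d_def diag)
qed

lemma d_le_half: "finite R \<Longrightarrow> x \<in> R \<Longrightarrow> d R x \<le> tot R / 2"
  using touching_le[of R "{x}"] by (simp add: tot_def d_def diag)

lemma d_pair_le: "finite R \<Longrightarrow> x \<in> R \<Longrightarrow> y \<in> R \<Longrightarrow> x \<noteq> y \<Longrightarrow> d R x + d R y - w x y \<le> tot R / 2"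
  using touching_le[of R "{x, y}"] by (simp add: tot_def d_def diag sym[of y x])

lemma total_split:
  assumes "u \<in> X" "v \<in> X" "u \<noteq> v" and R: "R = X - {u, v}"
  shows "tot X / 2 = w u v + d R u + d R v + tot R / 2"
proof -
  have fR: "finite R" using finX R by simp
  have "tot X = tot (insert u (insert v R))" using assms by (intro arg_cong[of _ _ tot]) auto
  also have "\<dots> = tot (insert v R) + 2 * d (insert v R) u" using assms fR by (intro tot_insert) auto
  also have "tot (insert v R) = tot R + 2 * d R v" using assms fR by (intro tot_insert) auto
  also have "d (insert v R) u = w u v + d R u" using assms fR by (simp add: d_def)
  finally show ?thesis by simp
qed

lemma common_le:
  assumes "finite R" "\<And>x. x \<in> R \<Longrightarrow> w u x \<le> W" "\<And>x. x \<in> R \<Longrightarrow> w v x \<le> W"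
  shows "(\<Sum>x\<in>R. w u x * w v x) \<le> W * (d R u + d R v) / 2"
proof -
  have "(\<Sum>x\<in>R. w u x * w v x) \<le> (\<Sum>x\<in>R. W * w v x)" using assms nonneg by (intro sum_mono mult_right_mono) auto
  moreover have "(\<Sum>x\<in>R. w u x * w v x) \<le> (\<Sum>x\<in>R. w u x * W)" using assms nonneg by (intro sum_mono mult_left_mono) auto
  ultimately show ?thesis by (simp add: d_def algebra_simps flip: sum_distrib_left sum_distrib_right)
qed

lemma product_le: "d R u * d R v \<le> (d R u + d R v)\<^sup>2 / 4"
  using sum_squares_bound[of "d R u" "d R v"] by (simp add: power2_eq_square algebra_simps)

lemma cross_sum: "finite R \<Longrightarrow> (\<Sum>(x, y)\<in>R2 R. w u x * w v y) = d R u * d R v - (\<Sum>x\<in>R. w u x * w v x)"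
proof -
  assume R: "finite R"
  have "(\<Sum>y\<in>R - {x}. w u x * w v y) = w u x * d R v - w u x * w v x" if "x \<in> R" for x
    using sum.remove[OF R that, of "w v"] by (simp add: d_def algebra_simps flip: sum_distrib_left)
  then show ?thesis unfolding sum_R2[OF R] by (simp add: sum_subtractf d_def flip: sum_distrib_right)
qed

text \<open>Divided by \<open>w u v\<close>, the terms through the heaviest edge are: for closed
  lists a common neighbour of \<open>u\<close> and \<open>v\<close>, in six positions; for paths an
  extension by two edges at one end or by one edge at each end. All are estimated through c, the
  degrees into \<open>R\<close> and the weight \<rho> inside \<open>R\<close>, as prepared in
  \<open>quadratic_estimate\<close>.\<close>

lemma heavy3:
  assumes tX: "tot X = 2" and uv: "u \<in> X" "v \<in> X" "u \<noteq> v" and mx: "\<And>x y. x \<in> X \<Longrightarrow> y \<in> X \<Longrightarrow> w x y \<le> w u v"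
    and le: "3 * w u v \<le> 1"
  shows "(\<Sum>xs\<in>{xs\<in>DL 3 X. {u, v} \<in> ce xs}. cw w xs) + (\<Sum>xs\<in>{xs\<in>DL 4 X. {u, v} \<in> pe xs}. pw w xs) / 2
        \<le> w u v * (2 / 3)"
proof -
  define R where "R = X - {u, v}"
  have fR: "finite R" using finX by (simp add: R_def)
  define c where "c = (\<Sum>x\<in>R. w u x * w v x)"
  define \<rho> where "\<rho> = tot R / 2"
  have one: "w u v + (d R u + d R v) + \<rho> = 1" using total_split[OF uv R_def] tX by (simp add: \<rho>_def)
  have sR: "w x u = w u x" "w x v = w v x" if "x \<in> R" for x by (rule sym)+
  have sR2: "w (fst a) u = w u (fst a)" "w (fst a) v = w v (fst a)" "w (snd a) u = w u (snd a)" "w (snd a) v = w v (snd a)"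
     "w (snd a) (fst a) = w (fst a) (snd a)" if "a \<in> R2 R" for a by (rule sym)+
  have C: "(\<Sum>xs\<in>{xs\<in>DL 3 X. {u, v} \<in> ce xs}. cw w xs) \<le> w u v * (6 * c)"
  proof -
    have "{xs\<in>DL 3 X. {u, v} \<in> ce xs} \<subseteq> (\<Union>\<phi>\<in>set [\<lambda>x. [u, v, x], \<lambda>x. [v, u, x], \<lambda>x. [x, u, v], \<lambda>x. [x, v, u], \<lambda>x. [u, x, v], \<lambda>x. [v, x, u]]. \<phi> ` R)"
    proof
      fix xs assume xs: "xs \<in> {xs\<in>DL 3 X. {u, v} \<in> ce xs}"
      then obtain a b e where "xs = [a, b, e]" by (auto simp: DL_def length_Suc_conv numeral_3_eq_3)
      with xs show "xs \<in> (\<Union>\<phi>\<in>set [\<lambda>x. [u, v, x], \<lambda>x. [v, u, x], \<lambda>x. [x, u, v], \<lambda>x. [x, v, u], \<lambda>x. [u, x, v], \<lambda>x. [v, x, u]]. \<phi> ` R)"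
        by (auto simp: DL_def ce_def doubleton_eq_iff R_def)
    qed
    from sum_le_images[where F = "cw w", OF fR this cw_nonneg]
    have "(\<Sum>xs\<in>{xs\<in>DL 3 X. {u, v} \<in> ce xs}. cw w xs) \<le> 6 * (\<Sum>x\<in>R. w u v * (w u x * w v x))"
      by (simp add: cw_def sym[of v u] sR mult_ac cong: sum.cong_simp)
    then show ?thesis by (simp add: c_def flip: sum_distrib_left)
  qed
  have Pth: "(\<Sum>xs\<in>{xs\<in>DL 4 X. {u, v} \<in> pe xs}. pw w xs) \<le> w u v * (2 * (\<Sum>(x, y)\<in>R2 R. w v x * w x y) +
      2 * (\<Sum>(x, y)\<in>R2 R. w u x * w x y) + 2 * (\<Sum>(x, y)\<in>R2 R. w u x * w v y))"
  proof -
    let ?\<phi>s = "[\<lambda>(x, y). [u, v, x, y], \<lambda>(x, y). [y, x, v, u], \<lambda>(x, y). [v, u, x, y], \<lambda>(x, y). [y, x, u, v],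
       \<lambda>(x, y). [x, u, v, y], \<lambda>(x, y). [y, v, u, x]]"
    have "{xs\<in>DL 4 X. {u, v} \<in> pe xs} \<subseteq> (\<Union>\<phi>\<in>set ?\<phi>s. \<phi> ` R2 R)"
    proof
      fix xs assume xs: "xs \<in> {xs\<in>DL 4 X. {u, v} \<in> pe xs}"
      then obtain a b e f where "xs = [a, b, e, f]" by (auto simp: DL_def length_Suc_conv numeral_eq_Suc)
      with xs show "xs \<in> (\<Union>\<phi>\<in>set ?\<phi>s. \<phi> ` R2 R)"
        by (auto simp: DL_def doubleton_eq_iff R_def R2_def image_iff split_def)
    qed
    from sum_le_images[where F = "pw w", OF finite_R(1)[OF fR] this pw_nonneg]
    show ?thesis
      by (simp add: split_def sym[of v u] sR2 mult_ac sum_distrib_left distrib_left cong: sum.cong_simp)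
  qed
  have step: "(\<Sum>(x, y)\<in>R2 R. w v x * w x y) \<le> d R v * \<rho>" for v
  proof -
    have "(\<Sum>(x, y)\<in>R2 R. w v x * w x y) = (\<Sum>x\<in>R. w v x * d R x)"
      unfolding sum_R2[OF fR] using d_remove[OF fR] by (simp add: d_def flip: sum_distrib_left)
    also have "\<dots> \<le> (\<Sum>x\<in>R. w v x * \<rho>)" using d_le_half[OF fR] nonneg by (intro sum_mono mult_left_mono) (auto simp: \<rho>_def)
    finally show ?thesis by (simp add: d_def flip: sum_distrib_right)
  qed
  have "(\<Sum>xs\<in>{xs\<in>DL 3 X. {u, v} \<in> ce xs}. cw w xs) + (\<Sum>xs\<in>{xs\<in>DL 4 X. {u, v} \<in> pe xs}. pw w xs) / 2
     \<le> w u v * (6 * c) + w u v * ((\<Sum>(x, y)\<in>R2 R. w v x * w x y) + (\<Sum>(x, y)\<in>R2 R. w u x * w x y) + (\<Sum>(x, y)\<in>R2 R. w u x * w v y))"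
    using C Pth by (simp add: algebra_simps)
  \<comment> \<open>In a path with \<open>u\<close> and \<open>v\<close> in the middle the outer
    vertices differ, which subtracts c once: 6c becomes 5c.\<close>
  also have "\<dots> = w u v * (5 * c + d R u * d R v + ((\<Sum>(x, y)\<in>R2 R. w v x * w x y) + (\<Sum>(x, y)\<in>R2 R. w u x * w x y)))"
    unfolding cross_sum[OF fR] c_def by (simp add: algebra_simps)
  also have "\<dots> \<le> w u v * (5 * c + d R u * d R v + (d R u + d R v) * \<rho>)"
    using step[of u] step[of v] nonneg by (intro mult_left_mono) (auto simp: algebra_simps)
  also have "\<dots> \<le> w u v * (2 / 3)"
  proof (intro mult_left_mono quadratic_estimate[of "w u v"])
    show "c \<le> w u v * (d R u + d R v) / 2" unfolding c_def using mx uv fR by (intro common_le) (auto simp: R_def)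
  qed (use one le nonneg product_le d_nonneg tot_nonneg in \<open>auto simp: \<rho>_def\<close>)
  finally show ?thesis .
qed

end

context weights
begin

lemma d_ge_two: "finite R \<Longrightarrow> y \<in> R \<Longrightarrow> z \<in> R \<Longrightarrow> y \<noteq> z \<Longrightarrow> w x y + w x z \<le> d R x"
  unfolding d_def using sum_mono2[of R "{y, z}" "w x"] nonneg by simp

lemma d_plus_edge_le:
  assumes "finite R" "x \<in> R" "a \<in> R" "b \<in> R" "a \<noteq> b" "x \<noteq> a" "x \<noteq> b"
  shows "d R x + w a b \<le> tot R / 2"
  using d_pair_le[of R a x] d_ge_two[of R b x a] assms by auto

lemma two_edges_le:
  assumes "finite R" "x \<in> R" "y \<in> R" "x \<noteq> y" "a \<in> R" "b \<in> R" "a \<noteq> b" "{x, y} \<noteq> {a, b}"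
  shows "w x y + w a b \<le> tot R / 2"
proof -
  have "(x \<noteq> a \<and> x \<noteq> b) \<or> (y \<noteq> a \<and> y \<noteq> b)" using assms by auto
  then show ?thesis
    using d_plus_edge_le[of R x a b] d_plus_edge_le[of R y a b] w_le_d[of R y x] w_le_d[of R x y] sym[of x y] assms
    by fastforce
qed

lemma heavy4:
  assumes tX: "tot X = 2" and uv: "u \<in> X" "v \<in> X" "u \<noteq> v" and mx: "\<And>x y. x \<in> X \<Longrightarrow> y \<in> X \<Longrightarrow> w x y \<le> w u v"
    and le: "4 * w u v \<le> 1"
  shows "(\<Sum>xs\<in>{xs\<in>DL 4 X. {u, v} \<in> ce xs}. cw w xs) + (\<Sum>xs\<in>{xs\<in>DL 5 X. {u, v} \<in> pe xs}. pw w xs) / 2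
        \<le> w u v * (1 / 8)"
proof -
  define R where "R = X - {u, v}"
  have fR: "finite R" using finX by (simp add: R_def)
  define c where "c = (\<Sum>(x, y)\<in>R2 R. w u x * w v y * w x y)"
  define \<rho> where "\<rho> = tot R / 2"
  define \<alpha> where "\<alpha> = d R u"
  define \<gamma> where "\<gamma> = d R v"
  define a where "a = (\<alpha> + \<gamma>) / 2"
  have one: "w u v + 2 * a + \<rho> = 1" using total_split[OF uv R_def] tX by (simp add: \<rho>_def \<alpha>_def \<gamma>_def a_def add_divide_distrib)
  have nn: "\<alpha> \<ge> 0" "\<gamma> \<ge> 0" "\<rho> \<ge> 0" "a \<ge> 0" using d_nonneg tot_nonneg by (auto simp: \<alpha>_def \<gamma>_def \<rho>_def a_def)
  have ag: "\<alpha> * \<gamma> \<le> a\<^sup>2" using product_le[of R u v] by (simp add: a_def \<alpha>_def \<gamma>_def power2_eq_square)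
  have sR2: "w (fst p) u = w u (fst p)" "w (fst p) v = w v (fst p)" "w (snd p) u = w u (snd p)" "w (snd p) v = w v (snd p)"
     "w (snd p) (fst p) = w (fst p) (snd p)" if "p \<in> R2 R" for p by (rule sym)+
  have sR3: "w (fst p) u = w u (fst p)" "w (fst p) v = w v (fst p)" "w (fst (snd p)) u = w u (fst (snd p))" "w (fst (snd p)) v = w v (fst (snd p))"
     "w (fst (snd p)) (fst p) = w (fst p) (fst (snd p))" "w (snd (snd p)) (fst (snd p)) = w (fst (snd p)) (snd (snd p))"
    if "p \<in> R3 R" for p by (rule sym)+
  have C: "(\<Sum>xs\<in>{xs\<in>DL 4 X. {u, v} \<in> ce xs}. cw w xs) \<le> w u v * (8 * c)"
  proof -
    let ?\<phi>s = "[\<lambda>(x, y). [u, v, y, x], \<lambda>(x, y). [v, y, x, u], \<lambda>(x, y). [y, x, u, v], \<lambda>(x, y). [x, u, v, y],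
      \<lambda>(x, y). [x, y, v, u], \<lambda>(x, y). [u, x, y, v], \<lambda>(x, y). [v, u, x, y], \<lambda>(x, y). [y, v, u, x]]"
    have "{xs\<in>DL 4 X. {u, v} \<in> ce xs} \<subseteq> (\<Union>\<phi>\<in>set ?\<phi>s. \<phi> ` R2 R)"
    proof
      fix xs assume xs: "xs \<in> {xs\<in>DL 4 X. {u, v} \<in> ce xs}"
      then obtain a b e f where l: "xs = [a, b, e, f]" by (auto simp: DL_def length_Suc_conv numeral_eq_Suc)
      have ds: "distinct [a, b, e, f]" "set [a, b, e, f] \<subseteq> X" using xs l by (auto simp: DL_def)
      have "{u, v} \<in> ce xs" using xs by simp
      then have "{u, v} = {f, a} \<or> {u, v} = {a, b} \<or> {u, v} = {b, e} \<or> {u, v} = {e, f}" unfolding l by (simp add: ce_def)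
      then consider "u = a" "v = b" | "u = f" "v = a" | "u = e" "v = f" | "u = b" "v = e" | "u = f" "v = e" | "u = a" "v = f" | "u = b" "v = a" | "u = e" "v = b" unfolding doubleton_eq_iff by blast
      then show "xs \<in> (\<Union>\<phi>\<in>set ?\<phi>s. \<phi> ` R2 R)"
      proof cases
        case 1
        then show ?thesis using ds l by (intro UN_I[of "\<lambda>(x, y). [u, v, y, x]"] image_eqI[of _ _ "(f, e)"]) (auto simp: R_def R2_def)
      next
        case 2
        then show ?thesis using ds l by (intro UN_I[of "\<lambda>(x, y). [v, y, x, u]"] image_eqI[of _ _ "(e, b)"]) (auto simp: R_def R2_def)
      next
        case 3
        then show ?thesis using ds l by (intro UN_I[of "\<lambda>(x, y). [y, x, u, v]"] image_eqI[of _ _ "(b, a)"]) (auto simp: R_def R2_def)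
      next
        case 4
        then show ?thesis using ds l by (intro UN_I[of "\<lambda>(x, y). [x, u, v, y]"] image_eqI[of _ _ "(a, f)"]) (auto simp: R_def R2_def)
      next
        case 5
        then show ?thesis using ds l by (intro UN_I[of "\<lambda>(x, y). [x, y, v, u]"] image_eqI[of _ _ "(a, b)"]) (auto simp: R_def R2_def)
      next
        case 6
        then show ?thesis using ds l by (intro UN_I[of "\<lambda>(x, y). [u, x, y, v]"] image_eqI[of _ _ "(b, e)"]) (auto simp: R_def R2_def)
      next
        case 7
        then show ?thesis using ds l by (intro UN_I[of "\<lambda>(x, y). [v, u, x, y]"] image_eqI[of _ _ "(e, f)"]) (auto simp: R_def R2_def)
      next
        case 8
        then show ?thesis using ds l by (intro UN_I[of "\<lambda>(x, y). [y, v, u, x]"] image_eqI[of _ _ "(f, a)"]) (auto simp: R_def R2_def)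
      qed
    qed
    from sum_le_images[where F = "cw w", OF finite_R(1)[OF fR] this cw_nonneg]
    have "(\<Sum>xs\<in>{xs\<in>DL 4 X. {u, v} \<in> ce xs}. cw w xs) \<le> 8 * (\<Sum>p\<in>R2 R. w u v * (w u (fst p) * w v (snd p) * w (fst p) (snd p)))"
      by (simp add: cw_def split_def sym[of v u] sR2 mult_ac cong: sum.cong_simp)
    then show ?thesis by (simp add: c_def split_def flip: sum_distrib_left)
  qed
  \<comment> \<open>\<open>T1\<close> belongs to the paths that have the heaviest edge at an end,
    \<open>T2\<close> to those that have it second from an end.\<close>
  define T1 where "T1 z = (\<Sum>(x, y, t)\<in>R3 R. w z x * w x y * w y t)" for z
  define T2 where "T2 p q = (\<Sum>(x, y, t)\<in>R3 R. w p x * w q y * w y t)" for p q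
  have Pth: "(\<Sum>xs\<in>{xs\<in>DL 5 X. {u, v} \<in> pe xs}. pw w xs) \<le> w u v * (2 * T1 u + 2 * T1 v + 2 * T2 u v + 2 * T2 v u)"
  proof -
    let ?\<phi>s = "[\<lambda>(x, y, z). [u, v, x, y, z], \<lambda>(x, y, z). [z, y, x, v, u], \<lambda>(x, y, z). [v, u, x, y, z], \<lambda>(x, y, z). [z, y, x, u, v],
       \<lambda>(x, y, z). [x, u, v, y, z], \<lambda>(x, y, z). [z, y, v, u, x], \<lambda>(x, y, z). [x, v, u, y, z], \<lambda>(x, y, z). [z, y, u, v, x]]"
    have "{xs\<in>DL 5 X. {u, v} \<in> pe xs} \<subseteq> (\<Union>\<phi>\<in>set ?\<phi>s. \<phi> ` R3 R)"
    proof
      fix xs assume xs: "xs \<in> {xs\<in>DL 5 X. {u, v} \<in> pe xs}"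
      then obtain a b e f g where l: "xs = [a, b, e, f, g]" by (auto simp: DL_def length_Suc_conv numeral_eq_Suc)
      have ds: "distinct [a, b, e, f, g]" "set [a, b, e, f, g] \<subseteq> X" using xs l by (auto simp: DL_def)
      have "{u, v} \<in> pe xs" using xs by simp
      then have "{u, v} = {a, b} \<or> {u, v} = {b, e} \<or> {u, v} = {e, f} \<or> {u, v} = {f, g}" unfolding l by (simp add: ce_def)
      then consider "u = a" "v = b" | "u = g" "v = f" | "u = b" "v = a" | "u = f" "v = g" | "u = b" "v = e" | "u = f" "v = e" | "u = e" "v = b" | "u = e" "v = f" unfolding doubleton_eq_iff by blast
      then show "xs \<in> (\<Union>\<phi>\<in>set ?\<phi>s. \<phi> ` R3 R)"
      proof cases
        case 1
        then show ?thesis using ds l by (intro UN_I[of "\<lambda>(x, y, z). [u, v, x, y, z]"] image_eqI[of _ _ "(e, f, g)"]) (auto simp: R_def R3_def)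
      next
        case 2
        then show ?thesis using ds l by (intro UN_I[of "\<lambda>(x, y, z). [z, y, x, v, u]"] image_eqI[of _ _ "(e, b, a)"]) (auto simp: R_def R3_def)
      next
        case 3
        then show ?thesis using ds l by (intro UN_I[of "\<lambda>(x, y, z). [v, u, x, y, z]"] image_eqI[of _ _ "(e, f, g)"]) (auto simp: R_def R3_def)
      next
        case 4
        then show ?thesis using ds l by (intro UN_I[of "\<lambda>(x, y, z). [z, y, x, u, v]"] image_eqI[of _ _ "(e, b, a)"]) (auto simp: R_def R3_def)
      next
        case 5
        then show ?thesis using ds l by (intro UN_I[of "\<lambda>(x, y, z). [x, u, v, y, z]"] image_eqI[of _ _ "(a, f, g)"]) (auto simp: R_def R3_def)
      next
        case 6
        then show ?thesis using ds l by (intro UN_I[of "\<lambda>(x, y, z). [z, y, v, u, x]"] image_eqI[of _ _ "(g, b, a)"]) (auto simp: R_def R3_def)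
      next
        case 7
        then show ?thesis using ds l by (intro UN_I[of "\<lambda>(x, y, z). [x, v, u, y, z]"] image_eqI[of _ _ "(a, f, g)"]) (auto simp: R_def R3_def)
      next
        case 8
        then show ?thesis using ds l by (intro UN_I[of "\<lambda>(x, y, z). [z, y, u, v, x]"] image_eqI[of _ _ "(g, b, a)"]) (auto simp: R_def R3_def)
      qed
    qed
    from sum_le_images[where F = "pw w", OF finite_R(2)[OF fR] this pw_nonneg]
    show ?thesis
      by (simp add: T1_def T2_def split_def sym[of v u] sR3 mult_ac sum_distrib_left distrib_left cong: sum.cong_simp)
  qed
  \<comment> \<open>After x the continuation from y has weight d R y - w x y, which
    \<open>d_pair_le\<close> bounds by \<rho> - d R x. Only the product d (\<rho> - d) is left to be
    estimated, by \<tau>.\<close>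
  have T1: "T1 z \<le> d R z * \<tau>" if \<tau>: "\<And>x. x \<in> R \<Longrightarrow> d R x * (\<rho> - d R x) \<le> \<tau>" for z \<tau>
  proof -
    have "T1 z = (\<Sum>x\<in>R. w z x * (\<Sum>y\<in>R - {x}. w x y * d (R - {x, y}) y))"
      unfolding T1_def sum_R3[OF fR] by (simp add: d_def mult.assoc flip: sum_distrib_left)
    also have "\<dots> \<le> (\<Sum>x\<in>R. w z x * \<tau>)"
    proof (intro sum_mono mult_left_mono nonneg)
      fix x assume x: "x \<in> R"
      have "(\<Sum>y\<in>R - {x}. w x y * d (R - {x, y}) y) \<le> (\<Sum>y\<in>R - {x}. w x y * (\<rho> - d R x))"
        using x fR d_remove2[OF fR] d_pair_le[OF fR] nonneg
        by (intro sum_mono mult_left_mono) (fastforce simp: \<rho>_def algebra_simps)+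
      also have "\<dots> = d R x * (\<rho> - d R x)" using d_remove[OF fR x] by (simp add: d_def flip: sum_distrib_right)
      finally show "(\<Sum>y\<in>R - {x}. w x y * d (R - {x, y}) y) \<le> \<tau>" using \<tau>[OF x] by linarith
    qed
    finally show ?thesis by (simp add: d_def flip: sum_distrib_right)
  qed
  have T2eq: "T2 p q = (\<Sum>(x, y)\<in>R2 R. w p x * w q y * (d R y - w x y))" for p q
    unfolding T2_def sum_R3[OF fR] sum_R2[OF fR]
  proof (intro sum.cong refl)
    fix x y assume xy: "x \<in> R" "y \<in> R - {x}"
    have "(\<Sum>z\<in>R - {x, y}. w p x * w q y * w y z) = w p x * w q y * d (R - {x, y}) y"
      by (simp add: d_def sum_distrib_left)
    then show "(\<Sum>z\<in>R - {x, y}. w p x * w q y * w y z) = w p x * w q y * (d R y - w x y)"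
      using d_remove2[OF fR, of x y] xy by auto
  qed
  have cross: "(\<Sum>(x, y)\<in>R2 R. w u x * w v y) \<le> \<alpha> * \<gamma>"
    unfolding cross_sum[OF fR] by (simp add: \<alpha>_def \<gamma>_def sum_nonneg nonneg)
  have aux: "d R (fst p) + d R (snd p) - w (fst p) (snd p) \<le> \<rho>" if "p \<in> R2 R" for p
    unfolding \<rho>_def by (rule d_pair_le[OF fR]) (use that in \<open>auto simp: R2_def\<close>)
  \<comment> \<open>Adding both directions and one more c completes d R x + d R y - w x y, the
    weight of the edges of \<open>R\<close> that meet x or y. This c is what turns 8c into
    7c.\<close>
  have T2: "T2 u v + T2 v u \<le> \<alpha> * \<gamma> * \<rho> - c"
  proof -
    have "T2 v u = (\<Sum>(x, y)\<in>R2 R. w u x * w v y * (d R x - w x y))"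
      unfolding T2eq by (subst R2_swap[OF fR]) (simp add: sym mult_ac)
    then have "T2 u v + T2 v u + c = (\<Sum>(x, y)\<in>R2 R. w u x * w v y * (d R x + d R y - w x y))"
      unfolding T2eq c_def by (simp add: split_def algebra_simps flip: sum.distrib)
    also have "\<dots> \<le> (\<Sum>(x, y)\<in>R2 R. w u x * w v y * \<rho>)"
      unfolding split_def by (intro sum_mono mult_left_mono mult_nonneg_nonneg nonneg aux)
    also have "\<dots> = (\<Sum>(x, y)\<in>R2 R. w u x * w v y) * \<rho>" by (simp add: split_def sum_distrib_right)
    also have "\<dots> \<le> \<alpha> * \<gamma> * \<rho>" using cross nn by (intro mult_right_mono)
    finally show ?thesis by simp
  qed
  have main: "(\<Sum>xs\<in>{xs\<in>DL 4 X. {u, v} \<in> ce xs}. cw w xs) + (\<Sum>xs\<in>{xs\<in>DL 5 X. {u, v} \<in> pe xs}. pw w xs) / 2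
      \<le> w u v * (7 * c + a\<^sup>2 * \<rho> + 2 * a * \<tau>)" if \<tau>: "\<And>x. x \<in> R \<Longrightarrow> d R x * (\<rho> - d R x) \<le> \<tau>" for \<tau>
  proof -
    have "(\<Sum>xs\<in>{xs\<in>DL 4 X. {u, v} \<in> ce xs}. cw w xs) + (\<Sum>xs\<in>{xs\<in>DL 5 X. {u, v} \<in> pe xs}. pw w xs) / 2
        \<le> w u v * (8 * c) + w u v * (T1 u + T1 v + T2 u v + T2 v u)"
      using C Pth by (simp add: algebra_simps)
    also have "\<dots> = w u v * (8 * c + (T1 u + T1 v + T2 u v + T2 v u))" by (simp add: distrib_left)
    also have "\<dots> \<le> w u v * (7 * c + a\<^sup>2 * \<rho> + 2 * a * \<tau>)"
    proof (rule mult_left_mono)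
      have "T1 u + T1 v \<le> 2 * a * \<tau>" using T1[of \<tau> u] T1[of \<tau> v] \<tau> by (simp add: a_def \<alpha>_def \<gamma>_def algebra_simps)
      moreover have "\<alpha> * \<gamma> * \<rho> \<le> a\<^sup>2 * \<rho>" using ag nn by (intro mult_right_mono)
      ultimately show "8 * c + (T1 u + T1 v + T2 u v + T2 v u) \<le> 7 * c + a\<^sup>2 * \<rho> + 2 * a * \<tau>" using T2 by linarith
    qed (rule nonneg)
    finally show ?thesis .
  qed
  obtain r where r: "r \<ge> 0" "r \<le> w u v" "\<And>x y. (x, y) \<in> R2 R \<Longrightarrow> w x y \<le> r" "r = 0 \<or> (\<exists>x y. (x, y) \<in> R2 R \<and> r = w x y)"
  proof (cases "R2 R = {}")
    case True
    then show ?thesis using that[of 0] nonneg by auto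
  next
    case False
    define S where "S = (\<lambda>(x, y). w x y) ` R2 R"
    have S: "finite S" "S \<noteq> {}" using False finite_R(1)[OF fR] by (auto simp: S_def)
    have "Max S \<in> S" using S by (rule Max_in)
    then obtain x y where xy: "(x, y) \<in> R2 R" "Max S = w x y" by (auto simp: S_def)
    show ?thesis
    proof (rule that[of "Max S"])
      show "w p q \<le> Max S" if "(p, q) \<in> R2 R" for p q using S that by (intro Max_ge) (auto simp: S_def image_iff)
      show "Max S \<le> w u v" using xy mx[of x y] by (auto simp: R2_def R_def)
    qed (use xy nonneg in auto)
  qed
  \<comment> \<open>\<tau> bounds d (\<rho> - d). If 2r exceeds \<rho>, the ends of the heaviest
    edge of \<open>R\<close> have degree at least r and all other vertices at most \<rho> - r, so
    every degree is at least as far from \<rho>/2 as r is.\<close>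
  have "7 * c + a\<^sup>2 * \<rho> + 2 * a * \<tau> \<le> 1 / 8 \<and> (\<forall>x\<in>R. d R x * (\<rho> - d R x) \<le> \<tau>)"
    if \<tau>: "\<tau> = (if 2 * r \<le> \<rho> then \<rho>\<^sup>2 / 4 else r * (\<rho> - r))" for \<tau>
  proof (cases "2 * r \<le> \<rho>")
    case True
    have "c \<le> (\<Sum>(x, y)\<in>R2 R. w u x * w v y * r)"
      unfolding c_def split_def using r(3) nonneg by (intro sum_mono mult_left_mono mult_nonneg_nonneg) auto
    also have "\<dots> = (\<Sum>(x, y)\<in>R2 R. w u x * w v y) * r" by (simp add: split_def sum_distrib_right)
    also have "\<dots> \<le> \<alpha> * \<gamma> * r" using cross r by (intro mult_right_mono)
    also have "\<dots> \<le> a\<^sup>2 * r" using ag r by (intro mult_right_mono)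
    finally have "7 * c + a\<^sup>2 * \<rho> + 2 * a * \<tau> \<le> 7 * (r * a\<^sup>2) + a\<^sup>2 * \<rho> + 2 * a * (\<rho>\<^sup>2 / 4)"
      using True by (simp add: \<tau> mult_ac)
    also have "\<dots> \<le> 1 / 8" using nn r True one by (intro cubic_estimate_small) auto
    finally have "7 * c + a\<^sup>2 * \<rho> + 2 * a * \<tau> \<le> 1 / 8" .
    moreover have "x * (\<rho> - x) \<le> \<rho>\<^sup>2 / 4" for x using sum_squares_bound[of x "\<rho> - x"]
      by (simp add: power2_eq_square algebra_simps)
    ultimately show ?thesis using True by (simp add: \<tau>)
  next
    case False
    then have "r \<noteq> 0" using nn by auto
    then obtain x0 y0 where xy: "x0 \<in> R" "y0 \<in> R" "x0 \<noteq> y0" "r = w x0 y0" using r(4) by (auto simp: R2_def)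
    have rr: "r \<le> \<rho>" using w_le_d[OF fR xy(2), of x0] d_le_half[OF fR xy(1)] xy by (simp add: \<rho>_def)
    define P where "P = w u x0 * w v y0 + w u y0 * w v x0"
    \<comment> \<open>Both orders of the heaviest pair are separated; every other pair has weight at
      most \<rho> - r by \<open>two_edges_le\<close>.\<close>
    define S where "S = {(x0, y0), (y0, x0)}"
    have S: "S \<subseteq> R2 R" "finite (R2 R)" using xy finite_R[OF fR] by (auto simp: S_def R2_def)
    have cS: "(\<Sum>(x, y)\<in>S. w u x * w v y) = P" "(\<Sum>(x, y)\<in>S. w u x * w v y * w x y) = r * P"
      using xy(3) by (simp_all add: S_def P_def xy(4) sym[of y0 x0] algebra_simps)
    have "c = (\<Sum>(x, y)\<in>R2 R - S. w u x * w v y * w x y) + r * P"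
      unfolding c_def cS(2)[symmetric] by (rule sum.subset_diff[OF S])
    also have "(\<Sum>(x, y)\<in>R2 R - S. w u x * w v y * w x y) \<le> (\<Sum>(x, y)\<in>R2 R - S. w u x * w v y * (\<rho> - r))"
    proof -
      have "w x y \<le> \<rho> - r" if "(x, y) \<in> R2 R - S" for x y
      proof -
        have "x \<in> R" "y \<in> R" "x \<noteq> y" "{x, y} \<noteq> {x0, y0}" using that by (auto simp: R2_def S_def doubleton_eq_iff)
        then show ?thesis using two_edges_le[OF fR, of x y x0 y0] xy by (simp add: \<rho>_def)
      qed
      then show ?thesis unfolding split_def using nonneg by (intro sum_mono mult_left_mono mult_nonneg_nonneg) auto
    qed
    also have "(\<Sum>(x, y)\<in>R2 R - S. w u x * w v y * (\<rho> - r)) = ((\<Sum>(x, y)\<in>R2 R. w u x * w v y) - P) * (\<rho> - r)"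
      using sum.subset_diff[OF S, of "\<lambda>(x, y). w u x * w v y"] cS(1) by (simp add: split_def flip: sum_distrib_right)
    also have "\<dots> \<le> (a\<^sup>2 - P) * (\<rho> - r)" using cross ag rr by (intro mult_right_mono) auto
    finally have c: "c \<le> (2 * r - \<rho>) * P + (\<rho> - r) * a\<^sup>2" by (simp add: algebra_simps)
    have P: "P \<le> w u v * a"
    proof -
      have W: "w u x0 \<le> w u v" "w u y0 \<le> w u v" "w v x0 \<le> w u v" "w v y0 \<le> w u v" using mx uv xy by (auto simp: R_def)
      have "P \<le> w u x0 * w u v + w u y0 * w u v" unfolding P_def using W nonneg by (intro add_mono mult_left_mono)
      also have "\<dots> \<le> \<alpha> * w u v" using d_ge_two[OF fR xy(1,2,3), of u] nonneg
        by (simp add: \<alpha>_def mult_right_mono flip: distrib_right)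
      finally have 1: "P \<le> \<alpha> * w u v" .
      have "P \<le> w u v * w v y0 + w u v * w v x0" unfolding P_def using W nonneg by (intro add_mono mult_right_mono)
      also have "\<dots> \<le> w u v * \<gamma>" using d_ge_two[OF fR xy(1,2,3), of v] nonneg
        by (simp add: \<gamma>_def mult_left_mono add.commute flip: distrib_left)
      finally show ?thesis using 1 by (simp add: a_def algebra_simps)
    qed
    have "7 * c + a\<^sup>2 * \<rho> + 2 * a * \<tau> \<le> 7 * ((2 * r - \<rho>) * P + (\<rho> - r) * a\<^sup>2) + a\<^sup>2 * \<rho> + 2 * a * (r * (\<rho> - r))"
      using c False by (simp add: \<tau>)
    also have "\<dots> \<le> 1 / 8" using r(2) False rr le one P by (intro cubic_estimate_large[of r "w u v"]) auto
    finally have 1: "7 * c + a\<^sup>2 * \<rho> + 2 * a * \<tau> \<le> 1 / 8" .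
    have "d R x * (\<rho> - d R x) \<le> r * (\<rho> - r)" if x: "x \<in> R" for x
    proof (cases "x = x0 \<or> x = y0")
      case True
      then have "r \<le> d R x" using w_le_d[OF fR xy(2), of x0] w_le_d[OF fR xy(1), of y0] sym[of y0 x0] xy(4) by auto
      then have "0 \<le> (d R x - r) * (d R x + r - \<rho>)" using False by (intro mult_nonneg_nonneg) auto
      then show ?thesis by (simp add: algebra_simps)
    next
      case neq: False
      then have "d R x \<le> \<rho> - r" using d_plus_edge_le[OF fR x xy(1,2,3)] xy(4) by (simp add: \<rho>_def)
      then have "0 \<le> (r - d R x) * (\<rho> - r - d R x)" using False by (intro mult_nonneg_nonneg) auto
      then show ?thesis by (simp add: algebra_simps)
    qed
    then show ?thesis using 1 False by (simp add: \<tau>)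
  qed
  then obtain \<tau> where \<tau>: "7 * c + a\<^sup>2 * \<rho> + 2 * a * \<tau> \<le> 1 / 8" "\<And>x. x \<in> R \<Longrightarrow> d R x * (\<rho> - d R x) \<le> \<tau>" by blast
  show ?thesis by (rule order_trans[OF main[OF \<tau>(2)] mult_left_mono[OF \<tau>(1) nonneg]])
qed

theorem bound3: "Ssum w X 3 + Qsum w X 3 / 2 \<le> 2 * 3 / 3 ^ 3 * (tot X / 2) ^ 3"
proof -
  have "Ssum w X 3 + Qsum w X 3 / 2 \<le> 2 / 9 * (tot X / 2) ^ 3"
  proof (rule heaviest_edge_bound)
    fix w' u v
    assume a: "weights X w'" "weights.tot w' X = 2" "u \<in> X" "v \<in> X" "u \<noteq> v"
      "\<And>x y. x \<in> X \<Longrightarrow> y \<in> X \<Longrightarrow> w' x y \<le> w' u v" "real 3 * w' u v \<le> 1"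
    have "3 * w' u v \<le> 1" using a(7) by simp
    from weights.heavy3[OF a(1-6) this]
    show "(\<Sum>xs\<in>{xs\<in>DL 3 X. {u, v} \<in> ce xs}. cw w' xs) + (\<Sum>xs\<in>{xs\<in>DL (Suc 3) X. {u, v} \<in> pe xs}. pw w' xs) / 2
        \<le> real 3 * w' u v * (2 / 9)" by simp
  qed auto
  then show ?thesis by simp
qed

theorem bound4: "Ssum w X 4 + Qsum w X 4 / 2 \<le> 2 * 4 / 4 ^ 4 * (tot X / 2) ^ 4"
proof -
  have "Ssum w X 4 + Qsum w X 4 / 2 \<le> 1 / 32 * (tot X / 2) ^ 4"
  proof (rule heaviest_edge_bound)
    fix w' u v
    assume a: "weights X w'" "weights.tot w' X = 2" "u \<in> X" "v \<in> X" "u \<noteq> v"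
      "\<And>x y. x \<in> X \<Longrightarrow> y \<in> X \<Longrightarrow> w' x y \<le> w' u v" "real 4 * w' u v \<le> 1"
    have "4 * w' u v \<le> 1" using a(7) by simp
    from weights.heavy4[OF a(1-6) this]
    show "(\<Sum>xs\<in>{xs\<in>DL 4 X. {u, v} \<in> ce xs}. cw w' xs) + (\<Sum>xs\<in>{xs\<in>DL (Suc 4) X. {u, v} \<in> pe xs}. pw w' xs) / 2
        \<le> real 4 * w' u v * (1 / 32)" by simp
  qed auto
  then show ?thesis by simp
qed

lemma sum_DL2: "(\<Sum>xs\<in>DL 2 X. pw w xs) = tot X"
proof -
  have "DL 0 X = {[]}" by (auto simp: DL_def)
  then have "(\<Sum>xs\<in>DL 2 X. pw w xs) = (\<Sum>y\<in>X. \<Sum>x\<in>X - {y}. w x y)"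
    unfolding numeral_2_eq_2 sum_DL_Suc[OF finX] by simp
  also have "\<dots> = (\<Sum>y\<in>X. d X y)" using d_remove[OF finX] by (intro sum.cong refl) (simp add: d_def sym)
  finally show ?thesis by (simp add: tot_def)
qed

text \<open>For m = 2 a closed list uses one edge twice, so the sum is not squarefree and the
  optimality argument for m at least 3 is replaced: the closing edge and the extensions of a pair
  together weigh at most the degree of its head, hence at most half of \<open>tot X\<close>. This
  even allows the full \<open>Qsum\<close>.\<close>

theorem bound2: "Ssum w X 2 + Qsum w X 2 / 2 \<le> 2 * (tot X / 2) ^ 2"
proof -
  have "Qsum w X 2 = (\<Sum>xs\<in>DL 2 X. pw w xs * D xs)"
    unfolding Qsum_def sum_DL_Suc[OF finX]
  proof (rule sum.cong[OF refl])
    fix zs :: "'a list" assume "zs \<in> DL 2 X"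
    then have "zs \<noteq> []" by (auto simp: DL_def)
    then show "(\<Sum>y\<in>X - set zs. pw w (y # zs)) = pw w zs * D zs"
      by (simp add: pw_Cons mult.commute flip: sum_distrib_left sum_w_hd)
  qed
  then have "Ssum w X 2 + Qsum w X 2 = (\<Sum>xs\<in>DL 2 X. pw w xs * (w (last xs) (hd xs) + D xs))"
    by (simp add: Ssum_def cw_def distrib_left sum.distrib)
  also have "\<dots> \<le> (\<Sum>xs\<in>DL 2 X. pw w xs * (tot X / 2))"
  proof (intro sum_mono mult_left_mono pw_nonneg)
    fix xs :: "'a list" assume xs: "xs \<in> DL 2 X"
    then have m: "last xs \<in> set xs" "hd xs \<in> X" by (auto simp: DL_def intro!: last_in_set subsetD[OF _ hd_in_set])
    have s: "set xs \<subseteq> X" using xs by (simp add: DL_def)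
    have "w (last xs) (hd xs) \<le> d (set xs) (hd xs)" using w_le_d[of "set xs" "last xs" "hd xs"] m sym by simp
    then have "w (last xs) (hd xs) + D xs \<le> d X (hd xs)" using d_union[OF finX s, of "hd xs"] by (simp add: D_def)
    then show "w (last xs) (hd xs) + D xs \<le> tot X / 2" using d_le_half[OF finX m(2)] by linarith
  qed
  also have "\<dots> = 2 * (tot X / 2)\<^sup>2" by (simp add: sum_DL2 power2_eq_square flip: sum_divide_distrib sum_distrib_right)
  finally show ?thesis using sum_nonneg[of "DL (Suc 2) X" "pw w"] pw_nonneg by (simp add: Qsum_def)
qed

end

lemma pw_scale: "s \<noteq> 0 \<Longrightarrow> xs \<noteq> [] \<Longrightarrow> pw (\<lambda>x y. w x y / s) xs = pw w xs / s ^ (length xs - 1)"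
  by (induction xs rule: induct_list012) (auto simp: field_simps)

theorem (in weights) bound_large:
  assumes m: "3 \<le> m"
  shows "Ssum w X m + Qsum w X m / 2 \<le> 3 * real m / real m ^ m * (tot X / 2) ^ m"
proof (cases "tot X = 0")
  case True
  have w0: "w x y = 0" if "x \<in> X" "y \<in> X" for x y
    using w_le_d[OF finX that(2), of x] d_le_half[OF finX that(1)] nonneg[of x y] True by simp
  have pw0: "pw w xs = 0" if xs: "xs \<in> DL k X" "2 \<le> k" for xs k
  proof -
    obtain x y zs where "xs = x # y # zs" using xs by (cases xs; cases "tl xs") (auto simp: DL_def)
    then show ?thesis using xs w0 by (auto simp: DL_def)
  qed
  have "Ssum w X m = 0" "Qsum w X m = 0"
    unfolding Ssum_def Qsum_def cw_def using pw0 m by (auto intro!: sum.neutral)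
  then show ?thesis using True m by simp
next
  case False
  define s where "s = tot X / 2"
  have s: "s > 0" using False tot_nonneg[of X] by (simp add: s_def)
  interpret N: weights X "\<lambda>x y. w x y / s"
    by unfold_locales (use finX nonneg sym diag s in auto)
  have "N.tot X = tot X / s" by (simp add: N.tot_def N.d_def tot_def d_def sum_divide_distrib)
  then have "N.tot X = 2" using s by (simp add: s_def)
  then have le: "Ssum (\<lambda>x y. w x y / s) X m + Qsum (\<lambda>x y. w x y / s) X m / 2 \<le> 3 * real m / real m ^ m"
    using N.large_m_bound m by simp
  have "Ssum (\<lambda>x y. w x y / s) X m = Ssum w X m / s ^ m"
    unfolding Ssum_def sum_divide_distrib
  proof (rule sum.cong[OF refl])
    fix xs assume "xs \<in> DL m X"
    then have "xs \<noteq> []" "length xs = m" using m by (auto simp: DL_def)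
    moreover have "s ^ m = s ^ (m - 1) * s" using m by (simp add: power_eq_if)
    ultimately show "cw (\<lambda>x y. w x y / s) xs = cw w xs / s ^ m" using s pw_scale[of s xs w] by (simp add: cw_def)
  qed
  moreover have "Qsum (\<lambda>x y. w x y / s) X m = Qsum w X m / s ^ m"
    unfolding Qsum_def sum_divide_distrib
  proof (rule sum.cong[OF refl])
    fix xs assume "xs \<in> DL (Suc m) X"
    then have "xs \<noteq> []" "length xs = Suc m" by (auto simp: DL_def)
    then show "pw (\<lambda>x y. w x y / s) xs = pw w xs / s ^ m" using s pw_scale[of s xs w] by simp
  qed
  ultimately have "(Ssum w X m + Qsum w X m / 2) / s ^ m \<le> 3 * real m / real m ^ m"
    using le by (simp add: add_divide_distrib)
  then show ?thesis using s by (simp add: pos_divide_le_eq flip: s_def)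
qed

section \<open>Odd cycles with the maximal number of local maxima\<close>

lemma pe_nth: "pe l = (\<lambda>i. {l ! i, l ! Suc i}) ` {i. Suc i < length l}"
proof (induction l rule: pe.induct)
  case (1 x y xs)
  have "{i. Suc i < length (x # y # xs)} = insert 0 (Suc ` {i. Suc i < length (y # xs)})"
    by (auto simp: image_iff less_Suc_eq_0_disj)
  then show ?case using 1 by (simp add: image_image)
qed auto

lemma ce_nth:
  assumes "l \<noteq> []"
  shows "ce l = (\<lambda>i. {l ! i, l ! (Suc i mod length l)}) ` {..<length l}"
proof -
  obtain n where n: "length l = Suc n" using assms by (cases l) auto
  have "{..<length l} = insert n {i. Suc i < length l}" using n by auto
  moreover have "(\<lambda>i. {l ! i, l ! (Suc i mod length l)}) ` {i. Suc i < length l} = pe l"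
    by (auto simp: pe_nth)
  ultimately show ?thesis using n assms by (simp add: ce_def last_conv_nth hd_conv_nth)
qed

lemma ce_image: "l \<noteq> [] \<Longrightarrow> ce l = (\<lambda>e. (!) l ` e) ` snd (cycle_graph (length l))"
proof -
  assume "l \<noteq> []"
  moreover have "snd (cycle_graph (length l)) = (\<lambda>i. {i, Suc i mod length l}) ` {..<length l}"
    by (auto simp: cycle_graph_def)
  ultimately show ?thesis by (simp add: ce_nth image_image)
qed

definition copies :: "'a set \<Rightarrow> 'a set set \<Rightarrow> nat \<Rightarrow> ('a set \<times> 'a set set) set" where
  "copies V E k = {(V', E'). V' \<subseteq> V \<and> E' \<subseteq> E \<and> (\<forall>e\<in>E'. e \<subseteq> V') \<and> graph_iso (V', E') (cycle_graph k)}"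

definition copy_of :: "'a list \<Rightarrow> 'a set \<times> 'a set set" where
  "copy_of l = (set l, ce l)"

definition cyc :: "'a set set \<Rightarrow> nat \<Rightarrow> 'a list set" where
  "cyc E k = {l. length l = k \<and> distinct l \<and> ce l \<subseteq> E}"

lemma num_copies_cycle: "num_copies (V, E) (cycle_graph k) = card (copies V E k)"
  by (simp add: num_copies_def copies_def)

lemma cycle_edges: "e \<in> snd (cycle_graph k) \<Longrightarrow> e \<subseteq> {0..<k}"
  by (auto simp: cycle_graph_def)

lemma cycle_edge_pair: "e \<in> snd (cycle_graph k) \<Longrightarrow> \<exists>i j. e = {i, j} \<and> i < k \<and> j < k"
proof -
  assume "e \<in> snd (cycle_graph k)"
  then obtain i where "e = {i, Suc i mod k}" "i < k" by (auto simp: cycle_graph_def)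
  then show ?thesis by (intro exI[of _ i] exI[of _ "Suc i mod k"]) simp
qed

lemma copy_of_cyc:
  assumes l: "l \<in> cyc E k" and k: "3 \<le> k" and E: "\<And>e. e \<in> E \<Longrightarrow> e \<subseteq> V"
  shows "copy_of l \<in> copies V E k"
proof -
  have len: "length l = k" "distinct l" "l \<noteq> []" using l k by (auto simp: cyc_def)
  have nz: "\<exists>e\<in>ce l. v \<in> e" if v: "v \<in> set l" for v
  proof -
    obtain i where "i < length l" "v = l ! i" using v by (auto simp: in_set_conv_nth)
    then show ?thesis using len by (auto simp: ce_nth)
  qed
  have bij: "bij_betw ((!) l) {0..<k} (set l)" using len by (intro bij_betw_nth) (auto simp: atLeast0LessThan)
  define f where "f = the_inv_into {0..<k} ((!) l)"
  have f: "bij_betw f (set l) {0..<k}" unfolding f_def by (rule bij_betw_the_inv_into[OF bij])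
  have ff: "l ! f v = v \<and> f v < k" if "v \<in> set l" for v
    using f_the_inv_into_f_bij_betw[OF bij, of v] f that bij_betwE[OF f] by (auto simp: f_def)
  have inj: "inj_on ((!) l) {0..<k}" using bij by (simp add: bij_betw_def)
  have "{u, v} \<in> ce l \<longleftrightarrow> {f u, f v} \<in> snd (cycle_graph k)" if uv: "u \<in> set l" "v \<in> set l" for u v
  proof -
    have "{u, v} = (!) l ` {f u, f v}" using ff uv by simp
    then have "{u, v} \<in> ce l \<longleftrightarrow> (!) l ` {f u, f v} \<in> (\<lambda>e. (!) l ` e) ` snd (cycle_graph k)"
      using len by (simp add: ce_image)
    also have "\<dots> \<longleftrightarrow> {f u, f v} \<in> snd (cycle_graph k)"
      by (rule inj_on_image_mem_iff[of "\<lambda>e. (!) l ` e" "Pow {0..<k}"])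
        (use inj inj_on_image_Pow ff uv cycle_edges in \<open>auto dest: cycle_edges\<close>)
    finally show ?thesis .
  qed
  then have "graph_iso (set l, ce l) (cycle_graph k)"
    using f by (auto simp: graph_iso_def cycle_graph_def intro!: exI[of _ f])
  moreover have "set l \<subseteq> V"
  proof
    fix v assume "v \<in> set l"
    then obtain e where "e \<in> ce l" "v \<in> e" using nz by blast
    then show "v \<in> V" using E l by (auto simp: cyc_def)
  qed
  moreover have "\<forall>e\<in>ce l. e \<subseteq> set l" using ce_edges[of l] len k by blast
  ultimately show ?thesis using l by (auto simp: copies_def copy_of_def cyc_def)
qed

text \<open>Rotations and reversals of a list give the same copy; the counts below choose convenient
  lists among them.\<close>

lemma copies_eq:
  assumes k: "3 \<le> k" and E: "\<And>e. e \<in> E \<Longrightarrow> e \<subseteq> V \<and> card e = 2"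
  shows "copies V E k = copy_of ` cyc E k"
proof (intro equalityI subsetI)
  fix c assume "c \<in> copies V E k"
  then obtain V' E' f where c: "c = (V', E')" "V' \<subseteq> V" "E' \<subseteq> E" "\<And>e. e \<in> E' \<Longrightarrow> e \<subseteq> V'"
    and f: "bij_betw f V' {0..<k}" "\<And>u v. u \<in> V' \<Longrightarrow> v \<in> V' \<Longrightarrow> {u, v} \<in> E' \<longleftrightarrow> {f u, f v} \<in> snd (cycle_graph k)"
    by (auto simp: copies_def graph_iso_def cycle_graph_def)
  define g where "g = the_inv_into V' f"
  have g: "bij_betw g {0..<k} V'" unfolding g_def by (rule bij_betw_the_inv_into[OF f(1)])
  have gf: "g (f v) = v \<and> f v < k" if "v \<in> V'" for v
    using the_inv_into_f_f[of f V' v] f(1) that by (auto simp: g_def bij_betw_def)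
  have fg: "f (g i) = i \<and> g i \<in> V'" if "i < k" for i
    using f_the_inv_into_f_bij_betw[OF f(1), of i] bij_betwE[OF g] that by (auto simp: g_def)
  define l where "l = map g [0..<k]"
  have len: "length l = k" "set l = V'" "l \<noteq> []" "\<And>i. i < k \<Longrightarrow> l ! i = g i"
    using g k by (auto simp: l_def bij_betw_def)
  have dl: "distinct l" using g by (simp add: l_def distinct_map bij_betw_def)
  have "E' = ce l"
  proof (intro equalityI subsetI)
    fix e assume e: "e \<in> E'"
    then have "card e = 2" using c(3) E by auto
    then obtain u v where uv: "e = {u, v}" unfolding card_2_iff by blast
    then have V: "u \<in> V'" "v \<in> V'" using c(4)[OF e] by auto
    have "{f u, f v} \<in> snd (cycle_graph k)" using f(2)[OF V] e uv by simp
    moreover have "e = (!) l ` {f u, f v}" using uv gf V len by simp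
    ultimately show "e \<in> ce l" using len(1) ce_image[OF len(3)] by blast
  next
    fix e assume "e \<in> ce l"
    then obtain d where d: "d \<in> snd (cycle_graph k)" "e = (!) l ` d" using len by (auto simp: ce_image)
    then obtain i j where ij: "d = {i, j}" "i < k" "j < k" using cycle_edge_pair by blast
    then have "e = {g i, g j}" using d len by simp
    moreover have "{g i, g j} \<in> E'" using f(2)[of "g i" "g j"] fg ij d by simp
    ultimately show "e \<in> E'" by simp
  qed
  then have "c = copy_of l" "l \<in> cyc E k" using c len dl by (auto simp: copy_of_def cyc_def)
  then show "c \<in> copy_of ` cyc E k" by blast
next
  fix c assume "c \<in> copy_of ` cyc E k"
  then show "c \<in> copies V E k" using copy_of_cyc[OF _ k, of _ E V] E by blast
qed

lemma pe_snoc: "xs \<noteq> [] \<Longrightarrow> pe (xs @ [y]) = insert {last xs, y} (pe xs)"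
  by (induction xs rule: pe.induct) auto

lemma pe_rev: "pe (rev xs) = pe xs"
proof (induction xs rule: pe.induct)
  case (1 x y xs)
  then show ?case using pe_snoc[of "rev (y # xs)" x] by (simp add: insert_commute)
qed auto

lemma copy_of_rev: "copy_of (rev l) = copy_of l"
  by (cases "l = []") (simp_all add: copy_of_def ce_def pe_rev last_rev hd_rev insert_commute)

lemma copy_of_rotate1: "copy_of (rotate1 l) = copy_of l"
proof (cases l)
  case (Cons x ys)
  then show ?thesis
    by (cases ys) (use pe_snoc[of ys x] in \<open>auto simp: copy_of_def ce_def insert_commute\<close>)
qed simp

lemma copy_of_rotate: "copy_of (rotate n l) = copy_of l"
  by (induction n) (auto simp: rotate_def copy_of_rotate1 simp flip: rotate_def)

lemma cyc_copy_of: "l \<in> cyc E k \<Longrightarrow> copy_of l' = copy_of l \<Longrightarrow> distinct l' \<Longrightarrow> length l' = k \<Longrightarrow> l' \<in> cyc E k"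
  by (auto simp: cyc_def copy_of_def)

definition peaks :: "('a \<Rightarrow> nat) \<Rightarrow> 'a set \<times> 'a set set \<Rightarrow> 'a set" where
  "peaks r c = {v\<in>fst c. \<forall>u. {u, v} \<in> snd c \<longrightarrow> r u < r v}"

text \<open>In a list of length 2m + 1 the peaks sit at the odd positions, and the closing edge
  joins the non-peaks at positions 0 and 2m, called the seam below.\<close>

definition zigzag :: "('a \<Rightarrow> nat) \<Rightarrow> nat \<Rightarrow> 'a list \<Rightarrow> bool" where
  "zigzag r m l \<longleftrightarrow> (\<forall>j<m. r (l ! (2 * j)) < r (l ! (2 * j + 1)) \<and> r (l ! (2 * j + 2)) < r (l ! (2 * j + 1)))"

lemma zigzag_rev:
  assumes "length l = 2 * m + 1" "zigzag r m l"
  shows "zigzag r m (rev l)"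
  unfolding zigzag_def
proof (intro allI impI)
  fix j assume j: "j < m"
  have "rev l ! (2 * j) = l ! (2 * (m - 1 - j) + 2)" "rev l ! (2 * j + 1) = l ! (2 * (m - 1 - j) + 1)"
    "rev l ! (2 * j + 2) = l ! (2 * (m - 1 - j))"
  proof -
    have "2 * m + 1 - Suc (2 * j) = 2 * (m - 1 - j) + 2" "2 * m + 1 - Suc (2 * j + 1) = 2 * (m - 1 - j) + 1"
      "2 * m + 1 - Suc (2 * j + 2) = 2 * (m - 1 - j)" using j by arith+
    then show "rev l ! (2 * j) = l ! (2 * (m - 1 - j) + 2)" "rev l ! (2 * j + 1) = l ! (2 * (m - 1 - j) + 1)"
      "rev l ! (2 * j + 2) = l ! (2 * (m - 1 - j))"
      using assms(1) j by (simp_all only: rev_nth)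
  qed
  moreover have "m - 1 - j < m" using j by simp
  ultimately show "r (rev l ! (2 * j)) < r (rev l ! (2 * j + 1)) \<and> r (rev l ! (2 * j + 2)) < r (rev l ! (2 * j + 1))"
    using assms(2) by (simp only: zigzag_def)
qed

lemma independent_card:
  assumes "\<And>i. i < 2 * m \<Longrightarrow> \<not> (p i \<and> p (Suc i))"
  shows "card {i\<in>{1..2 * m}. p i} \<le> m"
  using assms
proof (induction m)
  case (Suc m)
  have "{i\<in>{1..2 * Suc m}. p i} = {i\<in>{1..2 * m}. p i} \<union> {i\<in>{2 * m + 1, 2 * m + 2}. p i}" by auto
  then have "card {i\<in>{1..2 * Suc m}. p i} \<le> card {i\<in>{1..2 * m}. p i} + card {i\<in>{2 * m + 1, 2 * m + 2}. p i}"
    by (simp only: card_Un_le)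
  moreover have "card {i\<in>{2 * m + 1, 2 * m + 2}. p i} \<le> 1"
  proof -
    have "{i\<in>{2 * m + 1, 2 * m + 2}. p i} \<subseteq> {if p (2 * m + 1) then 2 * m + 1 else 2 * m + 2}"
      using Suc.prems[of "2 * m + 1"] by auto
    then have "card {i\<in>{2 * m + 1, 2 * m + 2}. p i} \<le> card {if p (2 * m + 1) then 2 * m + 1 else 2 * m + 2}"
      by (rule card_mono[rotated]) simp
    then show ?thesis by simp
  qed
  moreover have "card {i\<in>{1..2 * m}. p i} \<le> m" using Suc by simp
  ultimately show ?case by simp
qed simp

text \<open>Position 2m is not chosen, so each of the m pairs of neighbouring positions must
  contribute its odd member, working down from the top.\<close>

lemma independent_odd:
  assumes "\<And>i. i < 2 * m \<Longrightarrow> \<not> (p i \<and> p (Suc i))" "\<not> p (2 * m)" "m \<le> card {i\<in>{1..2 * m}. p i}" "j < m"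
  shows "p (2 * j + 1)"
  using assms
proof (induction m)
  case (Suc m)
  have le: "card {i\<in>{1..2 * m}. p i} \<le> m" using Suc.prems(1) by (intro independent_card) simp
  have p1: "p (2 * m + 1)"
  proof (rule ccontr)
    assume n: "\<not> p (2 * m + 1)"
    have "i \<le> 2 * m" if "p i" "i \<le> 2 * Suc m" for i
    proof -
      have "i \<noteq> 2 * m + 1" "i \<noteq> 2 * m + 2" using that(1) n Suc.prems(2) by auto
      then show ?thesis using that(2) by simp
    qed
    then have "{i\<in>{1..2 * Suc m}. p i} = {i\<in>{1..2 * m}. p i}" by auto
    then show False using le Suc.prems(3) by simp
  qed
  have "{i\<in>{1..2 * Suc m}. p i} \<subseteq> insert (2 * m + 1) {i\<in>{1..2 * m}. p i}"
  proof
    fix i assume i: "i \<in> {i\<in>{1..2 * Suc m}. p i}"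
    then have "i \<noteq> 2 * m + 2" using Suc.prems(2) by auto
    then show "i \<in> insert (2 * m + 1) {i\<in>{1..2 * m}. p i}" using i by auto
  qed
  then have "card {i\<in>{1..2 * Suc m}. p i} \<le> card (insert (2 * m + 1) {i\<in>{1..2 * m}. p i})"
    by (rule card_mono[rotated]) simp
  then have "m \<le> card {i\<in>{1..2 * m}. p i}"
    using Suc.prems(3) by (simp add: card_insert_if split: if_splits)
  moreover have "\<not> p (2 * m)" using Suc.prems(1)[of "2 * m"] p1 by simp
  ultimately have "j < m \<Longrightarrow> p (2 * j + 1)" using Suc by simp
  then show ?case using p1 Suc.prems(4) by (cases "j = m") auto
qed simp

text \<open>Around an odd cycle membership in the set of peaks cannot alternate throughout, and
  adjacent peaks are impossible, so two consecutive vertices are no peaks. Rotating these to the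
  seam leaves m peaks for the positions 1 to 2m - 1, which forces the odd ones.\<close>

lemma zigzag_exists:
  assumes l: "l \<in> cyc E (2 * m + 1)" and m: "1 \<le> m" and c: "m \<le> card (peaks r (copy_of l))"
  shows "\<exists>l'\<in>cyc E (2 * m + 1). copy_of l' = copy_of l \<and> zigzag r m l'"
proof -
  let ?k = "2 * m + 1"
  let ?S = "peaks r (copy_of l)"
  have len: "length l = ?k" "distinct l" "l \<noteq> []" using l by (auto simp: cyc_def)
  have indep: "\<not> (l' ! i \<in> ?S \<and> l' ! (Suc i mod ?k) \<in> ?S)" "{l' ! i, l' ! (Suc i mod ?k)} \<in> ce l"
    if l': "copy_of l' = copy_of l" "length l' = ?k" and i: "i < ?k" for l' i
  proof -
    have "l' \<noteq> []" using l' by auto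
    then show e: "{l' ! i, l' ! (Suc i mod ?k)} \<in> ce l" using l' i by (auto simp: copy_of_def ce_nth)
    show "\<not> (l' ! i \<in> ?S \<and> l' ! (Suc i mod ?k) \<in> ?S)"
    proof
      assume "l' ! i \<in> ?S \<and> l' ! (Suc i mod ?k) \<in> ?S"
      then have "r (l' ! i) < r (l' ! (Suc i mod ?k))" "r (l' ! (Suc i mod ?k)) < r (l' ! i)"
        using e by (auto simp: peaks_def copy_of_def insert_commute)
      then show False by simp
    qed
  qed
  have "\<exists>i<?k. l ! i \<notin> ?S \<and> l ! (Suc i mod ?k) \<notin> ?S"
  proof (rule ccontr)
    assume "\<not> ?thesis"
    then have alt: "l ! (Suc i mod ?k) \<in> ?S \<longleftrightarrow> l ! i \<notin> ?S" if "i < ?k" for i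
      using indep(1)[of l i] len that by blast
    have "l ! i \<in> ?S \<longleftrightarrow> (l ! 0 \<in> ?S \<longleftrightarrow> even i)" if "i < ?k" for i
      using that
    proof (induction i)
      case (Suc i)
      then show ?case using alt[of i] by auto
    qed simp
    from this[of "2 * m"] have "l ! (2 * m) \<in> ?S \<longleftrightarrow> l ! 0 \<in> ?S" by simp
    then show False using alt[of "2 * m"] by simp
  qed
  then obtain i where i: "i < ?k" "l ! i \<notin> ?S" "l ! (Suc i mod ?k) \<notin> ?S" by blast
  define l' where "l' = rotate (Suc i) l"
  have l': "copy_of l' = copy_of l" "length l' = ?k" "distinct l'" using len unfolding l'_def by (simp_all only: copy_of_rotate length_rotate distinct_rotate)
  have nth: "l' ! j = l ! ((Suc i + j) mod ?k)" if "j < ?k" for j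
    using nth_rotate[of j l "Suc i"] that len by (simp add: l'_def)
  have n0: "l' ! 0 \<notin> ?S" using nth[of 0] i by simp
  have "(Suc i + 2 * m) mod ?k = i" using i by (metis add_Suc_shift add.commute mod_add_self2 mod_less Suc_eq_plus1)
  then have n2: "l' ! (2 * m) \<notin> ?S" using nth[of "2 * m"] i by simp
  have "?S \<subseteq> (!) l' ` {i\<in>{1..2 * m}. l' ! i \<in> ?S}"
  proof
    fix v assume v: "v \<in> ?S"
    then have "v \<in> set l'" using l' by (auto simp: peaks_def copy_of_def)
    then obtain j where j: "j < ?k" "v = l' ! j" using l' by (metis in_set_conv_nth)
    then have "0 < j" using n0 v by (metis gr0I)
    then show "v \<in> (!) l' ` {i\<in>{1..2 * m}. l' ! i \<in> ?S}" using j v by auto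
  qed
  then have "card ?S \<le> card {i\<in>{1..2 * m}. l' ! i \<in> ?S}" by (rule surj_card_le[rotated]) simp
  then have mc: "m \<le> card {i\<in>{1..2 * m}. l' ! i \<in> ?S}" using c by simp
  have odd: "l' ! (2 * j + 1) \<in> ?S" if "j < m" for j
  proof (rule independent_odd[OF _ n2 mc that])
    fix i assume "i < 2 * m"
    then show "\<not> (l' ! i \<in> ?S \<and> l' ! Suc i \<in> ?S)" using indep(1)[OF l'(1,2), of i] by simp
  qed
  have "zigzag r m l'"
    unfolding zigzag_def
  proof (intro allI impI)
    fix j assume j: "j < m"
    have "{l' ! (2 * j), l' ! (2 * j + 1)} \<in> ce l" using indep(2)[OF l'(1,2), of "2 * j"] j by simp
    moreover have "{l' ! (2 * j + 2), l' ! (2 * j + 1)} \<in> ce l"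
      using indep(2)[OF l'(1,2), of "2 * j + 1"] j by (simp add: insert_commute)
    ultimately show "r (l' ! (2 * j)) < r (l' ! (2 * j + 1)) \<and> r (l' ! (2 * j + 2)) < r (l' ! (2 * j + 1))"
      using odd[OF j] by (simp add: peaks_def copy_of_def)
  qed
  then show ?thesis using cyc_copy_of[OF l l'(1,3,2)] l'(1) by blast
qed

text \<open>The inserted vertices need not be distinct, so that the number of lists is exactly a
  product; for an upper bound this is harmless.\<close>

fun weave :: "('a \<Rightarrow> 'a \<Rightarrow> 'a set) \<Rightarrow> 'a list \<Rightarrow> 'a list set" where
  "weave N (t # t' # ts) = (\<lambda>(s, l). t # s # l) ` (N t t' \<times> weave N (t' # ts))"
| "weave N ts = {ts}"

lemma weave_card:
  assumes "\<And>a b. finite (N a b)"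
  shows "finite (weave N ts) \<and> real (card (weave N ts)) = pw (\<lambda>a b. real (card (N a b))) ts"
  using assms
proof (induction N ts rule: weave.induct)
  case (1 N t t' ts)
  have "inj_on (\<lambda>(s, l). t # s # l) (N t t' \<times> weave N (t' # ts))" by (auto simp: inj_on_def)
  then have "card (weave N (t # t' # ts)) = card (N t t') * card (weave N (t' # ts))"
    by (simp add: card_image card_cartesian_product)
  moreover have "finite (N t t' \<times> weave N (t' # ts))" using 1 by simp
  then have "finite (weave N (t # t' # ts))" unfolding weave.simps by (rule finite_imageI)
  ultimately show ?case using 1 by simp
qed auto

lemma weaveI:
  "length l + 1 = 2 * length ts \<Longrightarrow> (\<And>j. j < length ts \<Longrightarrow> l ! (2 * j) = ts ! j) \<Longrightarrow>
   (\<And>j. Suc j < length ts \<Longrightarrow> l ! (2 * j + 1) \<in> N (ts ! j) (ts ! Suc j)) \<Longrightarrow> l \<in> weave N ts"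
proof (induction N ts arbitrary: l rule: weave.induct)
  case (1 N t t' ts)
  obtain a s l' where l: "l = a # s # l'" using 1(2) by (cases l; cases "tl l") auto
  have "l' \<in> weave N (t' # ts)"
  proof (rule 1(1))
    show "length l' + 1 = 2 * length (t' # ts)" using 1(2) l by simp
    show "l' ! (2 * j) = (t' # ts) ! j" if "j < length (t' # ts)" for j using 1(3)[of "Suc j"] that l by simp
    show "l' ! (2 * j + 1) \<in> N ((t' # ts) ! j) ((t' # ts) ! Suc j)" if "Suc j < length (t' # ts)" for j
      using 1(4)[of "Suc j"] that l by simp
  qed
  moreover have "a = t" "s \<in> N t t'" using 1(3)[of 0] 1(4)[of 0] l by simp_all
  ultimately show ?case using l by auto
next
  case ("2_1" N)
  then show ?case by simp
next
  case ("2_2" N v)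
  then show ?case by (cases l) auto
qed

definition evens :: "nat \<Rightarrow> 'a list \<Rightarrow> 'a list" where
  "evens n l = map (\<lambda>j. l ! (2 * j)) [0..<n]"

lemma evens_DL:
  assumes "distinct l" "2 * n \<le> length l + 1" "\<And>j. j < n \<Longrightarrow> l ! (2 * j) \<in> X"
  shows "evens n l \<in> DL n X"
  using assms by (auto simp: evens_def DL_def distinct_map inj_on_def nth_eq_iff_index_eq)

section \<open>The upper bound\<close>

lemma double_card_image:
  assumes fin: "finite A" and g: "\<And>x. x \<in> A \<Longrightarrow> g x \<in> A \<and> g x \<noteq> x \<and> f (g x) = f x"
  shows "2 * card (f ` A) \<le> card A"
proof -
  have "(\<Sum>c\<in>f ` A. 2) \<le> (\<Sum>c\<in>f ` A. card {x\<in>A. f x = c})"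
  proof (rule sum_mono)
    fix c assume "c \<in> f ` A"
    then obtain x where x: "x \<in> A" "c = f x" by blast
    then have "{x, g x} \<subseteq> {x\<in>A. f x = c}" using g by auto
    then have "card {x, g x} \<le> card {x\<in>A. f x = c}" using fin by (intro card_mono) auto
    then show "2 \<le> card {x\<in>A. f x = c}" using g[OF x(1)] by (auto simp: card_insert_if split: if_splits)
  qed
  also have "\<dots> = card A"
    using sum.group[OF fin, of "f ` A" f "\<lambda>_. 1::nat"] fin by simp
  finally show ?thesis by (simp add: mult.commute)
qed

lemma weights_add:
  assumes "weights X n" "weights X z"
  shows "weights X (\<lambda>x y. n x y + z x y)"
proof -
  interpret N: weights X n by fact
  interpret Z: weights X z by fact
  show ?thesis
    by unfold_locales (use N.finX N.nonneg Z.nonneg N.sym Z.sym N.diag Z.diag in \<open>simp_all add: add_nonneg_nonneg\<close>)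
qed

lemma pw_mono:
  assumes "weights X n" "weights X z"
  shows "pw n xs \<le> pw (\<lambda>x y. n x y + z x y) xs"
proof -
  interpret N: weights X n by fact
  interpret Z: weights X z by fact
  interpret W: weights X "\<lambda>x y. n x y + z x y" using weights_add[OF assms] .
  show ?thesis
  proof (induction xs rule: induct_list012)
    case (3 x y xs)
    then show ?case using mult_mono[of "n x y" "n x y + z x y" "pw n (y # xs)"] N.nonneg Z.nonneg N.pw_nonneg by simp
  qed auto
qed

text \<open>In the cyclic product of a sum, keep the terms with no factor z, and with the factor z only at
  the closing edge or only at the first edge; by rotation the last two kinds have the same sum.\<close>

lemma Ssum_add_ge:
  assumes n: "weights X n" and z: "weights X z" and m: "2 \<le> m"
  shows "Ssum n X m + 2 * (\<Sum>xs\<in>DL m X. pw n xs * z (last xs) (hd xs)) \<le> Ssum (\<lambda>x y. n x y + z x y) X m"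
proof -
  interpret N: weights X n by fact
  interpret Z: weights X z by fact
  let ?w = "\<lambda>x y. n x y + z x y"
  interpret W: weights X ?w using weights_add[OF n z] .
  let ?c = "\<lambda>xs. pw n xs * z (last xs) (hd xs)"
  have tm: "cw n xs + ?c xs + ?c (rotate1 xs) \<le> cw ?w xs" if xs: "xs \<in> DL m X" for xs
  proof -
    obtain x y ys where e: "xs = x # y # ys" using xs m by (cases xs; cases "tl xs") (auto simp: DL_def)
    define p P where "p = pw n (y # ys)" and "P = pw ?w (y # ys)"
    define l where "l = last (y # ys)"
    have p: "0 \<le> p" "p \<le> P" by (simp_all add: p_def P_def N.pw_nonneg pw_mono[OF n z])
    have "cw n xs = n x y * p * n l x" "?c xs = n x y * p * z l x" "cw ?w xs = (n x y + z x y) * P * (n l x + z l x)"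
      "?c (rotate1 xs) = p * n l x * z x y"
      using pw_snoc[of "y # ys" n x] by (simp_all add: e cw_def p_def P_def l_def)
    moreover have "(n x y + z x y) * p * (n l x + z l x) \<le> (n x y + z x y) * P * (n l x + z l x)"
      using p N.nonneg Z.nonneg by (intro mult_right_mono mult_left_mono) auto
    moreover have "0 \<le> z x y * p * z l x" using p Z.nonneg by simp
    ultimately show ?thesis by (simp add: algebra_simps)
  qed
  have "Ssum n X m + 2 * (\<Sum>xs\<in>DL m X. ?c xs) = (\<Sum>xs\<in>DL m X. cw n xs + ?c xs + ?c (rotate1 xs))"
    using sum_DL_rotate1[OF N.finX, of ?c m] by (simp add: Ssum_def sum.distrib)
  also have "\<dots> \<le> Ssum ?w X m" unfolding Ssum_def by (rule sum_mono[OF tm])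
  finally show ?thesis .
qed

text \<open>A crude bound, for the terms that carry the number of bad vertices as a factor.\<close>

lemma (in weights) sum_pw_le: "(\<Sum>xs\<in>DL (Suc (Suc k)) X. pw w xs) \<le> tot X ^ Suc k"
proof (induction k)
  case 0
  have DL0: "DL 0 X = {[]}" by (auto simp: DL_def)
  have "(\<Sum>xs\<in>DL (Suc (Suc 0)) X. pw w xs) = (\<Sum>x\<in>X. \<Sum>y\<in>X - {x}. w y x)"
    by (simp add: sum_DL_Suc[OF finX, where F = "pw w"] sum_DL_Suc[OF finX, where F = "\<lambda>zs. \<Sum>y\<in>X - set zs. pw w (y # zs)"] DL0)
  also have "\<dots> \<le> (\<Sum>x\<in>X. \<Sum>y\<in>X. w y x)" using finX nonneg by (intro sum_mono sum_mono2) auto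
  finally show ?case by (simp add: tot_def d_def sym)
next
  case (Suc k)
  have "(\<Sum>xs\<in>DL (Suc (Suc (Suc k))) X. pw w xs) = (\<Sum>zs\<in>DL (Suc (Suc k)) X. \<Sum>y\<in>X - set zs. pw w (y # zs))"
    by (rule sum_DL_Suc[OF finX])
  also have "\<dots> \<le> (\<Sum>zs\<in>DL (Suc (Suc k)) X. tot X * pw w zs)"
  proof (rule sum_mono)
    fix zs assume zs: "zs \<in> DL (Suc (Suc k)) X"
    then have ne: "zs \<noteq> []" and hd: "hd zs \<in> X" by (cases zs; auto simp: DL_def)+
    have "(\<Sum>y\<in>X - set zs. pw w (y # zs)) = (\<Sum>y\<in>X - set zs. w y (hd zs)) * pw w zs"
      by (simp add: pw_Cons[OF ne] sum_distrib_right)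
    also have "(\<Sum>y\<in>X - set zs. w y (hd zs)) \<le> (\<Sum>y\<in>X. w (hd zs) y)"
      unfolding sym[of _ "hd zs"] by (rule sum_mono2) (use finX nonneg in auto)
    also have "\<dots> \<le> tot X" unfolding tot_def d_def
      by (rule member_le_sum[OF hd, of "\<lambda>x. \<Sum>y\<in>X. w x y"]) (use finX nonneg in \<open>auto intro: sum_nonneg\<close>)
    finally show "(\<Sum>y\<in>X - set zs. pw w (y # zs)) \<le> tot X * pw w zs" by (simp add: mult_right_mono pw_nonneg)
  qed
  also have "\<dots> \<le> tot X * tot X ^ Suc k" using Suc.IH tot_nonneg by (simp add: sum_distrib_left[symmetric] mult_left_mono)
  finally show ?case by simp
qed

section \<open>Classification and count of the cycles in a fixed graph\<close>

locale counting = hubs V E X B r + ranked V E r B "X \<union> fin_graph.bad V E X" D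
  for V :: "'a set" and E X B and r :: "'a \<Rightarrow> nat" and D +
  fixes m :: nat
  assumes m: "2 \<le> m" and inj: "inj_on r V"
begin

abbreviation "K \<equiv> 2 * m + 1"

lemma cyc_facts:
  assumes "l \<in> cyc E K"
  shows "length l = K" "distinct l" "set l \<subseteq> V" "l ! 0 \<in> V" "{l ! 0, l ! (2 * m)} \<in> E"
    "\<And>i. i < 2 * m \<Longrightarrow> {l ! i, l ! Suc i} \<in> E"
proof -
  show len: "length l = K" "distinct l" using assms by (auto simp: cyc_def)
  have ne: "l \<noteq> []" using len by auto
  have e: "{l ! i, l ! (Suc i mod K)} \<in> E" if "i < K" for i
    using assms that len ce_nth[OF ne] by (auto simp: cyc_def)
  show "{l ! i, l ! Suc i} \<in> E" if "i < 2 * m" for i using e[of i] that by simp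
  show "{l ! 0, l ! (2 * m)} \<in> E" using e[of "2 * m"] by (simp add: insert_commute)
  show sub: "set l \<subseteq> V"
  proof
    fix v assume "v \<in> set l"
    then obtain i where "i < K" "v = l ! i" using len by (metis in_set_conv_nth)
    then show "v \<in> V" using e[of i] adj_in by auto
  qed
  show "l ! 0 \<in> V" using sub ne len nth_mem[of 0 l] by auto
qed

lemma finite_cyc: "finite (cyc E K)"
  by (rule finite_subset[OF _ finite_lists_length_eq[OF finV, of K]]) (use cyc_facts in auto)

text \<open>All m + 1 non-peaks are hubs. They form a path in the hub weights, and the edge at the
  seam is a mere edge of the graph.\<close>

definition TB where
  "TB = {l\<in>cyc E K. zigzag r m l \<and> (\<forall>j\<le>m. l ! (2 * j) \<in> X) \<and> (\<forall>j<m. l ! (2 * j + 1) \<in> V - X - bad X)}"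

text \<open>The non-peak at position 2m is not a hub, and the last peak with it forms a link. The
  hubs lie in \<open>B\<close>, as \<open>card_links\<close> requires. Lists with the non-hub at
  position 0 are reversed.\<close>

definition TA where
  "TA = {l\<in>cyc E K. zigzag r m l \<and> (\<forall>j<m. l ! (2 * j) \<in> B) \<and> l ! (2 * m) \<in> V - X \<and> (\<forall>j<m. l ! (2 * j + 1) \<in> V - X - bad X)}"

text \<open>One free choice fewer than the maximal number of peaks, and one special choice. The
  length 2m + 3 is that of \<open>gen_error\<close> for m peaks and m + 1 other vertices.\<close>

definition Err where "Err = {S. gen (2 * m + 3) (m - 1) 1 S}"

text \<open>A vertex that is not a peak is reached downwards from a neighbour in the cycle, so only
  peaks are chosen freely.\<close>

lemma few_peaks:
  assumes l: "l \<in> cyc E K" and few: "card (peaks r (copy_of l)) \<le> m - 1"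
  shows "set l \<in> Err"
proof -
  note f = cyc_facts[OF l]
  let ?P = "peaks r (copy_of l)"
  have "gen (card (set l)) (card (set l \<inter> ?P)) 1 (set l)"
  proof (rule gen_few)
    fix v assume v: "v \<in> set l"
    show "v \<in> ?P \<or> (\<exists>u\<in>set l. {u, v} \<in> E \<and> r v < r u)"
    proof (rule disjCI)
      assume "\<not> (\<exists>u\<in>set l. {u, v} \<in> E \<and> r v < r u)"
      moreover have "u \<in> set l \<and> {u, v} \<in> E \<and> r u \<noteq> r v" if u: "{u, v} \<in> ce l" for u
      proof -
        have "{u, v} \<in> E" "u \<in> set l" using u l ce_edges[OF f(2) _ u] m f(1) by (auto simp: cyc_def)
        moreover have "u \<noteq> v" "u \<in> V" "v \<in> V" using calculation adj_neq adj_in by auto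
        ultimately show ?thesis using inj by (auto simp: inj_on_def)
      qed
      ultimately show "v \<in> ?P" using v by (force simp: peaks_def copy_of_def)
    qed
  qed (use f in auto)
  moreover have "card (set l) = K" using f by (simp add: distinct_card)
  moreover have "card (set l \<inter> ?P) \<le> m - 1"
    using card_mono[of ?P "set l \<inter> ?P"] few by (auto simp: peaks_def copy_of_def)
  ultimately show ?thesis unfolding Err_def using gen_mono[of K _ 1 "set l" "2 * m + 3" "m - 1" 1] by simp
qed

definition NN :: "'a \<Rightarrow> 'a \<Rightarrow> 'a set" where "NN a b = (if a = b then {} else cl {a, b})"

lemma weave_NN: "finite (weave NN ts)" "real (card (weave NN ts)) = pw nn ts"
proof -
  have "finite (NN a b)" for a b by (simp add: NN_def fin_cl)
  moreover have "(\<lambda>a b. real (card (NN a b))) = nn" by (simp add: NN_def nn_def fun_eq_iff)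
  ultimately show "finite (weave NN ts)" "real (card (weave NN ts)) = pw nn ts" using weave_card[of NN ts] by simp_all
qed

text \<open>A peak that is not bad has at most two hubs as neighbours, so its two neighbours in the
  cycle are all of them.\<close>

lemma between_NN:
  assumes l: "l \<in> cyc E K" and j: "j < m" and s: "l ! (2 * j + 1) \<in> V - X - bad X"
    and t: "l ! (2 * j) \<in> X" "l ! (2 * j + 2) \<in> X"
  shows "l ! (2 * j + 1) \<in> NN (l ! (2 * j)) (l ! (2 * j + 2))"
proof -
  note f = cyc_facts[OF l]
  let ?s = "l ! (2 * j + 1)" and ?T = "{l ! (2 * j), l ! (2 * j + 2)}"
  have ne: "l ! (2 * j) \<noteq> l ! (2 * j + 2)" using f(1,2) j by (simp add: nth_eq_iff_index_eq)
  have "{l ! (2 * j), ?s} \<in> E" "{l ! (2 * j + 2), ?s} \<in> E"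
    using f(6)[of "2 * j"] f(6)[of "2 * j + 1"] j by (simp_all add: insert_commute)
  then have "?T \<subseteq> nb E X ?s" using t by (auto simp: nb_def)
  moreover have "card (nb E X ?s) \<le> 2" using s by (auto simp: bad_def bad0_def)
  ultimately have "?T = nb E X ?s" using ne finite_nb by (intro card_seteq) simp_all
  then show ?thesis using s ne by (auto simp: NN_def cl_def)
qed

lemma TB_card: "real (card TB) \<le> Qsum nn X m"
proof -
  have "TB \<subseteq> (\<Union>ts\<in>DL (Suc m) X. weave NN ts)"
  proof
    fix l assume l: "l \<in> TB"
    then have c: "l \<in> cyc E K" by (simp add: TB_def)
    note f = cyc_facts[OF c]
    have t: "l ! (2 * j) \<in> X" if "j \<le> m" for j using l that by (simp add: TB_def)
    have "evens (Suc m) l \<in> DL (Suc m) X" using f(1,2) t by (intro evens_DL) auto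
    moreover have "l \<in> weave NN (evens (Suc m) l)"
    proof (rule weaveI)
      fix j assume j: "Suc j < length (evens (Suc m) l)"
      then have "l ! (2 * j + 1) \<in> NN (l ! (2 * j)) (l ! (2 * j + 2))"
        using l t[of j] t[of "Suc j"] by (intro between_NN[OF c]) (auto simp: TB_def evens_def)
      then show "l ! (2 * j + 1) \<in> NN (evens (Suc m) l ! j) (evens (Suc m) l ! Suc j)"
        using j by (simp add: evens_def nth_append del: upt_Suc)
    qed (use f in \<open>simp_all add: evens_def del: upt_Suc\<close>)
    ultimately show "l \<in> (\<Union>ts\<in>DL (Suc m) X. weave NN ts)" by blast
  qed
  then have "card TB \<le> card (\<Union>ts\<in>DL (Suc m) X. weave NN ts)"
    using finite_DL[OF finX] weave_NN by (intro card_mono) auto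
  also have "\<dots> \<le> (\<Sum>ts\<in>DL (Suc m) X. card (weave NN ts))" by (rule card_UN_le[OF finite_DL[OF finX]])
  finally have "real (card TB) \<le> real (\<Sum>ts\<in>DL (Suc m) X. card (weave NN ts))" by (rule of_nat_mono)
  then show ?thesis by (simp add: weave_NN(2) Qsum_def)
qed

lemma finite_links: "finite (links a b)"
  by (rule finite_subset[of _ "V \<times> V"]) (use finV in \<open>auto simp: links_def\<close>)

text \<open>The last two entries of the list are a link from the last hub to the first; the part
  before them is a weave of the m hubs.\<close>

lemma TA_card: "real (card TA) \<le> (\<Sum>ts\<in>DL m B. pw nn ts * real (card (links (last ts) (hd ts))))"
proof -
  let ?f = "\<lambda>(u, (x, t)). u @ [x, t]"
  let ?P = "\<lambda>ts. weave NN ts \<times> links (last ts) (hd ts)"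
  have finP: "finite (?P ts)" for ts using weave_NN finite_links by simp
  have "TA \<subseteq> (\<Union>ts\<in>DL m B. ?f ` ?P ts)"
  proof
    fix l assume l: "l \<in> TA"
    then have c: "l \<in> cyc E K" by (simp add: TA_def)
    note f = cyc_facts[OF c]
    have t: "l ! (2 * j) \<in> B" if "j < m" for j using l that by (simp add: TA_def)
    have tX: "l ! (2 * j) \<in> X" if "j < m" for j using t[OF that] BX by auto
    define u where "u = take (2 * m - 1) l"
    define x where "x = l ! (2 * m - 1)"
    define y where "y = l ! (2 * m)"
    have mm: "2 * (m - 1) + 1 = 2 * m - 1" "2 * (m - 1) + 2 = 2 * m" "Suc (2 * m - 1) = 2 * m" using m by auto
    have lu: "l = u @ [x, y]"
    proof -
      have "l = take (2 * m - 1) l @ drop (2 * m - 1) l" by simp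
      also have "drop (2 * m - 1) l = l ! (2 * m - 1) # drop (2 * m) l"
        using Cons_nth_drop_Suc[of "2 * m - 1" l] f(1) unfolding mm(3) by simp
      also have "drop (2 * m) l = l ! (2 * m) # drop (Suc (2 * m)) l"
        using Cons_nth_drop_Suc[of "2 * m" l] f(1) by simp
      finally show ?thesis using f(1) by (simp add: u_def x_def y_def)
    qed
    let ?ts = "evens m l"
    have DL: "?ts \<in> DL m B" using f(1,2) t by (intro evens_DL) auto
    have lts: "length ?ts = m" "?ts \<noteq> []" using m by (auto simp: evens_def)
    have hl: "hd ?ts = l ! 0" "last ?ts = l ! (2 * (m - 1))"
      using lts m by (simp_all add: hd_conv_nth last_conv_nth) (simp_all add: evens_def)
    have lenu: "length u = 2 * m - 1" using f(1) by (simp add: u_def)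
    have un: "u ! i = l ! i" if "i < 2 * m - 1" for i using that by (simp add: u_def)
    have "u \<in> weave NN ?ts"
    proof (rule weaveI)
      show "length u + 1 = 2 * length ?ts" using lenu lts m by simp
      show "u ! (2 * j) = ?ts ! j" if "j < length ?ts" for j using that lts un[of "2 * j"] by (simp add: evens_def)
      fix j assume "Suc j < length ?ts"
      then have j: "Suc j < m" using lts by simp
      then have "l ! (2 * j + 1) \<in> NN (l ! (2 * j)) (l ! (2 * j + 2))"
        using l tX[of j] tX[of "Suc j"] by (intro between_NN[OF c]) (auto simp: TA_def)
      then show "u ! (2 * j + 1) \<in> NN (?ts ! j) (?ts ! Suc j)"
        using j un[of "2 * j + 1"] by (simp add: evens_def)
    qed
    moreover have "(x, y) \<in> links (last ?ts) (hd ?ts)"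
    proof -
      have "x \<in> V - X - bad X" using l m mm(1) unfolding TA_def x_def by (metis (no_types, lifting) mem_Collect_eq diff_less less_le_trans zero_less_numeral zero_less_one)
      moreover have "y \<in> V - X" using l by (simp add: TA_def y_def)
      moreover have "{x, y} \<in> E" using f(6)[of "2 * m - 1"] m unfolding mm(3) by (simp add: x_def y_def)
      moreover have "zigzag r m l" using l by (simp add: TA_def)
      then have "r (l ! (2 * (m - 1) + 2)) < r (l ! (2 * (m - 1) + 1))" using m unfolding zigzag_def by simp
      then have "r y < r x" unfolding mm by (simp add: x_def y_def)
      moreover have "{l ! (2 * (m - 1)), x} \<in> E" using f(6)[of "2 * (m - 1)"] m mm(1) by (simp add: x_def)
      moreover have "{l ! 0, y} \<in> E" using f(5) by (simp add: y_def)
      ultimately show ?thesis using tX[of 0] tX[of "m - 1"] m unfolding hl by (simp add: links_def nb_def)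
    qed
    ultimately have "(u, (x, y)) \<in> ?P ?ts" by simp
    then have "l \<in> ?f ` ?P ?ts" using lu by (intro image_eqI[of _ _ "(u, (x, y))"]) simp_all
    then show "l \<in> (\<Union>ts\<in>DL m B. ?f ` ?P ts)" using DL by blast
  qed
  then have "card TA \<le> card (\<Union>ts\<in>DL m B. ?f ` ?P ts)"
    using finite_DL[OF finB] finP by (intro card_mono) auto
  also have "\<dots> \<le> (\<Sum>ts\<in>DL m B. card (?f ` ?P ts))" by (rule card_UN_le[OF finite_DL[OF finB]])
  also have "\<dots> \<le> (\<Sum>ts\<in>DL m B. card (weave NN ts) * card (links (last ts) (hd ts)))"
    using card_image_le[OF finP] by (intro sum_mono) (simp add: card_cartesian_product)
  finally have "real (card TA) \<le> real (\<Sum>ts\<in>DL m B. card (weave NN ts) * card (links (last ts) (hd ts)))" by (rule of_nat_mono)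
  then show ?thesis by (simp add: weave_NN(2))
qed

text \<open>A list and its reversal describe the same copy and both lie in \<open>TB\<close>, which
  is the origin of the factor 1/2 at \<open>Qsum\<close>. In \<open>TA\<close> only one end of the
  list is a hub, so no such halving occurs.\<close>

lemma TB_double: "2 * card (copy_of ` TB) \<le> card TB"
proof (rule double_card_image[of _ rev])
  show "finite TB" using finite_cyc by (simp add: TB_def)
  fix l assume l: "l \<in> TB"
  then have c: "l \<in> cyc E K" by (simp add: TB_def)
  note f = cyc_facts[OF c]
  have rt: "rev l ! (2 * j) = l ! (2 * (m - j))" if "j \<le> m" for j
    using f(1) that by (simp add: rev_nth diff_mult_distrib2)
  have rs: "rev l ! (2 * j + 1) = l ! (2 * (m - 1 - j) + 1)" if "j < m" for j
  proof -
    have "K - Suc (2 * j + 1) = 2 * (m - 1 - j) + 1" using that by arith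
    then show ?thesis using f(1) that by (simp add: rev_nth)
  qed
  have "rev l ! (2 * j) \<in> X" if "j \<le> m" for j using l that unfolding rt[OF that] by (simp add: TB_def)
  moreover have "rev l ! (2 * j + 1) \<in> V - X - bad X" if "j < m" for j
    using l that unfolding rs[OF that] by (simp add: TB_def)
  moreover have "rev l \<in> cyc E K" using cyc_copy_of[OF c copy_of_rev] f by simp
  moreover have "zigzag r m (rev l)" using zigzag_rev[OF f(1)] l by (simp add: TB_def)
  ultimately have "rev l \<in> TB" by (simp add: TB_def)
  moreover have "rev l ! 0 \<noteq> l ! 0" using rt[of 0] f(1,2) m by (simp add: nth_eq_iff_index_eq)
  ultimately show "rev l \<in> TB \<and> rev l \<noteq> l \<and> copy_of (rev l) = copy_of l" using copy_of_rev by auto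
qed

text \<open>Outside \<open>Err\<close> no peak can be had by a special step. A peak that is a hub or
  bad could; so could a peak next to a light non-peak (one outside \<open>B\<close>) that is reached
  downwards from another peak. This forces all inner non-peaks into \<open>B\<close>, and at least
  one of the two at the seam.\<close>

lemma copies_cover: "copies V E K \<subseteq> {c. fst c \<in> Err \<and> snd c \<subseteq> Pow (fst c)} \<union> copy_of ` TB \<union> copy_of ` TA"
proof
  fix c assume c: "c \<in> copies V E K"
  then obtain l where l: "l \<in> cyc E K" "c = copy_of l"
    using copies_eq[of K E V] edge m by auto
  have edges: "snd c \<subseteq> Pow (fst c)" using c unfolding copies_def by (cases c) (simp, blast)
  show "c \<in> {c. fst c \<in> Err \<and> snd c \<subseteq> Pow (fst c)} \<union> copy_of ` TB \<union> copy_of ` TA"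
  proof (cases "set l \<in> Err")
    case True
    then show ?thesis using edges l by (simp add: copy_of_def)
  next
    case False
    then have "m \<le> card (peaks r (copy_of l))" using few_peaks[OF l(1)] by fastforce
    then obtain l' where l': "l' \<in> cyc E K" "copy_of l' = c" and zz: "zigzag r m l'"
      using zigzag_exists[OF l(1), of r] m l(2) by auto
    note f = cyc_facts[OF l'(1)]
    have sl: "set l' = set l" using l' l by (simp add: copy_of_def)
    let ?s = "\<lambda>j. l' ! (2 * j + 1)" and ?t = "\<lambda>j. l' ! (2 * j)"
    have z: "r (?t j) < r (?s j)" "r (?t (Suc j)) < r (?s j)" "{?s j, ?t j} \<in> E" "{?s j, ?t (Suc j)} \<in> E" if "j < m" for j
      using zz that f(6)[of "2 * j"] f(6)[of "2 * j + 1"] by (auto simp: zigzag_def insert_commute)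
    have sne: "?s i \<noteq> ?s j" if "i < m" "j < m" "i \<noteq> j" for i j
      using f(1,2) that by (simp add: nth_eq_iff_index_eq)
    let ?S = "?s ` {..<m}" and ?T = "?t ` {..m}"
    have ST: "?S \<union> ?T = set l'"
    proof (intro equalityI subsetI)
      fix v assume "v \<in> set l'"
      then obtain i where i: "i < K" "v = l' ! i" using f by (metis in_set_conv_nth)
      show "v \<in> ?S \<union> ?T"
      proof (cases "even i")
        case True
        then have "v = ?t (i div 2)" "i div 2 \<le> m" using i by auto
        then show ?thesis by blast
      next
        case False
        then have "v = ?s (i div 2)" using i by auto
        moreover have "i div 2 < m" using i False by (elim oddE) simp
        ultimately show ?thesis by blast
      qed
    qed (use f in auto)
    have S0: "?s 0 \<in> ?S" "?s (m - 1) \<in> ?S" and T0: "?t 0 \<in> ?T" "?t m \<in> ?T"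
      by (rule imageI; use m in simp)+
    have cS: "card ?S \<le> m" "card ?T \<le> m + 1" using card_image_le[of "{..<m}" ?s] card_image_le[of "{..m}" ?t] by auto
    \<comment> \<open>The negated condition is the hypothesis \<open>error\<close> of
      \<open>gen_error\<close>, with \<open>?S\<close> the peaks and \<open>?T\<close> the other
      vertices.\<close>
    have noerr: "\<not> (s \<in> X \<union> bad X \<or> (\<exists>t\<in>?T - B. {t, s} \<in> E \<and> ((\<exists>u\<in>?S - {s}. {u, t} \<in> E \<and> r t < r u) \<or>
       (\<exists>t'\<in>?T. (\<exists>u\<in>?S - {s}. {u, t'} \<in> E \<and> r t' < r u) \<and> {t', t} \<in> E \<and> r t < r t'))))" if s: "s \<in> ?S" for s
    proof
      assume err: "s \<in> X \<union> bad X \<or> (\<exists>t\<in>?T - B. {t, s} \<in> E \<and> ((\<exists>u\<in>?S - {s}. {u, t} \<in> E \<and> r t < r u) \<or>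
       (\<exists>t'\<in>?T. (\<exists>u\<in>?S - {s}. {u, t'} \<in> E \<and> r t' < r u) \<and> {t', t} \<in> E \<and> r t < r t')))"
      have "\<exists>u\<in>?S. {u, t} \<in> E \<and> r t < r u" if t: "t \<in> ?T" for t
      proof -
        obtain j where j: "j \<le> m" "t = ?t j" using t by blast
        show ?thesis
        proof (cases j)
          case 0
          then show ?thesis using z(1,3)[of 0] m j S0(1) by (intro bexI[of _ "?s 0"]) simp_all
        next
          case (Suc i)
          then show ?thesis using z(2,4)[of i] j by (intro bexI[of _ "?s i"]) auto
        qed
      qed
      then have "gen (card ?S + 2 + card ?T) (card ?S - 1) 1 (?S \<union> ?T)"
        using gen_error[OF _ _ _ s _ err] ST f(3) by auto
      then have "gen (2 * m + 3) (m - 1) 1 (set l')" unfolding ST by (rule gen_mono) (use cS in auto)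
      then show False using False sl by (simp add: Err_def)
    qed
    have sX: "?s j \<in> V - X - bad X" if "j < m" for j
      using noerr[of "?s j"] that f(1,3) by auto
    have tB: "?t j \<in> B" if "0 < j" "j < m" for j
    proof (rule ccontr)
      assume n: "?t j \<notin> B"
      obtain i where i: "j = Suc i" using \<open>0 < j\<close> by (cases j) auto
      have "?s i \<in> ?S - {?s j}" using sne[of i j] that i by auto
      moreover have "{?s i, ?t j} \<in> E" "r (?t j) < r (?s i)" using z[of i] that i by auto
      moreover have "{?t j, ?s j} \<in> E" using z(3)[of j] that by (simp add: insert_commute)
      ultimately show False using noerr[of "?s j"] n that by (metis (no_types, lifting) DiffI atMost_iff imageI lessThan_iff less_imp_le)
    qed
    have tV: "?t j \<in> V" if "j \<le> m" for j using f(1,3) that nth_mem[of "2 * j" l'] by auto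
    have s0: "?s 0 \<in> ?S - {?s (m - 1)}" "?s (m - 1) \<in> ?S - {?s 0}" using sne[of 0 "m - 1"] m S0 by auto
    have mm: "Suc (m - 1) = m" using m by simp
    have last: "{?s (m - 1), ?t m} \<in> E" "r (?t m) < r (?s (m - 1))" using z(2,4)[of "m - 1"] m unfolding mm by auto
    have first: "{?s 0, ?t 0} \<in> E" "r (?t 0) < r (?s 0)" using z(1,3)[of 0] m by auto
    \<comment> \<open>If both vertices at the seam were light, one could descend from a peak to the
      higher of them and on to the lower one, next to which the other outer peak is found by a
      special step.\<close>
    have ends: "?t 0 \<in> B \<or> ?t m \<in> B"
    proof (rule ccontr)
      assume "\<not> ?thesis"
      then have n: "?t 0 \<in> ?T - B" "?t m \<in> ?T - B" using T0 by auto
      have "?t 0 \<noteq> ?t m" using f(1,2) m by (simp add: nth_eq_iff_index_eq)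
      then have "r (?t 0) \<noteq> r (?t m)" using inj tV[of 0] tV[of m] by (auto simp: inj_on_def)
      then consider "r (?t 0) < r (?t m)" | "r (?t m) < r (?t 0)" by linarith
      then show False
      proof cases
        case 1
        have "{?t 0, ?s 0} \<in> E" "{?t m, ?t 0} \<in> E" using first f(5) by (simp_all add: insert_commute)
        then show False using noerr[of "?s 0"] n s0 last 1 by blast
      next
        case 2
        have "{?t m, ?s (m - 1)} \<in> E" "{?t 0, ?t m} \<in> E" using last f(5) by (simp_all add: insert_commute)
        then show False using noerr[of "?s (m - 1)"] n s0 first 2 by blast
      qed
    qed
    show ?thesis
    proof (cases "?t 0 \<in> X \<and> ?t m \<in> X")
      case True
      have "?t j \<in> X" if "j \<le> m" for j
        using True tB[of j] BX that by (cases "j = 0"; cases "j = m") auto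
      then have "l' \<in> TB" using l' zz sX by (simp add: TB_def)
      then show ?thesis using l'(2) by blast
    next
      case False
      then consider "?t 0 \<in> B" "?t m \<notin> X" | "?t m \<in> B" "?t 0 \<notin> X" using ends BX by auto
      then show ?thesis
      proof cases
        case 1
        have "?t j \<in> B" if "j < m" for j using 1 tB[of j] that by (cases "j = 0") auto
        then have "l' \<in> TA" using l' zz sX tV[of m] 1 by (simp add: TA_def)
        then show ?thesis using l'(2) by blast
      next
        case 2
        have rt: "rev l' ! (2 * j) = ?t (m - j)" if "j \<le> m" for j
          using f(1) that by (simp add: rev_nth diff_mult_distrib2)
        have rs: "rev l' ! (2 * j + 1) = ?s (m - 1 - j)" if "j < m" for j
        proof -
          have "K - Suc (2 * j + 1) = 2 * (m - 1 - j) + 1" using that by arith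
          then show ?thesis using f(1) that by (simp add: rev_nth)
        qed
        have "rev l' ! (2 * j) \<in> B" if "j < m" for j
          using 2 tB[of "m - j"] that rt[of j] by (cases "j = 0") auto
        moreover have "rev l' ! (2 * m) \<in> V - X" using 2 tV[of 0] rt[of m] by simp
        moreover have "rev l' \<in> cyc E K" using cyc_copy_of[OF l'(1) copy_of_rev] f by simp
        moreover have "rev l' ! (2 * j + 1) \<in> V - X - bad X" if "j < m" for j using rs[OF that] sX[of "m - 1 - j"] that by simp
        ultimately have "rev l' \<in> TA" using zigzag_rev[OF f(1) zz] by (simp add: TA_def)
        then have "copy_of (rev l') \<in> copy_of ` TA" by (rule imageI)
        then show ?thesis using l'(2) by (simp add: copy_of_rev)
      qed
    qed
  qed
qed

end

context counting
begin

definition w :: "'a \<Rightarrow> 'a \<Rightarrow> real" where "w a b = nn a b + zz a b"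

lemma weights_nn: "weights X nn"
  by unfold_locales (auto simp: finX nn_def insert_commute)

lemma weights_zz: "weights X zz"
  by unfold_locales (auto simp: finX zz_def z1_def)

lemma weights_w: "weights X w"
  using weights_add[OF weights_nn weights_zz] by (simp add: w_def[abs_def])

text \<open>A copy is a vertex set with a family of its subsets as edges; a set of at most 2m + 3
  vertices has at most 2^2^(2m+3) such families.\<close>

lemma card_Err:
  assumes M: "D \<le> M" "card (X \<union> bad X) \<le> M" "1 \<le> M" and n: "1 \<le> card V"
  shows "card {c. fst c \<in> Err \<and> snd c \<subseteq> Pow (fst c)} \<le> 2 ^ 2 ^ (2 * m + 3) * (65 * (2 * m + 3) + 3) ^ (2 * m + 3) * card V ^ (m - 1) * M"
    and "finite {c. fst c \<in> Err \<and> snd c \<subseteq> Pow (fst c)}"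
proof -
  have e: "{c. fst c \<in> Err \<and> snd c \<subseteq> Pow (fst c)} = (SIGMA S:Err. Pow (Pow S))"
  proof (rule set_eqI)
    fix c show "c \<in> {c. fst c \<in> Err \<and> snd c \<subseteq> Pow (fst c)} \<longleftrightarrow> c \<in> (SIGMA S:Err. Pow (Pow S))" by (cases c) simp
  qed
  have finE: "finite Err" unfolding Err_def by (rule gen_finite)
  have S: "finite S \<and> card S \<le> 2 * m + 3" if "S \<in> Err" for S using gen_sub that by (auto simp: Err_def)
  show "finite {c. fst c \<in> Err \<and> snd c \<subseteq> Pow (fst c)}" unfolding e using finE S by (intro finite_SigmaI) auto
  have "card (SIGMA S:Err. Pow (Pow S)) = (\<Sum>S\<in>Err. 2 ^ 2 ^ card S)"
    using finE S by (simp add: card_SigmaI card_Pow)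
  also have "\<dots> \<le> (\<Sum>S\<in>Err. 2 ^ 2 ^ (2 * m + 3))" using S by (intro sum_mono power_increasing) auto
  also have "\<dots> = 2 ^ 2 ^ (2 * m + 3) * card Err" by simp
  also have "card Err \<le> (65 * (2 * m + 3) + 3) ^ (2 * m + 3) * card V ^ (m - 1) * M ^ 1"
    unfolding Err_def by (rule gen_bound[OF M(1,2) n M(3)]) simp
  finally show "card {c. fst c \<in> Err \<and> snd c \<subseteq> Pow (fst c)} \<le> 2 ^ 2 ^ (2 * m + 3) * (65 * (2 * m + 3) + 3) ^ (2 * m + 3) * card V ^ (m - 1) * M"
    unfolding e by (simp add: mult.assoc)
qed

text \<open>Reversal of the lists replaces the number of links from the last hub to the first by its
  average over both directions, which is what \<open>card_links\<close> bounds.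
  \<open>Ssum_add_ge\<close> absorbs the double coefficient of \<open>zz\<close>.\<close>

lemma TA_weight: "real (card TA) \<le> Ssum w X m + 4 * real (card (bad X)) * (2 * real (card V)) ^ (m - 1)"
proof -
  interpret N: weights X nn by (rule weights_nn)
  interpret Z: weights X zz by (rule weights_zz)
  have pw_rev: "pw nn (rev xs) = pw nn xs" for xs
  proof (induction xs rule: induct_list012)
    case (3 x y xs)
    then show ?case using pw_snoc[of "rev (y # xs)" nn x] N.sym[of y x] by simp
  qed auto
  let ?L = "\<lambda>a b. real (card (links a b))"
  let ?b = "real (card (bad X))"
  have "2 * (\<Sum>ts\<in>DL m B. pw nn ts * ?L (last ts) (hd ts))
      = (\<Sum>ts\<in>DL m B. pw nn ts * ?L (last ts) (hd ts)) + (\<Sum>ts\<in>DL m B. pw nn (rev ts) * ?L (last (rev ts)) (hd (rev ts)))"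
    using sum_DL_rev[OF finB, of "\<lambda>ts. pw nn ts * ?L (last ts) (hd ts)" m] by simp
  also have "\<dots> = (\<Sum>ts\<in>DL m B. pw nn ts * (?L (last ts) (hd ts) + ?L (hd ts) (last ts)))"
    unfolding sum.distrib[symmetric]
  proof (intro sum.cong refl)
    fix ts assume "ts \<in> DL m B"
    then have "ts \<noteq> []" using m by (auto simp: DL_def)
    then show "pw nn ts * ?L (last ts) (hd ts) + pw nn (rev ts) * ?L (last (rev ts)) (hd (rev ts))
      = pw nn ts * (?L (last ts) (hd ts) + ?L (hd ts) (last ts))"
      by (simp add: pw_rev last_rev hd_rev algebra_simps)
  qed
  also have "\<dots> \<le> (\<Sum>ts\<in>DL m B. pw nn ts * (2 * nn (last ts) (hd ts) + 4 * zz (last ts) (hd ts) + 8 * ?b))"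
  proof (intro sum_mono mult_left_mono N.pw_nonneg)
    fix ts assume ts: "ts \<in> DL m B"
    obtain x y ys where e: "ts = x # y # ys" using ts m by (cases ts; cases "tl ts") (auto simp: DL_def)
    have "last ts \<in> B" "hd ts \<in> B" "last ts \<noteq> hd ts" using ts last_in_set[of "y # ys"] by (auto simp: DL_def e)
    then show "?L (last ts) (hd ts) + ?L (hd ts) (last ts) \<le> 2 * nn (last ts) (hd ts) + 4 * zz (last ts) (hd ts) + 8 * ?b"
      by (rule card_links)
  qed
  also have "\<dots> \<le> (\<Sum>ts\<in>DL m X. pw nn ts * (2 * nn (last ts) (hd ts) + 4 * zz (last ts) (hd ts) + 8 * ?b))"
  proof (rule sum_mono2[OF finite_DL[OF finX]])
    show "DL m B \<subseteq> DL m X" using BX by (auto simp: DL_def)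
    fix ts show "0 \<le> pw nn ts * (2 * nn (last ts) (hd ts) + 4 * zz (last ts) (hd ts) + 8 * ?b)"
      using N.pw_nonneg[of ts] N.nonneg Z.nonneg by (intro mult_nonneg_nonneg add_nonneg_nonneg) simp_all
  qed
  also have "\<dots> = 2 * (Ssum nn X m + 2 * (\<Sum>ts\<in>DL m X. pw nn ts * zz (last ts) (hd ts))) + 8 * ?b * (\<Sum>ts\<in>DL m X. pw nn ts)"
    by (simp add: Ssum_def cw_def sum.distrib sum_distrib_left algebra_simps)
  also have "\<dots> \<le> 2 * Ssum w X m + 8 * ?b * (2 * real (card V)) ^ (m - 1)"
  proof (intro add_mono mult_left_mono)
    show "Ssum nn X m + 2 * (\<Sum>ts\<in>DL m X. pw nn ts * zz (last ts) (hd ts)) \<le> Ssum w X m"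
      using Ssum_add_ge[OF weights_nn weights_zz m] by (simp add: w_def[abs_def])
    obtain k where k: "m = Suc (Suc k)" using m by (metis Suc_le_D numeral_2_eq_2 Suc_le_mono)
    have "(\<Sum>ts\<in>DL m X. pw nn ts) \<le> N.tot X ^ (m - 1)" using N.sum_pw_le[of k] k by simp
    also have "\<dots> \<le> (2 * real (card V)) ^ (m - 1)"
    proof (rule power_mono)
      have "N.tot X \<le> (\<Sum>a\<in>X. \<Sum>b\<in>X. nn a b + zz a b)"
        unfolding N.tot_def N.d_def using Z.nonneg by (intro sum_mono) simp
      then show "N.tot X \<le> 2 * real (card V)" using total_weight by linarith
    qed (rule N.tot_nonneg)
    finally show "(\<Sum>ts\<in>DL m X. pw nn ts) \<le> (2 * real (card V)) ^ (m - 1)" .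
  qed simp_all
  finally show ?thesis using TA_card by linarith
qed

lemma copies_bound:
  assumes M: "D \<le> M" "card (X \<union> bad X) \<le> M" "1 \<le> M" and n: "1 \<le> card V"
  shows "real (card (copies V E K)) \<le> Ssum w X m + Qsum w X m / 2
    + (2 ^ 2 ^ (2 * m + 3) * (65 * (2 * real m + 3) + 3) ^ (2 * m + 3) + 4 * 2 ^ (m - 1)) * real (card V) ^ (m - 1) * real M"
proof -
  let ?F = "{c. fst c \<in> Err \<and> snd c \<subseteq> Pow (fst c)}"
  have finT: "finite TA" "finite TB" using finite_cyc by (simp_all add: TA_def TB_def)
  have "card (copies V E K) \<le> card (?F \<union> copy_of ` TB \<union> copy_of ` TA)"
    using copies_cover card_Err(2)[OF assms] finT by (intro card_mono) auto
  also have "\<dots> \<le> card ?F + card (copy_of ` TB) + card TA"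
    using card_Un_le[of "?F \<union> copy_of ` TB" "copy_of ` TA"] card_Un_le[of ?F "copy_of ` TB"] card_image_le[OF finT(1), of copy_of]
    by linarith
  finally have "real (card (copies V E K)) \<le> real (card ?F) + real (card (copy_of ` TB)) + real (card TA)"
    using of_nat_mono by fastforce
  moreover have "2 * real (card (copy_of ` TB)) \<le> Qsum nn X m"
    using of_nat_mono[OF TB_double, where 'a = real] TB_card by simp
  moreover have "Qsum nn X m \<le> Qsum w X m"
    unfolding Qsum_def w_def by (intro sum_mono pw_mono[OF weights_nn weights_zz])
  moreover have "real (card ?F) \<le> 2 ^ 2 ^ (2 * m + 3) * (65 * (2 * real m + 3) + 3) ^ (2 * m + 3) * real (card V) ^ (m - 1) * real M"
    using of_nat_mono[OF card_Err(1)[OF assms], where 'a = real] by simp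
  moreover note TA_weight
  moreover have "4 * real (card (bad X)) * (2 * real (card V)) ^ (m - 1) \<le> 4 * 2 ^ (m - 1) * real (card V) ^ (m - 1) * real M"
  proof -
    have "card (bad X) \<le> card (X \<union> bad X)" using finX fin_bad by (intro card_mono) auto
    then have "real (card (bad X)) \<le> real M" using M(2) by simp
    then have "real (card (bad X)) * (4 * (2 * real (card V)) ^ (m - 1)) \<le> real M * (4 * (2 * real (card V)) ^ (m - 1))"
      by (rule mult_right_mono) simp
    then show ?thesis by (simp add: power_mult_distrib mult_ac)
  qed
  ultimately show ?thesis unfolding distrib_right by linarith
qed

lemma weight_le: "weights.tot w X \<le> 2 * real (card V)"
  using total_weight weights.tot_def[OF weights_w] weights.d_def[OF weights_w] by (simp add: w_def)

end

text \<open>By the degree sum at most 64 n / D vertices have degree at least D. Hubs and bad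
  vertices are more by a constant factor, so a special step has O(D + n/D) choices.\<close>

lemma (in k33_free) upper:
  assumes m: "2 \<le> m" and n: "1 \<le> card V" and c: "0 \<le> c"
    and opt: "\<And>w :: 'a \<Rightarrow> 'a \<Rightarrow> real. \<And>X. weights X w \<Longrightarrow> Ssum w X m + Qsum w X m / 2 \<le> c * (weights.tot w X / 2) ^ m"
    and D: "1 \<le> D"
  shows "real (card (copies V E (2 * m + 1))) \<le> c * real (card V) ^ m
    + (2 ^ 2 ^ (2 * m + 3) * (65 * (2 * real m + 3) + 3) ^ (2 * m + 3) + 4 * 2 ^ (m - 1)) * real (card V) ^ (m - 1)
      * (real D + 10 ^ 19 * real (card V) / real D)"
proof -
  obtain r :: "'a \<Rightarrow> nat" where r: "inj_on r V" "\<And>v. v \<in> V \<Longrightarrow> card {u\<in>nb E V v. r u < r v} \<le> 64"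
    using rank_exists by blast
  define B where "B = {v\<in>V. D \<le> card (nb E V v)}"
  \<comment> \<open>Adding \<open>bad0 B\<close> makes every vertex outside \<open>X\<close> see at
    most two vertices of \<open>B\<close>.\<close>
  define X where "X = B \<union> bad0 B"
  have BV: "B \<subseteq> V" and XV: "X \<subseteq> V" and bX: "bad X \<subseteq> V"
    using bad_subset[of X] by (auto simp: B_def X_def bad0_def)
  interpret counting V E X B r D m
  proof unfold_locales
    fix v assume v: "v \<in> V - X"
    then have "v \<notin> bad0 B" "v \<in> V - B" by (auto simp: X_def)
    then show "card (nb E B v) \<le> 2" by (auto simp: bad0_def)
  qed (use XV bX r m in \<open>auto simp: X_def B_def\<close>)
  have "card V \<noteq> 0" using n by simp
  then have edV: "ed E V < 32 * card V" using sparse[of V] finV by auto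
  have "card B * D \<le> (\<Sum>v\<in>B. card (nb E V v))"
    using sum_bounded_below[of B D "\<lambda>v. card (nb E V v)"] by (auto simp: B_def)
  also have "\<dots> \<le> (\<Sum>v\<in>V. card (nb E V v))" using finV BV by (intro sum_mono2) auto
  also have "\<dots> \<le> 64 * card V" using handshake[OF finV] edV by simp
  finally have cB: "real (card B) * real D \<le> 64 * real (card V)"
    using of_nat_mono[of "card B * D" "64 * card V", where 'a = real] by simp
  have "card X \<le> 8225 * card B" using card_bad0[OF BV] card_Un_le[of B "bad0 B"] by (simp add: X_def)
  moreover have "card (X \<union> bad X) \<le> 5000000000001 * card X" using card_bad[OF XV] card_Un_le[of X "bad X"] by simp
  \<comment> \<open>41125000000008225 = 8225 * 5000000000001; multiplied by 64 it stays below
    10^19.\<close>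
  ultimately have cZ: "card (X \<union> bad X) \<le> 41125000000008225 * card B" by linarith
  let ?M = "D + card (X \<union> bad X)"
  have "real (card (X \<union> bad X)) \<le> 41125000000008225 * real (card B)"
    using of_nat_mono[OF cZ, where 'a = real] by simp
  moreover have "real (card B) \<le> 64 * real (card V) / real D" using cB D by (simp add: field_simps)
  ultimately have "real (card (X \<union> bad X)) \<le> 41125000000008225 * (64 * real (card V) / real D)" by linarith
  also have "\<dots> \<le> 10 ^ 19 * real (card V) / real D" using D by (simp add: divide_right_mono)
  finally have M: "real ?M \<le> real D + 10 ^ 19 * real (card V) / real D" by simp
  have "real (card (copies V E (2 * m + 1))) \<le> Ssum w X m + Qsum w X m / 2
    + (2 ^ 2 ^ (2 * m + 3) * (65 * (2 * real m + 3) + 3) ^ (2 * m + 3) + 4 * 2 ^ (m - 1)) * real (card V) ^ (m - 1) * real ?M"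
    using D by (intro copies_bound n) auto
  also have "Ssum w X m + Qsum w X m / 2 \<le> c * (weights.tot w X / 2) ^ m" by (rule opt[OF weights_w])
  also have "\<dots> \<le> c * real (card V) ^ m"
    using weight_le weights.tot_nonneg[OF weights_w] c by (intro mult_left_mono power_mono) auto
  also have "(2 ^ 2 ^ (2 * m + 3) * (65 * (2 * real m + 3) + 3) ^ (2 * m + 3) + 4 * 2 ^ (m - 1)) * real (card V) ^ (m - 1) * real ?M
    \<le> (2 ^ 2 ^ (2 * m + 3) * (65 * (2 * real m + 3) + 3) ^ (2 * m + 3) + 4 * 2 ^ (m - 1)) * real (card V) ^ (m - 1) * (real D + 10 ^ 19 * real (card V) / real D)"
    by (rule mult_left_mono[OF M]) simp
  finally show ?thesis by simp
qed

section \<open>From one planar graph to the maximum\<close>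

abbreviation planar_on :: "nat \<Rightarrow> nat set set \<Rightarrow> bool" where
  "planar_on n E \<equiv> simple_graph ({0..<n}, E) \<and> planar ({0..<n}, E)"

lemma finite_counts: "finite {num_copies ({0..<n}, E) H | E. planar_on n E}"
proof -
  have "{E. planar_on n E} \<subseteq> Pow (Pow {0..<n})" by (auto simp: simple_graph_def)
  then have "finite {E. planar_on n E}" by (rule finite_subset) simp
  then have "finite ((\<lambda>E. num_copies ({0..<n}, E) H) ` {E. planar_on n E})" by (rule finite_imageI)
  moreover have "{num_copies ({0..<n}, E) H | E. planar_on n E} = (\<lambda>E. num_copies ({0..<n}, E) H) ` {E. planar_on n E}"
    by blast
  ultimately show ?thesis by simp
qed

text \<open>Provides a member of the set whose maximum is \<open>NP\<close>, so that the maximum is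
  attained.\<close>

lemma planar_empty: "planar_on n {}"
  by (auto simp: simple_graph_def planar_def intro!: exI[of _ "of_nat :: nat \<Rightarrow> complex"] inj_onI)

lemma NP_ge: "planar_on n E \<Longrightarrow> num_copies ({0..<n}, E) H \<le> NP n H"
  unfolding NP_def by (rule Max_ge[OF finite_counts]) blast

lemma NP_le:
  assumes "\<And>E. planar_on n E \<Longrightarrow> real (num_copies ({0..<n}, E) H) \<le> b"
  shows "real (NP n H) \<le> b"
proof -
  have "NP n H \<in> {num_copies ({0..<n}, E) H | E. planar_on n E}"
    unfolding NP_def by (rule Max_in[OF finite_counts]) (use planar_empty in blast)
  then show ?thesis using assms by auto
qed

lemma NP_upper:
  assumes m: "2 \<le> m" and c: "0 \<le> c"
    and opt: "\<And>w :: nat \<Rightarrow> nat \<Rightarrow> real. \<And>X. weights X w \<Longrightarrow> Ssum w X m + Qsum w X m / 2 \<le> c * (weights.tot w X / 2) ^ m"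
  shows "\<exists>C\<ge>0. \<forall>n\<ge>1. real (NP n (cycle_graph (2 * m + 1))) \<le> c * real n ^ m + C * real n powr (real m - 1 / 5)"
proof -
  define A where "A = (2 ^ 2 ^ (2 * m + 3) * (65 * (2 * real m + 3) + 3) ^ (2 * m + 3) + 4 * 2 ^ (m - 1) :: real)"
  have A: "0 \<le> A" by (simp add: A_def)
  have "real (NP n (cycle_graph (2 * m + 1))) \<le> c * real n ^ m + A * (2 + 10 ^ 19) * real n powr (real m - 1 / 5)"
    if n: "1 \<le> n" for n
  proof (rule NP_le)
    fix E assume E: "planar_on n E"
    interpret k33_free "{0..<n}" E by (rule planar_k33_free) (use E in auto)
    \<comment> \<open>With this threshold \<open>D\<close> is at most 2 n^(4/5) and n / D at most
      n^(1/5).\<close>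
    define D where "D = nat \<lceil>real n powr (4 / 5)\<rceil>"
    have p1: "1 \<le> real n powr (4 / 5)" using n by (simp add: ge_one_powr_ge_zero)
    then have "1 \<le> \<lceil>real n powr (4 / 5)\<rceil>" by linarith
    then have D: "1 \<le> D" unfolding D_def by linarith
    have Dr: "real D = of_int \<lceil>real n powr (4 / 5)\<rceil>" using p1 by (simp add: D_def)
    have D1: "real n powr (4 / 5) \<le> real D" and D2: "real D \<le> 2 * real n powr (4 / 5)"
      unfolding Dr using p1 by linarith+
    have "real n = real n powr (4 / 5) * real n powr (1 / 5)" using n by (simp flip: powr_add)
    then have "real n / real D \<le> real n powr (1 / 5)"
      using D1 D mult_right_mono[OF D1, of "real n powr (1 / 5)"] by (simp add: divide_le_eq mult.commute)
    also have "\<dots> \<le> real n powr (4 / 5)" using n by (intro powr_mono) auto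
    finally have D3: "real n / real D \<le> real n powr (4 / 5)" .
    have pm: "real n ^ (m - 1) * real n powr (4 / 5) = real n powr (real m - 1 / 5)"
      using n m by (simp add: powr_realpow[symmetric] of_nat_diff flip: powr_add)
    have "real (num_copies ({0..<n}, E) (cycle_graph (2 * m + 1))) \<le> c * real n ^ m
        + A * real n ^ (m - 1) * (real D + 10 ^ 19 * real n / real D)"
      using upper[OF m _ c opt D] n unfolding A_def num_copies_cycle by simp
    also have "real D + 10 ^ 19 * real n / real D \<le> (2 + 10 ^ 19) * real n powr (4 / 5)"
    proof -
      have "10 ^ 19 * real n / real D = 10 ^ 19 * (real n / real D)" by simp
      moreover have "10 ^ 19 * (real n / real D) \<le> 10 ^ 19 * real n powr (4 / 5)" by (rule mult_left_mono[OF D3]) simp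
      ultimately show ?thesis using D2 unfolding distrib_right by linarith
    qed
    also have "A * real n ^ (m - 1) * ((2 + 10 ^ 19) * real n powr (4 / 5)) = A * (2 + 10 ^ 19) * (real n ^ (m - 1) * real n powr (4 / 5))"
      by (simp only: mult_ac)
    also note pm
    finally show "real (num_copies ({0..<n}, E) (cycle_graph (2 * m + 1))) \<le> c * real n ^ m + A * (2 + 10 ^ 19) * real n powr (real m - 1 / 5)"
      using A by (simp add: mult_left_mono)
  qed
  then show ?thesis using A by (intro exI[of _ "A * (2 + 10 ^ 19)"]) auto
qed

section \<open>The lower bound\<close>

text \<open>\<open>q\<close> is the number of classes into which the vertices other than the hubs
  are dealt out in turn: q = m for the general construction, q = 1 with m = 2 for pentagons.\<close>

locale drawing =
  fixes m q n :: nat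
  assumes m: "2 \<le> m" and q: "1 \<le> q" "q \<le> m" and n: "m \<le> n"
begin

definition cls :: "nat \<Rightarrow> nat" where "cls v = (v - m) mod q"
definition lev :: "nat \<Rightarrow> nat" where "lev v = (v - m) div q + 1"
definition lft :: "nat \<Rightarrow> nat" where "lft j = (if j = m - 1 then 0 else j)"
definition rgt :: "nat \<Rightarrow> nat" where "rgt j = (if j = m - 1 then m - 1 else Suc j)"
definition sg :: "nat \<Rightarrow> real" where "sg j = (if j = m - 1 then - 1 else 1)"

text \<open>The hubs are placed on the real axis, the other vertices above the midpoints of the intervals
  between consecutive hubs, and for the class joining the last hub to the first below the axis.\<close>

definition pos :: "nat \<Rightarrow> complex" where
  "pos v = (if v < m then Complex (real v) 0
    else Complex ((real (lft (cls v)) + real (rgt (cls v))) / 2) (sg (cls v) * real (lev v)))"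

text \<open>Coordinates adapted to a class: its left and right hub are (-1, 0) and (1, 0) and
  its vertices are (0, 1), (0, 2), and so on.\<close>

definition cu :: "nat \<Rightarrow> complex \<Rightarrow> real" where
  "cu j z = (2 * Re z - real (lft j) - real (rgt j)) / (real (rgt j) - real (lft j))"
definition ct :: "nat \<Rightarrow> complex \<Rightarrow> real" where "ct j z = sg j * Im z"

text \<open>A non-hub sends up to three edges: to the left and the right hub of its class and to the
  next vertex of the class. Edges are indexed by these pairs of kind and start.\<close>

definition nxt :: "nat \<Rightarrow> nat \<Rightarrow> nat" where
  "nxt k v = (if k = 0 then lft (cls v) else if k = 1 then rgt (cls v) else v + q)"

definition arcs :: "(nat \<times> nat) set" where
  "arcs = {(k, v). k < 3 \<and> m \<le> v \<and> v < n \<and> nxt k v < n}"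

definition Gr :: "nat set set" where "Gr = (\<lambda>(k, v). {v, nxt k v}) ` arcs"

lemma lr: "lft j < rgt j" if "j < m" using that m by (auto simp: lft_def rgt_def)
lemma rm: "rgt j < m" if "j < m" using that m by (auto simp: rgt_def)
lemma cls_m: "cls v < m" using q less_le_trans[OF mod_less_divisor[of q "v - m"]] by (simp add: cls_def)

lemma small_eq: "m \<le> v \<Longrightarrow> m \<le> w \<Longrightarrow> cls v = cls w \<Longrightarrow> lev v = lev w \<Longrightarrow> v = w"
proof -
  assume a: "m \<le> v" "m \<le> w" "cls v = cls w" "lev v = lev w"
  have "v - m = (v - m) div q * q + (v - m) mod q" by (simp only: div_mult_mod_eq)
  also have "\<dots> = (w - m) div q * q + (w - m) mod q" using a(3,4) by (simp add: cls_def lev_def)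
  also have "\<dots> = w - m" by (simp only: div_mult_mod_eq)
  finally show "v = w" using a(1,2) by simp
qed

lemma up: "m \<le> v \<Longrightarrow> cls (v + q) = cls v \<and> lev (v + q) = lev v + 1"
proof -
  assume "m \<le> v"
  then have e: "v + q - m = (v - m) + q" by simp
  have "q \<noteq> 0" using q by simp
  then show ?thesis unfolding cls_def lev_def e by simp
qed

lemma coords: "cu j z = cu j z' \<Longrightarrow> ct j z = ct j z' \<Longrightarrow> j < m \<Longrightarrow> z = z'"
  using lr[of j] by (auto simp: cu_def ct_def sg_def complex_eq_iff field_simps split: if_splits)

lemma cu_small: "m \<le> v \<Longrightarrow> cls v = j \<Longrightarrow> cu j (pos v) = 0"
  by (auto simp: cu_def pos_def field_simps)
lemma ct_small: "m \<le> v \<Longrightarrow> cls v = j \<Longrightarrow> ct j (pos v) = real (lev v)" by (simp add: ct_def pos_def sg_def)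
lemma cu_lft: "j < m \<Longrightarrow> cu j (pos (lft j)) = - 1"
  using lr[of j] rm[of j] by (simp add: cu_def pos_def field_simps)
lemma cu_rgt: "j < m \<Longrightarrow> cu j (pos (rgt j)) = 1"
  using lr[of j] rm[of j] by (simp add: cu_def pos_def field_simps)
lemma ct_big: "v < m \<Longrightarrow> ct j (pos v) = 0" by (simp add: ct_def pos_def)
lemma lev1: "1 \<le> lev v" by (simp add: lev_def)

lemma cu_affine: "cu j ((1 - s) *\<^sub>R z + s *\<^sub>R z') = (1 - s) * cu j z + s * cu j z'"
proof -
  have "2 * Re ((1 - s) *\<^sub>R z + s *\<^sub>R z') - real (lft j) - real (rgt j)
    = (1 - s) * (2 * Re z - real (lft j) - real (rgt j)) + s * (2 * Re z' - real (lft j) - real (rgt j))"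
    by (simp add: algebra_simps)
  then show ?thesis unfolding cu_def by (simp only: add_divide_distrib times_divide_eq_right)
qed
lemma ct_affine: "ct j ((1 - s) *\<^sub>R z + s *\<^sub>R z') = (1 - s) * ct j z + s * ct j z'"
  by (simp add: ct_def algebra_simps)

definition seg :: "nat \<times> nat \<Rightarrow> complex set" where
  "seg g = closed_segment (pos (snd g)) (pos (nxt (fst g) (snd g)))"

text \<open>In the coordinates of its class, an edge to a hub is the segment from (0, c) to (-1, 0)
  or (1, 0), and an edge inside the class is a vertical unit step.\<close>

lemma seg_coords:
  assumes g: "(k, v) \<in> arcs" and z: "z \<in> seg (k, v)"
  defines "j \<equiv> cls v" and "c \<equiv> real (lev v)"
  shows "k = 0 \<Longrightarrow> cu j z \<le> 0 \<and> -1 \<le> cu j z \<and> ct j z = (1 + cu j z) * c"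
    "k = 1 \<Longrightarrow> 0 \<le> cu j z \<and> cu j z \<le> 1 \<and> ct j z = (1 - cu j z) * c"
    "k = 2 \<Longrightarrow> cu j z = 0 \<and> c \<le> ct j z \<and> ct j z \<le> c + 1"
proof -
  have v: "m \<le> v" "j < m" using g cls_m by (auto simp: arcs_def j_def)
  obtain s where s: "0 \<le> s" "s \<le> 1" "z = (1 - s) *\<^sub>R pos v + s *\<^sub>R pos (nxt k v)"
    using z by (auto simp: seg_def closed_segment_def)
  have 0: "cu j (pos v) = 0" "ct j (pos v) = c" using cu_small ct_small v by (auto simp: j_def c_def)
  show "cu j z \<le> 0 \<and> -1 \<le> cu j z \<and> ct j z = (1 + cu j z) * c" if "k = 0"
  proof -
    have "cu j (pos (nxt k v)) = - 1" "ct j (pos (nxt k v)) = 0"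
      using that cu_lft ct_big lr[of j] rm[of j] v by (auto simp: nxt_def j_def)
    then show ?thesis using s 0 by (simp add: cu_affine ct_affine)
  qed
  show "0 \<le> cu j z \<and> cu j z \<le> 1 \<and> ct j z = (1 - cu j z) * c" if "k = 1"
  proof -
    have "cu j (pos (nxt k v)) = 1" "ct j (pos (nxt k v)) = 0"
      using that cu_rgt ct_big rm[of j] v by (auto simp: nxt_def j_def)
    then show ?thesis using s 0 by (simp add: cu_affine ct_affine)
  qed
  show "cu j z = 0 \<and> c \<le> ct j z \<and> ct j z \<le> c + 1" if "k = 2"
  proof -
    have "cu j (pos (nxt k v)) = 0" "ct j (pos (nxt k v)) = c + 1"
      using that cu_small[of "v + q" j] ct_small[of "v + q" j] up[OF v(1)] v by (auto simp: nxt_def j_def c_def)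
    moreover have "(1 - s) * c + s * (c + 1) = c + s" by (simp add: algebra_simps)
    ultimately show ?thesis using s 0 by (simp add: cu_affine ct_affine)
  qed
qed

text \<open>A half-strip over, or for the last class below, the interval between the two hubs. Its
  vertical sides are removed except for the hubs, so that half-strips over adjacent intervals share
  only a hub.\<close>

definition region :: "nat \<Rightarrow> complex \<Rightarrow> bool" where
  "region j z \<longleftrightarrow> -1 \<le> cu j z \<and> cu j z \<le> 1 \<and> 0 \<le> ct j z \<and> (\<bar>cu j z\<bar> = 1 \<longrightarrow> ct j z = 0)"

lemma region_Re: "region j z \<Longrightarrow> j < m - 1 \<Longrightarrow> real j \<le> Re z \<and> Re z \<le> real j + 1 \<and> (Re z = real j \<or> Re z = real j + 1 \<longrightarrow> Im z = 0) \<and> 0 \<le> Im z"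
  by (auto simp: region_def cu_def ct_def sg_def lft_def rgt_def)

text \<open>Different classes meet only on the real axis, and there \<open>seg_axis\<close> leaves
  nothing but hubs; crossings remain to be excluded within a single class.\<close>

lemma region_disjoint:
  assumes "region j z" "region k z" "j \<noteq> k" "j < m" "k < m"
  shows "Im z = 0"
proof -
  have *: "Im z = 0" if "region j z" "region k z" "j < k" "k < m" for j k
  proof (cases "k = m - 1")
    case True
    then have "Im z \<le> 0" using that(2) by (simp add: region_def ct_def sg_def)
    then show ?thesis using region_Re[OF that(1)] that True by simp
  next
    case False
    then have j: "j < m - 1" "k < m - 1" using that by auto
    have "real j + 1 \<le> real k" using that(3) by simp
    then have "Re z = real k" using region_Re[OF that(1) j(1)] region_Re[OF that(2) j(2)] by linarith
    then show ?thesis using region_Re[OF that(2) j(2)] by simp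
  qed
  show ?thesis using assms *[of j k] *[of k j] by (cases "j < k") auto
qed

lemma seg_region:
  assumes "(k, v) \<in> arcs" "z \<in> seg (k, v)"
  shows "region (cls v) z"
proof -
  have "k = 0 \<or> k = 1 \<or> k = 2" using assms by (auto simp: arcs_def)
  then show ?thesis using seg_coords[OF assms] lev1[of v] by (auto simp: region_def)
qed

lemma small_region: "m \<le> v \<Longrightarrow> region (cls v) (pos v)"
  using cu_small ct_small by (simp add: region_def)

lemma seg_axis:
  assumes g: "(k, v) \<in> arcs" and z: "z \<in> seg (k, v)" and i: "Im z = 0"
  shows "nxt k v < m \<and> z = pos (nxt k v)"
proof -
  have v: "cls v < m" by (rule cls_m)
  have t: "ct (cls v) z = 0" using i by (simp add: ct_def)
  have l: "real (lev v) \<noteq> 0" "0 < real (lev v)" using lev1[of v] by auto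
  have k: "k = 0 \<or> k = 1 \<or> k = 2" using g by (auto simp: arcs_def)
  have b: "lft (cls v) < m" "rgt (cls v) < m" using lr[OF v] rm[OF v] by auto
  from k show ?thesis
  proof (elim disjE)
    assume k: "k = 0"
    then have "cu (cls v) z = - 1" using seg_coords(1)[OF g z] t l by auto
    then have "z = pos (lft (cls v))" using t cu_lft[OF v] ct_big[OF b(1)] v by (intro coords[of "cls v"]) auto
    then show ?thesis using k b by (simp add: nxt_def)
  next
    assume k: "k = 1"
    then have "cu (cls v) z = 1" using seg_coords(2)[OF g z] t l by auto
    then have "z = pos (rgt (cls v))" using t cu_rgt[OF v] ct_big[OF b(2)] v by (intro coords[of "cls v"]) auto
    then show ?thesis using k b by (simp add: nxt_def)
  next
    assume "k = 2"
    then show ?thesis using seg_coords(3)[OF g z] t l by auto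
  qed
qed

lemma pos_inj: "inj_on pos {0..<n}"
proof (rule inj_onI)
  fix v w assume e: "pos v = pos w"
  have im: "Im (pos v) = 0 \<longleftrightarrow> v < m" for v using lev1[of v] by (auto simp: pos_def sg_def)
  show "v = w"
  proof (cases "v < m")
    case True
    then show ?thesis using e im[of w] im[of v] by (simp add: pos_def)
  next
    case False
    then have ge: "m \<le> v" "m \<le> w" using e im[of w] im[of v] by auto
    then have "cls v = cls w" using region_disjoint[of "cls v" "pos v" "cls w"] small_region[of v] small_region[of w] e cls_m im[of v]
      by auto
    moreover have "lev v = lev w" using ct_small[OF ge(1)] ct_small[OF ge(2)] e calculation by simp
    ultimately show ?thesis using small_eq ge by blast
  qed
qed

lemma seg_vertex:
  assumes g: "(k, v) \<in> arcs" and w: "pos w \<in> seg (k, v)"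
  shows "pos w \<in> pos ` {v, nxt k v}"
proof (cases "w < m")
  case True
  then have "Im (pos w) = 0" by (simp add: pos_def)
  then show ?thesis using seg_axis[OF g w] by auto
next
  case False
  then have wm: "m \<le> w" by simp
  have vm: "m \<le> v" using g by (simp add: arcs_def)
  have k: "k = 0 \<or> k = 1 \<or> k = 2" using g by (auto simp: arcs_def)
  have "Im (pos w) \<noteq> 0" using False lev1[of w] by (simp add: pos_def sg_def)
  then have c: "cls v = cls w" using region_disjoint[OF seg_region[OF g w] small_region[OF wm]] cls_m by auto
  have uw: "cu (cls v) (pos w) = 0" "ct (cls v) (pos w) = real (lev w)" using cu_small[OF wm] ct_small[OF wm] c by auto
  from k show ?thesis
  proof (elim disjE)
    assume "k = 0"
    then have "lev w = lev v" using seg_coords(1)[OF g w] uw by simp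
    then show ?thesis using small_eq[OF wm vm] c by simp
  next
    assume "k = 1"
    then have "lev w = lev v" using seg_coords(2)[OF g w] uw by simp
    then show ?thesis using small_eq[OF wm vm] c by simp
  next
    assume k2: "k = 2"
    then have "real (lev v) \<le> real (lev w)" "real (lev w) \<le> real (lev v) + 1" using seg_coords(3)[OF g w] uw by auto
    then have "lev w = lev v \<or> lev w = lev v + 1" by linarith
    then have "w = v \<or> w = v + q" using small_eq[OF wm vm] small_eq[OF wm, of "v + q"] up[OF vm] c vm by auto
    then show ?thesis using k2 by (auto simp: nxt_def)
  qed
qed

text \<open>Within a class the sign of u tells the kind of the edge, and the level is recovered as t
  / (1 + u), as t / (1 - u), or from the unit interval that contains t.\<close>

lemma seg_unique:
  assumes g: "(k, v) \<in> arcs" and h: "(l, w) \<in> arcs" and z: "z \<in> seg (k, v)" "z \<in> seg (l, w)"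
    and nv: "z \<notin> pos ` {0..<n}"
  shows "k = l \<and> v = w"
proof -
  have bd: "v < n" "w < n" "nxt k v < n" "nxt l w < n" "m \<le> v" "m \<le> w" using g h by (auto simp: arcs_def)
  have i: "Im z \<noteq> 0" using seg_axis[OF g z(1)] nv bd by auto
  have c: "cls w = cls v" using region_disjoint[OF seg_region[OF g z(1)] seg_region[OF h z(2)] _ cls_m cls_m] i by metis
  let ?j = "cls v"
  define u t where "u = cu ?j z" and "t = ct ?j z"
  have notv: "\<not> (u = 0 \<and> t = real (lev x))" if "x < n" "m \<le> x" "cls x = ?j" for x
  proof
    assume "u = 0 \<and> t = real (lev x)"
    then have "z = pos x" using cu_small[OF that(2,3)] ct_small[OF that(2,3)] cls_m
      by (intro coords[of ?j]) (auto simp: u_def t_def)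
    then show False using nv that by auto
  qed
  have t0: "t \<noteq> 0" using i by (auto simp: t_def ct_def sg_def)
  have A: "(k' = 0 \<and> u < 0 \<and> t = (1 + u) * real (lev x)) \<or> (k' = 1 \<and> 0 < u \<and> t = (1 - u) * real (lev x)) \<or>
      (k' = 2 \<and> u = 0 \<and> real (lev x) < t \<and> t < real (lev x) + 1)"
    if a: "(k', x) \<in> arcs" and zx: "z \<in> seg (k', x)" and cx: "cls x = ?j" for k' x
  proof -
    have b: "x < n" "m \<le> x" and k: "k' = 0 \<or> k' = 1 \<or> k' = 2" using a by (auto simp: arcs_def)
    note s = seg_coords[OF a zx, unfolded cx, folded u_def t_def]
    from k show ?thesis
    proof (elim disjE)
      assume k0: "k' = 0"
      then show ?thesis using s(1)[OF k0] notv[OF b cx] by (cases "u = 0") auto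
    next
      assume k1: "k' = 1"
      then show ?thesis using s(2)[OF k1] notv[OF b cx] by (cases "u = 0") auto
    next
      assume k2: "k' = 2"
      then have "x + q < n" using a by (simp add: arcs_def nxt_def)
      then have "t \<noteq> real (lev x) + 1" using notv[of "x + q"] up[OF b(2)] b cx s(3)[OF k2] by auto
      moreover have "t \<noteq> real (lev x)" using notv[OF b cx] s(3)[OF k2] by auto
      ultimately show ?thesis using s(3)[OF k2] k2 by auto
    qed
  qed
  have "k = l \<and> lev v = lev w"
    using A[OF g z(1) refl] A[OF h z(2) c] t0 by (elim disjE conjE) auto
  then show ?thesis using small_eq[OF bd(5,6)] c by simp
qed

lemma Gr_planar: "planar_on n Gr"
proof -
  have nv: "nxt k v \<noteq> v" if "(k, v) \<in> arcs" for k v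
    using that lr[OF cls_m[of v]] rm[OF cls_m[of v]] q by (auto simp: arcs_def nxt_def split: if_splits)
  have sg: "simple_graph ({0..<n}, Gr)"
    using nv by (fastforce simp: simple_graph_def Gr_def arcs_def card_insert_if)
  \<comment> \<open>Edges are sets of numbers; minimum and maximum give each a direction.\<close>
  define \<gamma> :: "nat set \<Rightarrow> real \<Rightarrow> complex" where "\<gamma> e = linepath (pos (Min e)) (pos (Max e))" for e
  have pim: "path_image (\<gamma> e) = seg (k, v)" "arc (\<gamma> e)" "{pathstart (\<gamma> e), pathfinish (\<gamma> e)} = pos ` e"
    if g: "(k, v) \<in> arcs" and e: "e = {v, nxt k v}" for e k v
  proof -
    have "(Min e = v \<and> Max e = nxt k v) \<or> (Min e = nxt k v \<and> Max e = v)" unfolding e by (simp add: min_def max_def)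
    then have "\<gamma> e = linepath (pos v) (pos (nxt k v)) \<or> \<gamma> e = linepath (pos (nxt k v)) (pos v)"
      unfolding \<gamma>_def by auto
    then obtain a b where ab: "\<gamma> e = linepath a b" "a = pos v \<and> b = pos (nxt k v) \<or> a = pos (nxt k v) \<and> b = pos v" by blast
    have "pos v \<noteq> pos (nxt k v)" using pos_inj nv[OF g] g by (auto simp: inj_on_def arcs_def)
    then have "a \<noteq> b" "seg (k, v) = closed_segment a b" "pos ` e = {a, b}"
      using ab(2) by (elim disjE; simp add: seg_def e closed_segment_commute insert_commute)+
    then show "path_image (\<gamma> e) = seg (k, v)" "arc (\<gamma> e)" "{pathstart (\<gamma> e), pathfinish (\<gamma> e)} = pos ` e"
      unfolding ab(1) by simp_all
  qed
  have ends: "pos ` {v, nxt k v} \<subseteq> seg (k, v)" for k v by (auto simp: seg_def)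
  have "planar ({0..<n}, Gr)"
    unfolding planar_def fst_conv snd_conv
  proof (intro exI[of _ pos] exI[of _ \<gamma>] conjI ballI impI)
    show "inj_on pos {0..<n}" by (rule pos_inj)
    fix e assume "e \<in> Gr"
    then obtain k v where a: "(k, v) \<in> arcs" "e = {v, nxt k v}" by (auto simp: Gr_def)
    show "arc (\<gamma> e)" "{pathstart (\<gamma> e), pathfinish (\<gamma> e)} = pos ` e" by (rule pim[OF a])+
    show "path_image (\<gamma> e) \<inter> pos ` {0..<n} = pos ` e"
      unfolding pim(1)[OF a]
    proof (intro equalityI subsetI)
      fix z assume "z \<in> pos ` e"
      then show "z \<in> seg (k, v) \<inter> pos ` {0..<n}" using ends[of v k] a by (auto simp: arcs_def)
    next
      fix z assume "z \<in> seg (k, v) \<inter> pos ` {0..<n}"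
      then show "z \<in> pos ` e" using seg_vertex[OF a(1)] a(2) by blast
    qed
    fix e' assume "e' \<in> Gr" and ne: "e \<noteq> e'"
    then obtain l w where b: "(l, w) \<in> arcs" "e' = {w, nxt l w}" by (auto simp: Gr_def)
    show "path_image (\<gamma> e) \<inter> path_image (\<gamma> e') \<subseteq> pos ` (e \<inter> e')"
    proof
      fix z assume "z \<in> path_image (\<gamma> e) \<inter> path_image (\<gamma> e')"
      then have z: "z \<in> seg (k, v)" "z \<in> seg (l, w)" unfolding pim(1)[OF a] pim(1)[OF b] by auto
      then have "z \<in> pos ` {0..<n}" using seg_unique[OF a(1) b(1) z] ne a(2) b(2) by auto
      then obtain x where x: "x < n" "z = pos x" by auto
      have "pos x \<in> pos ` e" "pos x \<in> pos ` e'" using seg_vertex[OF a(1), of x] seg_vertex[OF b(1), of x] z x a(2) b(2) by auto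
      moreover have "e \<subseteq> {0..<n}" "e' \<subseteq> {0..<n}" using a b by (auto simp: arcs_def)
      ultimately have "x \<in> e" "x \<in> e'" using inj_on_image_mem_iff[OF pos_inj, of x e] inj_on_image_mem_iff[OF pos_inj, of x e'] x by auto
      then show "z \<in> pos ` (e \<inter> e')" using x by blast
    qed
  qed
  then show ?thesis using sg by simp
qed

end

lemma nat_mod_inj:
  fixes a b j m :: nat
  assumes "(j + a) mod m = (j + b) mod m" "a < b + m" "b < a + m"
  shows "a = b"
proof -
  have *: "x = y" if "(j + x) mod m = (j + y) mod m" "x \<le> y" "y < x + m" for x y :: nat
  proof -
    have "m dvd (j + y) - (j + x)" using that by (subst mod_eq_dvd_iff_nat[symmetric]) auto
    then show ?thesis using that nat_dvd_not_less[of "y - x" m] by (cases "x = y") auto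
  qed
  show ?thesis using assms *[of a b] *[of b a] by (cases "a \<le> b") auto
qed

lemma finite_copies: "finite V \<Longrightarrow> finite E \<Longrightarrow> finite (copies V E k)"
  by (rule finite_subset[of _ "Pow V \<times> Pow E"]) (auto simp: copies_def)

context drawing
begin

lemma Gr_sub: "e \<in> Gr \<Longrightarrow> e \<subseteq> {0..<n}"
  using Gr_planar by (auto simp: simple_graph_def)

lemma finite_Gr: "finite Gr"
  by (rule finite_subset[of _ "Pow {0..<n}"]) (use Gr_sub in auto)

lemma Gr_hub: "m \<le> v \<Longrightarrow> v < n \<Longrightarrow> {v, lft (cls v)} \<in> Gr \<and> {v, rgt (cls v)} \<in> Gr"
proof -
  assume v: "m \<le> v" "v < n"
  have "(0, v) \<in> arcs" "(1, v) \<in> arcs" using v lr[OF cls_m[of v]] rm[OF cls_m[of v]] n by (auto simp: arcs_def nxt_def)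
  from imageI[OF this(1), of "\<lambda>(k, v). {v, nxt k v}"] imageI[OF this(2), of "\<lambda>(k, v). {v, nxt k v}"]
  show ?thesis by (simp add: Gr_def nxt_def)
qed

lemma Gr_step: "m \<le> v \<Longrightarrow> v + q < n \<Longrightarrow> {v, v + q} \<in> Gr"
proof -
  assume v: "m \<le> v" "v + q < n"
  then have "(2, v) \<in> arcs" by (auto simp: arcs_def nxt_def)
  then have "(\<lambda>(k, v). {v, nxt k v}) (2, v) \<in> Gr" unfolding Gr_def by (rule imageI)
  then show ?thesis by (simp add: nxt_def)
qed

end

section \<open>Cycles of length 2m + 1 in the construction\<close>

locale full_drawing = drawing m m n for m n +
  fixes M :: nat
  assumes M: "m * (M + 2) \<le> n"
begin

abbreviation "K \<equiv> 2 * m + 1"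

definition sm :: "nat \<Rightarrow> nat \<Rightarrow> nat" where "sm i c = m + (c * m + i)"

definition lo :: "bool \<Rightarrow> (nat \<Rightarrow> nat) \<Rightarrow> nat \<Rightarrow> nat" where "lo d f j = (if d then f j else f j + 1)"

text \<open>Positions 0 and 2m hold two consecutive vertices of the class \<open>j\<close>, at
  levels \<open>f j\<close> and \<open>f j + 1\<close> in an order given by \<open>d\<close>; every
  other class contributes one vertex at its level in \<open>f\<close>, and the hubs fill the odd
  positions. With the levels 0 to M available, \<open>f\<close> takes values below M, so
  \<open>j\<close>, \<open>d\<close> and \<open>f\<close> can be chosen in 2m M^m ways.\<close>

definition vx :: "nat \<Rightarrow> bool \<Rightarrow> (nat \<Rightarrow> nat) \<Rightarrow> nat \<Rightarrow> nat" where
  "vx j d f x = (if x = 0 then sm j (lo (\<not> d) f j) else if odd x then (j + 1 + x div 2) mod m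
     else sm ((j + x div 2) mod m) (if x = 2 * m then lo d f j else f ((j + x div 2) mod m)))"

definition cycle_list :: "nat \<Rightarrow> bool \<Rightarrow> (nat \<Rightarrow> nat) \<Rightarrow> nat list" where
  "cycle_list j d f = map (vx j d f) [0..<K]"

lemma mpos: "0 < m" using m by simp

lemma sm_inj: "i < m \<Longrightarrow> i' < m \<Longrightarrow> sm i c = sm i' c' \<Longrightarrow> i = i' \<and> c = c'"
proof -
  assume a: "i < m" "i' < m" "sm i c = sm i' c'"
  then have e: "c * m + i = c' * m + i'" by (simp add: sm_def)
  have "i = (c * m + i) mod m" "i' = (c' * m + i') mod m" using a by simp_all
  moreover have "c = (c * m + i) div m" "c' = (c' * m + i') div m" using a by simp_all
  ultimately show ?thesis unfolding e by simp
qed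

lemma sm_ge: "m \<le> sm i c" by (simp add: sm_def)

lemma sm_less: "i < m \<Longrightarrow> c \<le> M \<Longrightarrow> sm i c < n"
proof -
  assume a: "i < m" "c \<le> M"
  have "c * m \<le> M * m" using a by simp
  moreover have "m * (M + 2) = M * m + 2 * m" by (simp add: algebra_simps)
  ultimately show ?thesis using M a unfolding sm_def by linarith
qed

lemma Gr_sm:
  assumes i: "i < m" and c: "c \<le> M"
  shows "{sm i c, i} \<in> Gr" "{sm i c, Suc i mod m} \<in> Gr" "c < M \<Longrightarrow> {sm i c, sm i (c + 1)} \<in> Gr"
proof -
  have cl: "cls (sm i c) = i" using i by (simp add: cls_def sm_def)
  have "{i, Suc i mod m} = {lft i, rgt i}" using i by (cases "Suc i = m") (auto simp: lft_def rgt_def)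
  then have "i \<in> {lft i, rgt i}" "Suc i mod m \<in> {lft i, rgt i}" by blast+
  then show "{sm i c, i} \<in> Gr" "{sm i c, Suc i mod m} \<in> Gr"
    using Gr_hub[OF sm_ge sm_less[OF i c]] unfolding cl by (metis insertE singletonD)+
  assume "c < M"
  then show "{sm i c, sm i (c + 1)} \<in> Gr" using Gr_step[OF sm_ge[of i c]] sm_less[OF i, of "c + 1"] by (simp add: sm_def add_ac)
qed

lemma lo: "lo d f j \<noteq> lo (\<not> d) f j" "{lo d f j, lo (\<not> d) f j} = {f j, f j + 1}"
  by (auto simp: lo_def)

lemma vx_simps:
  assumes j: "j < m"
  shows "vx j d f 0 = sm j (lo (\<not> d) f j)" "vx j d f (2 * a + 1) = (j + 1 + a) mod m" "vx j d f (2 * m) = sm j (lo d f j)"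
    "1 \<le> a \<Longrightarrow> a < m \<Longrightarrow> vx j d f (2 * a) = sm ((j + a) mod m) (f ((j + a) mod m))"
  using j m by (simp_all add: vx_def)

lemma index_cases:
  assumes "x < K"
  obtains "x = 0" | a where "x = 2 * a + 1" "a < m" | "x = 2 * m" | a where "x = 2 * a" "1 \<le> a" "a < m"
proof (cases "even x")
  case True
  then obtain a where a: "x = 2 * a" by blast
  then have "a \<le> m" using assms by simp
  then consider "a = 0" | "a = m" | "1 \<le> a" "a < m" by linarith
  then show thesis by cases (use a that in auto)
next
  case False
  then obtain a where "x = 2 * a + 1" by (metis oddE)
  then show thesis using that(2)[of a] assms by auto
qed

lemma mod_ne: "1 \<le> a \<Longrightarrow> a < m \<Longrightarrow> j < m \<Longrightarrow> (j + a) mod m \<noteq> j"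
  using nat_mod_inj[of j a m 0] by auto

text \<open>The vertex set of a cycle reveals \<open>j\<close>, the only class met twice, and all of
  \<open>f\<close>.\<close>

lemma sm_mem:
  assumes j: "j < m" and i: "i < m"
  shows "sm i e \<in> vx j d f ` {..<K} \<longleftrightarrow> (if i = j then e \<in> {f j, f j + 1} else e = f i)"
proof
  assume "sm i e \<in> vx j d f ` {..<K}"
  then obtain x where x: "x < K" "sm i e = vx j d f x" by auto
  note v = vx_simps[OF j, where d = d and f = f]
  from x(1) show "if i = j then e \<in> {f j, f j + 1} else e = f i"
  proof (cases rule: index_cases)
    case 1
    then have "i = j \<and> e = lo (\<not> d) f j" using sm_inj[OF i j] x(2) v(1) by simp
    then show ?thesis using lo(2)[of d f j] by auto
  next
    case (2 a)
    then have "sm i e = (j + 1 + a) mod m" using x(2) v(2)[of a] by simp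
    then show ?thesis using sm_ge[of i e] mod_less_divisor[OF mpos, of "j + 1 + a"] by linarith
  next
    case 3
    then have "i = j \<and> e = lo d f j" using sm_inj[OF i j] x(2) v(3) by simp
    then show ?thesis using lo(2)[of d f j] by auto
  next
    case (4 a)
    then have "i = (j + a) mod m \<and> e = f ((j + a) mod m)" using sm_inj[OF i mod_less_divisor[OF mpos]] x(2) v(4)[of a] by simp
    then show ?thesis using mod_ne[OF 4(2,3) j] by auto
  qed
next
  assume e: "if i = j then e \<in> {f j, f j + 1} else e = f i"
  note v = vx_simps[OF j, where d = d and f = f]
  show "sm i e \<in> vx j d f ` {..<K}"
  proof (cases "i = j")
    case True
    then have "e \<in> {lo d f j, lo (\<not> d) f j}" using e unfolding lo(2) by simp
    then have "sm i e = vx j d f (2 * m) \<or> sm i e = vx j d f 0" using v(1,3) True by auto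
    then show ?thesis by (elim disjE) (rule image_eqI, assumption, simp)+
  next
    case False
    define a where "a = (if j < i then i - j else i + m - j)"
    have a: "1 \<le> a" "a < m" "(j + a) mod m = i" using False i j by (auto simp: a_def)
    then have "sm i e = vx j d f (2 * a)" using v(4)[OF a(1,2)] e False by simp
    then show ?thesis using a by (intro image_eqI[of _ _ "2 * a"]) auto
  qed
qed

lemma vx_inj:
  assumes j: "j < m"
  shows "inj_on (vx j d f) {..<K}"
proof (rule inj_onI)
  note v = vx_simps[OF j, where d = d and f = f]
  \<comment> \<open>A label that separates hubs (m and above) from non-hubs (their class, below m),
    so that positions of different kinds are told apart at once.\<close>
  define cl where "cl y = (if y < m then m + y else (y - m) mod m)" for y
  have clsm: "cl (sm i c) = i" if "i < m" for i c using that by (simp add: cl_def sm_def)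
  have clb: "cl (y mod m) = m + y mod m" for y using mod_less_divisor[OF mpos, of y] by (simp add: cl_def)
  have mm: "(j + a) mod m < m" for a by (rule mod_less_divisor[OF mpos])
  fix x y assume x: "x \<in> {..<K}" and y: "y \<in> {..<K}" and e: "vx j d f x = vx j d f y"
  have cle: "cl (vx j d f x) = cl (vx j d f y)" using e by simp
  from x have x': "x < K" by simp
  from y have y': "y < K" by simp
  have sep: "(j + a) mod m \<noteq> m + b" "m + b \<noteq> (j + a) mod m" for a b using mm[of a] by linarith+
  have mn: "(j + a) mod m \<noteq> j" "j \<noteq> (j + a) mod m" if "1 \<le> a" "a < m" for a using mod_ne[OF that j] by simp_all
  have ln: "sm j (lo d f j) \<noteq> sm j (lo (\<not> d) f j)" "sm j (lo (\<not> d) f j) \<noteq> sm j (lo d f j)"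
    using sm_inj[OF j j] lo(1) by metis+
  have sep': "j \<noteq> m + b" "m + b \<noteq> j" for b using j by linarith+
  from x' show "x = y"
  proof (cases rule: index_cases)
    case 1
    from y' show ?thesis
      by (cases rule: index_cases)
        (use cle e v mn j ln mm sep' 1 in \<open>auto simp: clsm clb\<close>)
  next
    case (2 a)
    from y' show ?thesis
    proof (cases rule: index_cases)
      case (2 b)
      then show ?thesis using e v(2)[of a] v(2)[of b] \<open>x = 2 * a + 1\<close> nat_mod_inj[of "j + 1" a m b] \<open>a < m\<close> by auto
    qed (use cle v j mm sep' sep 2 in \<open>auto simp: clsm clb\<close>)
  next
    case 3
    from y' show ?thesis
      by (cases rule: index_cases)
        (use cle e v mn j ln mm sep' 3 in \<open>auto simp: clsm clb\<close>)
  next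
    case (4 a)
    from y' show ?thesis
    proof (cases rule: index_cases)
      case (4 b)
      then have "(j + a) mod m = (j + b) mod m"
        using e v(4)[of a] v(4)[of b] \<open>x = 2 * a\<close> \<open>1 \<le> a\<close> \<open>a < m\<close> sm_inj[OF mm mm] by auto
      then show ?thesis using nat_mod_inj[of j a m b] \<open>a < m\<close> 4 \<open>x = 2 * a\<close> by auto
    qed (use cle v mn j mm sep sep' 4 in \<open>auto simp: clsm clb\<close>)
  qed
qed

lemma cycle_list_props: "length (cycle_list j d f) = K" "i < K \<Longrightarrow> cycle_list j d f ! i = vx j d f i"
    "set (cycle_list j d f) = vx j d f ` {..<K}" "cycle_list j d f \<noteq> []"
  by (auto simp: cycle_list_def atLeast0LessThan simp del: upt_Suc)

lemma ce_cycle_list: "ce (cycle_list j d f) = (\<lambda>i. {vx j d f i, vx j d f (Suc i mod K)}) ` {..<K}"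
  unfolding ce_nth[OF cycle_list_props(4)] cycle_list_props(1)
  by (rule image_cong) (simp_all only: cycle_list_props(2) lessThan_iff mod_less_divisor zero_less_Suc Suc_eq_plus1[symmetric])

lemma cycle_list_cyc:
  assumes j: "j < m" and f: "\<And>i. i < m \<Longrightarrow> f i < M"
  shows "cycle_list j d f \<in> cyc Gr K"
proof -
  note v = vx_simps[OF j, where d = d and f = f]
  have lo_le: "lo d f j \<le> M" for d using f[OF j] by (simp add: lo_def)
  have mm: "(j + a) mod m < m" for a by (rule mod_less_divisor[OF mpos])
  have "{vx j d f i, vx j d f (Suc i mod K)} \<in> Gr" if "i < K" for i
    using that
  proof (cases rule: index_cases)
    case 1
    have "vx j d f (Suc i mod K) = Suc j mod m" using 1 v(2)[of 0] m by simp
    then show ?thesis using 1 v(1) Gr_sm(2)[OF j lo_le] by simp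
  next
    case (2 a)
    let ?t = "(j + 1 + a) mod m"
    have t: "?t = (j + (a + 1)) mod m" by (simp add: add_ac)
    have tm: "?t < m" by (rule mod_less_divisor[OF mpos])
    have "Suc i mod K = 2 * (a + 1)" using 2 by simp
    moreover have "\<exists>c\<le>M. vx j d f (2 * (a + 1)) = sm ?t c"
    proof (cases "a + 1 = m")
      case True
      then have "?t = (j + m) mod m" by (simp only: t)
      then have "?t = j" using j by simp
      then show ?thesis using v(3) lo_le True by auto
    next
      case False
      then have "a + 1 < m" using 2 by simp
      then have "vx j d f (2 * (a + 1)) = sm ?t (f ?t)" using v(4)[of "a + 1"] by (simp add: add_ac)
      then show ?thesis using f[OF tm] by (intro exI[of _ "f ?t"]) simp
    qed
    ultimately obtain c where "c \<le> M" "vx j d f (Suc i mod K) = sm ?t c" by auto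
    moreover have "vx j d f i = ?t" using 2 v(2)[of a] by simp
    ultimately show ?thesis using Gr_sm(1)[OF tm, of c] by (simp add: insert_commute)
  next
    case 3
    have s0: "vx j d f (Suc i mod K) = sm j (lo (\<not> d) f j)" using 3 v(1) by simp
    have "{sm j (f j), sm j (f j + 1)} \<in> Gr" using Gr_sm(3)[OF j, of "f j"] f[OF j] by simp
    then show ?thesis unfolding s0 using 3 v(3) by (cases d) (simp_all add: lo_def insert_commute)
  next
    case (4 a)
    let ?t = "(j + a) mod m"
    have "Suc i mod K = 2 * a + 1" using 4 by simp
    then have "vx j d f (Suc i mod K) = Suc ?t mod m" using v(2)[of a] by (simp add: mod_Suc_eq)
    moreover have "vx j d f i = sm ?t (f ?t)" using v(4)[of a] 4 by simp
    ultimately show ?thesis using Gr_sm(2)[OF mm[of a], of "f ?t"] f[OF mm[of a]] by simp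
  qed
  moreover have "distinct (cycle_list j d f)"
    using vx_inj[OF j, of d f] by (simp add: cycle_list_def distinct_map atLeast0LessThan del: upt_Suc)
  ultimately show ?thesis using cycle_list_props(1) by (auto simp: cyc_def ce_cycle_list)
qed

text \<open>Recovers \<open>d\<close> from the edges: the two vertices of the class \<open>j\<close>
  differ in which of them is joined to the hub \<open>Suc j mod m\<close>.\<close>

lemma orientation:
  assumes j: "j < m"
  shows "{sm j (lo (\<not> d) f j), Suc j mod m} \<in> ce (cycle_list j d f)"
    "{sm j (lo d f j), Suc j mod m} \<notin> ce (cycle_list j d f)"
proof -
  note v = vx_simps[OF j, where d = d and f = f]
  have v1: "vx j d f 1 = Suc j mod m" using v(2)[of 0] by simp
  have "{vx j d f 0, vx j d f (Suc 0 mod K)} \<in> ce (cycle_list j d f)"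
    unfolding ce_cycle_list by (rule imageI) simp
  then show "{sm j (lo (\<not> d) f j), Suc j mod m} \<in> ce (cycle_list j d f)" using v(1) v1 m by simp
  show "{sm j (lo d f j), Suc j mod m} \<notin> ce (cycle_list j d f)"
  proof
    assume "{sm j (lo d f j), Suc j mod m} \<in> ce (cycle_list j d f)"
    then obtain i where i: "i < K" "{sm j (lo d f j), Suc j mod m} = {vx j d f i, vx j d f (Suc i mod K)}"
      unfolding ce_cycle_list by auto
    then have "vx j d f ` {2 * m, 1} = vx j d f ` {i, Suc i mod K}" using v(3) v1 by simp
    then have "{2 * m, 1} = {i, Suc i mod K}"
      using i m by (subst (asm) inj_on_image_eq_iff[OF vx_inj[OF j]]) auto
    then have "i = 2 * m \<and> Suc i mod K = 1 \<or> i = 1 \<and> Suc i mod K = 2 * m" by (auto simp: doubleton_eq_iff)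
    then show False using m by auto
  qed
qed

lemma copies_ge: "2 * m * M ^ m \<le> card (copies {0..<n} Gr K)"
proof -
  let ?P = "{..<m} \<times> (UNIV :: bool set) \<times> ({..<m} \<rightarrow>\<^sub>E {..<M})"
  let ?F = "\<lambda>(j, d, f). copy_of (cycle_list j d f)"
  have "inj_on ?F ?P"
  proof (rule inj_onI)
    fix p p' assume p: "p \<in> ?P" and p': "p' \<in> ?P" and eq: "?F p = ?F p'"
    obtain j d f where e: "p = (j, d, f)" by (cases p)
    obtain j' d' f' where e': "p' = (j', d', f')" by (cases p')
    have j: "j < m" "j' < m" and f: "f \<in> {..<m} \<rightarrow>\<^sub>E {..<M}" "f' \<in> {..<m} \<rightarrow>\<^sub>E {..<M}" using p p' e e' by auto
    have s: "vx j d f ` {..<K} = vx j' d' f' ` {..<K}" and c: "ce (cycle_list j d f) = ce (cycle_list j' d' f')"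
      using eq unfolding e e' by (simp_all add: copy_of_def cycle_list_props(3))
    have mem: "(if i = j then a \<in> {f j, f j + 1} else a = f i) \<longleftrightarrow> (if i = j' then a \<in> {f' j', f' j' + 1} else a = f' i)"
      if "i < m" for i a using sm_mem[OF j(1) that, of a d f] sm_mem[OF j(2) that, of a d' f'] s by simp
    have jj: "j = j'"
    proof (rule ccontr)
      assume "j \<noteq> j'"
      then show False using mem[OF j(1), of "f j"] mem[OF j(1), of "f j + 1"] by simp
    qed
    have "f i = f' i" if "i < m" for i
    proof (cases "i = j")
      case True
      have "a \<in> {f j, f j + 1} \<longleftrightarrow> a \<in> {f' j, f' j + 1}" for a using mem[OF j(1), of a] unfolding jj by simp
      then have "{f j, f j + 1} = {f' j, f' j + 1}" by blast
      then have "f j = f' j" by (auto simp: doubleton_eq_iff)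
      then show ?thesis using True by simp
    next
      case False
      then show ?thesis using mem[OF that, of "f i"] jj by auto
    qed
    then have ff: "f = f'" using f by (intro PiE_ext[of f "{..<m}" "\<lambda>_. {..<M}" f']) auto
    have "d = d'"
    proof (rule ccontr)
      assume "d \<noteq> d'"
      then have "d' = (\<not> d)" by auto
      then show False using orientation(1)[OF j(1), of d f] orientation(2)[OF j(1), of d' f] c jj ff by simp
    qed
    then show "p = p'" using e e' jj ff by simp
  qed
  moreover have "?F ` ?P \<subseteq> copies {0..<n} Gr K"
  proof (rule image_subsetI)
    fix p assume p: "p \<in> ?P"
    obtain j d f where e: "p = (j, d, f)" by (cases p)
    have "cycle_list j d f \<in> cyc Gr K" using p e by (intro cycle_list_cyc) (auto simp: PiE_def Pi_def)
    then show "?F p \<in> copies {0..<n} Gr K" unfolding e using copy_of_cyc[of _ Gr K "{0..<n}"] Gr_sub m by simp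
  qed
  ultimately have "card ?P \<le> card (copies {0..<n} Gr K)"
    by (rule card_inj_on_le[OF _ _ finite_copies]) (use finite_Gr in auto)
  then show ?thesis by (simp add: card_cartesian_product card_PiE mult_ac)
qed

end

text \<open>Both hubs are joined to the whole path on the other n - 2 vertices; a pentagon is given
  by an edge of the path, a further vertex and one of two ways of attaching the edge. Two separate
  classes would only give about n^2, since here the edge and the vertex come from the same n - 2
  vertices.\<close>

lemma pentagons_ge:
  assumes n: "4 \<le> n"
  shows "2 * ((n - 3) * (n - 4)) \<le> NP n (cycle_graph 5)"
proof -
  interpret drawing 2 1 n by unfold_locales (use n in auto)
  have h: "{v, 0} \<in> Gr \<and> {v, 1} \<in> Gr" if "2 \<le> v" "v < n" for v
    using Gr_hub[OF that] unfolding cls_def lft_def rgt_def by simp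
  have st: "{v, v + 1} \<in> Gr" if "2 \<le> v" "v + 1 < n" for v using Gr_step[of v] that by simp
  let ?P = "(UNIV :: bool set) \<times> (SIGMA y:{2..<n - 1}. {2..<n} - {y, y + 1})"
  define lst where "lst p = (case p of (d, y, x) \<Rightarrow> [if d then y + 1 else y, 1, x, 0, if d then y else y + 1])" for p :: "bool \<times> nat \<times> nat"
  have "inj_on (\<lambda>p. copy_of (lst p)) ?P"
  proof (rule inj_onI)
    fix p p' assume p: "p \<in> ?P" and p': "p' \<in> ?P" and eq: "copy_of (lst p) = copy_of (lst p')"
    obtain d y x where e: "p = (d, y, x)" by (cases p)
    obtain d' y' x' where e': "p' = (d', y', x')" by (cases p')
    have r: "2 \<le> y" "2 \<le> x" "x \<noteq> y" "x \<noteq> y + 1" "2 \<le> y'" "2 \<le> x'" "x' \<noteq> y'" "x' \<noteq> y' + 1" using p p' e e' by auto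
    have c: "ce (lst p) = ce (lst p')" and s: "set (lst p) = set (lst p')" using eq by (simp_all add: copy_of_def)
    have "{a\<in>ce (lst p). 0 \<notin> a \<and> 1 \<notin> a} = {{y, y + 1}}" "{a\<in>ce (lst p'). 0 \<notin> a \<and> 1 \<notin> a} = {{y', y' + 1}}"
      using r unfolding e e' lst_def by (auto simp: ce_def split: if_splits)
    then have "{y, y + 1} = {y', y' + 1}" using c by simp
    then have y: "y = y'" by (auto simp: doubleton_eq_iff)
    have "set (lst p) - {0, 1, y, y + 1} = {x}" "set (lst p') - {0, 1, y', y' + 1} = {x'}"
      using r unfolding e e' lst_def by (auto split: if_splits)
    then have x: "x = x'" using s y by simp
    have "{y, 1} \<in> ce (lst p) \<longleftrightarrow> \<not> d" "{y', 1} \<in> ce (lst p') \<longleftrightarrow> \<not> d'"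
      using r unfolding e e' lst_def by (auto simp: ce_def doubleton_eq_iff)
    then have "d = d'" using c y by simp
    then show "p = p'" using e e' x y by simp
  qed
  moreover have "(\<lambda>p. copy_of (lst p)) ` ?P \<subseteq> copies {0..<n} Gr 5"
  proof (rule image_subsetI)
    fix p assume p: "p \<in> ?P"
    obtain d y x where e: "p = (d, y, x)" by (cases p)
    have r: "2 \<le> y" "y + 1 < n" "2 \<le> x" "x < n" "x \<noteq> y" "x \<noteq> y + 1" using p e by auto
    have "lst p \<in> cyc Gr 5"
      using r h[of y] h[of "y + 1"] h[of x] st[of y] unfolding e lst_def
      by (cases d) (auto simp: cyc_def ce_def insert_commute)
    then show "copy_of (lst p) \<in> copies {0..<n} Gr 5" using copy_of_cyc[of _ Gr 5 "{0..<n}"] Gr_sub by simp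
  qed
  ultimately have "card ?P \<le> card (copies {0..<n} Gr 5)"
    by (rule card_inj_on_le[OF _ _ finite_copies]) (use finite_Gr in auto)
  moreover have "card ?P = 2 * ((n - 3) * (n - 4))"
  proof -
    have "card ({2..<n} - {y, y + 1}) = n - 4" if "y \<in> {2..<n - 1}" for y
      using that by (subst card_Diff_subset) auto
    then have "card (SIGMA y:{2..<n - 1}. {2..<n} - {y, y + 1}) = (n - 3) * (n - 4)"
      using card_SigmaI[of "{2..<n - 1}" "\<lambda>y. {2..<n} - {y, y + 1}"] by (simp add: numeral_3_eq_3)
    then show ?thesis by (simp add: card_cartesian_product)
  qed
  ultimately show ?thesis using NP_ge[OF Gr_planar, of "cycle_graph 5"] by (simp add: num_copies_cycle)
qed

lemma odd_cycles_ge: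
  assumes m: "2 \<le> m" and n: "m * (M + 2) \<le> n"
  shows "2 * m * M ^ m \<le> NP n (cycle_graph (2 * m + 1))"
proof -
  have "m \<le> m * (M + 2)" by simp
  then interpret full_drawing m n M by unfold_locales (use m n in linarith)+
  show ?thesis using copies_ge NP_ge[OF Gr_planar, of "cycle_graph (2 * m + 1)"] by (simp add: num_copies_cycle)
qed

section \<open>Asymptotic form of the bounds\<close>

lemma pow_le_powr:
  assumes "1 \<le> n" "1 \<le> m"
  shows "real n ^ (m - 1) \<le> real n powr (real m - 1 / 5)"
proof -
  have "real n ^ (m - 1) = real n powr real (m - 1)" using assms by (subst powr_realpow) simp_all
  also have "\<dots> \<le> real n powr (real m - 1 / 5)" using assms by (intro powr_mono) (auto simp: of_nat_diff)
  finally show ?thesis .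
qed

text \<open>Rounding costs at most 3 in n / m, and Bernoulli's inequality turns this into a loss of
  3m (n/m)^(m-1) in the power; 6 m^2 = 2m * 3m.\<close>

lemma odd_cycles_ge_real:
  assumes m: "2 \<le> m" and n: "3 * m \<le> n"
  shows "2 * real m * (real n / real m) ^ m - 6 * real m ^ 2 * real n ^ (m - 1) \<le> real (NP n (cycle_graph (2 * m + 1)))"
proof -
  define x where "x = real n / real m"
  have m0: "0 < real m" using m by simp
  have x3: "3 \<le> x" using of_nat_mono[OF n, where 'a = real] m0 by (simp add: x_def field_simps)
  have xn: "x \<le> real n" 
  proof -
    have "1 * real n \<le> real m * real n" using m by (intro mult_right_mono) auto
    then show ?thesis using m0 by (simp add: x_def divide_le_eq mult.commute)
  qed
  define M where "M = n div m - 2"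
  have "3 \<le> n div m" using n m by (simp add: less_eq_div_iff_mult_less_eq)
  then have "M + 2 = n div m" by (simp add: M_def)
  then have "m * (M + 2) \<le> n" by (simp only: times_div_less_eq_dividend)
  then have 1: "2 * m * M ^ m \<le> NP n (cycle_graph (2 * m + 1))" by (rule odd_cycles_ge[OF m])
  have "x < real (n div m) + 1"
  proof -
    have "n < m * (n div m) + m" using m mult_div_mod_eq[of m n] mod_less_divisor[of m n] by linarith
    then have "real n < real m * real (n div m) + real m" by (metis of_nat_add of_nat_less_iff of_nat_mult)
    then show ?thesis using m0 by (simp add: x_def field_simps)
  qed
  then have M: "x - 3 \<le> real M" using \<open>3 \<le> n div m\<close> by (simp add: M_def of_nat_diff)
  have xm: "x ^ m = x * x ^ (m - 1)" using m by (cases m) auto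
  have "1 + real m * (- 3 / x) \<le> (1 + (- 3 / x)) ^ m" using x3 by (intro Bernoulli_inequality) (simp add: field_simps)
  then have "x ^ m * (1 + real m * (- 3 / x)) \<le> x ^ m * (1 + (- 3 / x)) ^ m" using x3 by (intro mult_left_mono) auto
  also have "\<dots> = (x - 3) ^ m" using x3 by (simp flip: power_mult_distrib add: field_simps)
  also have "\<dots> \<le> real M ^ m" using x3 M by (intro power_mono) auto
  also have "x ^ m * (1 + real m * (- 3 / x)) = x ^ m - 3 * real m * x ^ (m - 1)" using x3 unfolding xm by (simp add: field_simps)
  finally have "x ^ m - 3 * real m * x ^ (m - 1) \<le> real M ^ m" .
  moreover have "x ^ (m - 1) \<le> real n ^ (m - 1)" using x3 xn by (intro power_mono) auto
  then have "3 * real m * x ^ (m - 1) \<le> 3 * real m * real n ^ (m - 1)" by (intro mult_left_mono) auto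
  ultimately have "x ^ m - 3 * real m * real n ^ (m - 1) \<le> real M ^ m" by linarith
  then have "2 * real m * (x ^ m - 3 * real m * real n ^ (m - 1)) \<le> 2 * real m * real M ^ m" by (intro mult_left_mono) auto
  also have "\<dots> \<le> real (NP n (cycle_graph (2 * m + 1)))" using of_nat_mono[OF 1, where 'a = real] by simp
  finally show ?thesis by (simp add: x_def power2_eq_square algebra_simps)
qed

theorem theorem1p1:
  shows "(\<exists>C N0. \<forall>n\<ge>N0.
            \<bar>real (NP n (cycle_graph 5)) - 2 * real n ^ 2\<bar> \<le> C * real n powr (2 - 1/5))
       \<and> (\<forall>m::nat. m \<in> {3, 4} \<longrightarrow> (\<exists>C N0. \<forall>n\<ge>N0.
            \<bar>real (NP n (cycle_graph (2*m+1))) - 2 * real m * (real n / real m) ^ m\<bar>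
              \<le> C * real n powr (real m - 1/5)))
       \<and> (\<forall>m::nat. m \<ge> 5 \<longrightarrow> (\<exists>C N0. \<forall>n\<ge>N0.
            real (NP n (cycle_graph (2*m+1)))
              \<le> 3 * real m * (real n / real m) ^ m + C * real n powr (real m - 1/5)))"
proof (intro conjI allI impI)
  have "\<exists>C\<ge>0. \<forall>n\<ge>1. real (NP n (cycle_graph (2 * 2 + 1))) \<le> 2 * real n ^ 2 + C * real n powr (real 2 - 1 / 5)"
    by (rule NP_upper) (use weights.bound2 in auto)
  then obtain C where C: "0 \<le> C" "\<And>n. 1 \<le> n \<Longrightarrow> real (NP n (cycle_graph 5)) \<le> 2 * real n ^ 2 + C * real n powr (2 - 1 / 5)"
    by auto
  have "\<bar>real (NP n (cycle_graph 5)) - 2 * real n ^ 2\<bar> \<le> (C + 14) * real n powr (2 - 1 / 5)" if n: "4 \<le> n" for n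
  proof -
    have "real (2 * ((n - 3) * (n - 4))) = 2 * ((real n - 3) * (real n - 4))" using n by (simp add: of_nat_diff)
    also have "\<dots> = 2 * real n ^ 2 - 14 * real n + 24" by (simp add: power2_eq_square algebra_simps)
    finally have "2 * real n ^ 2 - 14 * real n \<le> real (NP n (cycle_graph 5))"
      using of_nat_mono[OF pentagons_ge[OF n], where 'a = real] by linarith
    moreover have "real n \<le> real n powr (2 - 1 / 5)" using pow_le_powr[of n 2] n by simp
    moreover have "0 \<le> C * real n powr (2 - 1 / 5)" using C(1) by simp
    ultimately show ?thesis using C(2)[of n] n unfolding distrib_right by linarith
  qed
  then show "\<exists>C N0. \<forall>n\<ge>N0. \<bar>real (NP n (cycle_graph 5)) - 2 * real n ^ 2\<bar> \<le> C * real n powr (2 - 1/5)" by blast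
next
  fix m :: nat assume m34: "m \<in> {3, 4}"
  have opt: "Ssum w X m + Qsum w X m / 2 \<le> 2 * real m / real m ^ m * (weights.tot w X / 2) ^ m"
    if "weights X w" for w :: "nat \<Rightarrow> nat \<Rightarrow> real" and X
    using m34 weights.bound3[OF that] weights.bound4[OF that] by auto
  have m: "2 \<le> m" using m34 by auto
  have "\<exists>C\<ge>0. \<forall>n\<ge>1. real (NP n (cycle_graph (2 * m + 1))) \<le> 2 * real m / real m ^ m * real n ^ m + C * real n powr (real m - 1 / 5)"
    by (rule NP_upper[OF m _ opt]) auto
  then obtain C where C: "0 \<le> C" "\<And>n. 1 \<le> n \<Longrightarrow> real (NP n (cycle_graph (2 * m + 1)))
      \<le> 2 * real m * (real n / real m) ^ m + C * real n powr (real m - 1 / 5)"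
    by (auto simp: power_divide)
  have "\<bar>real (NP n (cycle_graph (2 * m + 1))) - 2 * real m * (real n / real m) ^ m\<bar> \<le> (C + 6 * real m ^ 2) * real n powr (real m - 1 / 5)"
    if n: "3 * m \<le> n" for n
  proof -
    have n1: "1 \<le> n" using n m by linarith
    have "6 * real m ^ 2 * real n ^ (m - 1) \<le> 6 * real m ^ 2 * real n powr (real m - 1 / 5)"
      using m by (intro mult_left_mono pow_le_powr n1) auto
    moreover have "0 \<le> C * real n powr (real m - 1 / 5)" using C(1) by simp
    moreover have "0 \<le> 6 * real m ^ 2 * real n powr (real m - 1 / 5)" by simp
    ultimately show ?thesis using odd_cycles_ge_real[OF m n] C(2)[OF n1] unfolding distrib_right by linarith
  qed
  then show "\<exists>C N0. \<forall>n\<ge>N0. \<bar>real (NP n (cycle_graph (2*m+1))) - 2 * real m * (real n / real m) ^ m\<bar>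
              \<le> C * real n powr (real m - 1/5)" by blast
next
  fix m :: nat assume m5: "m \<ge> 5"
  have opt: "Ssum w X m + Qsum w X m / 2 \<le> 3 * real m / real m ^ m * (weights.tot w X / 2) ^ m"
    if "weights X w" for w :: "nat \<Rightarrow> nat \<Rightarrow> real" and X
    using weights.bound_large[OF that, of m] m5 by simp
  have m: "2 \<le> m" using m5 by auto
  have "\<exists>C\<ge>0. \<forall>n\<ge>1. real (NP n (cycle_graph (2 * m + 1))) \<le> 3 * real m / real m ^ m * real n ^ m + C * real n powr (real m - 1 / 5)"
    by (rule NP_upper[OF m _ opt]) auto
  then have "\<exists>C. \<forall>n\<ge>1. real (NP n (cycle_graph (2 * m + 1)))
      \<le> 3 * real m * (real n / real m) ^ m + C * real n powr (real m - 1 / 5)"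
    by (auto simp: power_divide)
  then show "\<exists>C N0. \<forall>n\<ge>N0. real (NP n (cycle_graph (2*m+1)))
              \<le> 3 * real m * (real n / real m) ^ m + C * real n powr (real m - 1/5)" by blast
qed

end
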